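(* Let $m\ge1$ be an integer. The genuine Hecke algebra $\mathcal{H}_\varepsilon(\widetilde{G}(F),K_m^* )$ is a finitely presented $\mathbb{C}$-algebra.
   Context: $F$ is a non-archimedean local field with ring of integers $\mathscr{O}$, maximal ideal $\mathscr{P}$, uniformizer $t$, normalized valuation $v$, residue field of cardinality $q$ and characteristic $p$; $n$ is coprime to $p$, and $F$ contains the group $\mu_n(F)$ of $n$ distinct $n$th roots of unity. For $x\in\mathscr{O}^\times$, $\omega(x)\in\mu_{q-1}(F)$ is the unique element with $x\in\omega(x)(1+\mathscr{P})$. The Hilbert symbol is $(a,b)_F=\omega\big((-1)^{v(a)v(b)}b^{v(a)}/a^{v(b)}\big)^{(q-1)/n}$. $G=\mathrm{SL}_2$. For $g=\begin{pmatrix}a&b\\c&d\end{pmatrix}$ put $X(g)=c$ if $c\ne0$, $X(g)=d$ if $c=0$; the Kubota cocycle is $\delta(g,h)=\big(\tfrac{X(gh)}{X(g)},\tfrac{X(gh)}{X(h)}\big)_F$. $\widetilde{G}(F)=G(F)\times\mu_n(F)$ with product $(g,a)(h,b)=(gh,\delta(g,h)ab)$, a locally compact central extension of $G(F)$ by $\mu_n(F)$. The map $S(g)=(g,\theta(g))$ on $G(\mathscr{O})$, with $\theta\begin{pmatrix}a&b\\c&d\end{pmatrix}=1$ if $c=0$ or $c\in\mathscr{O}^\times$ and $=(c,d)_F$ otherwise, is a homomorphism. $K_m=\ker(G(\mathscr{O})\to G(\mathscr{O}/\mathscr{P}^m))$ and $K_m^*=S(K_m)$, a compact open subgroup. Fix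 a faithful character $\varepsilon:\mu_n(F)\hookrightarrow\mathbb{C}^\times$. $\mathcal{H}_\varepsilon(\widetilde{G}(F),K_m^* )$ is the space of locally constant compactly supported $f:\widetilde{G}(F)\to\mathbb{C}$ with $f(\zeta g)=\varepsilon(\zeta)f(g)$ for $\zeta\in\mu_n(F)$ and $f(k_1gk_2)=f(g)$ for $k_1,k_2\in K_m^*$, with product $(f*h)(x)=\int_{\widetilde{G}(F)}f(y)h(y^{-1}x)\,dy$, where $dy$ is the Haar measure giving $\mu_n(F)\times K_m^*$ measure $1$. Finitely presented means isomorphic to $\mathbb{C}\langle x_1,\dots,x_p\rangle/\langle R_1,\dots,R_q\rangle$, a quotient of a noncommutative polynomial ring in finitely many variables by a two-sided ideal generated by finitely many elements. *)

theory Defs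
  imports
    "HOL-Analysis.Analysis"
    "HOL-Algebra.Module"
    "HOL-Algebra.QuotRing"
    "HOL-Library.Poly_Mapping"
begin

section \<open>Non-archimedean local fields\<close>

text \<open>
  A valuation is a function \<open>v\<close> to the integers whose value at \<open>0\<close> is irrelevant; \<open>pideal v k\<close> is the
  (fractional) ideal \<open>P\<^sup>k\<close>, so \<open>pideal v 0\<close> is the ring of integers and \<open>pideal v 1\<close> its maximal ideal.
\<close>

definition pideal :: "('a::field \<Rightarrow> int) \<Rightarrow> int \<Rightarrow> 'a set"
  where "pideal v k = {x. x = 0 \<or> k \<le> v x}"

definition unit_group :: "('a::field \<Rightarrow> int) \<Rightarrow> 'a set"
  where "unit_group v = {x. x \<noteq> 0 \<and> v x = 0}"

definition residue_classes :: "('a::field \<Rightarrow> int) \<Rightarrow> 'a set set"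
  where "residue_classes v = (\<lambda>x. {y. y - x \<in> pideal v 1}) ` pideal v 0"

definition residue_card :: "('a::field \<Rightarrow> int) \<Rightarrow> nat"
  where "residue_card v = card (residue_classes v)"

definition residue_char :: "('a::field \<Rightarrow> int) \<Rightarrow> nat"
  where "residue_char v = (LEAST p. 0 < p \<and> of_nat p \<in> pideal v 1)"

text \<open>
  A non-archimedean local field is a field that is complete with respect to a normalized
  discrete valuation and has finite residue field.
\<close>

locale nonarch_local_field =
  fixes v :: "'a::field \<Rightarrow> int"
  assumes val_mult: "x \<noteq> 0 \<Longrightarrow> y \<noteq> 0 \<Longrightarrow> v (x * y) = v x + v y"
    and val_add: "x \<noteq> 0 \<Longrightarrow> y \<noteq> 0 \<Longrightarrow> x + y \<noteq> 0 \<Longrightarrow> min (v x) (v y) \<le> v (x + y)"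
    and uniformizer: "\<exists>t. t \<noteq> 0 \<and> v t = 1"
    and complete:
      "(\<And>k::nat. \<exists>N::nat. \<forall>i\<ge>N. \<forall>j\<ge>N. s i - s j \<in> pideal v (int k)) \<Longrightarrow>
        \<exists>l. \<forall>k::nat. \<exists>N::nat. \<forall>i\<ge>N. s i - l \<in> pideal v (int k)"
    and finite_residue: "finite (residue_classes v)"

definition roots_of_1 :: "nat \<Rightarrow> 'a::field set"
  where "roots_of_1 n = {x. x ^ n = 1}"

definition teich :: "('a::field \<Rightarrow> int) \<Rightarrow> 'a \<Rightarrow> 'a"
  where "teich v x =
    (THE z. z \<in> roots_of_1 (residue_card v - 1) \<and> x \<in> (\<lambda>y. z * (1 + y)) ` pideal v 1)"

definition hilbert_symbol :: "('a::field \<Rightarrow> int) \<Rightarrow> nat \<Rightarrow> 'a \<Rightarrow> 'a \<Rightarrow> 'a"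
  where "hilbert_symbol v n a b =
    teich v ((-1) powi (v a * v b) * (b powi v a / a powi v b)) ^ ((residue_card v - 1) div n)"


section \<open>The covering group\<close>

definition kubota_X :: "'a::field ^ 2 ^ 2 \<Rightarrow> 'a"
  where "kubota_X g = (if g $ 2 $ 1 \<noteq> 0 then g $ 2 $ 1 else g $ 2 $ 2)"

definition kubota_cocycle ::
    "('a::field \<Rightarrow> int) \<Rightarrow> nat \<Rightarrow> 'a ^ 2 ^ 2 \<Rightarrow> 'a ^ 2 ^ 2 \<Rightarrow> 'a"
  where "kubota_cocycle v n g h =
    hilbert_symbol v n (kubota_X (g ** h) / kubota_X g) (kubota_X (g ** h) / kubota_X h)"

text \<open>The unit is \<open>(1, 1)\<close> because \<open>\<delta>(1, g) = \<delta>(g, 1) = 1\<close>.\<close>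

definition cover ::
    "('a::field \<Rightarrow> int) \<Rightarrow> nat \<Rightarrow> (('a ^ 2 ^ 2) \<times> 'a) monoid"
  where "cover v n =
    \<lparr>carrier = {g. det g = 1} \<times> roots_of_1 n,
     monoid.mult = (\<lambda>(g, a) (h, b). (g ** h, kubota_cocycle v n g h * a * b)),
     one = (mat 1, 1)\<rparr>"

definition kubota_theta :: "('a::field \<Rightarrow> int) \<Rightarrow> nat \<Rightarrow> 'a ^ 2 ^ 2 \<Rightarrow> 'a"
  where "kubota_theta v n g =
    (if g $ 2 $ 1 = 0 \<or> g $ 2 $ 1 \<in> unit_group v then 1
     else hilbert_symbol v n (g $ 2 $ 1) (g $ 2 $ 2))"

definition congruence_subgroup :: "('a::field \<Rightarrow> int) \<Rightarrow> nat \<Rightarrow> ('a ^ 2 ^ 2) set"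
  where "congruence_subgroup v m =
    {g. det g = 1 \<and> (\<forall>i j. g $ i $ j \<in> pideal v 0) \<and>
        (\<forall>i j. g $ i $ j - mat 1 $ i $ j \<in> pideal v (int m))}"

definition lifted_subgroup ::
    "('a::field \<Rightarrow> int) \<Rightarrow> nat \<Rightarrow> nat \<Rightarrow> (('a ^ 2 ^ 2) \<times> 'a) set"
  where "lifted_subgroup v n m = (\<lambda>g. (g, kubota_theta v n g)) ` congruence_subgroup v m"

definition central_roots :: "nat \<Rightarrow> (('a::field ^ 2 ^ 2) \<times> 'a) set"
  where "central_roots n = {mat 1} \<times> roots_of_1 n"

text \<open>
  The covering group carries the group topology in which the compact open subgroups \<open>K\<^sub>j\<^sup>*\<close>, \<open>j \<ge> 1\<close>, form
  a neighbourhood basis of the identity; it is generated by their left cosets.  It is the only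
  Hausdorff group topology in which all \<open>K\<^sub>j\<^sup>*\<close> are compact and open, since they decrease to \<open>{1}\<close>.
\<close>

definition cover_topology ::
    "('a::field \<Rightarrow> int) \<Rightarrow> nat \<Rightarrow> (('a ^ 2 ^ 2) \<times> 'a) topology"
  where "cover_topology v n = topology_generated_by
    {x <#\<^bsub>cover v n\<^esub> lifted_subgroup v n j | x j. x \<in> carrier (cover v n) \<and> 1 \<le> j}"

text \<open>
  Only second countable locally compact groups occur below, and there the regularity of a Borel
  measure that is finite on compact sets is automatic.
\<close>

definition haar_measure :: "'g monoid \<Rightarrow> 'g topology \<Rightarrow> 'g measure \<Rightarrow> bool"
  where "haar_measure G T M \<longleftrightarrow>
    space M = carrier G \<and>
    sets M = sigma_sets (carrier G) {U. openin T U} \<and>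
    (\<forall>x \<in> carrier G. \<forall>A \<in> sets M. emeasure M (x <#\<^bsub>G\<^esub> A) = emeasure M A) \<and>
    (\<forall>C. compactin T C \<longrightarrow> emeasure M C < \<infinity>) \<and>
    emeasure M (carrier G) \<noteq> 0"


section \<open>The genuine Hecke algebra\<close>

definition faithful_character :: "nat \<Rightarrow> ('a::field \<Rightarrow> complex) \<Rightarrow> bool"
  where "faithful_character n \<epsilon> \<longleftrightarrow>
    (\<forall>x \<in> roots_of_1 n. \<epsilon> x \<noteq> 0) \<and>
    (\<forall>x \<in> roots_of_1 n. \<forall>y \<in> roots_of_1 n. \<epsilon> (x * y) = \<epsilon> x * \<epsilon> y) \<and>
    inj_on \<epsilon> (roots_of_1 n)"

definition locally_constant_on :: "'g topology \<Rightarrow> ('g \<Rightarrow> complex) \<Rightarrow> bool"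
  where "locally_constant_on T f \<longleftrightarrow>
    (\<forall>x \<in> topspace T. \<exists>U. openin T U \<and> x \<in> U \<and> (\<forall>y \<in> U. f y = f x))"

definition compactly_supported :: "'g topology \<Rightarrow> ('g \<Rightarrow> complex) \<Rightarrow> bool"
  where "compactly_supported T f \<longleftrightarrow> compactin T (T closure_of {x \<in> topspace T. f x \<noteq> 0})"

text \<open>
  Functions on the covering group are represented by functions on the ambient type that vanish
  outside its carrier.
\<close>

definition hecke_space ::
    "('a::field \<Rightarrow> int) \<Rightarrow> nat \<Rightarrow> nat \<Rightarrow> ('a \<Rightarrow> complex) \<Rightarrow> (('a ^ 2 ^ 2) \<times> 'a \<Rightarrow> complex) set"
  where "hecke_space v n m \<epsilon> =
    {f. (\<forall>x. x \<notin> carrier (cover v n) \<longrightarrow> f x = 0) \<and>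
        locally_constant_on (cover_topology v n) f \<and>
        compactly_supported (cover_topology v n) f \<and>
        (\<forall>\<zeta> \<in> roots_of_1 n. \<forall>g \<in> carrier (cover v n).
           f ((mat 1, \<zeta>) \<otimes>\<^bsub>cover v n\<^esub> g) = \<epsilon> \<zeta> * f g) \<and>
        (\<forall>k \<in> lifted_subgroup v n m. \<forall>l \<in> lifted_subgroup v n m. \<forall>g \<in> carrier (cover v n).
           f (k \<otimes>\<^bsub>cover v n\<^esub> g \<otimes>\<^bsub>cover v n\<^esub> l) = f g)}"

definition convolution ::
    "'g monoid \<Rightarrow> 'g measure \<Rightarrow> ('g \<Rightarrow> complex) \<Rightarrow> ('g \<Rightarrow> complex) \<Rightarrow> 'g \<Rightarrow> complex"
  where "convolution G M f h x =
    (if x \<in> carrier G then (LINT y|M. f y * h (inv\<^bsub>G\<^esub> y \<otimes>\<^bsub>G\<^esub> x)) else 0)"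

text \<open>
  The unit is supported on \<open>\<mu>\<^sub>n K\<^sub>m\<^sup>*\<close> with value \<open>\<epsilon>(\<zeta>)\<close> on \<open>\<zeta> K\<^sub>m\<^sup>*\<close>, given that \<open>\<mu>\<^sub>n K\<^sub>m\<^sup>*\<close> has measure \<open>1\<close>.
  Note that \<open>(g, a) = (1, a / \<theta>(g)) S(g)\<close>.
\<close>

definition hecke_one ::
    "('a::field \<Rightarrow> int) \<Rightarrow> nat \<Rightarrow> nat \<Rightarrow> ('a \<Rightarrow> complex) \<Rightarrow> ('a ^ 2 ^ 2) \<times> 'a \<Rightarrow> complex"
  where "hecke_one v n m \<epsilon> = (\<lambda>(g, a).
    if g \<in> congruence_subgroup v m \<and> a \<in> roots_of_1 n
    then \<epsilon> (a / kubota_theta v n g) else 0)"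

definition hecke_algebra ::
    "('a::field \<Rightarrow> int) \<Rightarrow> nat \<Rightarrow> nat \<Rightarrow> ('a \<Rightarrow> complex) \<Rightarrow> (('a ^ 2 ^ 2) \<times> 'a) measure
      \<Rightarrow> (complex, ('a ^ 2 ^ 2) \<times> 'a \<Rightarrow> complex) module"
  where "hecke_algebra v n m \<epsilon> M =
    \<lparr>carrier = hecke_space v n m \<epsilon>,
     monoid.mult = convolution (cover v n) M,
     one = hecke_one v n m \<epsilon>,
     zero = (\<lambda>x. 0),
     add = (\<lambda>f h x. f x + h x),
     smult = (\<lambda>c f x. c * f x)\<rparr>"


section \<open>Finitely presented complex algebras\<close>

definition complex_ring :: "complex ring"
  where "complex_ring =
    \<lparr>carrier = UNIV, monoid.mult = (*), one = 1, zero = 0, add = (+)\<rparr>"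

text \<open>The library locale \<open>algebra\<close> is restricted to commutative algebras.\<close>

locale complex_algebra = module complex_ring A + ring A for A (structure) +
  assumes smult_mult_left: "x \<in> carrier A \<Longrightarrow> y \<in> carrier A \<Longrightarrow> (c \<odot> x) \<otimes> y = c \<odot> (x \<otimes> y)"
    and smult_mult_right: "x \<in> carrier A \<Longrightarrow> y \<in> carrier A \<Longrightarrow> x \<otimes> (c \<odot> y) = c \<odot> (x \<otimes> y)"

text \<open>
  Words over an alphabet, written additively, so that the convolution product of
  \<open>Poly_Mapping\<close> makes the finitely supported functions \<open>'x word \<Rightarrow>\<^sub>0 complex\<close> the free
  associative algebra.
\<close>

datatype 'x word = Word (letters: "'x list")

instantiation word :: (type) monoid_add
begin

definition zero_word :: "'a word"
  where "zero_word = Word []"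

definition plus_word :: "'a word \<Rightarrow> 'a word \<Rightarrow> 'a word"
  where "plus_word u w = Word (letters u @ letters w)"

instance
  by standard (simp_all add: zero_word_def plus_word_def)

end

definition free_algebra :: "nat \<Rightarrow> (complex, nat word \<Rightarrow>\<^sub>0 complex) module"
  where "free_algebra p =
    \<lparr>carrier = {f. \<forall>w \<in> Poly_Mapping.keys f. set (letters w) \<subseteq> {..<p}},
     monoid.mult = (*),
     one = 1,
     zero = 0,
     add = (+),
     smult = (\<lambda>c f. Poly_Mapping.single 0 c * f)\<rparr>"

text \<open>
  An isomorphism of the quotient ring with \<open>A\<close> is \<open>\<complex>\<close>-linear when it is compatible with the
  scalar multiplication \<open>c (f + I) = c f + I\<close>; the ideal generated by \<open>R\<close> is two-sided.
\<close>

definition finitely_presented_algebra :: "(complex, 'b) module \<Rightarrow> bool"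
  where "finitely_presented_algebra A \<longleftrightarrow>
    complex_algebra A \<and>
    (\<exists>p R I \<phi>.
       finite R \<and> R \<subseteq> carrier (free_algebra p) \<and>
       I = Idl\<^bsub>free_algebra p\<^esub> R \<and>
       \<phi> \<in> ring_iso (free_algebra p Quot I) A \<and>
       (\<forall>c. \<forall>f \<in> carrier (free_algebra p).
          \<phi> (I +>\<^bsub>free_algebra p\<^esub> (c \<odot>\<^bsub>free_algebra p\<^esub> f)) =
            c \<odot>\<^bsub>A\<^esub> \<phi> (I +>\<^bsub>free_algebra p\<^esub> f)))"

end

(*
  The preimage K of SL2(O) in the covering group contains the open subgroup U = K_m^* as a normal
  subgroup of finite index, and together with a = (diag(t, 1/t), 1) it satisfies a Cartan
  decomposition with representatives a^l, l >= 0.  Let e_k be the characteristic functions of the finitely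
  many cosets kU, k in K, and A that of UaU, extended genuinely.  The Iwahori factorization
  of U makes A^l a multiple of the function of U a^l U, so the e_k and A generate the algebra.
  If the lower right entry of k is a unit then k factors as upper unipotent, diagonal, lower unipotent
  and these factors can be moved across A, so A e_k A reduces to e A^2 e'; otherwise A e_k A is
  supported on K and K a K.  These finitely many relations, the multiplication table of the e_k and the
  commutation relations with A reduce every word to a combination of e_k A^l e_k', and the remaining
  ambiguity, coming from the stabilizers of the a^l, is absorbed by the commutation relations.
*)
theory Submission
  imports Defs
begin

section \<open>Presentations of complex algebras\<close>

text \<open>The cover intervenes in two ways. Cocycle values are needed only for the congruence
  subgroup, unipotents and diagonal one-units, where \<open>a\<close> is crossed exactly; elsewhere
  only matrices are compared, and the unknown root of unity is absorbed by a subgroup containing the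
  centre. In particular \<open>T\<close> consists of all lifts of diagonal units, since
  \<open>a\<close> commutes with these only up to roots of unity. Secondly, a double coset carries a
  genuine function only if no nontrivial central element stabilizes it; the same fact forbids
  cancellation in the values of powers of \<open>A\<close>. No basis of normal forms is chosen. Two
  normal forms with overlapping supports are proportional modulo the relations, so a vanishing
  combination is shortened either by merging two terms or by evaluating at one point. Reduction of
  words terminates because rewriting \<open>A e_k A\<close> consumes an exponent of
  \<open>A\<close>. That the cover is a group at all rests on the Steinberg relation, which matches
  the Pluecker relation between bottom rows of products. Haar integration is replaced by finite sums
  over cosets of the subgroup of measure one.\<close>

lemma word_exhaust_induct [case_names Nil Cons]:
  assumes "P 0" and "\<And>i w. P w \<Longrightarrow> P (Word [i] + w)"
  shows "P (w :: 'x word)"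
proof (cases w)
  case (Word l)
  have "P (Word l)"
    by (induction l) (use assms in \<open>auto simp: zero_word_def plus_word_def\<close>, metis append_Cons append_Nil word.sel)
  then show ?thesis by (simp add: Word)
qed

lemma poly_mapping_single_induct [case_names zero add]:
  fixes f :: "'b \<Rightarrow>\<^sub>0 'c::monoid_add"
  assumes "P 0"
    and "\<And>f w c. w \<notin> Poly_Mapping.keys f \<Longrightarrow> P f \<Longrightarrow> P (Poly_Mapping.single w c + f)"
  shows "P f"
proof (induction f rule: update_induct)
  case const
  show ?case by (rule assms(1))
next
  case (update f a b)
  have "Poly_Mapping.update a b f = Poly_Mapping.single a b + f"
    using update(1)
    by (intro poly_mapping_eqI)
      (auto simp: lookup_update lookup_add lookup_single when_def not_in_keys_iff_lookup_eq_zero)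
  then show ?case
    using assms(2) update by simp
qed

lemma letters_plus [simp]: "letters (u + w) = letters u @ letters w"
  by (simp add: plus_word_def)

lemma letters_zero [simp]: "letters 0 = []"
  by (simp add: zero_word_def)

lemma free_algebra_simps [simp]:
  "monoid.mult (free_algebra p) = (*)" "one (free_algebra p) = 1"
  "zero (free_algebra p) = 0" "add (free_algebra p) = (+)"
  "smult (free_algebra p) c f = Poly_Mapping.single 0 c * f"
  by (simp_all add: free_algebra_def)

lemma free_algebra_carrier_iff:
  "f \<in> carrier (free_algebra p) \<longleftrightarrow> (\<forall>w \<in> Poly_Mapping.keys f. set (letters w) \<subseteq> {..<p})"
  by (simp add: free_algebra_def)

lemma free_algebra_closed [simp, intro]:
  "0 \<in> carrier (free_algebra p)" "1 \<in> carrier (free_algebra p)"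
  "Poly_Mapping.single 0 c \<in> carrier (free_algebra p)"
  by (auto simp: free_algebra_carrier_iff in_keys_iff lookup_single lookup_one when_def split: if_splits)

lemma free_algebra_add [simp, intro]:
  "f \<in> carrier (free_algebra p) \<Longrightarrow> g \<in> carrier (free_algebra p) \<Longrightarrow> f + g \<in> carrier (free_algebra p)"
  using keys_add[of f g] unfolding free_algebra_carrier_iff by blast

lemma free_algebra_mult [simp, intro]:
  assumes "f \<in> carrier (free_algebra p)" "g \<in> carrier (free_algebra p)"
  shows "f * g \<in> carrier (free_algebra p)"
  unfolding free_algebra_carrier_iff
proof
  fix w assume "w \<in> Poly_Mapping.keys (f * g)"
  then obtain u v where "w = u + v" "u \<in> Poly_Mapping.keys f" "v \<in> Poly_Mapping.keys g"
    using keys_mult[of f g] by blast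
  then show "set (letters w) \<subseteq> {..<p}"
    using assms by (simp add: free_algebra_carrier_iff)
qed

lemma free_algebra_uminus [simp, intro]:
  "f \<in> carrier (free_algebra p) \<Longrightarrow> - f \<in> carrier (free_algebra p)"
  by (auto simp: free_algebra_carrier_iff in_keys_iff)

lemma free_algebra_diff [simp, intro]:
  "f \<in> carrier (free_algebra p) \<Longrightarrow> g \<in> carrier (free_algebra p) \<Longrightarrow> f - g \<in> carrier (free_algebra p)"
  using free_algebra_add[of f p "-g"] by simp

lemma free_algebra_letter [simp, intro]:
  "i < p \<Longrightarrow> Poly_Mapping.single (Word [i]) c \<in> carrier (free_algebra p)"
  by (simp add: free_algebra_carrier_iff)

lemma ring_free_algebra: "ring (free_algebra p)"
proof (rule ringI)
  show "abelian_group (free_algebra p)"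
  proof (rule abelian_groupI)
    fix x assume "x \<in> carrier (free_algebra p)"
    then show "\<exists>y\<in>carrier (free_algebra p). y \<oplus>\<^bsub>free_algebra p\<^esub> x = \<zero>\<^bsub>free_algebra p\<^esub>"
      by (intro bexI[of _ "- x"]) auto
  qed (simp_all add: add.assoc add.commute)
  show "monoid (free_algebra p)"
    by unfold_locales (simp_all add: mult.assoc)
qed (simp_all add: distrib_left distrib_right)

text \<open>Every word arises from the empty one by prepending letters, so among products only left
  multiplication by a single generator has to be considered. Normal forms are later shown to be
  stable in exactly this sense.\<close>

lemma free_algebra_induct [consumes 1, case_names zero one letter add smult]:
  assumes f: "f \<in> carrier (free_algebra p)"
    and zero: "P 0" and one: "P 1"
    and letter: "\<And>i f. i < p \<Longrightarrow> f \<in> carrier (free_algebra p) \<Longrightarrow> P f \<Longrightarrow>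
                   P (Poly_Mapping.single (Word [i]) 1 * f)"
    and add: "\<And>f g. f \<in> carrier (free_algebra p) \<Longrightarrow> g \<in> carrier (free_algebra p) \<Longrightarrow>
                   P f \<Longrightarrow> P g \<Longrightarrow> P (f + g)"
    and smult: "\<And>c f. f \<in> carrier (free_algebra p) \<Longrightarrow> P f \<Longrightarrow> P (Poly_Mapping.single 0 c * f)"
  shows "P f"
proof -
  have word: "P (Poly_Mapping.single w 1)" if "set (letters w) \<subseteq> {..<p}" for w
    using that
  proof (induction w rule: word_exhaust_induct)
    case Nil
    then show ?case using one by simp
  next
    case (Cons i w)
    then have "i < p" "set (letters w) \<subseteq> {..<p}" by auto
    moreover have "Poly_Mapping.single w 1 \<in> carrier (free_algebra p)"
      using calculation by (simp add: free_algebra_carrier_iff)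
    ultimately have "P (Poly_Mapping.single (Word [i]) 1 * Poly_Mapping.single w 1)"
      using Cons by (intro letter) auto
    then show ?case by (simp add: mult_single)
  qed
  show ?thesis using f
  proof (induction f rule: poly_mapping_single_induct)
    case zero
    show ?case by (rule assms(2))
  next
    case (add f w c)
    show ?case
    proof (cases "c = 0")
      case True
      then show ?thesis using add by simp
    next
      case False
      have k: "Poly_Mapping.keys (Poly_Mapping.single w c + f) = insert w (Poly_Mapping.keys f)"
        using add(1) False
        by (auto simp: in_keys_iff lookup_add lookup_single when_def split: if_splits)
      then have w: "set (letters w) \<subseteq> {..<p}" and f: "f \<in> carrier (free_algebra p)"
        using add.prems by (auto simp: free_algebra_carrier_iff)
      have s: "Poly_Mapping.single w 1 \<in> carrier (free_algebra p)"
        using w by (simp add: free_algebra_carrier_iff)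
      have "P (Poly_Mapping.single 0 c * Poly_Mapping.single w 1)"
        by (intro smult s word w)
      then have "P (Poly_Mapping.single w c)"
        by (simp add: mult_single)
      moreover have "Poly_Mapping.single w c \<in> carrier (free_algebra p)"
        using w by (simp add: free_algebra_carrier_iff)
      ultimately show ?thesis
        using add f by (intro assms(5)) auto
    qed
  qed
qed

context complex_algebra
begin

lemma complex_ring_simps [simp]:
  "carrier complex_ring = UNIV" "monoid.mult complex_ring = (*)" "one complex_ring = 1"
  "zero complex_ring = 0" "add complex_ring = (+)"
  by (simp_all add: complex_ring_def)

definition word_value :: "(nat \<Rightarrow> 'a) \<Rightarrow> nat word \<Rightarrow> 'a"
  where "word_value x w = foldr (\<lambda>i y. x i \<otimes> y) (letters w) \<one>"

text \<open>The homomorphism given by the universal property of the free algebra. The assignment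
  \<open>x\<close> is total on the naturals; on \<open>free_algebra p\<close> only its first
  \<open>p\<close> values enter.\<close>

definition free_value :: "(nat \<Rightarrow> 'a) \<Rightarrow> (nat word \<Rightarrow>\<^sub>0 complex) \<Rightarrow> 'a"
  where "free_value x f = (\<Oplus>w \<in> Poly_Mapping.keys f. Poly_Mapping.lookup f w \<odot> word_value x w)"

lemma word_value_closed [simp, intro]:
  assumes "x \<in> UNIV \<rightarrow> carrier A"
  shows "word_value x w \<in> carrier A"
proof (induction w rule: word_exhaust_induct)
  case (Cons i w)
  then show ?case using assms by (auto simp: word_value_def)
qed (simp add: word_value_def)

lemma word_value_plus:
  assumes "x \<in> UNIV \<rightarrow> carrier A"
  shows "word_value x (u + w) = word_value x u \<otimes> word_value x w"
proof (induction u rule: word_exhaust_induct)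
  case Nil
  then show ?case using word_value_closed[OF assms] by (simp add: word_value_def)
next
  case (Cons i u)
  have "word_value x (Word [i] + u + w) = x i \<otimes> word_value x (u + w)"
    by (simp add: word_value_def)
  also have "\<dots> = (x i \<otimes> word_value x u) \<otimes> word_value x w"
    using assms by (subst Cons, subst m_assoc) auto
  also have "x i \<otimes> word_value x u = word_value x (Word [i] + u)"
    by (simp add: word_value_def)
  finally show ?case .
qed

context
  fixes x :: "nat \<Rightarrow> 'a"
  assumes x: "x \<in> UNIV \<rightarrow> carrier A"
begin

text \<open>Coefficients can cancel in a sum, so the key sets of \<open>f\<close>, \<open>g\<close>
  and \<open>f + g\<close> may differ; padding with zero coefficients gives them a common index
  set.\<close>

lemma free_value_superset:
  assumes "finite S" "Poly_Mapping.keys f \<subseteq> S"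
  shows "free_value x f = (\<Oplus>w \<in> S. Poly_Mapping.lookup f w \<odot> word_value x w)"
  unfolding free_value_def
  by (rule add.finprod_mono_neutral_cong_left)
    (use assms x in \<open>auto simp: in_keys_iff smult_l_null[simplified] smult_closed[simplified]\<close>)

lemma free_value_closed [simp, intro]: "free_value x f \<in> carrier A"
  unfolding free_value_def by (intro finsum_closed) (use x in \<open>auto simp: smult_closed[simplified]\<close>)

lemma free_value_add: "free_value x (f + g) = free_value x f \<oplus> free_value x g"
proof -
  let ?S = "Poly_Mapping.keys f \<union> Poly_Mapping.keys g"
  have "free_value x (f + g) =
      (\<Oplus>w\<in>?S. Poly_Mapping.lookup f w \<odot> word_value x w \<oplus> Poly_Mapping.lookup g w \<odot> word_value x w)"
    using keys_add[of f g]
    by (subst free_value_superset[of ?S])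
      (use x in \<open>auto simp: lookup_add smult_l_distr[simplified]\<close>)
  also have "\<dots> = free_value x f \<oplus> free_value x g"
    by (subst (1 2) free_value_superset[of ?S])
      (use x in \<open>auto simp: finsum_addf smult_closed[simplified] Pi_def\<close>)
  finally show ?thesis .
qed

lemma free_value_single: "free_value x (Poly_Mapping.single w c) = c \<odot> word_value x w"
proof -
  have "free_value x (Poly_Mapping.single w c) =
      (\<Oplus>u\<in>{w}. Poly_Mapping.lookup (Poly_Mapping.single w c) u \<odot> word_value x u)"
    by (rule free_value_superset) (auto split: if_splits)
  then show ?thesis
    using x by (simp add: finsum_insert smult_closed[simplified] Pi_def)
qed

lemma free_value_zero: "free_value x 0 = \<zero>"
  by (simp add: free_value_def)

lemma free_value_one: "free_value x 1 = \<one>"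
  using free_value_single[of 0 1] by (simp add: word_value_def smult_one[simplified])

lemma free_value_letter: "free_value x (Poly_Mapping.single (Word [i]) 1) = x i"
  using x by (simp add: free_value_single word_value_def smult_one[simplified] Pi_def)

lemma free_value_single_mult:
  "free_value x (Poly_Mapping.single u c * g) = (c \<odot> word_value x u) \<otimes> free_value x g"
proof (induction g rule: poly_mapping_single_induct)
  case zero
  then show ?case using x by (simp add: free_value_zero smult_closed[simplified])
next
  case (add g w d)
  have "c * d \<odot> (word_value x u \<otimes> word_value x w)
      = (c \<odot> word_value x u) \<otimes> (d \<odot> word_value x w)"
    using x by (subst mult.commute)
      (simp add: smult_mult_left smult_mult_right smult_assoc1[simplified] smult_closed[simplified])
  then show ?case
    using add x
    by (simp add: distrib_left mult_single free_value_add free_value_single word_value_plus r_distr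
      smult_closed[simplified])
qed

lemma free_value_mult: "free_value x (f * g) = free_value x f \<otimes> free_value x g"
proof (induction f rule: poly_mapping_single_induct)
  case zero
  then show ?case by (simp add: free_value_zero)
next
  case (add f w c)
  then show ?case
    using x by (simp add: distrib_right free_value_add free_value_single_mult free_value_single l_distr
      smult_closed[simplified])
qed

lemma free_value_smult: "free_value x (Poly_Mapping.single 0 c * f) = c \<odot> free_value x f"
  by (simp add: free_value_single_mult word_value_def smult_mult_left)

lemma free_value_ring_hom: "ring_hom_ring (free_algebra p) A (free_value x)"
  by (rule ring_hom_ringI[OF ring_free_algebra ring_axioms])
    (simp_all add: free_value_mult free_value_add free_value_one)

end

end

text \<open>The first isomorphism theorem for the evaluation homomorphism: \<open>rel\<close> puts
  the ideal inside the kernel by minimality, \<open>ker\<close> gives the reverse inclusion, and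
  \<open>surj\<close> identifies the image.\<close>

theorem finitely_presented_algebraI:
  fixes A :: "(complex, 'b) module" (structure)
  assumes A: "complex_algebra A" and x: "x \<in> UNIV \<rightarrow> carrier A"
    and R: "finite R" "R \<subseteq> carrier (free_algebra p)"
    and rel: "\<And>r. r \<in> R \<Longrightarrow> complex_algebra.free_value A x r = \<zero>"
    and surj: "carrier A \<subseteq> complex_algebra.free_value A x ` carrier (free_algebra p)"
    and ker: "\<And>f. f \<in> carrier (free_algebra p) \<Longrightarrow> complex_algebra.free_value A x f = \<zero> \<Longrightarrow>
                f \<in> Idl\<^bsub>free_algebra p\<^esub> R"
  shows "finitely_presented_algebra A"
proof -
  interpret complex_algebra A by (rule A)
  interpret h: ring_hom_ring "free_algebra p" A "free_value x"
    by (rule free_value_ring_hom[OF x])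
  let ?I = "Idl\<^bsub>free_algebra p\<^esub> R"
  have ker_eq: "a_kernel (free_algebra p) A (free_value x) =
      {f \<in> carrier (free_algebra p). free_value x f = \<zero>}"
    by (rule a_kernel_def')
  have "?I \<subseteq> a_kernel (free_algebra p) A (free_value x)"
    by (rule h.R.genideal_minimal[OF h.kernel_is_ideal]) (use R rel in \<open>unfold ker_eq, blast\<close>)
  moreover have "a_kernel (free_algebra p) A (free_value x) \<subseteq> ?I"
    unfolding ker_eq using ker by blast
  ultimately have I: "?I = a_kernel (free_algebra p) A (free_value x)"
    by (rule equalityI)
  have img: "free_value x ` carrier (free_algebra p) = carrier A"
    using surj free_value_closed[OF x] by blast
  \<comment> \<open>Evaluation is constant on a coset of the kernel, so \<open>the_elem\<close>
    reads off the only element of its image.\<close>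
  let ?\<phi> = "\<lambda>X. the_elem (free_value x ` X)"
  have "?\<phi> \<in> ring_iso (free_algebra p Quot ?I) A"
    unfolding I by (rule h.FactRing_iso_set[OF img])
  moreover have "?\<phi> (?I +>\<^bsub>free_algebra p\<^esub> (c \<odot>\<^bsub>free_algebra p\<^esub> f)) =
      c \<odot> ?\<phi> (?I +>\<^bsub>free_algebra p\<^esub> f)" if f: "f \<in> carrier (free_algebra p)" for c f
  proof -
    have "c \<odot>\<^bsub>free_algebra p\<^esub> f \<in> carrier (free_algebra p)"
      using f by simp
    then show ?thesis
      unfolding I using f by (simp only: h.the_elem_simp) (simp add: free_value_smult[OF x])
  qed
  ultimately show ?thesis
    unfolding finitely_presented_algebra_def using R A by blast
qed


no_notation subset_mset (infix \<open><#\<close> 50)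

section \<open>Convolution algebras of genuine functions\<close>

context group
begin

lemma inv_mult_cancel [simp]:
  "x \<in> carrier G \<Longrightarrow> y \<in> carrier G \<Longrightarrow> inv x \<otimes> (x \<otimes> y) = y"
  "x \<in> carrier G \<Longrightarrow> y \<in> carrier G \<Longrightarrow> x \<otimes> (inv x \<otimes> y) = y"
  by (simp_all flip: m_assoc)

lemma l_coset_image: "x <# V = (\<lambda>v. x \<otimes> v) ` V"
  unfolding l_coset_def by blast

lemma l_coset_memI: "v \<in> V \<Longrightarrow> x \<otimes> v \<in> x <# V"
  unfolding l_coset_image by (rule imageI)

lemma l_coset_memE:
  assumes "y \<in> x <# V"
  obtains v where "v \<in> V" "y = x \<otimes> v"
  using assms unfolding l_coset_image by blast

lemma l_coset_l_coset:
  assumes "x \<in> carrier G" "y \<in> carrier G" "V \<subseteq> carrier G"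
  shows "x <# (y <# V) = (x \<otimes> y) <# V"
  unfolding l_coset_image image_image
  using assms by (intro image_cong[OF refl]) (simp add: m_assoc subsetD)

lemma l_coset_absorb:
  assumes "subgroup V G" "x \<in> carrier G" "v \<in> V"
  shows "(x \<otimes> v) <# V = x <# V"
proof -
  interpret V: subgroup V G by (rule assms(1))
  show ?thesis
  proof
    show "(x \<otimes> v) <# V \<subseteq> x <# V"
    proof
      fix y assume "y \<in> (x \<otimes> v) <# V"
      then obtain w where "w \<in> V" "y = x \<otimes> v \<otimes> w" by (rule l_coset_memE)
      then have "y = x \<otimes> (v \<otimes> w)" "v \<otimes> w \<in> V" using assms(2,3) by (simp_all add: m_assoc)
      then show "y \<in> x <# V" using l_coset_memI by simp
    qed
    show "x <# V \<subseteq> (x \<otimes> v) <# V"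
    proof
      fix y assume "y \<in> x <# V"
      then obtain w where "w \<in> V" "y = x \<otimes> w" by (rule l_coset_memE)
      then have "y = (x \<otimes> v) \<otimes> (inv v \<otimes> w)" "inv v \<otimes> w \<in> V"
        using assms(2,3) by (simp_all add: m_assoc)
      then show "y \<in> (x \<otimes> v) <# V" using l_coset_memI by simp
    qed
  qed
qed

lemma l_coset_eq_iff:
  assumes "subgroup V G" "x \<in> carrier G" "y \<in> carrier G"
  shows "x <# V = y <# V \<longleftrightarrow> inv x \<otimes> y \<in> V"
proof -
  interpret V: subgroup V G by (rule assms(1))
  show ?thesis
  proof
    assume "x <# V = y <# V"
    moreover have "y \<otimes> \<one> \<in> y <# V" by (intro l_coset_memI) simp
    ultimately have "y \<in> x <# V" using assms by simp
    then obtain v where "v \<in> V" "y = x \<otimes> v"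
      by (rule l_coset_memE)
    then show "inv x \<otimes> y \<in> V" using assms by simp
  next
    assume "inv x \<otimes> y \<in> V"
    from l_coset_absorb[OF assms(1,2) this] show "x <# V = y <# V"
      using assms by simp
  qed
qed

end

section \<open>Sums over left cosets, replacing Haar integration\<close>

locale coset_sum = group G for G (structure) +
  fixes V
  assumes V: "subgroup V G"
begin

sublocale V: subgroup V G by (rule V)

lemma V_carrier: "V \<subseteq> carrier G"
  by (rule V.subset)

definition cosets_of :: "'a set \<Rightarrow> 'a set set"
  where "cosets_of X = (\<lambda>x. x <# V) ` X"

definition coset_rep :: "'a set \<Rightarrow> 'a"
  where "coset_rep C = (SOME x. x \<in> C)"

definition coset_functions :: "('a \<Rightarrow> complex) set"
  where "coset_functions = {\<phi>. (\<forall>x \<in> carrier G. \<forall>v \<in> V. \<phi> (x \<otimes> v) = \<phi> x) \<and>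
     finite (cosets_of {x \<in> carrier G. \<phi> x \<noteq> 0})}"

text \<open>This is the Haar integral in the normalization where \<open>V\<close> has measure one: a
  member of \<open>coset_functions\<close> is a finite combination of indicators of left cosets. As
  it is constant on cosets, the choice in \<open>coset_rep\<close> has no influence.\<close>

definition sum_cosets :: "('a \<Rightarrow> complex) \<Rightarrow> complex"
  where "sum_cosets \<phi> = (\<Sum>C \<in> cosets_of {x \<in> carrier G. \<phi> x \<noteq> 0}. \<phi> (coset_rep C))"

lemma coset_self: "x \<in> carrier G \<Longrightarrow> x \<in> x <# V"
  using l_coset_memI[of \<one> V x] by simp

lemma coset_rep_coset:
  assumes "x \<in> carrier G"
  shows "\<exists>v\<in>V. coset_rep (x <# V) = x \<otimes> v"
proof -
  have "coset_rep (x <# V) \<in> x <# V"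
    unfolding coset_rep_def using coset_self[OF assms] by (rule someI)
  then show ?thesis by (rule l_coset_memE) blast
qed

lemma coset_rep_carrier:
  assumes "x \<in> carrier G"
  shows "coset_rep (x <# V) \<in> carrier G"
proof -
  obtain v where "v \<in> V" "coset_rep (x <# V) = x \<otimes> v"
    using coset_rep_coset[OF assms] by blast
  then show ?thesis using assms by simp
qed

lemma coset_functions_rep:
  assumes "\<phi> \<in> coset_functions" "x \<in> carrier G"
  shows "\<phi> (coset_rep (x <# V)) = \<phi> x"
proof -
  obtain v where "v \<in> V" "coset_rep (x <# V) = x \<otimes> v"
    using coset_rep_coset[OF assms(2)] by blast
  then show ?thesis using assms by (simp add: coset_functions_def)
qed

text \<open>Cosets on which the function vanishes may be added, so functions with different supports
  can be summed over one finite set \<open>D\<close>.\<close>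

lemma sum_cosets_superset:
  assumes \<phi>: "\<phi> \<in> coset_functions"
    and D: "finite D" "D \<subseteq> cosets_of (carrier G)"
    and sub: "\<And>x. x \<in> carrier G \<Longrightarrow> \<phi> x \<noteq> 0 \<Longrightarrow> x <# V \<in> D"
  shows "sum_cosets \<phi> = (\<Sum>C \<in> D. \<phi> (coset_rep C))"
  unfolding sum_cosets_def
proof (rule sum.mono_neutral_left[OF D(1)])
  show "cosets_of {x \<in> carrier G. \<phi> x \<noteq> 0} \<subseteq> D"
    using sub by (auto simp: cosets_of_def)
  show "\<forall>C\<in>D - cosets_of {x \<in> carrier G. \<phi> x \<noteq> 0}. \<phi> (coset_rep C) = 0"
  proof
    fix C assume C: "C \<in> D - cosets_of {x \<in> carrier G. \<phi> x \<noteq> 0}"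
    then obtain x where x: "x \<in> carrier G" "C = x <# V"
      using D(2) by (auto simp: cosets_of_def)
    then have "\<phi> x = 0" using C by (auto simp: cosets_of_def)
    then show "\<phi> (coset_rep C) = 0" using x coset_functions_rep[OF \<phi>] by simp
  qed
qed

lemma coset_functionsI:
  assumes "\<And>x v. x \<in> carrier G \<Longrightarrow> v \<in> V \<Longrightarrow> \<phi> (x \<otimes> v) = \<phi> x"
    and "finite D" "\<And>x. x \<in> carrier G \<Longrightarrow> \<phi> x \<noteq> 0 \<Longrightarrow> x <# V \<in> D"
  shows "\<phi> \<in> coset_functions"
  unfolding coset_functions_def
proof (intro CollectI conjI ballI assms(1))
  show "finite (cosets_of {x \<in> carrier G. \<phi> x \<noteq> 0})"
    by (rule finite_subset[OF _ assms(2)]) (use assms(3) in \<open>auto simp: cosets_of_def\<close>)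
qed

lemma coset_functions_linear:
  assumes "finite I" "\<And>i. i \<in> I \<Longrightarrow> \<phi> i \<in> coset_functions"
  shows "(\<lambda>x. \<Sum>i\<in>I. c i * \<phi> i x) \<in> coset_functions"
    and "sum_cosets (\<lambda>x. \<Sum>i\<in>I. c i * \<phi> i x) = (\<Sum>i\<in>I. c i * sum_cosets (\<phi> i))"
proof -
  define D where "D = (\<Union>i\<in>I. cosets_of {x \<in> carrier G. \<phi> i x \<noteq> 0})"
  have D: "finite D" "D \<subseteq> cosets_of (carrier G)"
    using assms by (auto simp: D_def coset_functions_def cosets_of_def)
  have i: "x <# V \<in> D" if "x \<in> carrier G" "i \<in> I" "\<phi> i x \<noteq> 0" for x i
    using that by (auto simp: D_def cosets_of_def)
  have s: "x <# V \<in> D" if x: "x \<in> carrier G" "(\<Sum>i\<in>I. c i * \<phi> i x) \<noteq> 0" for x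
  proof -
    obtain j where "j \<in> I" "c j * \<phi> j x \<noteq> 0"
      using sum.not_neutral_contains_not_neutral[OF x(2)] by blast
    then show ?thesis using i x(1) by auto
  qed
  show *: "(\<lambda>x. \<Sum>i\<in>I. c i * \<phi> i x) \<in> coset_functions"
  proof (rule coset_functionsI[OF _ D(1) s])
    fix x v assume "x \<in> carrier G" "v \<in> V"
    then have "\<phi> i (x \<otimes> v) = \<phi> i x" if "i \<in> I" for i
      using assms(2)[OF that] by (simp add: coset_functions_def)
    then show "(\<Sum>i\<in>I. c i * \<phi> i (x \<otimes> v)) = (\<Sum>i\<in>I. c i * \<phi> i x)" by simp
  qed
  have "(\<Sum>i\<in>I. c i * sum_cosets (\<phi> i)) = (\<Sum>i\<in>I. \<Sum>C\<in>D. c i * \<phi> i (coset_rep C))"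
    using sum_cosets_superset[OF assms(2) D i] by (simp add: sum_distrib_left)
  also have "\<dots> = (\<Sum>C\<in>D. \<Sum>i\<in>I. c i * \<phi> i (coset_rep C))"
    by (rule sum.swap)
  finally show "sum_cosets (\<lambda>x. \<Sum>i\<in>I. c i * \<phi> i x) = (\<Sum>i\<in>I. c i * sum_cosets (\<phi> i))"
    using sum_cosets_superset[OF * D s] by simp
qed

lemma sum_cosets_add:
  assumes "\<phi> \<in> coset_functions" "\<psi> \<in> coset_functions"
  shows "sum_cosets (\<lambda>x. \<phi> x + \<psi> x) = sum_cosets \<phi> + sum_cosets \<psi>"
  using coset_functions_linear(2)[of "{True, False}" "\<lambda>b. if b then \<phi> else \<psi>" "\<lambda>_. 1"] assms
  by simp

lemma sum_cosets_scale:
  assumes "\<phi> \<in> coset_functions"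
  shows "sum_cosets (\<lambda>x. c * \<phi> x) = c * sum_cosets \<phi>"
  using coset_functions_linear(2)[of "{()}" "\<lambda>_. \<phi>" "\<lambda>_. c"] assms by simp

text \<open>Left invariance of the integral. Left translation by \<open>inv g\<close> permutes left
  cosets and carries those of the support of \<open>\<phi>\<close> to those of the translated
  function, so both finite sums have the same terms.\<close>

lemma sum_cosets_translate:
  assumes \<phi>: "\<phi> \<in> coset_functions" and g: "g \<in> carrier G"
  shows "(\<lambda>x. \<phi> (g \<otimes> x)) \<in> coset_functions"
    and "sum_cosets (\<lambda>x. \<phi> (g \<otimes> x)) = sum_cosets \<phi>"
proof -
  define D where "D = cosets_of {x \<in> carrier G. \<phi> x \<noteq> 0}"
  define E where "E = (\<lambda>C. inv g <# C) ` D"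
  have D: "finite D" "D \<subseteq> cosets_of (carrier G)"
    using \<phi> by (auto simp: D_def coset_functions_def cosets_of_def)
  have inD: "x <# V \<in> D" if "x \<in> carrier G" "\<phi> x \<noteq> 0" for x
    using that by (auto simp: D_def cosets_of_def)
  have "inv g <# (x <# V) \<in> cosets_of (carrier G)" if "x \<in> carrier G" for x
    using that g V_carrier by (simp add: l_coset_l_coset cosets_of_def)
  then have E: "finite E" "E \<subseteq> cosets_of (carrier G)"
    using D by (auto simp: E_def cosets_of_def)
  have sub: "x <# V \<in> E" if x: "x \<in> carrier G" "\<phi> (g \<otimes> x) \<noteq> 0" for x
  proof -
    have "x <# V = inv g <# ((g \<otimes> x) <# V)"
      using x g V_carrier by (simp add: l_coset_l_coset)
    then show ?thesis using inD[of "g \<otimes> x"] x g by (auto simp: E_def)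
  qed
  show *: "(\<lambda>x. \<phi> (g \<otimes> x)) \<in> coset_functions"
  proof (rule coset_functionsI[OF _ E(1) sub])
    fix x v assume "x \<in> carrier G" "v \<in> V"
    then show "\<phi> (g \<otimes> (x \<otimes> v)) = \<phi> (g \<otimes> x)"
      using \<phi> g by (simp add: coset_functions_def flip: m_assoc)
  qed
  have inj: "inj_on (\<lambda>C. inv g <# C) D"
  proof (rule inj_onI)
    fix C C' assume C: "C \<in> D" "C' \<in> D" "inv g <# C = inv g <# C'"
    have *: "g <# (inv g <# B) = B" if "B \<in> D" for B
    proof -
      obtain x where "x \<in> carrier G" "B = x <# V"
        using \<open>B \<in> D\<close> D(2) unfolding cosets_of_def by blast
      then show ?thesis using g V_carrier by (simp add: l_coset_l_coset)
    qed
    show "C = C'"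
      by (rule trans[OF *[OF C(1), symmetric, unfolded C(3)] *[OF C(2)]])
  qed
  have "(\<Sum>C\<in>E. \<phi> (g \<otimes> coset_rep C)) = (\<Sum>C\<in>D. \<phi> (g \<otimes> coset_rep (inv g <# C)))"
    unfolding E_def using inj by (simp add: sum.reindex)
  also have "\<dots> = (\<Sum>C\<in>D. \<phi> (coset_rep C))"
  proof (rule sum.cong[OF refl])
    fix C assume "C \<in> D"
    then obtain x where x: "x \<in> carrier G" "C = x <# V"
      using D(2) by (auto simp: cosets_of_def)
    have "inv g <# C = (inv g \<otimes> x) <# V"
      using x g V_carrier by (simp add: l_coset_l_coset)
    then obtain v where v: "v \<in> V" "coset_rep (inv g <# C) = inv g \<otimes> x \<otimes> v"
      using coset_rep_coset[of "inv g \<otimes> x"] x(1) g by (metis inv_closed m_closed)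
    have "\<phi> (g \<otimes> coset_rep (inv g <# C)) = \<phi> (x \<otimes> v)"
      using v x g by (simp add: m_assoc)
    also have "\<dots> = \<phi> (coset_rep C)"
      using \<phi> v x coset_functions_rep[OF \<phi> x(1)] by (simp add: coset_functions_def)
    finally show "\<phi> (g \<otimes> coset_rep (inv g <# C)) = \<phi> (coset_rep C)" .
  qed
  also have "\<dots> = sum_cosets \<phi>"
    using sum_cosets_superset[OF \<phi> D inD] by simp
  finally show "sum_cosets (\<lambda>x. \<phi> (g \<otimes> x)) = sum_cosets \<phi>"
    using sum_cosets_superset[OF * E sub] by simp
qed

lemma sum_cosets_single:
  assumes \<phi>: "\<phi> \<in> coset_functions" and y: "y \<in> carrier G"
    and "\<And>x. x \<in> carrier G \<Longrightarrow> \<phi> x \<noteq> 0 \<Longrightarrow> inv y \<otimes> x \<in> V"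
  shows "sum_cosets \<phi> = \<phi> y"
proof -
  have "sum_cosets \<phi> = (\<Sum>C\<in>{y <# V}. \<phi> (coset_rep C))"
  proof (rule sum_cosets_superset[OF \<phi>])
    fix x assume "x \<in> carrier G" "\<phi> x \<noteq> 0"
    then show "x <# V \<in> {y <# V}"
      using assms(3) l_coset_eq_iff[OF V y] by blast
  qed (use y in \<open>auto simp: cosets_of_def\<close>)
  then show ?thesis using coset_functions_rep[OF \<phi> y] by simp
qed

lemma sum_cosets_cong:
  assumes "\<And>x. x \<in> carrier G \<Longrightarrow> \<phi> x = \<psi> x"
  shows "sum_cosets \<phi> = sum_cosets \<psi>"
proof -
  have e: "{x \<in> carrier G. \<phi> x \<noteq> 0} = {x \<in> carrier G. \<psi> x \<noteq> 0}"
    using assms by auto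
  show ?thesis
    unfolding sum_cosets_def e
    by (rule sum.cong) (auto simp: cosets_of_def assms coset_rep_carrier)
qed

text \<open>With finitely many representatives \<open>x0\<close> and \<open>y0\<close>, the coset of
  \<open>x \<otimes> y\<close> is that of \<open>x0 \<otimes> v \<otimes> y0\<close> for some
  \<open>v\<close> in \<open>V\<close>, and by commensurability the elements
  \<open>v \<otimes> y0\<close> meet only finitely many left cosets.\<close>

lemma finite_cosets_mult:
  assumes X: "X \<subseteq> carrier G" "finite (cosets_of X)"
    and Y: "Y \<subseteq> carrier G" "finite (cosets_of Y)"
    and comm: "\<And>y. y \<in> Y \<Longrightarrow> finite (cosets_of ((\<lambda>v. v \<otimes> y) ` V))"
  shows "finite (cosets_of {x \<otimes> y | x y. x \<in> X \<and> y \<in> Y})"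
proof -
  have "\<exists>X0\<subseteq>X. finite X0 \<and> cosets_of X = cosets_of X0"
    unfolding cosets_of_def by (rule finite_subset_image[OF X(2)[unfolded cosets_of_def] order_refl])
  then obtain X0 where X0: "X0 \<subseteq> X" "finite X0" "cosets_of X = cosets_of X0"
    by blast
  have "\<exists>Y0\<subseteq>Y. finite Y0 \<and> cosets_of Y = cosets_of Y0"
    unfolding cosets_of_def by (rule finite_subset_image[OF Y(2)[unfolded cosets_of_def] order_refl])
  then obtain Y0 where Y0: "Y0 \<subseteq> Y" "finite Y0" "cosets_of Y = cosets_of Y0"
    by blast
  define F where "F = (\<Union>x\<in>X0. \<Union>y\<in>Y0. (\<lambda>C. x <# C) ` cosets_of ((\<lambda>v. v \<otimes> y) ` V))"
  have "finite F"
    unfolding F_def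
    by (intro finite_UN_I finite_imageI X0(2) Y0(2) comm) (use Y0(1) in blast)
  moreover have "cosets_of {x \<otimes> y | x y. x \<in> X \<and> y \<in> Y} \<subseteq> F"
  proof
    fix C assume "C \<in> cosets_of {x \<otimes> y | x y. x \<in> X \<and> y \<in> Y}"
    then obtain x y where xy: "x \<in> X" "y \<in> Y" "C = (x \<otimes> y) <# V"
      by (auto simp: cosets_of_def)
    have "x <# V \<in> cosets_of X0" "y <# V \<in> cosets_of Y0"
      unfolding X0(3)[symmetric] Y0(3)[symmetric] using xy(1,2) by (auto simp: cosets_of_def)
    then obtain x0 y0 where x0: "x0 \<in> X0" "x <# V = x0 <# V" and y0: "y0 \<in> Y0" "y <# V = y0 <# V"
      unfolding cosets_of_def by (elim imageE)
    have car: "x \<in> carrier G" "y \<in> carrier G" "x0 \<in> carrier G" "y0 \<in> carrier G"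
      using subsetD[OF X(1)] subsetD[OF Y(1)] xy(1,2) subsetD[OF X0(1) x0(1)] subsetD[OF Y0(1) y0(1)]
      by simp_all
    have v: "inv x0 \<otimes> x \<in> V" using l_coset_eq_iff[OF V car(3,1)] x0(2) by simp
    have "C = x <# (y <# V)" using xy car V_carrier by (simp add: l_coset_l_coset)
    also have "\<dots> = (x \<otimes> y0) <# V"
      unfolding y0(2) using car V_carrier by (simp add: l_coset_l_coset)
    also have "\<dots> = x0 <# (((inv x0 \<otimes> x) \<otimes> y0) <# V)"
      using car V_carrier by (simp add: l_coset_l_coset m_assoc)
    also have "\<dots> \<in> F"
    proof -
      have "(inv x0 \<otimes> x \<otimes> y0) <# V \<in> cosets_of ((\<lambda>v. v \<otimes> y0) ` V)"
        unfolding cosets_of_def by (rule imageI, rule image_eqI[OF refl v])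
      then show ?thesis
        unfolding F_def by (intro UN_I[OF x0(1)] UN_I[OF y0(1)] imageI)
    qed
    finally show "C \<in> F" .
  qed
  ultimately show ?thesis by (rule finite_subset[rotated])
qed

end


text \<open>\<open>Z\<close> stands for the central roots of unity and \<open>U\<close> for the
  lifted congruence subgroup. Cosets are taken modulo \<open>Z <#> U\<close>, because the integrand
  in a convolution of genuine functions is invariant under \<open>Z\<close> as well.\<close>

locale central_pair = group G for G (structure) +
  fixes Z U :: "'a set"
  assumes Z: "subgroup Z G" and Z_central: "z \<in> Z \<Longrightarrow> x \<in> carrier G \<Longrightarrow> x \<otimes> z = z \<otimes> x"
    and U: "subgroup U G"
begin

lemma Z_carrier: "z \<in> Z \<Longrightarrow> z \<in> carrier G"
  using subgroup.subset[OF Z] by blast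

lemma U_carrier: "u \<in> U \<Longrightarrow> u \<in> carrier G"
  using subgroup.subset[OF U] by blast

lemma ZU_iff: "x \<in> Z <#> U \<longleftrightarrow> (\<exists>z\<in>Z. \<exists>u\<in>U. x = z \<otimes> u)"
  by (auto simp: set_mult_def)

lemma ZU_I: "z \<in> Z \<Longrightarrow> u \<in> U \<Longrightarrow> z \<otimes> u \<in> Z <#> U"
  by (auto simp: set_mult_def)

lemma one_Z: "\<one> \<in> Z" and one_U: "\<one> \<in> U"
  using subgroup.one_closed[OF Z] subgroup.one_closed[OF U] by auto

lemmas ZU_closed = subgroup.m_closed[OF Z] subgroup.m_closed[OF U]
  subgroup.m_inv_closed[OF Z] subgroup.m_inv_closed[OF U] one_Z one_U

lemma Z_left_comm: "z \<in> Z \<Longrightarrow> x \<in> carrier G \<Longrightarrow> y \<in> carrier G \<Longrightarrow> x \<otimes> (z \<otimes> y) = z \<otimes> (x \<otimes> y)"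
  using Z_central[of z x] Z_carrier[of z] by (metis m_assoc)

lemma ZU_subgroup: "subgroup (Z <#> U) G"
proof (rule subgroupI)
  show "Z <#> U \<subseteq> carrier G"
    using Z_carrier U_carrier by (auto simp: ZU_iff)
  show "Z <#> U \<noteq> {}"
    using one_Z one_U by (auto simp: set_mult_def)
next
  fix x assume "x \<in> Z <#> U"
  then obtain z u where x: "z \<in> Z" "u \<in> U" "x = z \<otimes> u" by (auto simp: ZU_iff)
  then have "inv x = inv z \<otimes> inv u"
    using Z_central[of "inv z" "inv u"] Z_carrier U_carrier ZU_closed by (simp add: inv_mult_group)
  then show "inv x \<in> Z <#> U" using x ZU_closed by (simp add: ZU_I)
next
  fix x y assume "x \<in> Z <#> U" "y \<in> Z <#> U"
  then obtain z u z' u' where x: "z \<in> Z" "u \<in> U" "x = z \<otimes> u" "z' \<in> Z" "u' \<in> U" "y = z' \<otimes> u'"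
    by (auto simp: ZU_iff)
  then have "x \<otimes> y = (z \<otimes> z') \<otimes> (u \<otimes> u')"
    using Z_carrier U_carrier by (simp add: m_assoc Z_left_comm)
  then show "x \<otimes> y \<in> Z <#> U" using x ZU_closed by (simp add: ZU_I)
qed

sublocale coset_sum G "Z <#> U"
  by (intro coset_sum.intro coset_sum_axioms.intro ZU_subgroup group_axioms)

end

text \<open>\<open>commensurable\<close> makes convolutions finite sums. \<open>admissible\<close>
  says that the stabilizer of \<open>g\<close> under \<open>Z\<close> and the two-sided action of
  \<open>U\<close> has trivial part in \<open>Z\<close>; if such a \<open>z\<close> had
  \<open>\<epsilon> z\<close> different from one, every genuine biinvariant function would vanish at
  \<open>g\<close>.\<close>

locale hecke_pair = central_pair G Z U for G (structure) and Z U :: "'a set" +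
  fixes \<epsilon> :: "'a \<Rightarrow> complex"
  assumes eps_mult: "z \<in> Z \<Longrightarrow> z' \<in> Z \<Longrightarrow> \<epsilon> (z \<otimes> z') = \<epsilon> z * \<epsilon> z'"
    and eps_nonzero: "z \<in> Z \<Longrightarrow> \<epsilon> z \<noteq> 0"
    and commensurable: "g \<in> carrier G \<Longrightarrow> finite (cosets_of ((\<lambda>v. v \<otimes> g) ` (Z <#> U)))"
    and admissible: "g \<in> carrier G \<Longrightarrow> z \<in> Z \<Longrightarrow> u \<in> U \<Longrightarrow> u' \<in> U \<Longrightarrow>
      z \<otimes> u \<otimes> g \<otimes> u' = g \<Longrightarrow> z = \<one>"
begin

lemma eps_one: "\<epsilon> \<one> = 1"
  using eps_mult[of \<one> \<one>] eps_nonzero[of \<one>] one_Z by simp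

lemma eps_inv: "z \<in> Z \<Longrightarrow> \<epsilon> (inv z) = inverse (\<epsilon> z)"
  using eps_mult[of z "inv z"] eps_nonzero[of z] ZU_closed(3)[of z] Z_carrier[of z] eps_one
  by (simp add: field_simps)

definition hecke_functions :: "('a \<Rightarrow> complex) set"
  where "hecke_functions = {f. (\<forall>x. x \<notin> carrier G \<longrightarrow> f x = 0) \<and>
     (\<forall>z\<in>Z. \<forall>x\<in>carrier G. f (z \<otimes> x) = \<epsilon> z * f x) \<and>
     (\<forall>u\<in>U. \<forall>u'\<in>U. \<forall>x\<in>carrier G. f (u \<otimes> x \<otimes> u') = f x) \<and>
     finite (cosets_of {x \<in> carrier G. f x \<noteq> 0})}"

definition convol :: "('a \<Rightarrow> complex) \<Rightarrow> ('a \<Rightarrow> complex) \<Rightarrow> 'a \<Rightarrow> complex"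
  where "convol f h x = (if x \<in> carrier G then sum_cosets (\<lambda>y. f y * h (inv y \<otimes> x)) else 0)"

text \<open>The genuine function carried by the double coset \<open>Z U g U\<close>, normalized to
  be one at \<open>g\<close>. The chosen \<open>z\<close> is unique by \<open>admissible\<close>,
  which is the content of \<open>chi_eq\<close>.\<close>

definition chi :: "'a \<Rightarrow> 'a \<Rightarrow> complex"
  where "chi g x = (if \<exists>z\<in>Z. \<exists>u\<in>U. \<exists>u'\<in>U. x = z \<otimes> u \<otimes> g \<otimes> u'
     then \<epsilon> (SOME z. z \<in> Z \<and> (\<exists>u\<in>U. \<exists>u'\<in>U. x = z \<otimes> u \<otimes> g \<otimes> u')) else 0)"

context
  fixes f
  assumes f: "f \<in> hecke_functions"
begin

lemma hecke_outside: "x \<notin> carrier G \<Longrightarrow> f x = 0"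
  using f by (simp add: hecke_functions_def)

lemma hecke_genuine: "z \<in> Z \<Longrightarrow> x \<in> carrier G \<Longrightarrow> f (z \<otimes> x) = \<epsilon> z * f x"
  using f by (simp add: hecke_functions_def)

lemma hecke_bi: "u \<in> U \<Longrightarrow> u' \<in> U \<Longrightarrow> x \<in> carrier G \<Longrightarrow> f (u \<otimes> x \<otimes> u') = f x"
  using f by (simp add: hecke_functions_def)

lemma hecke_left: "u \<in> U \<Longrightarrow> x \<in> carrier G \<Longrightarrow> f (u \<otimes> x) = f x"
  using hecke_bi[of u \<one> x] one_U U_carrier[of u] by simp

lemma hecke_right: "u \<in> U \<Longrightarrow> x \<in> carrier G \<Longrightarrow> f (x \<otimes> u) = f x"
  using hecke_bi[of \<one> u x] one_U U_carrier[of u] by simp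

lemma hecke_finite: "finite (cosets_of {x \<in> carrier G. f x \<noteq> 0})"
  using f by (simp add: hecke_functions_def)

lemma hecke_double:
  assumes "z \<in> Z" "u \<in> U" "u' \<in> U" "x \<in> carrier G"
  shows "f (z \<otimes> u \<otimes> x \<otimes> u') = \<epsilon> z * f x"
proof -
  have "z \<otimes> u \<otimes> x \<otimes> u' = z \<otimes> (u \<otimes> x \<otimes> u')"
    using assms Z_carrier U_carrier by (simp add: m_assoc)
  then show ?thesis
    using assms U_carrier by (simp add: hecke_genuine hecke_bi)
qed

lemma hecke_ZU_left: "z \<in> Z \<Longrightarrow> u \<in> U \<Longrightarrow> x \<in> carrier G \<Longrightarrow> f (z \<otimes> u \<otimes> x) = \<epsilon> z * f x"
  using hecke_double[of z u \<one> x] one_U U_carrier[of u] Z_carrier[of z] by simp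

lemma hecke_ZU_right:
  assumes "z \<in> Z" "u \<in> U" "x \<in> carrier G"
  shows "f (x \<otimes> (z \<otimes> u)) = \<epsilon> z * f x"
  using assms Z_left_comm[of z x u] hecke_genuine[of z "x \<otimes> u"] hecke_right[of u x] U_carrier[of u]
  by simp

end

lemma hecke_functionsI:
  assumes "\<And>x. x \<notin> carrier G \<Longrightarrow> f x = 0"
    and "\<And>z x. z \<in> Z \<Longrightarrow> x \<in> carrier G \<Longrightarrow> f (z \<otimes> x) = \<epsilon> z * f x"
    and l: "\<And>u x. u \<in> U \<Longrightarrow> x \<in> carrier G \<Longrightarrow> f (u \<otimes> x) = f x"
    and r: "\<And>u x. u \<in> U \<Longrightarrow> x \<in> carrier G \<Longrightarrow> f (x \<otimes> u) = f x"
    and D: "finite D" "\<And>x. x \<in> carrier G \<Longrightarrow> f x \<noteq> 0 \<Longrightarrow> x <# (Z <#> U) \<in> D"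
  shows "f \<in> hecke_functions"
  unfolding hecke_functions_def
proof (intro CollectI conjI allI impI ballI assms(1,2))
  fix u u' x assume "u \<in> U" "u' \<in> U" "x \<in> carrier G"
  then show "f (u \<otimes> x \<otimes> u') = f x"
    using l r U_carrier by simp
next
  show "finite (cosets_of {x \<in> carrier G. f x \<noteq> 0})"
    by (rule finite_subset[OF _ D(1)]) (use D(2) in \<open>unfold cosets_of_def, blast\<close>)
qed simp_all

text \<open>Replacing \<open>y\<close> by \<open>y \<otimes> (z \<otimes> u)\<close> multiplies the
  first factor by \<open>\<epsilon> z\<close> and the second by its inverse, so the integrand
  descends to cosets modulo \<open>Z <#> U\<close>.\<close>

lemma convol_coset_function:
  assumes f: "f \<in> hecke_functions" and h: "h \<in> hecke_functions" and x: "x \<in> carrier G"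
  shows "(\<lambda>y. f y * h (inv y \<otimes> x)) \<in> coset_functions"
proof (rule coset_functionsI[OF _ hecke_finite[OF f]])
  fix y v assume y: "y \<in> carrier G" and "v \<in> Z <#> U"
  then obtain z u where v: "z \<in> Z" "u \<in> U" "v = z \<otimes> u" by (auto simp: ZU_iff)
  have "inv (y \<otimes> v) \<otimes> x = inv z \<otimes> inv u \<otimes> (inv y \<otimes> x)"
    using v y x Z_carrier U_carrier Z_central[of "inv z" "inv u"] ZU_closed(3)
    by (simp add: inv_mult_group m_assoc)
  then have "h (inv (y \<otimes> v) \<otimes> x) = inverse (\<epsilon> z) * h (inv y \<otimes> x)"
    using hecke_ZU_left[OF h, of "inv z" "inv u" "inv y \<otimes> x"] v y x ZU_closed(3,4)
    by (simp add: eps_inv)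
  then show "f (y \<otimes> v) * h (inv (y \<otimes> v) \<otimes> x) = f y * h (inv y \<otimes> x)"
    using hecke_ZU_right[OF f v(1,2) y] v eps_nonzero[OF v(1)] by simp
next
  fix y assume "y \<in> carrier G" "f y * h (inv y \<otimes> x) \<noteq> 0"
  then show "y <# (Z <#> U) \<in> cosets_of {x \<in> carrier G. f x \<noteq> 0}"
    by (simp add: cosets_of_def)
qed

lemma sum_cosets_nonzeroE:
  assumes "sum_cosets \<phi> \<noteq> 0"
  obtains y where "y \<in> carrier G" "\<phi> y \<noteq> 0"
proof -
  obtain C where "C \<in> cosets_of {x \<in> carrier G. \<phi> x \<noteq> 0}" "\<phi> (coset_rep C) \<noteq> 0"
    using sum.not_neutral_contains_not_neutral[OF assms[unfolded sum_cosets_def]] by blast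
  then show thesis using that coset_rep_carrier unfolding cosets_of_def by blast
qed

lemma convol_nonzeroE:
  assumes "convol f h x \<noteq> 0"
  obtains y where "y \<in> carrier G" "x \<in> carrier G" "f y \<noteq> 0" "h (inv y \<otimes> x) \<noteq> 0"
proof -
  have x: "x \<in> carrier G" and s: "sum_cosets (\<lambda>y. f y * h (inv y \<otimes> x)) \<noteq> 0"
    using assms by (auto simp: convol_def split: if_splits)
  obtain y where "y \<in> carrier G" "f y * h (inv y \<otimes> x) \<noteq> 0"
    by (rule sum_cosets_nonzeroE[OF s])
  then show thesis using that x by simp
qed

text \<open>The support lies in the product of the two supports, which
  \<open>finite_cosets_mult\<close> controls. Invariance under left multiplication by
  \<open>U\<close> is the substitution of \<open>inv u \<otimes> y\<close> for \<open>y\<close>; the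
  other invariances hold term by term.\<close>

lemma convol_closed:
  assumes f: "f \<in> hecke_functions" and h: "h \<in> hecke_functions"
  shows "convol f h \<in> hecke_functions"
proof -
  define D where "D = cosets_of {y \<otimes> w | y w. y \<in> {y \<in> carrier G. f y \<noteq> 0} \<and> w \<in> {w \<in> carrier G. h w \<noteq> 0}}"
  have D: "finite D"
    unfolding D_def
  proof (rule finite_cosets_mult)
    fix y assume "y \<in> {w \<in> carrier G. h w \<noteq> 0}"
    then have "y \<in> carrier G" by simp
    then show "finite (cosets_of ((\<lambda>v. v \<otimes> y) ` (Z <#> U)))"
      by (rule commensurable)
  qed (use f h hecke_finite in auto)
  show ?thesis
  proof (rule hecke_functionsI[OF _ _ _ _ D])
    fix x assume "x \<notin> carrier G"
    then show "convol f h x = 0" by (simp add: convol_def)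
  next
    fix z x assume z: "z \<in> Z" and x: "x \<in> carrier G"
    have "sum_cosets (\<lambda>y. f y * h (inv y \<otimes> (z \<otimes> x))) =
        sum_cosets (\<lambda>y. \<epsilon> z * (f y * h (inv y \<otimes> x)))"
      by (rule sum_cosets_cong) (use z x in \<open>simp add: Z_left_comm hecke_genuine[OF h]\<close>)
    then show "convol f h (z \<otimes> x) = \<epsilon> z * convol f h x"
      using sum_cosets_scale[OF convol_coset_function[OF f h x]] z x Z_carrier
      by (simp add: convol_def)
  next
    fix u x assume u: "u \<in> U" and x: "x \<in> carrier G"
    note uc = U_carrier[OF u]
    have "sum_cosets (\<lambda>y. f y * h (inv y \<otimes> x)) =
        sum_cosets (\<lambda>y. f (inv u \<otimes> y) * h (inv (inv u \<otimes> y) \<otimes> x))"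
      using sum_cosets_translate(2)[OF convol_coset_function[OF f h x], of "inv u"] uc by simp
    also have "\<dots> = sum_cosets (\<lambda>y. f y * h (inv y \<otimes> (u \<otimes> x)))"
      by (rule sum_cosets_cong)
        (use u uc x ZU_closed(4) in \<open>simp add: hecke_left[OF f] inv_mult_group m_assoc\<close>)
    finally show "convol f h (u \<otimes> x) = convol f h x"
      using uc x by (simp add: convol_def)
    have "sum_cosets (\<lambda>y. f y * h (inv y \<otimes> (x \<otimes> u))) = sum_cosets (\<lambda>y. f y * h (inv y \<otimes> x))"
      by (rule sum_cosets_cong)
        (use u uc x in \<open>simp add: hecke_right[OF h] flip: m_assoc\<close>)
    then show "convol f h (x \<otimes> u) = convol f h x"
      using uc x by (simp add: convol_def)
  next
    fix x assume x: "x \<in> carrier G" "convol f h x \<noteq> 0"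
    then obtain y where y: "y \<in> carrier G" "f y \<noteq> 0" "h (inv y \<otimes> x) \<noteq> 0"
      using convol_nonzeroE by blast
    have "x = y \<otimes> (inv y \<otimes> x)" using x y by simp
    moreover have "inv y \<otimes> x \<in> carrier G" using x y by simp
    ultimately show "x <# (Z <#> U) \<in> D"
      unfolding D_def cosets_of_def using y by blast
  qed
qed

lemma hecke_zero: "(\<lambda>x. 0) \<in> hecke_functions"
  by (rule hecke_functionsI[of _ "{}"]) simp_all

lemma hecke_linear:
  assumes f: "f \<in> hecke_functions" and h: "h \<in> hecke_functions"
  shows "(\<lambda>x. c * f x + d * h x) \<in> hecke_functions"
  by (rule hecke_functionsI[of _ "cosets_of {x \<in> carrier G. f x \<noteq> 0} \<union> cosets_of {x \<in> carrier G. h x \<noteq> 0}"])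
    (use hecke_outside[OF f] hecke_outside[OF h] hecke_finite[OF f] hecke_finite[OF h]
      in \<open>auto simp: hecke_genuine[OF f] hecke_genuine[OF h] hecke_left[OF f] hecke_left[OF h]
        hecke_right[OF f] hecke_right[OF h] algebra_simps cosets_of_def\<close>)

lemma hecke_add: "f \<in> hecke_functions \<Longrightarrow> h \<in> hecke_functions \<Longrightarrow> (\<lambda>x. f x + h x) \<in> hecke_functions"
  using hecke_linear[of f h 1 1] by simp

lemma hecke_scale: "f \<in> hecke_functions \<Longrightarrow> (\<lambda>x. c * f x) \<in> hecke_functions"
  using hecke_linear[of f f c 0] by simp

lemma convol_add_left:
  assumes "f \<in> hecke_functions" "g \<in> hecke_functions" "h \<in> hecke_functions"
  shows "convol (\<lambda>x. f x + g x) h = (\<lambda>x. convol f h x + convol g h x)"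
  using sum_cosets_add[OF convol_coset_function[OF assms(1,3)] convol_coset_function[OF assms(2,3)]]
  by (auto simp: convol_def fun_eq_iff distrib_right)

lemma convol_add_right:
  assumes "f \<in> hecke_functions" "g \<in> hecke_functions" "h \<in> hecke_functions"
  shows "convol h (\<lambda>x. f x + g x) = (\<lambda>x. convol h f x + convol h g x)"
  using sum_cosets_add[OF convol_coset_function[OF assms(3,1)] convol_coset_function[OF assms(3,2)]]
  by (auto simp: convol_def fun_eq_iff distrib_left)

lemma convol_scale_left:
  assumes "f \<in> hecke_functions" "h \<in> hecke_functions"
  shows "convol (\<lambda>x. c * f x) h = (\<lambda>x. c * convol f h x)"
  using sum_cosets_scale[OF convol_coset_function[OF assms], of _ c]
  by (auto simp: convol_def fun_eq_iff mult.assoc)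

lemma convol_scale_right:
  assumes "f \<in> hecke_functions" "h \<in> hecke_functions"
  shows "convol f (\<lambda>x. c * h x) = (\<lambda>x. c * convol f h x)"
  using sum_cosets_scale[OF convol_coset_function[OF assms], of _ c]
  by (auto simp: convol_def fun_eq_iff mult.left_commute)

text \<open>A finite form of Fubini: the sum over the support of \<open>f\<close> runs over a fixed
  finite set \<open>D\<close> of cosets and can be pulled out of the other sum.\<close>

lemma convol_assoc:
  assumes f: "f \<in> hecke_functions" and h: "h \<in> hecke_functions" and k: "k \<in> hecke_functions"
  shows "convol (convol f h) k = convol f (convol h k)"
proof
  fix x
  show "convol (convol f h) k x = convol f (convol h k) x"
  proof (cases "x \<in> carrier G")
    case x: True
    define D where "D = cosets_of {x \<in> carrier G. f x \<noteq> 0}"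
    have D: "finite D" using hecke_finite[OF f] by (simp add: D_def)
    have Dc: "D \<subseteq> cosets_of (carrier G)" by (auto simp: D_def cosets_of_def)
    have r: "coset_rep C \<in> carrier G" if "C \<in> D" for C
      using that Dc coset_rep_carrier by (auto simp: cosets_of_def)
    have inD: "y <# (Z <#> U) \<in> D" if "y \<in> carrier G" "f y \<noteq> 0" for y
      using that by (auto simp: D_def cosets_of_def)
    have expand: "convol f h' y = (\<Sum>C\<in>D. f (coset_rep C) * h' (inv (coset_rep C) \<otimes> y))"
      if "h' \<in> hecke_functions" "y \<in> carrier G" for h' y
      using sum_cosets_superset[OF convol_coset_function[OF f that] D Dc] inD that
      by (simp add: convol_def)
    \<comment> \<open>Translation by the inverse of the representative turns the remaining sum into
      the convolution of \<open>h\<close> and \<open>k\<close> at the shifted point.\<close>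
    have F: "(\<lambda>y. h (inv (coset_rep C) \<otimes> y) * k (inv y \<otimes> x)) \<in> coset_functions \<and>
        sum_cosets (\<lambda>y. h (inv (coset_rep C) \<otimes> y) * k (inv y \<otimes> x)) =
        convol h k (inv (coset_rep C) \<otimes> x)" if C: "C \<in> D" for C
    proof -
      let ?c = "coset_rep C"
      let ?\<phi> = "\<lambda>y. h y * k (inv y \<otimes> (inv ?c \<otimes> x))"
      have \<phi>: "?\<phi> \<in> coset_functions"
        using convol_coset_function[OF h k] r[OF C] x by simp
      have e: "?\<phi> (inv ?c \<otimes> y) = h (inv ?c \<otimes> y) * k (inv y \<otimes> x)" if "y \<in> carrier G" for y
        using that r[OF C] x by (simp add: inv_mult_group m_assoc)
      have 1: "(\<lambda>y. ?\<phi> (inv ?c \<otimes> y)) \<in> coset_functions"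
        and 2: "sum_cosets (\<lambda>y. ?\<phi> (inv ?c \<otimes> y)) = sum_cosets ?\<phi>"
        using sum_cosets_translate[OF \<phi>, of "inv ?c"] r[OF C] by auto
      have "(\<lambda>y. h (inv ?c \<otimes> y) * k (inv y \<otimes> x)) \<in> coset_functions"
        using 1 unfolding coset_functions_def by (simp add: e cong: conj_cong)
      moreover have "sum_cosets (\<lambda>y. h (inv ?c \<otimes> y) * k (inv y \<otimes> x)) = sum_cosets ?\<phi>"
        unfolding 2[symmetric] by (rule sum_cosets_cong) (rule e[symmetric])
      ultimately show ?thesis
        using r[OF C] x by (simp add: convol_def)
    qed
    have "convol (convol f h) k x = sum_cosets (\<lambda>y. convol f h y * k (inv y \<otimes> x))"
      using x by (simp add: convol_def)
    also have "\<dots> = sum_cosets (\<lambda>y. \<Sum>C\<in>D. f (coset_rep C) *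
        (h (inv (coset_rep C) \<otimes> y) * k (inv y \<otimes> x)))"
      by (rule sum_cosets_cong) (simp add: expand[OF h] sum_distrib_right mult.assoc)
    also have "\<dots> = (\<Sum>C\<in>D. f (coset_rep C) * convol h k (inv (coset_rep C) \<otimes> x))"
      using coset_functions_linear(2)[OF D, of "\<lambda>C y. h (inv (coset_rep C) \<otimes> y) * k (inv y \<otimes> x)"] F
      by simp
    also have "\<dots> = convol f (convol h k) x"
      using expand[OF convol_closed[OF h k] x] by simp
    finally show ?thesis .
  qed (simp add: convol_def)
qed

text \<open>Two expressions of one element, with central factors \<open>z\<close> and
  \<open>w\<close>, combine to an equation that fixes \<open>g\<close> with central factor
  \<open>inv z \<otimes> w\<close>; \<open>admissible\<close> then forces
  \<open>w = z\<close>.\<close>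

lemma chi_eq:
  assumes g: "g \<in> carrier G" and z: "z \<in> Z" and u: "u \<in> U" "u' \<in> U"
  shows "chi g (z \<otimes> u \<otimes> g \<otimes> u') = \<epsilon> z"
proof -
  let ?P = "\<lambda>w. w \<in> Z \<and> (\<exists>u1\<in>U. \<exists>u2\<in>U. z \<otimes> u \<otimes> g \<otimes> u' = w \<otimes> u1 \<otimes> g \<otimes> u2)"
  have "?P z" using z u by blast
  then have "?P (Eps ?P)" by (rule someI)
  then obtain u1 u2 where w: "Eps ?P \<in> Z" "u1 \<in> U" "u2 \<in> U"
      "z \<otimes> u \<otimes> g \<otimes> u' = Eps ?P \<otimes> u1 \<otimes> g \<otimes> u2" by blast
  define w where "w = Eps ?P"
  note w = w[folded w_def]
  note c = g Z_carrier[OF z] Z_carrier[OF w(1)] U_carrier[OF u(1)] U_carrier[OF u(2)]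
    U_carrier[OF w(2)] U_carrier[OF w(3)]
  have "(inv z \<otimes> w) \<otimes> (inv u \<otimes> u1) \<otimes> g \<otimes> (u2 \<otimes> inv u') =
      inv u \<otimes> inv z \<otimes> (w \<otimes> u1 \<otimes> g \<otimes> u2) \<otimes> inv u'"
    using c w(1) ZU_closed(3)[OF z]
    by (simp add: m_assoc Z_left_comm[of _ "inv u"] Z_left_comm[of w])
  also have "\<dots> = g"
    unfolding w(4)[symmetric] using c by (simp add: m_assoc)
  finally have "inv z \<otimes> w = \<one>"
    by (rule admissible[OF g, rotated 3]) (use z u w ZU_closed in auto)
  then have "w = z"
    using c by (metis inv_equality inv_inv inv_closed inv_comm)
  moreover have "\<exists>z1\<in>Z. \<exists>u1\<in>U. \<exists>u2\<in>U. z \<otimes> u \<otimes> g \<otimes> u' = z1 \<otimes> u1 \<otimes> g \<otimes> u2"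
    using z u by blast
  ultimately show ?thesis
    by (simp add: chi_def w_def)
qed

lemma chi_nonzeroE:
  assumes "chi g x \<noteq> 0"
  obtains z u u' where "z \<in> Z" "u \<in> U" "u' \<in> U" "x = z \<otimes> u \<otimes> g \<otimes> u'"
  using assms unfolding chi_def by (meson)

lemma chi_self: "g \<in> carrier G \<Longrightarrow> chi g g = 1"
  using chi_eq[of g \<one> \<one> \<one>] one_Z one_U eps_one by simp

text \<open>If \<open>chi g x\<close> vanishes, an expression of the moved point as a member of the
  double coset could be moved back to \<open>x\<close> and would make \<open>chi g x\<close>
  nonzero. Otherwise the central factors just multiply.\<close>

lemma chi_transfer:
  assumes g: "g \<in> carrier G" and "z \<in> Z" "u \<in> U" "u' \<in> U" and x: "x \<in> carrier G"
  shows "chi g (z \<otimes> u \<otimes> x \<otimes> u') = \<epsilon> z * chi g x"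
proof -
  note c = g x Z_carrier[OF assms(2)] U_carrier[OF assms(3)] U_carrier[OF assms(4)]
  show ?thesis
  proof (cases "chi g x = 0")
    case True
    have "chi g (z \<otimes> u \<otimes> x \<otimes> u') = 0"
    proof (rule ccontr)
      assume "chi g (z \<otimes> u \<otimes> x \<otimes> u') \<noteq> 0"
      then obtain z1 u1 u2 where w: "z1 \<in> Z" "u1 \<in> U" "u2 \<in> U"
        "z \<otimes> u \<otimes> x \<otimes> u' = z1 \<otimes> u1 \<otimes> g \<otimes> u2"
        by (rule chi_nonzeroE)
      note c' = Z_carrier[OF w(1)] U_carrier[OF w(2)] U_carrier[OF w(3)]
      have "x = inv u \<otimes> inv z \<otimes> (z \<otimes> u \<otimes> x \<otimes> u') \<otimes> inv u'"
        using c by (simp add: m_assoc)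
      also have "\<dots> = (inv z \<otimes> z1) \<otimes> (inv u \<otimes> u1) \<otimes> g \<otimes> (u2 \<otimes> inv u')"
        unfolding w(4) using c c' w(1) ZU_closed(3)[OF assms(2)]
        by (simp add: m_assoc Z_left_comm[of _ "inv u"] Z_left_comm[of z1])
      finally have "chi g x = \<epsilon> (inv z \<otimes> z1)"
        using chi_eq[OF g, of "inv z \<otimes> z1" "inv u \<otimes> u1" "u2 \<otimes> inv u'"] w assms ZU_closed by simp
      then show False using True eps_nonzero w assms ZU_closed by simp
    qed
    then show ?thesis using True by simp
  next
    case False
    then obtain z1 u1 u2 where w: "z1 \<in> Z" "u1 \<in> U" "u2 \<in> U" "x = z1 \<otimes> u1 \<otimes> g \<otimes> u2"
      by (rule chi_nonzeroE)
    note c' = Z_carrier[OF w(1)] U_carrier[OF w(2)] U_carrier[OF w(3)]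
    have "z \<otimes> u \<otimes> x \<otimes> u' = (z \<otimes> z1) \<otimes> (u \<otimes> u1) \<otimes> g \<otimes> (u2 \<otimes> u')"
      unfolding w(4) using c c' w(1) by (simp add: m_assoc Z_left_comm[of z1])
    then have "chi g (z \<otimes> u \<otimes> x \<otimes> u') = \<epsilon> (z \<otimes> z1)"
      using chi_eq[OF g, of "z \<otimes> z1" "u \<otimes> u1" "u2 \<otimes> u'"] w assms ZU_closed by simp
    moreover have "chi g x = \<epsilon> z1"
      unfolding w(4) by (rule chi_eq[OF g w(1-3)])
    ultimately show ?thesis using eps_mult w assms by simp
  qed
qed

lemma chi_hecke:
  assumes g: "g \<in> carrier G"
  shows "chi g \<in> hecke_functions"
proof (rule hecke_functionsI[OF _ _ _ _ commensurable[OF g]])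
  fix x assume "x \<notin> carrier G"
  show "chi g x = 0"
  proof (rule ccontr)
    assume "chi g x \<noteq> 0"
    then obtain z u u' where w: "z \<in> Z" "u \<in> U" "u' \<in> U" "x = z \<otimes> u \<otimes> g \<otimes> u'"
      by (rule chi_nonzeroE)
    have "x \<in> carrier G"
      unfolding w(4) by (intro m_closed Z_carrier U_carrier w g)
    then show False using \<open>x \<notin> carrier G\<close> by contradiction
  qed
next
  fix z x assume z: "z \<in> Z" and x: "x \<in> carrier G"
  then show "chi g (z \<otimes> x) = \<epsilon> z * chi g x"
    using chi_transfer[OF g z one_U one_U x] Z_carrier by simp
next
  fix u x assume u: "u \<in> U" and x: "x \<in> carrier G"
  then show "chi g (u \<otimes> x) = chi g x"
    using chi_transfer[OF g one_Z u one_U x] U_carrier eps_one by simp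
  show "chi g (x \<otimes> u) = chi g x"
    using chi_transfer[OF g one_Z one_U u x] u x U_carrier eps_one by simp
next
  fix x assume x: "x \<in> carrier G" "chi g x \<noteq> 0"
  obtain z u u' where w: "z \<in> Z" "u \<in> U" "u' \<in> U" "x = z \<otimes> u \<otimes> g \<otimes> u'"
    by (rule chi_nonzeroE[OF x(2)])
  have v: "z \<otimes> u \<in> Z <#> U" "u' \<in> Z <#> U"
    using w(1,2) ZU_I[OF one_Z w(3)] U_carrier[OF w(3)] by (simp_all add: ZU_I)
  have "x <# (Z <#> U) = (z \<otimes> u \<otimes> g) <# (Z <#> U)"
    unfolding w(4) using l_coset_absorb[OF ZU_subgroup _ v(2)] g w Z_carrier U_carrier by simp
  then show "x <# (Z <#> U) \<in> cosets_of ((\<lambda>v. v \<otimes> g) ` (Z <#> U))"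
    using v(1) unfolding cosets_of_def by blast
qed

text \<open>When \<open>k\<close> normalizes \<open>U\<close> in this sense, its double coset is the
  single coset of \<open>k\<close> modulo \<open>Z <#> U\<close>; only the term \<open>y = k\<close>
  survives and convolution becomes translation.\<close>

lemma chi_normalizing_left:
  assumes k: "k \<in> carrier G" and norm: "\<And>u. u \<in> U \<Longrightarrow> inv k \<otimes> u \<otimes> k \<in> U"
    and f: "f \<in> hecke_functions" and x: "x \<in> carrier G"
  shows "convol (chi k) f x = f (inv k \<otimes> x)"
proof -
  have "sum_cosets (\<lambda>y. chi k y * f (inv y \<otimes> x)) = chi k k * f (inv k \<otimes> x)"
  proof (rule sum_cosets_single[OF convol_coset_function[OF chi_hecke[OF k] f x] k])
    fix y assume "y \<in> carrier G" "chi k y * f (inv y \<otimes> x) \<noteq> 0"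
    then have "chi k y \<noteq> 0" by simp
    then obtain z u u' where w: "z \<in> Z" "u \<in> U" "u' \<in> U" "y = z \<otimes> u \<otimes> k \<otimes> u'"
      by (rule chi_nonzeroE)
    have "inv k \<otimes> y = z \<otimes> ((inv k \<otimes> u \<otimes> k) \<otimes> u')"
      using w k Z_carrier U_carrier by (simp add: m_assoc Z_left_comm[of z])
    then show "inv k \<otimes> y \<in> Z <#> U"
      using w norm ZU_closed(2) ZU_I by simp
  qed
  then show ?thesis using x chi_self[OF k] by (simp add: convol_def)
qed

lemma chi_normalizing_right:
  assumes k: "k \<in> carrier G" and norm: "\<And>u. u \<in> U \<Longrightarrow> k \<otimes> u \<otimes> inv k \<in> U"
    and f: "f \<in> hecke_functions" and x: "x \<in> carrier G"
  shows "convol f (chi k) x = f (x \<otimes> inv k)"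
proof -
  have e: "inv (x \<otimes> inv k) \<otimes> x = k" using x k by (simp add: inv_mult_group m_assoc)
  have "sum_cosets (\<lambda>y. f y * chi k (inv y \<otimes> x)) = f (x \<otimes> inv k) * chi k (inv (x \<otimes> inv k) \<otimes> x)"
  proof (rule sum_cosets_single[OF convol_coset_function[OF f chi_hecke[OF k] x]])
    show "x \<otimes> inv k \<in> carrier G" using x k by simp
    fix y assume y: "y \<in> carrier G" and "f y * chi k (inv y \<otimes> x) \<noteq> 0"
    then have "chi k (inv y \<otimes> x) \<noteq> 0" by simp
    then obtain z u u' where w: "z \<in> Z" "u \<in> U" "u' \<in> U" "inv y \<otimes> x = z \<otimes> u \<otimes> k \<otimes> u'"
      by (rule chi_nonzeroE)
    have "inv (x \<otimes> inv k) \<otimes> y = inv (inv y \<otimes> x \<otimes> inv k)"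
      using x y k by (simp add: inv_mult_group m_assoc)
    also have "inv y \<otimes> x \<otimes> inv k = z \<otimes> (u \<otimes> (k \<otimes> u' \<otimes> inv k))"
      unfolding w(4) using w k Z_carrier U_carrier by (simp add: m_assoc)
    finally show "inv (x \<otimes> inv k) \<otimes> y \<in> Z <#> U"
      using w norm ZU_closed(2) ZU_I subgroup.m_inv_closed[OF ZU_subgroup] by simp
  qed
  then show ?thesis using x chi_self[OF k] e by (simp add: convol_def)
qed

lemma convol_one_left:
  assumes f: "f \<in> hecke_functions"
  shows "convol (chi \<one>) f = f"
proof
  fix x show "convol (chi \<one>) f x = f x"
    using chi_normalizing_left[OF one_closed _ f, of x] U_carrier hecke_outside[OF f, of x]
    by (cases "x \<in> carrier G") (simp_all add: convol_def)
qed

lemma convol_one_right: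
  assumes f: "f \<in> hecke_functions"
  shows "convol f (chi \<one>) = f"
proof
  fix x show "convol f (chi \<one>) x = f x"
    using chi_normalizing_right[OF one_closed _ f, of x] U_carrier hecke_outside[OF f, of x]
    by (cases "x \<in> carrier G") (simp_all add: convol_def)
qed

text \<open>The multiplication is a parameter: the convolution defined by an integral is compared
  with \<open>convol\<close> only on \<open>hecke_functions\<close>, and
  \<open>complex_algebra_hecke_ring\<close> asks no more of it.\<close>

definition hecke_ring :: "(('a \<Rightarrow> complex) \<Rightarrow> ('a \<Rightarrow> complex) \<Rightarrow> 'a \<Rightarrow> complex)
    \<Rightarrow> (complex, 'a \<Rightarrow> complex) module"
  where "hecke_ring mu =
    \<lparr>carrier = hecke_functions, monoid.mult = mu, one = chi \<one>, zero = (\<lambda>x. 0),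
     add = (\<lambda>f h x. f x + h x), smult = (\<lambda>c f x. c * f x)\<rparr>"

lemma hecke_ring_simps [simp]:
  "carrier (hecke_ring mu) = hecke_functions" "monoid.mult (hecke_ring mu) = mu"
  "one (hecke_ring mu) = chi \<one>" "zero (hecke_ring mu) = (\<lambda>x. 0)"
  "add (hecke_ring mu) = (\<lambda>f h x. f x + h x)" "smult (hecke_ring mu) = (\<lambda>c f x. c * f x)"
  by (simp_all add: hecke_ring_def)

lemma cring_complex_ring: "cring complex_ring"
  by (rule cringI) (auto simp: complex_ring_def algebra_simps Units_def
    intro!: abelian_groupI comm_monoidI exI[of _ "- x" for x])

lemma complex_algebra_hecke_ring:
  assumes mu: "\<And>f h. f \<in> hecke_functions \<Longrightarrow> h \<in> hecke_functions \<Longrightarrow> mu f h = convol f h"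
  shows "complex_algebra (hecke_ring mu)"
proof -
  have ab: "abelian_group (hecke_ring mu)"
  proof (rule abelian_groupI)
    fix f assume "f \<in> carrier (hecke_ring mu)"
    then show "\<exists>h\<in>carrier (hecke_ring mu). h \<oplus>\<^bsub>hecke_ring mu\<^esub> f = \<zero>\<^bsub>hecke_ring mu\<^esub>"
      using hecke_scale[of f "-1"] by (intro bexI[of _ "\<lambda>x. - 1 * f x"]) simp_all
  qed (simp_all add: hecke_add hecke_zero add.assoc add.commute add.left_commute)
  have mo: "monoid (hecke_ring mu)"
    by unfold_locales
      (simp_all add: mu convol_closed chi_hecke convol_assoc convol_one_left convol_one_right)
  have ri: "ring (hecke_ring mu)"
    by (rule ringI[OF ab mo])
      (simp_all add: mu hecke_add convol_add_left convol_add_right)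
  have mod: "module complex_ring (hecke_ring mu)"
    by (rule moduleI[OF cring_complex_ring ab])
      (simp_all add: hecke_scale complex_ring_def distrib_left distrib_right mult.assoc)
  show ?thesis
    by (intro complex_algebra.intro mod ri complex_algebra_axioms.intro)
      (simp_all add: mu hecke_scale convol_scale_left convol_scale_right)
qed

end


section \<open>Finite presentation from a Cartan decomposition\<close>

text \<open>In the application \<open>K\<close> is the preimage of SL2 over the integers,
  \<open>N\<close> and \<open>N'\<close> are the lifted upper and lower unipotents, \<open>T\<close>
  the lifts of diagonal units, and \<open>a\<close> lifts \<open>diag(t, 1/t)\<close>. Conjugation
  by \<open>a\<close> contracts \<open>N\<close>, conjugation by its inverse contracts
  \<open>N'\<close>; hence the opposite directions of \<open>N_conj\<close> and
  \<open>N'_conj\<close>. \<open>T_conj\<close> asks only for some \<open>h'\<close> in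
  \<open>T\<close>, as the crossing may change the root of unity. In \<open>stabilizer\<close> the
  element \<open>k\<close> is written as the conjugates of \<open>x\<close> and \<open>h\<close> by
  \<open>a [^] l\<close> times \<open>y\<close>, so that each factor can cross the power of
  \<open>a\<close>.\<close>

locale cartan_pair = central_pair G Z U for G (structure) and Z U :: "'a set" +
  fixes K N T N' :: "'a set" and a :: 'a
  assumes finite_Z: "finite Z"
    and K: "subgroup K G" and U_K: "U \<subseteq> K" and Z_K: "Z \<subseteq> K"
    and normal: "k \<in> K \<Longrightarrow> u \<in> U \<Longrightarrow> k \<otimes> u \<otimes> inv k \<in> U"
    and finite_index: "\<exists>E. finite E \<and> E \<subseteq> K \<and> (\<forall>k\<in>K. \<exists>e\<in>E. \<exists>u\<in>U. k = e \<otimes> u)"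
    and a [simp, intro]: "a \<in> carrier G"
    and a_finite: "\<exists>E. finite E \<and> E \<subseteq> U \<and> (\<forall>u\<in>U. \<exists>e\<in>E. \<exists>u'\<in>U. u \<otimes> a = e \<otimes> a \<otimes> u')"
    and subsets: "N \<subseteq> K" "T \<subseteq> K" "N' \<subseteq> K"
    and N_conj: "x \<in> N \<Longrightarrow> \<exists>x'\<in>N. a \<otimes> x = x' \<otimes> a"
    and T_conj: "h \<in> T \<Longrightarrow> \<exists>h'\<in>T. a \<otimes> h = h' \<otimes> a"
    and N'_conj: "y \<in> N' \<Longrightarrow> \<exists>y'\<in>N'. y \<otimes> a = a \<otimes> y'"
    and N'_conj_U: "y \<in> N' \<Longrightarrow> y \<in> U \<Longrightarrow> \<exists>y'\<in>N' \<inter> U. y \<otimes> a = a \<otimes> y'"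
    and iwahori: "u \<in> U \<Longrightarrow> \<exists>u1\<in>U. \<exists>u2\<in>U. \<exists>y\<in>N' \<inter> U. u = u1 \<otimes> y \<and> a \<otimes> u1 = u2 \<otimes> a"
    and cartan: "g \<in> carrier G \<Longrightarrow> \<exists>k1\<in>K. \<exists>k2\<in>K. \<exists>l::nat. g = k1 \<otimes> a [^] l \<otimes> k2"
    and cartan_unique: "k1 \<in> K \<Longrightarrow> k2 \<in> K \<Longrightarrow> k1 \<otimes> a [^] (l::nat) \<otimes> k2 = a [^] (l'::nat) \<Longrightarrow> l = l'"
    and stabilizer: "k \<in> K \<Longrightarrow> k' \<in> K \<Longrightarrow> 0 < l \<Longrightarrow> k \<otimes> a [^] (l::nat) = a [^] l \<otimes> k' \<Longrightarrow>
      \<exists>x\<in>N. \<exists>h\<in>T. \<exists>y\<in>N'. k \<otimes> a [^] l = a [^] l \<otimes> x \<otimes> h \<otimes> inv (a [^] l) \<otimes> y \<otimes> a [^] l"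
    and dichotomy: "k \<in> K \<Longrightarrow> (\<exists>x\<in>N. \<exists>h\<in>T. \<exists>y\<in>N'. k = x \<otimes> h \<otimes> y) \<or>
      (\<forall>u\<in>U. \<exists>k1\<in>K. \<exists>k2\<in>K. \<exists>i\<le>1::nat. a \<otimes> u \<otimes> k \<otimes> a = k1 \<otimes> a [^] i \<otimes> k2)"
    and a_admissible: "z \<in> Z \<Longrightarrow> u \<in> U \<Longrightarrow> u' \<in> U \<Longrightarrow>
      z \<otimes> u \<otimes> a [^] (l::nat) \<otimes> u' = a [^] l \<Longrightarrow> z = \<one>"
begin

lemma K_carrier: "k \<in> K \<Longrightarrow> k \<in> carrier G"
  using subgroup.subset[OF K] by blast

lemma U_in_K: "u \<in> U \<Longrightarrow> u \<in> K" and Z_in_K: "z \<in> Z \<Longrightarrow> z \<in> K"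
  and N_in_K: "x \<in> N \<Longrightarrow> x \<in> K" and T_in_K: "x \<in> T \<Longrightarrow> x \<in> K" and N'_in_K: "x \<in> N' \<Longrightarrow> x \<in> K"
  using subsetD[OF U_K] subsetD[OF Z_K] subsetD[OF subsets(1)] subsetD[OF subsets(2)]
    subsetD[OF subsets(3)] by blast+

lemmas K_closed = subgroup.m_closed[OF K] subgroup.m_inv_closed[OF K] subgroup.one_closed[OF K]

lemma normal':
  assumes "k \<in> K" "u \<in> U"
  shows "inv k \<otimes> u \<otimes> k \<in> U"
  using normal[OF K_closed(2)[OF assms(1)] assms(2)] K_carrier[OF assms(1)] by simp

lemma U_push_right:
  assumes "k \<in> K" "u \<in> U"
  obtains u' where "u' \<in> U" "u \<otimes> k = k \<otimes> u'"
proof (rule that)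
  show "u \<otimes> k = k \<otimes> (inv k \<otimes> u \<otimes> k)"
    using K_carrier[OF assms(1)] U_carrier[OF assms(2)] by (simp add: m_assoc)
qed (rule normal'[OF assms])

lemma U_push_left:
  assumes "k \<in> K" "u \<in> U"
  obtains u' where "u' \<in> U" "k \<otimes> u = u' \<otimes> k"
proof (rule that)
  show "k \<otimes> u = (k \<otimes> u \<otimes> inv k) \<otimes> k"
    using K_carrier[OF assms(1)] U_carrier[OF assms(2)] by (simp add: m_assoc)
qed (rule normal[OF assms])

text \<open>Commensurability of a single element. It passes to products, so the Cartan decomposition
  reduces it to \<open>K\<close> and \<open>a\<close>.\<close>

definition tame :: "'a \<Rightarrow> bool"
  where "tame g \<longleftrightarrow> g \<in> carrier G \<and> finite (cosets_of ((\<lambda>v. v \<otimes> g) ` (Z <#> U)))"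

lemma tame_mult:
  assumes g: "tame g" and h: "tame h"
  shows "tame (g \<otimes> h)"
proof -
  have gc: "g \<in> carrier G" and hc: "h \<in> carrier G"
    using g h by (simp_all add: tame_def)
  let ?X = "(\<lambda>v. v \<otimes> g) ` (Z <#> U)"
  have "finite (cosets_of {x \<otimes> y | x y. x \<in> ?X \<and> y \<in> {h}})"
  proof (rule finite_cosets_mult)
    show "?X \<subseteq> carrier G"
      by (rule image_subsetI, rule m_closed[OF subsetD[OF V_carrier] gc])
    show "finite (cosets_of ?X)" using g by (simp add: tame_def)
    show "{h} \<subseteq> carrier G" using hc by simp
    show "finite (cosets_of {h})" by (simp add: cosets_of_def)
    show "finite (cosets_of ((\<lambda>v. v \<otimes> y) ` (Z <#> U)))" if "y \<in> {h}" for y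
      using that h by (simp add: tame_def)
  qed
  moreover have "(\<lambda>v. v \<otimes> (g \<otimes> h)) ` (Z <#> U) \<subseteq> {x \<otimes> y | x y. x \<in> ?X \<and> y \<in> {h}}"
  proof (rule image_subsetI)
    fix v assume v: "v \<in> Z <#> U"
    have "v \<otimes> (g \<otimes> h) = (v \<otimes> g) \<otimes> h"
      using subsetD[OF V_carrier v] gc hc by (simp add: m_assoc)
    moreover have "v \<otimes> g \<in> ?X" using v by (rule imageI)
    ultimately show "v \<otimes> (g \<otimes> h) \<in> {x \<otimes> y | x y. x \<in> ?X \<and> y \<in> {h}}" by blast
  qed
  then have "cosets_of ((\<lambda>v. v \<otimes> (g \<otimes> h)) ` (Z <#> U)) \<subseteq> cosets_of {x \<otimes> y | x y. x \<in> ?X \<and> y \<in> {h}}"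
    unfolding cosets_of_def by (rule image_mono)
  ultimately show ?thesis
    using gc hc finite_subset unfolding tame_def by blast
qed

lemma tame_K:
  assumes "k \<in> K"
  shows "tame k"
proof -
  note kc = K_carrier[OF assms]
  have "cosets_of ((\<lambda>v. v \<otimes> k) ` (Z <#> U)) \<subseteq> {k <# (Z <#> U)}"
  proof
    fix C assume "C \<in> cosets_of ((\<lambda>v. v \<otimes> k) ` (Z <#> U))"
    then obtain v where v: "v \<in> Z <#> U" "C = (v \<otimes> k) <# (Z <#> U)"
      unfolding cosets_of_def image_image by blast
    then obtain z u where C: "z \<in> Z" "u \<in> U" "C = (z \<otimes> u \<otimes> k) <# (Z <#> U)"
      using ZU_iff[of v] by blast
    obtain u' where u': "u' \<in> U" "u \<otimes> k = k \<otimes> u'" by (rule U_push_right[OF assms C(2)])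
    have "z \<otimes> u \<otimes> k = k \<otimes> (z \<otimes> u')"
      using C u' kc Z_carrier U_carrier by (simp add: m_assoc Z_left_comm[of z k])
    then show "C \<in> {k <# (Z <#> U)}"
      using C l_coset_absorb[OF ZU_subgroup kc ZU_I[OF C(1) u'(1)]] by simp
  qed
  then have "finite (cosets_of ((\<lambda>v. v \<otimes> k) ` (Z <#> U)))"
    by (rule finite_subset) simp
  then show ?thesis
    using kc by (simp add: tame_def)
qed

lemma tame_a: "tame a"
proof -
  obtain E where E: "finite E" "E \<subseteq> U" "\<And>u. u \<in> U \<Longrightarrow> \<exists>e\<in>E. \<exists>u'\<in>U. u \<otimes> a = e \<otimes> a \<otimes> u'"
    using a_finite by blast
  have "cosets_of ((\<lambda>v. v \<otimes> a) ` (Z <#> U)) \<subseteq> cosets_of ((\<lambda>e. e \<otimes> a) ` E)"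
  proof
    fix C assume "C \<in> cosets_of ((\<lambda>v. v \<otimes> a) ` (Z <#> U))"
    then obtain v where v: "v \<in> Z <#> U" "C = (v \<otimes> a) <# (Z <#> U)"
      unfolding cosets_of_def image_image by blast
    then obtain z u where C: "z \<in> Z" "u \<in> U" "C = (z \<otimes> u \<otimes> a) <# (Z <#> U)"
      using ZU_iff[of v] by blast
    obtain e u' where e: "e \<in> E" "u' \<in> U" "u \<otimes> a = e \<otimes> a \<otimes> u'"
      using E(3)[OF C(2)] by blast
    have ec: "e \<in> carrier G" using e E(2) U_carrier by blast
    have "z \<otimes> u \<otimes> a = (e \<otimes> a) \<otimes> (z \<otimes> u')"
      using C e ec Z_carrier U_carrier by (simp add: m_assoc Z_left_comm[of z])
    then have "C = (e \<otimes> a) <# (Z <#> U)"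
      using C l_coset_absorb[OF ZU_subgroup _ ZU_I[OF C(1) e(2)], of "e \<otimes> a"] ec by simp
    then show "C \<in> cosets_of ((\<lambda>e. e \<otimes> a) ` E)"
      using e(1) by (simp add: cosets_of_def)
  qed
  then have "finite (cosets_of ((\<lambda>v. v \<otimes> a) ` (Z <#> U)))"
    by (rule finite_subset) (simp add: cosets_of_def E(1))
  then show ?thesis
    by (simp add: tame_def)
qed

lemma tame_all:
  assumes "g \<in> carrier G"
  shows "tame g"
proof -
  have "tame (a [^] l)" for l :: nat
    by (induction l) (auto intro: tame_mult tame_a tame_K K_closed)
  then show ?thesis
    using cartan[OF assms] tame_mult tame_K by metis
qed

text \<open>\<open>K\<close> normalizes \<open>U\<close>, so the factors from \<open>U\<close> slide
  past the outer factors of a Cartan decomposition, and what remains is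
  \<open>a_admissible\<close>.\<close>

lemma admissible_all:
  assumes g: "g \<in> carrier G" and z: "z \<in> Z" and u: "u \<in> U" "u' \<in> U"
    and eq: "z \<otimes> u \<otimes> g \<otimes> u' = g"
  shows "z = \<one>"
proof -
  obtain k1 k2 l where k: "k1 \<in> K" "k2 \<in> K" "g = k1 \<otimes> a [^] (l::nat) \<otimes> k2"
    using cartan[OF g] by blast
  obtain u1 where u1: "u1 \<in> U" "u \<otimes> k1 = k1 \<otimes> u1" by (rule U_push_right[OF k(1) u(1)])
  obtain u2 where u2: "u2 \<in> U" "k2 \<otimes> u' = u2 \<otimes> k2" by (rule U_push_left[OF k(2) u(2)])
  note c = K_carrier[OF k(1)] K_carrier[OF k(2)] Z_carrier[OF z] U_carrier[OF u(1)] U_carrier[OF u(2)]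
    U_carrier[OF u1(1)] U_carrier[OF u2(1)]
  have "k1 \<otimes> (z \<otimes> u1 \<otimes> a [^] l \<otimes> u2) \<otimes> k2 = z \<otimes> (k1 \<otimes> u1) \<otimes> a [^] l \<otimes> (u2 \<otimes> k2)"
    using c z by (simp add: m_assoc Z_left_comm[of z])
  also have "\<dots> = z \<otimes> u \<otimes> g \<otimes> u'"
    unfolding u1(2)[symmetric] u2(2)[symmetric] k(3) using c by (simp add: m_assoc)
  also have "\<dots> = k1 \<otimes> (a [^] l) \<otimes> k2" using eq k(3) by simp
  finally have "z \<otimes> u1 \<otimes> a [^] l \<otimes> u2 = a [^] l"
    using c by simp
  then show ?thesis by (rule a_admissible[OF z u1(1) u2(1)])
qed

end

locale hecke_cartan = cartan_pair G Z U K N T N' a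
  for G (structure) and Z U K N T N' :: "'a set" and a :: 'a +
  fixes \<epsilon> :: "'a \<Rightarrow> complex"
    and mu :: "('a \<Rightarrow> complex) \<Rightarrow> ('a \<Rightarrow> complex) \<Rightarrow> 'a \<Rightarrow> complex"
  assumes eps_mult': "z \<in> Z \<Longrightarrow> z' \<in> Z \<Longrightarrow> \<epsilon> (z \<otimes> z') = \<epsilon> z * \<epsilon> z'"
    and eps_nonzero': "z \<in> Z \<Longrightarrow> \<epsilon> z \<noteq> 0"
begin

sublocale hecke_pair G Z U \<epsilon>
proof
  fix g assume "g \<in> carrier G"
  then show "finite (cosets_of ((\<lambda>v. v \<otimes> g) ` (Z <#> U)))"
    using tame_all[of g] by (simp add: tame_def)
qed (use eps_mult' eps_nonzero' admissible_all in blast)+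

end

lemma single_zero_commutes:
  fixes f :: "'x word \<Rightarrow>\<^sub>0 complex"
  shows "f * Poly_Mapping.single 0 c = Poly_Mapping.single 0 c * f"
  by (induction f rule: poly_mapping_single_induct)
    (simp_all add: distrib_left distrib_right mult_single mult.commute)

text \<open>The complex linear span, scalars being multiples of the empty word. The inductive form
  allows closure properties to be proved one term at a time.\<close>

inductive_set lin_span :: "('x word \<Rightarrow>\<^sub>0 complex) set \<Rightarrow> ('x word \<Rightarrow>\<^sub>0 complex) set" for S where
  zero: "0 \<in> lin_span S"
| step: "x \<in> S \<Longrightarrow> f \<in> lin_span S \<Longrightarrow> Poly_Mapping.single 0 c * x + f \<in> lin_span S"

lemma lin_span_base: "x \<in> S \<Longrightarrow> x \<in> lin_span S"
  using lin_span.step[OF _ lin_span.zero, of x S 1] by simp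

lemma lin_span_add: "f \<in> lin_span S \<Longrightarrow> g \<in> lin_span S \<Longrightarrow> f + g \<in> lin_span S"
  by (induction f rule: lin_span.induct) (simp_all add: add.assoc lin_span.step)

lemma lin_span_smult: "f \<in> lin_span S \<Longrightarrow> Poly_Mapping.single 0 c * f \<in> lin_span S"
proof (induction f rule: lin_span.induct)
  case (step x f d)
  then show ?case
    using lin_span.step[of x S _ "c * d"]
    by (simp add: distrib_left mult_single flip: mult.assoc)
qed (simp add: lin_span.zero)

text \<open>Terms repeated in the generation are merged by adding their coefficients. The result is
  a sum over a set of distinct elements, whose cardinality drives the induction in
  \<open>kernel_normal_forms\<close>.\<close>

lemma lin_span_explicit:
  "f \<in> lin_span S \<Longrightarrow> \<exists>t c. finite t \<and> t \<subseteq> S \<and> f = (\<Sum>x\<in>t. Poly_Mapping.single 0 (c x) * x)"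
proof (induction f rule: lin_span.induct)
  case zero
  show ?case by (intro exI[of _ "{}"]) simp
next
  case (step x f d)
  then obtain t c where t: "finite t" "t \<subseteq> S" "f = (\<Sum>x\<in>t. Poly_Mapping.single 0 (c x) * x)"
    by blast
  define c' where "c' = (\<lambda>y. (if y \<in> t then c y else 0) + (if y = x then d else 0))"
  have "(\<Sum>y\<in>insert x t. Poly_Mapping.single 0 (c' y) * y) =
      (\<Sum>y\<in>insert x t. Poly_Mapping.single 0 (if y \<in> t then c y else 0) * y) +
      (\<Sum>y\<in>insert x t. Poly_Mapping.single 0 (if y = x then d else 0) * y)"
    by (simp add: c'_def single_add distrib_right sum.distrib)
  also have "(\<Sum>y\<in>insert x t. Poly_Mapping.single 0 (if y = x then d else 0) * y) =
      (\<Sum>y\<in>{x}. Poly_Mapping.single 0 d * y)"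
    using t(1) by (intro sum.mono_neutral_cong_right) auto
  also have "(\<Sum>y\<in>insert x t. Poly_Mapping.single 0 (if y \<in> t then c y else 0) * y) = f"
    unfolding t(3) using t(1) by (intro sum.mono_neutral_cong_right) auto
  finally show ?case
    using t step(1) by (intro exI[of _ "insert x t"] exI[of _ c']) (simp add: add.commute)
qed

section \<open>Generators and evaluation of words in the Hecke algebra\<close>

locale hecke_presentation = hecke_cartan +
  assumes mu: "f \<in> hecke_functions \<Longrightarrow> h \<in> hecke_functions \<Longrightarrow> mu f h = convol f h"
begin

interpretation H: complex_algebra "hecke_ring mu"
  by (rule complex_algebra_hecke_ring[OF mu])

lemma chi_K_left:
  assumes "k \<in> K" "f \<in> hecke_functions" "x \<in> carrier G"
  shows "convol (chi k) f x = f (inv k \<otimes> x)"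
  by (rule chi_normalizing_left[OF K_carrier[OF assms(1)] normal'[OF assms(1)] assms(2,3)])

lemma chi_K_right:
  assumes "k \<in> K" "f \<in> hecke_functions" "x \<in> carrier G"
  shows "convol f (chi k) x = f (x \<otimes> inv k)"
  by (rule chi_normalizing_right[OF K_carrier[OF assms(1)] normal[OF assms(1)] assms(2,3)])

text \<open>This makes the generators coming from \<open>K\<close> finite in number: only the coset
  of \<open>k\<close> modulo \<open>U\<close> matters.\<close>

lemma chi_coset:
  assumes k: "k \<in> K" and u: "u \<in> U"
  shows "chi (k \<otimes> u) = chi k"
proof
  fix x
  note c = K_carrier[OF k] U_carrier[OF u]
  have iff: "(\<exists>u1\<in>U. \<exists>u2\<in>U. x = z \<otimes> u1 \<otimes> (k \<otimes> u) \<otimes> u2) \<longleftrightarrow> (\<exists>u1\<in>U. \<exists>u2\<in>U. x = z \<otimes> u1 \<otimes> k \<otimes> u2)"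
    if z: "z \<in> Z" for z
  proof
    assume "\<exists>u1\<in>U. \<exists>u2\<in>U. x = z \<otimes> u1 \<otimes> (k \<otimes> u) \<otimes> u2"
    then obtain u1 u2 where w: "u1 \<in> U" "u2 \<in> U" "x = z \<otimes> u1 \<otimes> (k \<otimes> u) \<otimes> u2" by blast
    then have "x = z \<otimes> u1 \<otimes> k \<otimes> (u \<otimes> u2)"
      using c U_carrier Z_carrier[OF z] by (simp add: m_assoc)
    then show "\<exists>u1\<in>U. \<exists>u2\<in>U. x = z \<otimes> u1 \<otimes> k \<otimes> u2" using w u ZU_closed(2) by blast
  next
    assume "\<exists>u1\<in>U. \<exists>u2\<in>U. x = z \<otimes> u1 \<otimes> k \<otimes> u2"
    then obtain u1 u2 where w: "u1 \<in> U" "u2 \<in> U" "x = z \<otimes> u1 \<otimes> k \<otimes> u2" by blast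
    then have "x = z \<otimes> u1 \<otimes> (k \<otimes> u) \<otimes> (inv u \<otimes> u2)"
      using c U_carrier Z_carrier[OF z] by (simp add: m_assoc)
    then show "\<exists>u1\<in>U. \<exists>u2\<in>U. x = z \<otimes> u1 \<otimes> (k \<otimes> u) \<otimes> u2" using w u ZU_closed(2,4) by blast
  qed
  show "chi (k \<otimes> u) x = chi k x"
    unfolding chi_def using iff by (simp cong: conj_cong bex_cong)
qed

text \<open>Convolution with \<open>chi k\<close> is translation by \<open>k\<close>, and
  \<open>k\<close> normalizes \<open>U\<close>. The equivalence of memberships is proved for each
  fixed \<open>z\<close>, so that the choices of \<open>z\<close> made by \<open>chi_def\<close> on
  both sides coincide.\<close>

lemma convol_chi_K:
  assumes k: "k \<in> K" and g: "g \<in> carrier G"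
  shows "convol (chi k) (chi g) = chi (k \<otimes> g)"
proof
  fix x
  show "convol (chi k) (chi g) x = chi (k \<otimes> g) x"
  proof (cases "x \<in> carrier G")
    case x: True
    note kc = K_carrier[OF k]
    have iff: "(\<exists>u1\<in>U. \<exists>u2\<in>U. inv k \<otimes> x = z \<otimes> u1 \<otimes> g \<otimes> u2) \<longleftrightarrow>
        (\<exists>u1\<in>U. \<exists>u2\<in>U. x = z \<otimes> u1 \<otimes> (k \<otimes> g) \<otimes> u2)" if z: "z \<in> Z" for z
    proof
      assume "\<exists>u1\<in>U. \<exists>u2\<in>U. inv k \<otimes> x = z \<otimes> u1 \<otimes> g \<otimes> u2"
      then obtain u1 u2 where w: "u1 \<in> U" "u2 \<in> U" "inv k \<otimes> x = z \<otimes> u1 \<otimes> g \<otimes> u2" by blast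
      obtain u3 where u3: "u3 \<in> U" "k \<otimes> u1 = u3 \<otimes> k" by (rule U_push_left[OF k w(1)])
      have "x = k \<otimes> (inv k \<otimes> x)" using x kc by simp
      also have "\<dots> = z \<otimes> ((k \<otimes> u1) \<otimes> (g \<otimes> u2))"
        unfolding w(3) using kc z g w U_carrier Z_carrier by (simp add: m_assoc Z_left_comm[of z])
      also have "\<dots> = z \<otimes> u3 \<otimes> (k \<otimes> g) \<otimes> u2"
        unfolding u3(2) using kc z g w u3 U_carrier Z_carrier by (simp add: m_assoc)
      finally show "\<exists>u1\<in>U. \<exists>u2\<in>U. x = z \<otimes> u1 \<otimes> (k \<otimes> g) \<otimes> u2" using u3 w by blast
    next
      assume "\<exists>u1\<in>U. \<exists>u2\<in>U. x = z \<otimes> u1 \<otimes> (k \<otimes> g) \<otimes> u2"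
      then obtain u1 u2 where w: "u1 \<in> U" "u2 \<in> U" "x = z \<otimes> u1 \<otimes> (k \<otimes> g) \<otimes> u2" by blast
      obtain u3 where u3: "u3 \<in> U" "u1 \<otimes> k = k \<otimes> u3" by (rule U_push_right[OF k w(1)])
      have "inv k \<otimes> x = z \<otimes> (inv k \<otimes> ((u1 \<otimes> k) \<otimes> (g \<otimes> u2)))"
        unfolding w(3) using kc z g w U_carrier Z_carrier by (simp add: m_assoc Z_left_comm[of z])
      also have "\<dots> = z \<otimes> u3 \<otimes> g \<otimes> u2"
        unfolding u3(2) using kc z g w u3 U_carrier Z_carrier by (simp add: m_assoc)
      finally show "\<exists>u1\<in>U. \<exists>u2\<in>U. inv k \<otimes> x = z \<otimes> u1 \<otimes> g \<otimes> u2" using u3 w by blast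
    qed
    show ?thesis
      unfolding chi_K_left[OF k chi_hecke[OF g] x] chi_def using iff by (simp cong: conj_cong bex_cong)
  next
    case False
    then show ?thesis
      using hecke_outside[OF chi_hecke] K_carrier[OF k] g by (simp add: convol_def)
  qed
qed

lemma chi_Z:
  assumes z: "z \<in> Z"
  shows "chi z = (\<lambda>x. inverse (\<epsilon> z) * chi \<one> x)"
proof
  fix x
  show "chi z x = inverse (\<epsilon> z) * chi \<one> x"
  proof (cases "x \<in> carrier G")
    case True
    have "chi z x = convol (chi z) (chi \<one>) x"
      using convol_chi_K[OF Z_in_K[OF z] one_closed] Z_carrier[OF z] by simp
    also have "\<dots> = chi \<one> (inv z \<otimes> x)"
      by (rule chi_K_left[OF Z_in_K[OF z] chi_hecke[OF one_closed] True])
    also have "\<dots> = inverse (\<epsilon> z) * chi \<one> x"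
      using hecke_genuine[OF chi_hecke[OF one_closed] ZU_closed(3)[OF z] True] eps_inv[OF z] by simp
    finally show ?thesis .
  next
    case False
    then show ?thesis
      using hecke_outside[OF chi_hecke] Z_carrier[OF z] by simp
  qed
qed


text \<open>Cosets modulo \<open>U\<close> and not modulo \<open>Z <#> U\<close>: central elements
  stay among the generators, and a separate relation turns them into scalars.\<close>

definition KU :: "'a set set"
  where "KU = (\<lambda>k. k <# U) ` K"

text \<open>Cosets take the letters below \<open>card KU\<close>; the letter \<open>card KU\<close>
  itself is reserved for \<open>a\<close>.\<close>

definition idx :: "'a set \<Rightarrow> nat"
  where "idx = (SOME h. bij_betw h KU {0..<card KU})"

abbreviation "gens \<equiv> Suc (card KU)"

definition L :: "'a \<Rightarrow> nat word \<Rightarrow>\<^sub>0 complex"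
  where "L k = Poly_Mapping.single (Word [idx (k <# U)]) 1"

definition A :: "nat word \<Rightarrow>\<^sub>0 complex"
  where "A = Poly_Mapping.single (Word [card KU]) 1"

definition gen :: "nat \<Rightarrow> 'a \<Rightarrow> complex"
  where "gen i = (if i < card KU then chi (SOME k. k \<in> K \<and> idx (k <# U) = i) else chi a)"

definition ev :: "(nat word \<Rightarrow>\<^sub>0 complex) \<Rightarrow> 'a \<Rightarrow> complex"
  where "ev = complex_algebra.free_value (hecke_ring mu) gen"

lemma finite_KU: "finite KU"
proof -
  obtain E where E: "finite E" "E \<subseteq> K" "\<And>k. k \<in> K \<Longrightarrow> \<exists>e\<in>E. \<exists>u\<in>U. k = e \<otimes> u"
    using finite_index by blast
  have "KU \<subseteq> (\<lambda>e. e <# U) ` E"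
    unfolding KU_def
  proof (rule image_subsetI)
    fix k assume "k \<in> K"
    then obtain e u where e: "e \<in> E" "u \<in> U" "k = e \<otimes> u" using E(3) by blast
    then have "k <# U = e <# U"
      using l_coset_absorb[OF U, of e u] K_carrier subsetD[OF E(2)] by simp
    then show "k <# U \<in> (\<lambda>e. e <# U) ` E" using e(1) by simp
  qed
  then show ?thesis using E(1) finite_subset by blast
qed

lemma idx_bij: "bij_betw idx KU {0..<card KU}"
  unfolding idx_def using ex_bij_betw_finite_nat[OF finite_KU] by (rule someI_ex)

lemma idx_less: "k \<in> K \<Longrightarrow> idx (k <# U) < card KU"
  using bij_betwE[OF idx_bij] by (auto simp: KU_def)

lemma coset_eqD:
  assumes "k \<in> K" "k' \<in> K" "k <# U = k' <# U"
  obtains u where "u \<in> U" "k' = k \<otimes> u"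
proof (rule that)
  show "inv k \<otimes> k' \<in> U" using l_coset_eq_iff[OF U] assms K_carrier by blast
  show "k' = k \<otimes> (inv k \<otimes> k')" using assms K_carrier by simp
qed

lemma gen_idx:
  assumes k: "k \<in> K"
  shows "gen (idx (k <# U)) = chi k"
proof -
  define k' where "k' = (SOME k'. k' \<in> K \<and> idx (k' <# U) = idx (k <# U))"
  have k': "k' \<in> K \<and> idx (k' <# U) = idx (k <# U)"
    unfolding k'_def by (rule someI[of _ k]) (simp add: k)
  then have "k' <# U = k <# U"
    using bij_betw_imp_inj_on[OF idx_bij] k unfolding inj_on_def KU_def by blast
  then obtain u where "u \<in> U" "k = k' \<otimes> u"
    using coset_eqD[OF _ k] k' by blast
  then have "chi k = chi k'" using chi_coset k' by simp
  then show ?thesis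
    using idx_less[OF k] by (simp add: gen_def k'_def)
qed

lemma idx_obtain:
  assumes "i < card KU"
  obtains k where "k \<in> K" "idx (k <# U) = i"
proof -
  have "i \<in> idx ` KU" using idx_bij assms by (simp add: bij_betw_def)
  then show thesis using that unfolding KU_def by blast
qed

lemma gen_closed: "gen \<in> UNIV \<rightarrow> hecke_functions"
proof
  fix i show "gen i \<in> hecke_functions"
  proof (cases "i < card KU")
    case True
    then obtain k where "k \<in> K" "idx (k <# U) = i" by (rule idx_obtain)
    then show ?thesis using gen_idx chi_hecke K_carrier by metis
  qed (simp add: gen_def chi_hecke)
qed

lemma gen_closed': "gen \<in> UNIV \<rightarrow> carrier (hecke_ring mu)"
  using gen_closed by simp

lemma ev_closed: "ev f \<in> hecke_functions"
  using H.free_value_closed[OF gen_closed'] by (simp add: ev_def)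

lemma ev_mult: "ev (f * g) = convol (ev f) (ev g)"
  using H.free_value_mult[OF gen_closed', of f g] ev_closed by (simp add: ev_def mu)

lemma ev_add: "ev (f + g) = (\<lambda>x. ev f x + ev g x)"
  using H.free_value_add[OF gen_closed', of f g] by (simp add: ev_def)

lemma ev_zero: "ev 0 = (\<lambda>x. 0)"
  using H.free_value_zero[OF gen_closed'] by (simp add: ev_def)

lemma ev_one: "ev 1 = chi \<one>"
  using H.free_value_one[OF gen_closed'] by (simp add: ev_def)

lemma ev_smult: "ev (Poly_Mapping.single 0 c * f) = (\<lambda>x. c * ev f x)"
  using H.free_value_smult[OF gen_closed', of c f] by (simp add: ev_def)

lemma ev_diff: "ev (f - g) = (\<lambda>x. ev f x - ev g x)"
proof
  fix x
  have "ev f x = ev (f - g) x + ev g x"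
    using ev_add[of "f - g" g] by simp
  then show "ev (f - g) x = ev f x - ev g x" by simp
qed

lemma ev_L: "k \<in> K \<Longrightarrow> ev (L k) = chi k"
  using H.free_value_letter[OF gen_closed'] gen_idx by (simp add: ev_def L_def)

lemma ev_A: "ev A = chi a"
  using H.free_value_letter[OF gen_closed'] by (simp add: ev_def A_def gen_def)

lemma N'U_pow:
  assumes "y \<in> N'" "y \<in> U"
  shows "\<exists>y'\<in>N' \<inter> U. y \<otimes> a [^] (l::nat) = a [^] l \<otimes> y'"
proof (induction l)
  case 0
  show ?case using assms U_carrier by (intro bexI[of _ y]) auto
next
  case (Suc l)
  then obtain y' where y': "y' \<in> N' \<inter> U" "y \<otimes> a [^] l = a [^] l \<otimes> y'" by blast
  then obtain y'' where y'': "y'' \<in> N' \<inter> U" "y' \<otimes> a = a \<otimes> y''" using N'_conj_U by blast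
  have c: "y \<in> carrier G" "y' \<in> carrier G" "y'' \<in> carrier G"
    using U_carrier assms y' y'' by blast+
  have "y \<otimes> a [^] Suc l = (y \<otimes> a [^] l) \<otimes> a" using c by (simp add: m_assoc)
  also have "\<dots> = a [^] l \<otimes> (y' \<otimes> a)" unfolding y'(2) using c by (simp add: m_assoc)
  also have "\<dots> = a [^] Suc l \<otimes> y''" unfolding y''(2) using c by (simp add: m_assoc)
  finally show ?case using y''(1) by blast
qed

text \<open>In the Iwahori factorization of \<open>u\<close> the first factor crosses the
  \<open>a\<close> on its left and the lower unipotent one crosses the whole power on its right,
  both ending in \<open>U\<close>. Hence multiplying by \<open>A\<close> never leaves the double
  coset of a power of \<open>a\<close>.\<close>

lemma UaUaU:
  assumes u: "u \<in> U"
  shows "\<exists>u1\<in>U. \<exists>u2\<in>U. a \<otimes> u \<otimes> a [^] (l::nat) = u1 \<otimes> a [^] Suc l \<otimes> u2"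
proof -
  obtain u1 u2 y where w: "u1 \<in> U" "u2 \<in> U" "y \<in> N' \<inter> U" "u = u1 \<otimes> y" "a \<otimes> u1 = u2 \<otimes> a"
    using iwahori[OF u] by blast
  obtain y' where y': "y' \<in> N' \<inter> U" "y \<otimes> a [^] l = a [^] l \<otimes> y'"
    using N'U_pow w(3) by blast
  have c: "u1 \<in> carrier G" "u2 \<in> carrier G" "y \<in> carrier G" "y' \<in> carrier G"
    using U_carrier w y' by blast+
  have "a \<otimes> u \<otimes> a [^] l = (a \<otimes> u1) \<otimes> (y \<otimes> a [^] l)"
    unfolding w(4) using c by (simp add: m_assoc)
  also have "\<dots> = u2 \<otimes> (a \<otimes> a [^] l) \<otimes> y'"
    unfolding w(5) y'(2) using c by (simp add: m_assoc)
  also have "a \<otimes> a [^] l = a [^] Suc l"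
    by (simp add: nat_pow_comm[of a 1 l, simplified])
  finally show ?thesis using w y' by blast
qed

lemma ev_A_Suc: "ev (A ^ Suc l) = convol (chi a) (ev (A ^ l))"
  by (simp add: ev_mult ev_A)

lemma ev_A_pow_support:
  assumes "ev (A ^ l) x \<noteq> 0"
  shows "\<exists>z\<in>Z. \<exists>u\<in>U. \<exists>u'\<in>U. x = z \<otimes> u \<otimes> a [^] l \<otimes> u'"
  using assms
proof (induction l arbitrary: x)
  case 0
  then have "chi \<one> x \<noteq> 0" by (simp add: ev_one)
  then show ?case by (elim chi_nonzeroE) auto
next
  case (Suc l)
  have "convol (chi a) (ev (A ^ l)) x \<noteq> 0"
    using Suc.prems by (simp only: ev_A_Suc not_False_eq_True)
  then obtain y where y: "y \<in> carrier G" "x \<in> carrier G" "chi a y \<noteq> 0" "ev (A ^ l) (inv y \<otimes> x) \<noteq> 0"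
    by (rule convol_nonzeroE)
  obtain z u u' where w: "z \<in> Z" "u \<in> U" "u' \<in> U" "y = z \<otimes> u \<otimes> a \<otimes> u'"
    using y(3) by (rule chi_nonzeroE)
  obtain z1 u1 u2 where w1: "z1 \<in> Z" "u1 \<in> U" "u2 \<in> U" "inv y \<otimes> x = z1 \<otimes> u1 \<otimes> a [^] l \<otimes> u2"
    using Suc.IH[OF y(4)] by blast
  obtain u3 u4 where u34: "u3 \<in> U" "u4 \<in> U" "a \<otimes> (u' \<otimes> u1) \<otimes> a [^] l = u3 \<otimes> a [^] Suc l \<otimes> u4"
    using UaUaU[OF ZU_closed(2)[OF w(3) w1(2)]] by blast
  note c = Z_carrier[OF w(1)] U_carrier[OF w(2)] U_carrier[OF w(3)]
    Z_carrier[OF w1(1)] U_carrier[OF w1(2)] U_carrier[OF w1(3)] U_carrier[OF u34(1)] U_carrier[OF u34(2)]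
  have "x = y \<otimes> (inv y \<otimes> x)" using y by simp
  also have "\<dots> = z \<otimes> z1 \<otimes> u \<otimes> (a \<otimes> (u' \<otimes> u1) \<otimes> a [^] l) \<otimes> u2"
    unfolding w1(4) unfolding w(4) using c w1(1) by (simp add: m_assoc Z_left_comm[of z1])
  also have "\<dots> = (z \<otimes> z1) \<otimes> (u \<otimes> u3) \<otimes> a [^] Suc l \<otimes> (u4 \<otimes> u2)"
    unfolding u34(3) using c by (simp add: m_assoc del: nat_pow_Suc)
  finally show ?case
    using ZU_closed(1)[OF w(1) w1(1)] ZU_closed(2)[OF w(2) u34(1)] ZU_closed(2)[OF u34(2) w1(3)]
    by blast
qed

text \<open>There is no cancellation: in the sum for the value at \<open>a [^] Suc l\<close> every
  nonzero term equals the same number \<open>?c\<close>. The central factors \<open>z\<close> and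
  \<open>z1\<close> coming from the two arguments have product one by \<open>a_admissible\<close>,
  so their characters cancel.\<close>

lemma ev_A_pow_nonzero: "ev (A ^ l) (a [^] l) \<noteq> 0"
proof (induction l)
  case 0
  show ?case using chi_self[OF one_closed] by (simp add: ev_one)
next
  case (Suc l)
  let ?x = "a [^] Suc l"
  let ?c = "ev (A ^ l) (a [^] l)"
  let ?\<phi> = "\<lambda>y. chi a y * ev (A ^ l) (inv y \<otimes> ?x)"
  have \<phi>: "?\<phi> \<in> coset_functions"
    by (rule convol_coset_function[OF chi_hecke[OF a] ev_closed nat_pow_closed[OF a]])
  have val: "?\<phi> y = ?c" if y: "y \<in> carrier G" "?\<phi> y \<noteq> 0" for y
  proof -
    have y': "chi a y \<noteq> 0" "ev (A ^ l) (inv y \<otimes> ?x) \<noteq> 0" using y(2) by auto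
    obtain z u u' where w: "z \<in> Z" "u \<in> U" "u' \<in> U" "y = z \<otimes> u \<otimes> a \<otimes> u'"
      using y'(1) by (rule chi_nonzeroE)
    obtain z1 u1 u2 where w1: "z1 \<in> Z" "u1 \<in> U" "u2 \<in> U" "inv y \<otimes> ?x = z1 \<otimes> u1 \<otimes> a [^] l \<otimes> u2"
      using ev_A_pow_support[OF y'(2)] by blast
    obtain u3 u4 where u34: "u3 \<in> U" "u4 \<in> U" "a \<otimes> (u' \<otimes> u1) \<otimes> a [^] l = u3 \<otimes> ?x \<otimes> u4"
      using UaUaU[OF ZU_closed(2)[OF w(3) w1(2)]] by blast
    note c = Z_carrier[OF w(1)] U_carrier[OF w(2)] U_carrier[OF w(3)]
      Z_carrier[OF w1(1)] U_carrier[OF w1(2)] U_carrier[OF w1(3)] U_carrier[OF u34(1)] U_carrier[OF u34(2)]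
    have "?x = y \<otimes> (inv y \<otimes> ?x)" using y(1) nat_pow_closed[OF a, of "Suc l"] by (simp del: nat_pow_Suc)
    also have "\<dots> = z \<otimes> z1 \<otimes> u \<otimes> (a \<otimes> (u' \<otimes> u1) \<otimes> a [^] l) \<otimes> u2"
      unfolding w1(4) unfolding w(4) using c w1(1) by (simp add: m_assoc Z_left_comm[of z1])
    also have "\<dots> = (z \<otimes> z1) \<otimes> (u \<otimes> u3) \<otimes> ?x \<otimes> (u4 \<otimes> u2)"
      unfolding u34(3) using c by (simp add: m_assoc del: nat_pow_Suc)
    finally have "z \<otimes> z1 = \<one>"
      by (intro a_admissible[of "z \<otimes> z1" "u \<otimes> u3" "u4 \<otimes> u2" "Suc l"]) (rule ZU_closed w w1 u34 | assumption | simp)+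
    then have e: "\<epsilon> z * \<epsilon> z1 = 1"
      using eps_mult[OF w(1) w1(1)] eps_one by simp
    have "chi a y = \<epsilon> z" unfolding w(4) by (rule chi_eq[OF a w(1-3)])
    moreover have "ev (A ^ l) (inv y \<otimes> ?x) = \<epsilon> z1 * ?c"
      unfolding w1(4) by (rule hecke_double[OF ev_closed w1(1-3)]) simp
    ultimately show ?thesis using e by (simp add: mult.assoc[symmetric])
  qed
  let ?D = "cosets_of {y \<in> carrier G. ?\<phi> y \<noteq> 0}"
  have "?x = a \<otimes> a [^] l"
    using nat_pow_comm[of a 1 l] by simp
  then have "inv a \<otimes> ?x = a [^] l" by (simp del: nat_pow_Suc)
  then have "?\<phi> a \<noteq> 0" using Suc chi_self[OF a] by simp
  \<comment> \<open>The coset of \<open>a\<close> itself contributes, so the number of equal terms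
    is not zero.\<close>
  then have "a <# (Z <#> U) \<in> ?D" by (simp add: cosets_of_def)
  moreover have "finite ?D" using \<phi> by (simp add: coset_functions_def)
  ultimately have card: "card ?D \<noteq> 0" by auto
  have "ev (A ^ Suc l) ?x = sum_cosets ?\<phi>"
    using nat_pow_closed[OF a, of "Suc l"] by (simp add: ev_A_Suc convol_def del: nat_pow_Suc power_Suc)
  also have "\<dots> = (\<Sum>C\<in>?D. ?c)"
    unfolding sum_cosets_def
  proof (rule sum.cong[OF refl])
    fix C assume "C \<in> ?D"
    then obtain y where y: "y \<in> carrier G" "?\<phi> y \<noteq> 0" "C = y <# (Z <#> U)"
      unfolding cosets_of_def by blast
    show "?\<phi> (coset_rep C) = ?c"
      using coset_functions_rep[OF \<phi> y(1)] val[OF y(1,2)] y(3) by simp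
  qed
  finally show ?case using card Suc by simp
qed

section \<open>Normal forms and their supports\<close>

definition NF :: "'a \<Rightarrow> nat \<Rightarrow> 'a \<Rightarrow> nat word \<Rightarrow>\<^sub>0 complex"
  where "NF k l k' = L k * A ^ l * L k'"

definition NFs :: "nat set \<Rightarrow> (nat word \<Rightarrow>\<^sub>0 complex) set"
  where "NFs \<Lambda> = {NF k l k' | k l k'. k \<in> K \<and> l \<in> \<Lambda> \<and> k' \<in> K}"

lemma ev_NF:
  assumes k: "k \<in> K" "k' \<in> K" and x: "x \<in> carrier G"
  shows "ev (NF k l k') x = ev (A ^ l) (inv k \<otimes> x \<otimes> inv k')"
proof -
  have "ev (NF k l k') x = ev (L k * A ^ l) (x \<otimes> inv k')"
    unfolding NF_def ev_mult[of _ "L k'"] ev_L[OF k(2)]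
    by (rule chi_K_right[OF k(2) ev_closed x])
  also have "\<dots> = ev (A ^ l) (inv k \<otimes> (x \<otimes> inv k'))"
    unfolding ev_mult ev_L[OF k(1)]
    by (rule chi_K_left[OF k(1) ev_closed]) (simp add: x K_carrier[OF k(2)])
  finally show ?thesis using k x K_carrier by (simp add: m_assoc)
qed

lemma ev_NF_self:
  assumes k: "k \<in> K" "k' \<in> K"
  shows "ev (NF k l k') (k \<otimes> a [^] l \<otimes> k') \<noteq> 0"
proof -
  note c = K_carrier[OF k(1)] K_carrier[OF k(2)]
  have "inv k \<otimes> (k \<otimes> a [^] l \<otimes> k') \<otimes> inv k' = a [^] l"
    using c by (simp add: m_assoc)
  then show ?thesis
    using ev_NF[OF k, of "k \<otimes> a [^] l \<otimes> k'" l] ev_A_pow_nonzero[of l] c by simp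
qed

lemma ev_NF_support:
  assumes k: "k \<in> K" "k' \<in> K" and x: "ev (NF k l k') x \<noteq> 0"
  obtains z u u' where "z \<in> Z" "u \<in> U" "u' \<in> U" "x = z \<otimes> u \<otimes> (k \<otimes> a [^] l \<otimes> k') \<otimes> u'"
proof -
  have xc: "x \<in> carrier G" using x hecke_outside[OF ev_closed] by blast
  have "ev (A ^ l) (inv k \<otimes> x \<otimes> inv k') \<noteq> 0"
    using x by (simp only: ev_NF[OF k xc] not_False_eq_True)
  then obtain z u u' where w: "z \<in> Z" "u \<in> U" "u' \<in> U" "inv k \<otimes> x \<otimes> inv k' = z \<otimes> u \<otimes> a [^] l \<otimes> u'"
    using ev_A_pow_support by blast
  obtain u1 where u1: "u1 \<in> U" "k \<otimes> u = u1 \<otimes> k" by (rule U_push_left[OF k(1) w(2)])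
  obtain u2 where u2: "u2 \<in> U" "u' \<otimes> k' = k' \<otimes> u2" by (rule U_push_right[OF k(2) w(3)])
  note c = K_carrier[OF k(1)] K_carrier[OF k(2)] Z_carrier[OF w(1)] U_carrier[OF w(2)] U_carrier[OF w(3)]
    U_carrier[OF u1(1)] U_carrier[OF u2(1)]
  have "x = k \<otimes> (inv k \<otimes> x \<otimes> inv k') \<otimes> k'" using c xc by (simp add: m_assoc)
  also have "\<dots> = z \<otimes> ((k \<otimes> u) \<otimes> (a [^] l \<otimes> (u' \<otimes> k')))"
    unfolding w(4) using c w(1) by (simp add: m_assoc Z_left_comm[of z])
  also have "\<dots> = z \<otimes> u1 \<otimes> (k \<otimes> a [^] l \<otimes> k') \<otimes> u2"
    unfolding u1(2) u2(2) using c by (simp add: m_assoc)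
  finally show thesis by (rule that[OF w(1) u1(1) u2(1)])
qed

text \<open>On the support of a normal form a Hecke function is determined by its value at the
  centre \<open>k \<otimes> a [^] l \<otimes> k'\<close>, up to an invertible factor. In particular
  it vanishes everywhere there or nowhere.\<close>

lemma ev_NF_nonzero_on:
  assumes k: "k \<in> K" "k' \<in> K" and x: "x \<in> carrier G" "ev (NF k l k') x \<noteq> 0"
    and f: "f \<in> hecke_functions"
  obtains z where "z \<in> Z" "f x = \<epsilon> z * f (k \<otimes> a [^] l \<otimes> k')"
proof -
  obtain z u u' where w: "z \<in> Z" "u \<in> U" "u' \<in> U" "x = z \<otimes> u \<otimes> (k \<otimes> a [^] l \<otimes> k') \<otimes> u'"
    by (rule ev_NF_support[OF k x(2)])
  have "f x = \<epsilon> z * f (k \<otimes> a [^] l \<otimes> k')"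
    unfolding w(4) by (rule hecke_double[OF f w(1-3)]) (use k K_carrier in simp)
  then show thesis by (rule that[OF w(1)])
qed

text \<open>Induction on the number of cosets in the support. Subtracting a multiple of the normal
  form centred at a point \<open>x\<close> of the support kills the coset of \<open>x\<close>, and
  no new support arises because \<open>f\<close> is nonzero on the whole support of that normal
  form. The set \<open>\<Lambda>\<close> keeps track of the exponents that are used.\<close>

lemma hecke_spanned:
  assumes f: "f \<in> hecke_functions"
    and "\<And>x. f x \<noteq> 0 \<Longrightarrow> \<exists>k\<in>K. \<exists>k'\<in>K. \<exists>l\<in>\<Lambda>. x = k \<otimes> a [^] l \<otimes> k'"
  shows "\<exists>b\<in>lin_span (NFs \<Lambda>). ev b = f"
  using assms
proof (induction "card (cosets_of {x \<in> carrier G. f x \<noteq> 0})" arbitrary: f rule: less_induct)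
  case less
  show ?case
  proof (cases "\<forall>x. f x = 0")
    case True
    then have "ev 0 = f" by (auto simp: ev_zero)
    then show ?thesis using lin_span.zero by blast
  next
    case False
    then obtain x where x: "f x \<noteq> 0" by blast
    then obtain k k' l where k: "k \<in> K" "k' \<in> K" "l \<in> \<Lambda>" "x = k \<otimes> a [^] l \<otimes> k'"
      using less.prems(2) by blast
    have xc: "x \<in> carrier G" using x hecke_outside[OF less.prems(1)] by blast
    let ?n = "NF k l k'"
    define c where "c = f x / ev ?n x"
    define h where "h = (\<lambda>y. 1 * f y + (- c) * ev ?n y)"
    have nx: "ev ?n x \<noteq> 0" using ev_NF_self[OF k(1,2)] k(4) by simp
    have h: "h \<in> hecke_functions"
      unfolding h_def by (rule hecke_linear[OF less.prems(1) ev_closed])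
    have hx: "h x = 0" using nx by (simp add: h_def c_def)
    have hf: "f y \<noteq> 0" if "h y \<noteq> 0" for y
    proof
      assume fy: "f y = 0"
      then have ny: "ev ?n y \<noteq> 0" using that by (auto simp: h_def)
      then have yc: "y \<in> carrier G" using hecke_outside[OF ev_closed] by blast
      obtain z where "z \<in> Z" "f y = \<epsilon> z * f x"
        using ev_NF_nonzero_on[OF k(1,2) yc ny less.prems(1)] k(4) by blast
      then show False using fy x eps_nonzero by simp
    qed
    have xh: "x <# (Z <#> U) \<notin> cosets_of {y \<in> carrier G. h y \<noteq> 0}"
    proof
      assume "x <# (Z <#> U) \<in> cosets_of {y \<in> carrier G. h y \<noteq> 0}"
      then obtain y where y: "y \<in> carrier G" "h y \<noteq> 0" "x <# (Z <#> U) = y <# (Z <#> U)"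
        unfolding cosets_of_def by blast
      then have "inv x \<otimes> y \<in> Z <#> U" using l_coset_eq_iff[OF ZU_subgroup xc y(1)] by blast
      then obtain z u where v: "z \<in> Z" "u \<in> U" "inv x \<otimes> y = z \<otimes> u" using ZU_iff by blast
      have "y = x \<otimes> (inv x \<otimes> y)" using xc y by simp
      then have "h y = \<epsilon> z * h x" unfolding v(3) using hecke_ZU_right[OF h v(1,2) xc] by simp
      then show False using y(2) hx by simp
    qed
    have "cosets_of {y \<in> carrier G. h y \<noteq> 0} \<subseteq> cosets_of {y \<in> carrier G. f y \<noteq> 0}"
      unfolding cosets_of_def by (rule image_mono) (use hf in blast)
    moreover have "x <# (Z <#> U) \<in> cosets_of {y \<in> carrier G. f y \<noteq> 0}"
      using x xc by (simp add: cosets_of_def)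
    ultimately have "card (cosets_of {y \<in> carrier G. h y \<noteq> 0}) < card (cosets_of {y \<in> carrier G. f y \<noteq> 0})"
      using xh hecke_finite[OF less.prems(1)] by (intro psubset_card_mono) blast+
    then obtain b where b: "b \<in> lin_span (NFs \<Lambda>)" "ev b = h"
      using less.hyps[OF _ h] less.prems(2) hf by blast
    have "?n \<in> NFs \<Lambda>" using k unfolding NFs_def by blast
    then have "Poly_Mapping.single 0 c * ?n + b \<in> lin_span (NFs \<Lambda>)"
      using b(1) by (rule lin_span.step)
    moreover have "ev (Poly_Mapping.single 0 c * ?n + b) = f"
      using b(2) by (simp add: ev_add ev_smult h_def)
    ultimately show ?thesis by blast
  qed
qed

text \<open>The second alternative of \<open>dichotomy\<close>, under which
  \<open>A * L k * A\<close> reduces to exponents below 2.\<close>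

definition small :: "'a \<Rightarrow> bool"
  where "small k \<longleftrightarrow> (\<forall>u\<in>U. \<exists>k1\<in>K. \<exists>k2\<in>K. \<exists>i\<le>1::nat. a \<otimes> u \<otimes> k \<otimes> a = k1 \<otimes> a [^] i \<otimes> k2)"

lemma small_reduction:
  assumes k: "k \<in> K" "small k"
  shows "\<exists>b\<in>lin_span (NFs {..1::nat}). ev b = ev (A * L k * A)"
proof (rule hecke_spanned[OF ev_closed])
  fix x assume x: "ev (A * L k * A) x \<noteq> 0"
  have "ev (A * L k * A) = convol (chi a) (convol (chi k) (chi a))"
    using ev_L[OF k(1)] by (simp add: ev_mult ev_A mult.assoc)
  then have "convol (chi a) (convol (chi k) (chi a)) x \<noteq> 0" using x by simp
  then obtain y where y: "y \<in> carrier G" "x \<in> carrier G" "chi a y \<noteq> 0"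
      "convol (chi k) (chi a) (inv y \<otimes> x) \<noteq> 0"
    by (rule convol_nonzeroE)
  have "chi a (inv k \<otimes> (inv y \<otimes> x)) \<noteq> 0"
    using y(4) chi_K_left[OF k(1) chi_hecke[OF a], of "inv y \<otimes> x"] y(1,2) by simp
  then obtain z1 u1 u2 where w1: "z1 \<in> Z" "u1 \<in> U" "u2 \<in> U" "inv k \<otimes> (inv y \<otimes> x) = z1 \<otimes> u1 \<otimes> a \<otimes> u2"
    by (rule chi_nonzeroE)
  obtain z u u' where w: "z \<in> Z" "u \<in> U" "u' \<in> U" "y = z \<otimes> u \<otimes> a \<otimes> u'"
    using y(3) by (rule chi_nonzeroE)
  obtain u3 where u3: "u3 \<in> U" "k \<otimes> u1 = u3 \<otimes> k" by (rule U_push_left[OF k(1) w1(2)])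
  obtain k1 k2 i where ki: "k1 \<in> K" "k2 \<in> K" "i \<le> (1::nat)"
      "a \<otimes> (u' \<otimes> u3) \<otimes> k \<otimes> a = k1 \<otimes> a [^] i \<otimes> k2"
    using k(2) ZU_closed(2)[OF w(3) u3(1)] unfolding small_def by blast
  note c = K_carrier[OF k(1)] Z_carrier[OF w(1)] U_carrier[OF w(2)] U_carrier[OF w(3)]
    Z_carrier[OF w1(1)] U_carrier[OF w1(2)] U_carrier[OF w1(3)] U_carrier[OF u3(1)]
    K_carrier[OF ki(1)] K_carrier[OF ki(2)]
  have "x = y \<otimes> (k \<otimes> (inv k \<otimes> (inv y \<otimes> x)))" using y c by simp
  also have "\<dots> = z \<otimes> z1 \<otimes> u \<otimes> (a \<otimes> (u' \<otimes> ((k \<otimes> u1) \<otimes> a))) \<otimes> u2"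
    unfolding w1(4) unfolding w(4) using c w1(1) by (simp add: m_assoc Z_left_comm[of z1])
  also have "\<dots> = z \<otimes> z1 \<otimes> u \<otimes> (a \<otimes> (u' \<otimes> u3) \<otimes> k \<otimes> a) \<otimes> u2"
    unfolding u3(2) using c by (simp add: m_assoc)
  also have "\<dots> = (z \<otimes> z1 \<otimes> u \<otimes> k1) \<otimes> a [^] i \<otimes> (k2 \<otimes> u2)"
    unfolding ki(4) using c by (simp add: m_assoc)
  finally have x_eq: "x = (z \<otimes> z1 \<otimes> u \<otimes> k1) \<otimes> a [^] i \<otimes> (k2 \<otimes> u2)" .
  have mem: "z \<otimes> z1 \<otimes> u \<otimes> k1 \<in> K" "k2 \<otimes> u2 \<in> K"
    by (intro K_closed(1) Z_in_K U_in_K w w1 ki)+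
  have i: "i \<in> {..1::nat}" using ki(3) by simp
  have "\<exists>l\<in>{..1::nat}. x = (z \<otimes> z1 \<otimes> u \<otimes> k1) \<otimes> a [^] l \<otimes> (k2 \<otimes> u2)"
    using x_eq i by (rule bexI[where x = i])
  then have "\<exists>k'\<in>K. \<exists>l\<in>{..1::nat}. x = (z \<otimes> z1 \<otimes> u \<otimes> k1) \<otimes> a [^] l \<otimes> k'"
    using mem(2) by (rule bexI[where x = "k2 \<otimes> u2"])
  then show "\<exists>k\<in>K. \<exists>k'\<in>K. \<exists>l\<in>{..1::nat}. x = k \<otimes> a [^] l \<otimes> k'"
    using mem(1) by (rule bexI[where x = "z \<otimes> z1 \<otimes> u \<otimes> k1"])
qed

text \<open>The choice depends on the word \<open>L k\<close> and not on \<open>k\<close>: all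
  elements of a coset share one word, so the relations built from \<open>reduct\<close> are
  parametrized by finitely many words.\<close>

definition reduct :: "(nat word \<Rightarrow>\<^sub>0 complex) \<Rightarrow> nat word \<Rightarrow>\<^sub>0 complex"
  where "reduct w = (SOME b. b \<in> lin_span (NFs {..1::nat}) \<and> ev b = ev (A * w * A))"

lemma reduct:
  assumes "k \<in> K" "small k"
  shows "reduct (L k) \<in> lin_span (NFs {..1::nat})" "ev (reduct (L k)) = ev (A * L k * A)"
proof -
  obtain b where "b \<in> lin_span (NFs {..1::nat}) \<and> ev b = ev (A * L k * A)"
    using small_reduction[OF assms] by blast
  then have "reduct (L k) \<in> lin_span (NFs {..1::nat}) \<and> ev (reduct (L k)) = ev (A * L k * A)"
    unfolding reduct_def by (rule someI)
  then show "reduct (L k) \<in> lin_span (NFs {..1::nat})" "ev (reduct (L k)) = ev (A * L k * A)"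
    by (rule conjunct1, rule conjunct2)
qed

text \<open>The inverse of \<open>\<epsilon> z\<close> appears because translation by
  \<open>z\<close> evaluates a genuine function at \<open>inv z \<otimes> x\<close>. Commutation is
  imposed across a single \<open>a\<close> only; its consequences for powers are derived in
  \<open>cg_stabilizer\<close>.\<close>

definition rels :: "(nat word \<Rightarrow>\<^sub>0 complex) set"
  where "rels = {L k * L k' - L (k \<otimes> k') | k k'. k \<in> K \<and> k' \<in> K} \<union> {L \<one> - 1} \<union>
    {L z - Poly_Mapping.single 0 (inverse (\<epsilon> z)) | z. z \<in> Z} \<union>
    {L k * A - A * L k' | k k'. k \<in> K \<and> k' \<in> K \<and> k \<otimes> a = a \<otimes> k'} \<union>
    {A * L k * A - reduct (L k) | k. k \<in> K \<and> small k}"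

text \<open>The pairs in \<open>K\<close> may be infinitely many, but they enter only through the
  finitely many letters \<open>L k\<close>; the central family is indexed by the finite set
  \<open>Z\<close>.\<close>

lemma finite_rels: "finite rels"
proof -
  have "L ` K \<subseteq> (\<lambda>i. Poly_Mapping.single (Word [i]) 1) ` {..<card KU}"
    using idx_less by (auto simp: L_def)
  then have LK: "finite (L ` K)" by (rule finite_subset) simp
  have "{L k * L k' - L (k \<otimes> k') | k k'. k \<in> K \<and> k' \<in> K} \<subseteq>
      (\<lambda>(x, y, z). x * y - z) ` (L ` K \<times> L ` K \<times> L ` K)"
  proof
    fix r assume "r \<in> {L k * L k' - L (k \<otimes> k') | k k'. k \<in> K \<and> k' \<in> K}"
    then obtain k k' where r: "k \<in> K" "k' \<in> K" "r = L k * L k' - L (k \<otimes> k')" by blast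
    then have "(L k, L k', L (k \<otimes> k')) \<in> L ` K \<times> L ` K \<times> L ` K" using K_closed(1) by simp
    then show "r \<in> (\<lambda>(x, y, z). x * y - z) ` (L ` K \<times> L ` K \<times> L ` K)"
      using r(3) by (intro image_eqI[of _ _ "(L k, L k', L (k \<otimes> k'))"]) simp_all
  qed
  then have 1: "finite {L k * L k' - L (k \<otimes> k') | k k'. k \<in> K \<and> k' \<in> K}"
    by (rule finite_subset) (intro finite_imageI finite_cartesian_product LK)
  have 2: "finite {L z - Poly_Mapping.single 0 (inverse (\<epsilon> z)) | z. z \<in> Z}"
    using finite_Z by simp
  have "{L k * A - A * L k' | k k'. k \<in> K \<and> k' \<in> K \<and> k \<otimes> a = a \<otimes> k'} \<subseteq>
      (\<lambda>(x, y). x * A - A * y) ` (L ` K \<times> L ` K)" by fast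
  then have 3: "finite {L k * A - A * L k' | k k'. k \<in> K \<and> k' \<in> K \<and> k \<otimes> a = a \<otimes> k'}"
    by (rule finite_subset) (intro finite_imageI finite_cartesian_product LK)
  have "{A * L k * A - reduct (L k) | k. k \<in> K \<and> small k} \<subseteq> (\<lambda>x. A * x * A - reduct x) ` (L ` K)"
    by blast
  then have 4: "finite {A * L k * A - reduct (L k) | k. k \<in> K \<and> small k}"
    by (rule finite_subset) (intro finite_imageI LK)
  show ?thesis unfolding rels_def using 1 2 3 4 by simp
qed

abbreviation "FA \<equiv> carrier (free_algebra gens)"

lemma L_FA [simp, intro]: "k \<in> K \<Longrightarrow> L k \<in> FA"
  unfolding L_def using idx_less by (intro free_algebra_letter) (simp add: less_Suc_eq)

lemma A_FA [simp, intro]: "A \<in> FA"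
  unfolding A_def by (intro free_algebra_letter) simp

lemma A_pow_FA [simp, intro]: "A ^ l \<in> FA"
  by (induction l) auto

lemma NF_FA [simp, intro]: "k \<in> K \<Longrightarrow> k' \<in> K \<Longrightarrow> NF k l k' \<in> FA"
  unfolding NF_def by (intro free_algebra_mult L_FA A_pow_FA)

lemma span_FA: "b \<in> lin_span (NFs \<Lambda>) \<Longrightarrow> b \<in> FA"
  by (induction b rule: lin_span.induct) (auto simp: NFs_def)

lemma rels_cases [consumes 1]:
  assumes "r \<in> rels"
  obtains (mult) k k' where "k \<in> K" "k' \<in> K" "r = L k * L k' - L (k \<otimes> k')"
    | (one) "r = L \<one> - 1"
    | (central) z where "z \<in> Z" "r = L z - Poly_Mapping.single 0 (inverse (\<epsilon> z))"
    | (commute) k k' where "k \<in> K" "k' \<in> K" "k \<otimes> a = a \<otimes> k'" "r = L k * A - A * L k'"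
    | (small) k where "k \<in> K" "small k" "r = A * L k * A - reduct (L k)"
  using assms unfolding rels_def by blast

lemma rels_FA: "rels \<subseteq> FA"
proof
  fix r assume "r \<in> rels"
  then show "r \<in> FA"
  proof (cases rule: rels_cases)
    case (mult k k')
    then show ?thesis using K_closed(1)[of k k'] by simp
  next
    case one
    then show ?thesis using K_closed(3) by simp
  next
    case (central z)
    then show ?thesis using Z_in_K[of z] by simp
  next
    case (commute k k')
    then show ?thesis by simp
  next
    case (small k)
    then show ?thesis using span_FA[OF reduct(1)] by simp
  qed
qed

text \<open>Both sides are the function of the double coset of
  \<open>k \<otimes> a = a \<otimes> k'\<close>; for the right-hand side this uses that
  \<open>k'\<close> normalizes \<open>U\<close>.\<close>

lemma convol_chi_right_a:
  assumes k: "k \<in> K" "k' \<in> K" "k \<otimes> a = a \<otimes> k'"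
  shows "convol (chi k) (chi a) = convol (chi a) (chi k')"
proof
  fix x
  show "convol (chi k) (chi a) x = convol (chi a) (chi k') x"
  proof (cases "x \<in> carrier G")
    case x: True
    note c = K_carrier[OF k(1)] K_carrier[OF k(2)]
    have iff: "(\<exists>u1\<in>U. \<exists>u2\<in>U. x = z \<otimes> u1 \<otimes> (k \<otimes> a) \<otimes> u2) \<longleftrightarrow>
        (\<exists>u1\<in>U. \<exists>u2\<in>U. x \<otimes> inv k' = z \<otimes> u1 \<otimes> a \<otimes> u2)" if z: "z \<in> Z" for z
    proof
      assume "\<exists>u1\<in>U. \<exists>u2\<in>U. x = z \<otimes> u1 \<otimes> (k \<otimes> a) \<otimes> u2"
      then obtain u1 u2 where w: "u1 \<in> U" "u2 \<in> U" "x = z \<otimes> u1 \<otimes> (k \<otimes> a) \<otimes> u2" by blast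
      obtain u3 where u3: "u3 \<in> U" "k' \<otimes> u2 = u3 \<otimes> k'" by (rule U_push_left[OF k(2) w(2)])
      note c' = c Z_carrier[OF z] U_carrier[OF w(1)] U_carrier[OF w(2)] U_carrier[OF u3(1)]
      have "x \<otimes> inv k' = z \<otimes> u1 \<otimes> a \<otimes> (k' \<otimes> u2) \<otimes> inv k'"
        unfolding w(3) k(3) using c' by (simp add: m_assoc)
      also have "\<dots> = z \<otimes> u1 \<otimes> a \<otimes> u3"
        unfolding u3(2) using c' by (simp add: m_assoc)
      finally show "\<exists>u1\<in>U. \<exists>u2\<in>U. x \<otimes> inv k' = z \<otimes> u1 \<otimes> a \<otimes> u2" using w(1) u3(1) by blast
    next
      assume "\<exists>u1\<in>U. \<exists>u2\<in>U. x \<otimes> inv k' = z \<otimes> u1 \<otimes> a \<otimes> u2"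
      then obtain u1 u2 where w: "u1 \<in> U" "u2 \<in> U" "x \<otimes> inv k' = z \<otimes> u1 \<otimes> a \<otimes> u2" by blast
      obtain u3 where u3: "u3 \<in> U" "u2 \<otimes> k' = k' \<otimes> u3" by (rule U_push_right[OF k(2) w(2)])
      note c' = c Z_carrier[OF z] U_carrier[OF w(1)] U_carrier[OF w(2)] U_carrier[OF u3(1)]
      have "x = (x \<otimes> inv k') \<otimes> k'" using c x by (simp add: m_assoc)
      also have "\<dots> = z \<otimes> u1 \<otimes> (a \<otimes> (u2 \<otimes> k'))"
        unfolding w(3) using c' by (simp add: m_assoc)
      also have "\<dots> = z \<otimes> u1 \<otimes> (a \<otimes> k') \<otimes> u3"
        unfolding u3(2) using c' by (simp add: m_assoc)
      finally show "\<exists>u1\<in>U. \<exists>u2\<in>U. x = z \<otimes> u1 \<otimes> (k \<otimes> a) \<otimes> u2"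
        unfolding k(3) using w(1) u3(1) by blast
    qed
    show ?thesis
      unfolding convol_chi_K[OF k(1) a] chi_K_right[OF k(2) chi_hecke[OF a] x] chi_def
      using iff by (simp cong: conj_cong bex_cong)
  qed (simp add: convol_def)
qed

lemma ev_rels:
  assumes "r \<in> rels"
  shows "ev r = (\<lambda>x. 0)"
  using assms
proof (cases rule: rels_cases)
  case (mult k k')
  then show ?thesis
    using convol_chi_K[OF mult(1) K_carrier[OF mult(2)]] K_closed(1)
    by (simp add: ev_diff ev_mult ev_L)
next
  case one
  then show ?thesis using K_closed(3) by (simp add: ev_diff ev_L ev_one)
next
  case (central z)
  then show ?thesis
    using ev_smult[of "inverse (\<epsilon> z)" 1] Z_in_K
    by (simp add: ev_diff ev_L ev_one chi_Z)
next
  case (commute k k')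
  then show ?thesis
    using convol_chi_right_a[OF commute(1-3)] by (simp add: ev_diff ev_mult ev_L ev_A)
next
  case (small k)
  then show ?thesis using reduct(2)[OF small(1,2)] by (simp add: ev_diff)
qed

section \<open>Congruence modulo the ideal of relations\<close>

interpretation FR: ring "free_algebra gens"
  by (rule ring_free_algebra)

definition J :: "(nat word \<Rightarrow>\<^sub>0 complex) set"
  where "J = Idl\<^bsub>free_algebra gens\<^esub> rels"

interpretation J: ideal J "free_algebra gens"
  unfolding J_def by (rule FR.genideal_ideal[OF rels_FA])

lemma rels_J: "rels \<subseteq> J"
  unfolding J_def by (rule FR.genideal_self[OF rels_FA])

lemma ev_J:
  assumes "f \<in> J"
  shows "ev f = (\<lambda>x. 0)"
proof -
  interpret h: ring_hom_ring "free_algebra gens" "hecke_ring mu" ev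
    unfolding ev_def by (rule H.free_value_ring_hom[OF gen_closed'])
  have ker: "a_kernel (free_algebra gens) (hecke_ring mu) ev = {f \<in> FA. ev f = (\<lambda>x. 0)}"
    using a_kernel_def'[of "free_algebra gens" "hecke_ring mu" ev] by (simp only: hecke_ring_simps)
  have "J \<subseteq> a_kernel (free_algebra gens) (hecke_ring mu) ev"
    unfolding J_def
  proof (rule FR.genideal_minimal[OF h.kernel_is_ideal])
    show "rels \<subseteq> a_kernel (free_algebra gens) (hecke_ring mu) ev"
      unfolding ker using subsetD[OF rels_FA] ev_rels by blast
  qed
  then show ?thesis using assms unfolding ker by blast
qed

text \<open>Membership in \<open>FA\<close> is part of the relation because \<open>J\<close> absorbs
  products only with elements of \<open>FA\<close>; with it, congruences can be multiplied and
  chained without side conditions on each intermediate word.\<close>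

definition cg :: "(nat word \<Rightarrow>\<^sub>0 complex) \<Rightarrow> (nat word \<Rightarrow>\<^sub>0 complex) \<Rightarrow> bool"
  where "cg f g \<longleftrightarrow> f \<in> FA \<and> g \<in> FA \<and> f - g \<in> J"

lemma J_add: "f \<in> J \<Longrightarrow> g \<in> J \<Longrightarrow> f + g \<in> J"
  using J.a_closed by simp

lemma J_left: "f \<in> J \<Longrightarrow> h \<in> FA \<Longrightarrow> h * f \<in> J"
  using J.I_l_closed by simp

lemma J_right: "f \<in> J \<Longrightarrow> h \<in> FA \<Longrightarrow> f * h \<in> J"
  using J.I_r_closed by simp

lemma J_zero: "0 \<in> J"
  using J.zero_closed by simp

lemma cg_refl: "f \<in> FA \<Longrightarrow> cg f f"
  by (simp add: cg_def J_zero)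

lemma cg_sym:
  assumes "cg f g"
  shows "cg g f"
proof -
  have "Poly_Mapping.single 0 (- 1) * (f - g) \<in> J"
    using assms by (intro J_left) (simp_all add: cg_def)
  also have "Poly_Mapping.single 0 (- 1) * (f - g) = g - f"
    by (simp add: single_uminus)
  finally show ?thesis using assms by (simp add: cg_def)
qed

lemma cg_trans [trans]: "cg f g \<Longrightarrow> cg g h \<Longrightarrow> cg f h"
  using J_add[of "f - g" "g - h"] by (simp add: cg_def)

lemma cg_add:
  assumes "cg f g" "cg f' g'"
  shows "cg (f + f') (g + g')"
  using J_add[of "f - g" "f' - g'"] assms by (simp add: cg_def algebra_simps)

lemma cg_mult:
  assumes "cg f g" "cg f' g'"
  shows "cg (f * f') (g * g')"
proof -
  have "(f - g) * f' + g * (f' - g') \<in> J"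
    using assms by (intro J_add J_left J_right) (simp_all add: cg_def)
  then show ?thesis using assms by (simp add: cg_def algebra_simps)
qed

lemma cg_left: "cg f g \<Longrightarrow> h \<in> FA \<Longrightarrow> cg (h * f) (h * g)"
  by (rule cg_mult[OF cg_refl])

lemma cg_right: "cg f g \<Longrightarrow> h \<in> FA \<Longrightarrow> cg (f * h) (g * h)"
  by (rule cg_mult[OF _ cg_refl])

lemma cg_L_mult: "k \<in> K \<Longrightarrow> k' \<in> K \<Longrightarrow> cg (L k * L k') (L (k \<otimes> k'))"
  using subsetD[OF rels_J, of "L k * L k' - L (k \<otimes> k')"] K_closed(1)
  unfolding cg_def rels_def by blast

lemma cg_L_one: "cg (L \<one>) 1"
  using subsetD[OF rels_J, of "L \<one> - 1"] K_closed(3) unfolding cg_def rels_def by blast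

lemma cg_L_central: "z \<in> Z \<Longrightarrow> cg (L z) (Poly_Mapping.single 0 (inverse (\<epsilon> z)))"
  using subsetD[OF rels_J, of "L z - Poly_Mapping.single 0 (inverse (\<epsilon> z))"] Z_in_K
  unfolding cg_def rels_def by blast

lemma cg_commute: "k \<in> K \<Longrightarrow> k' \<in> K \<Longrightarrow> k \<otimes> a = a \<otimes> k' \<Longrightarrow> cg (L k * A) (A * L k')"
  using subsetD[OF rels_J, of "L k * A - A * L k'"] unfolding cg_def rels_def by blast

lemma cg_small: "k \<in> K \<Longrightarrow> small k \<Longrightarrow> cg (A * L k * A) (reduct (L k))"
  using subsetD[OF rels_J, of "A * L k * A - reduct (L k)"] span_FA[OF reduct(1)]
  unfolding cg_def rels_def by blast

text \<open>Group elements and words move together: each crossing of one \<open>a\<close> in the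
  group is matched by one commutation relation, and stability of \<open>S\<close> permits the next
  crossing.\<close>

lemma cg_commute_pow:
  assumes step: "\<And>k. k \<in> S \<Longrightarrow> \<exists>k'\<in>S. k \<otimes> a = a \<otimes> k'" and S: "S \<subseteq> K" and k: "k \<in> S"
  shows "\<exists>k'\<in>S. k \<otimes> a [^] l = a [^] l \<otimes> k' \<and> cg (L k * A ^ l) (A ^ l * L k')"
proof (induction l)
  case 0
  show ?case using k S K_carrier by (intro bexI[OF _ k]) (auto intro!: cg_refl)
next
  case (Suc l)
  then obtain k1 where k1: "k1 \<in> S" "k \<otimes> a [^] l = a [^] l \<otimes> k1" "cg (L k * A ^ l) (A ^ l * L k1)" by blast
  obtain k2 where k2: "k2 \<in> S" "k1 \<otimes> a = a \<otimes> k2" using step[OF k1(1)] by blast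
  have inK: "k \<in> K" "k1 \<in> K" "k2 \<in> K" using S k k1 k2 by blast+
  note c = K_carrier[OF inK(1)] K_carrier[OF inK(2)] K_carrier[OF inK(3)]
  have "k \<otimes> a [^] Suc l = (k \<otimes> a [^] l) \<otimes> a" using c by (simp add: m_assoc)
  also have "\<dots> = a [^] l \<otimes> (k1 \<otimes> a)" unfolding k1(2) using c by (simp add: m_assoc)
  also have "\<dots> = a [^] Suc l \<otimes> k2" unfolding k2(2) using c by (simp add: m_assoc)
  finally have g: "k \<otimes> a [^] Suc l = a [^] Suc l \<otimes> k2" .
  have "L k * A ^ Suc l = (L k * A ^ l) * A" by (simp add: power_commutes mult.assoc)
  also have "cg \<dots> (A ^ l * L k1 * A)" by (rule cg_right[OF k1(3) A_FA])
  also have "A ^ l * L k1 * A = A ^ l * (L k1 * A)" by (simp add: mult.assoc)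
  also have "cg \<dots> (A ^ l * (A * L k2))" by (rule cg_left[OF cg_commute[OF inK(2,3) k2(2)] A_pow_FA])
  also have "A ^ l * (A * L k2) = A ^ Suc l * L k2" by (simp add: power_commutes flip: mult.assoc)
  finally show ?case using g k2(1) by blast
qed

lemma cg_commute_pow':
  assumes step: "\<And>k. k \<in> S \<Longrightarrow> \<exists>k'\<in>S. a \<otimes> k = k' \<otimes> a" and S: "S \<subseteq> K" and k: "k \<in> S"
  shows "\<exists>k'\<in>S. a [^] l \<otimes> k = k' \<otimes> a [^] l \<and> cg (A ^ l * L k) (L k' * A ^ l)"
proof (induction l)
  case 0
  show ?case using k S K_carrier by (intro bexI[OF _ k]) (auto intro!: cg_refl)
next
  case (Suc l)
  then obtain k1 where k1: "k1 \<in> S" "a [^] l \<otimes> k = k1 \<otimes> a [^] l" "cg (A ^ l * L k) (L k1 * A ^ l)" by blast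
  obtain k2 where k2: "k2 \<in> S" "a \<otimes> k1 = k2 \<otimes> a" using step[OF k1(1)] by blast
  have inK: "k \<in> K" "k1 \<in> K" "k2 \<in> K" using S k k1 k2 by blast+
  note c = K_carrier[OF inK(1)] K_carrier[OF inK(2)] K_carrier[OF inK(3)]
  have pow: "a [^] Suc l = a \<otimes> a [^] l" using nat_pow_comm[of a 1 l] by simp
  have "a [^] Suc l \<otimes> k = a \<otimes> (a [^] l \<otimes> k)" unfolding pow using c by (simp add: m_assoc)
  also have "\<dots> = (a \<otimes> k1) \<otimes> a [^] l" unfolding k1(2) using c by (simp add: m_assoc)
  also have "\<dots> = k2 \<otimes> a [^] Suc l" unfolding k2(2) pow using c by (simp add: m_assoc)
  finally have g: "a [^] Suc l \<otimes> k = k2 \<otimes> a [^] Suc l" .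
  have "A ^ Suc l * L k = A * (A ^ l * L k)" by (simp add: mult.assoc)
  also have "cg \<dots> (A * (L k1 * A ^ l))" by (rule cg_left[OF k1(3) A_FA])
  also have "A * (L k1 * A ^ l) = A * L k1 * A ^ l" by (simp add: mult.assoc)
  also have "cg \<dots> (L k2 * A * A ^ l)"
    by (rule cg_right[OF cg_sym[OF cg_commute[OF inK(3,2) k2(2)[symmetric]]] A_pow_FA])
  also have "L k2 * A * A ^ l = L k2 * A ^ Suc l" by (simp add: mult.assoc)
  finally show ?case using g k2(1) by blast
qed

lemma cg_L_mult3:
  assumes "x \<in> K" "h \<in> K" "y \<in> K"
  shows "cg (L x * L h * L y) (L (x \<otimes> h \<otimes> y))"
  by (rule cg_trans[OF cg_right[OF cg_L_mult[OF assms(1,2)] L_FA[OF assms(3)]]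
    cg_L_mult[OF K_closed(1)[OF assms(1,2)] assms(3)]])

text \<open>The relations mention a single \<open>a\<close> only. In the factorization from
  \<open>stabilizer\<close> the factor \<open>y\<close> crosses the power from the left, while
  \<open>x\<close> and \<open>h\<close> are elements crossing it from the right; each is handled by
  iterating single commutations. The case \<open>l = 0\<close> is separate because there
  \<open>k = k'\<close> may be any element of \<open>K\<close>.\<close>

lemma cg_stabilizer:
  assumes k: "k \<in> K" "k' \<in> K" and eq: "k \<otimes> a [^] l = a [^] l \<otimes> k'"
  shows "cg (L k * A ^ l) (A ^ l * L k')"
proof (cases "l = 0")
  case True
  then have "k = k'" using eq K_carrier k by simp
  then show ?thesis using True k by (auto intro!: cg_refl)
next
  case False
  then obtain x h y where w: "x \<in> N" "h \<in> T" "y \<in> N'"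
    "k \<otimes> a [^] l = a [^] l \<otimes> x \<otimes> h \<otimes> inv (a [^] l) \<otimes> y \<otimes> a [^] l"
    using stabilizer[OF k _ eq] by blast
  obtain x' where x': "x' \<in> N" "a [^] l \<otimes> x = x' \<otimes> a [^] l" "cg (A ^ l * L x) (L x' * A ^ l)"
    using cg_commute_pow'[OF N_conj subsets(1) w(1)] by blast
  obtain h' where h': "h' \<in> T" "a [^] l \<otimes> h = h' \<otimes> a [^] l" "cg (A ^ l * L h) (L h' * A ^ l)"
    using cg_commute_pow'[OF T_conj subsets(2) w(2)] by blast
  obtain y' where y': "y' \<in> N'" "y \<otimes> a [^] l = a [^] l \<otimes> y'" "cg (L y * A ^ l) (A ^ l * L y')"
    using cg_commute_pow[OF N'_conj subsets(3) w(3)] by blast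
  have inK: "x \<in> K" "h \<in> K" "y \<in> K" "x' \<in> K" "h' \<in> K" "y' \<in> K"
    using subsets w x' h' y' by blast+
  note c = inK[THEN K_carrier] K_carrier[OF k(1)] K_carrier[OF k(2)]
  have "k \<otimes> a [^] l = (a [^] l \<otimes> x) \<otimes> h \<otimes> inv (a [^] l) \<otimes> y \<otimes> a [^] l" by (rule w(4))
  also have "\<dots> = x' \<otimes> (a [^] l \<otimes> h) \<otimes> inv (a [^] l) \<otimes> y \<otimes> a [^] l"
    unfolding x'(2) using c by (simp add: m_assoc)
  also have "\<dots> = (x' \<otimes> h' \<otimes> y) \<otimes> a [^] l"
    unfolding h'(2) using c by (simp add: m_assoc)
  finally have ke: "k = x' \<otimes> h' \<otimes> y"
    using c by simp
  \<comment> \<open>Substituting the factorization of \<open>k\<close> into the given equation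
    determines a matching factorization of \<open>k'\<close>.\<close>
  have "a [^] l \<otimes> k' = (x' \<otimes> h') \<otimes> (y \<otimes> a [^] l)"
    unfolding eq[symmetric] ke using c by (simp add: m_assoc)
  also have "\<dots> = x' \<otimes> (h' \<otimes> a [^] l) \<otimes> y'"
    unfolding y'(2) using c by (simp add: m_assoc)
  also have "\<dots> = (x' \<otimes> a [^] l) \<otimes> h \<otimes> y'"
    unfolding h'(2)[symmetric] using c by (simp add: m_assoc)
  also have "\<dots> = a [^] l \<otimes> (x \<otimes> h \<otimes> y')"
    unfolding x'(2)[symmetric] using c by (simp add: m_assoc)
  finally have ke': "k' = x \<otimes> h \<otimes> y'"
    using c by simp
  have "cg (L k * A ^ l) (L x' * L h' * L y * A ^ l)"
    unfolding ke by (intro cg_right[OF cg_sym[OF cg_L_mult3]] inK A_pow_FA)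
  also have "L x' * L h' * L y * A ^ l = L x' * L h' * (L y * A ^ l)" by (simp add: mult.assoc)
  also have "cg \<dots> (L x' * L h' * (A ^ l * L y'))"
    by (intro cg_left[OF y'(3)] free_algebra_mult L_FA inK)
  also have "L x' * L h' * (A ^ l * L y') = L x' * (L h' * A ^ l) * L y'" by (simp add: mult.assoc)
  also have "cg \<dots> (L x' * (A ^ l * L h) * L y')"
    by (intro cg_right[OF cg_left[OF cg_sym[OF h'(3)]]] L_FA inK)
  also have "L x' * (A ^ l * L h) * L y' = (L x' * A ^ l) * (L h * L y')" by (simp add: mult.assoc)
  also have "cg \<dots> ((A ^ l * L x) * (L h * L y'))"
    by (intro cg_right[OF cg_sym[OF x'(3)]] free_algebra_mult L_FA inK)
  also have "(A ^ l * L x) * (L h * L y') = A ^ l * (L x * L h * L y')" by (simp add: mult.assoc)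
  also have "cg \<dots> (A ^ l * L k')"
    unfolding ke' by (intro cg_left[OF cg_L_mult3] inK A_pow_FA)
  finally show ?thesis .
qed

text \<open>Equality of two Cartan expressions says that \<open>inv k1' \<otimes> k1\<close> on the
  left of \<open>a [^] l\<close> equals \<open>k2' \<otimes> inv k2\<close> on its right, which is
  the situation of \<open>cg_stabilizer\<close>.\<close>

lemma cg_NF_eq:
  assumes k: "k1 \<in> K" "k2 \<in> K" "k1' \<in> K" "k2' \<in> K"
    and eq: "k1 \<otimes> a [^] l \<otimes> k2 = k1' \<otimes> a [^] l' \<otimes> k2'"
  shows "l = l'" "cg (NF k1 l k2) (NF k1' l' k2')"
proof -
  note c = k[THEN K_carrier]
  have "(inv k1' \<otimes> k1) \<otimes> a [^] l \<otimes> (k2 \<otimes> inv k2') = inv k1' \<otimes> (k1 \<otimes> a [^] l \<otimes> k2) \<otimes> inv k2'"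
    using c by (simp add: m_assoc)
  also have "\<dots> = a [^] l'"
    unfolding eq using c by (simp add: m_assoc)
  finally show l: "l = l'"
    by (intro cartan_unique[of "inv k1' \<otimes> k1" "k2 \<otimes> inv k2'"] K_closed k)
  have "(inv k1' \<otimes> k1) \<otimes> a [^] l = inv k1' \<otimes> (k1 \<otimes> a [^] l \<otimes> k2) \<otimes> inv k2"
    using c by (simp add: m_assoc)
  also have "\<dots> = a [^] l \<otimes> (k2' \<otimes> inv k2)"
    unfolding eq using c by (simp add: l m_assoc)
  finally have st: "cg (L (inv k1' \<otimes> k1) * A ^ l) (A ^ l * L (k2' \<otimes> inv k2))"
    by (intro cg_stabilizer K_closed k)
  have inK: "inv k1' \<otimes> k1 \<in> K" "k2' \<otimes> inv k2 \<in> K" by (intro K_closed k)+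
  have "cg (L k1) (L k1' * L (inv k1' \<otimes> k1))"
    using cg_sym[OF cg_L_mult[OF k(3) inK(1)]] c by simp
  then have "cg (NF k1 l k2) (L k1' * L (inv k1' \<otimes> k1) * A ^ l * L k2)"
    unfolding NF_def by (intro cg_right A_pow_FA L_FA k)
  also have "L k1' * L (inv k1' \<otimes> k1) * A ^ l * L k2 = L k1' * (L (inv k1' \<otimes> k1) * A ^ l) * L k2"
    by (simp add: mult.assoc)
  also have "cg \<dots> (L k1' * (A ^ l * L (k2' \<otimes> inv k2)) * L k2)"
    by (intro cg_right cg_left st L_FA k)
  also have "L k1' * (A ^ l * L (k2' \<otimes> inv k2)) * L k2 = L k1' * A ^ l * (L (k2' \<otimes> inv k2) * L k2)"
    by (simp add: mult.assoc)
  also have "cg \<dots> (L k1' * A ^ l * L (k2' \<otimes> inv k2 \<otimes> k2))"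
    by (intro cg_left cg_L_mult free_algebra_mult L_FA A_pow_FA k inK)
  also have "L k1' * A ^ l * L (k2' \<otimes> inv k2 \<otimes> k2) = NF k1' l' k2'"
    using c by (simp add: NF_def l m_assoc)
  finally show "cg (NF k1 l k2) (NF k1' l' k2')" .
qed

lemma L_U_right: "k \<in> K \<Longrightarrow> u \<in> U \<Longrightarrow> L (k \<otimes> u) = L k"
  using l_coset_absorb[OF U] K_carrier by (simp add: L_def)

lemma L_U_left: "k \<in> K \<Longrightarrow> u \<in> U \<Longrightarrow> L (u \<otimes> k) = L k"
  using U_push_right[of k u] L_U_right by metis

text \<open>If the second normal form is nonzero at the centre of the first, the two centres differ
  by \<open>Z\<close> and \<open>U\<close> only. Letters ignore \<open>U\<close>, and the central
  relation turns the factor from \<open>Z\<close> into a scalar.\<close>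

lemma cg_NF_overlap:
  assumes k: "k1 \<in> K" "k2 \<in> K" "k1' \<in> K" "k2' \<in> K"
    and nz: "ev (NF k1' l' k2') (k1 \<otimes> a [^] l \<otimes> k2) \<noteq> 0"
  shows "\<exists>s. cg (NF k1' l' k2') (Poly_Mapping.single 0 s * NF k1 l k2)"
proof -
  obtain z u u' where w: "z \<in> Z" "u \<in> U" "u' \<in> U"
      "k1 \<otimes> a [^] l \<otimes> k2 = z \<otimes> u \<otimes> (k1' \<otimes> a [^] l' \<otimes> k2') \<otimes> u'"
    by (rule ev_NF_support[OF k(3,4) nz])
  note inK = Z_in_K[OF w(1)] U_in_K[OF w(2)] U_in_K[OF w(3)]
  note c = k[THEN K_carrier] inK[THEN K_carrier]
  have "k1 \<otimes> a [^] l \<otimes> k2 = (z \<otimes> (u \<otimes> k1')) \<otimes> a [^] l' \<otimes> (k2' \<otimes> u')"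
    unfolding w(4) using c by (simp add: m_assoc)
  then have "cg (NF k1 l k2) (NF (z \<otimes> (u \<otimes> k1')) l' (k2' \<otimes> u'))"
    by (intro cg_NF_eq K_closed k inK)
  also have "NF (z \<otimes> (u \<otimes> k1')) l' (k2' \<otimes> u') = L (z \<otimes> (u \<otimes> k1')) * A ^ l' * L k2'"
    by (simp add: NF_def L_U_right[OF k(4) w(3)])
  also have "cg \<dots> (L z * L (u \<otimes> k1') * A ^ l' * L k2')"
    by (intro cg_right cg_sym[OF cg_L_mult] A_pow_FA L_FA k inK K_closed)
  also have "cg \<dots> (Poly_Mapping.single 0 (inverse (\<epsilon> z)) * L (u \<otimes> k1') * A ^ l' * L k2')"
    by (intro cg_right cg_L_central w A_pow_FA L_FA k inK K_closed)
  also have "\<dots> = Poly_Mapping.single 0 (inverse (\<epsilon> z)) * NF k1' l' k2'"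
    by (simp add: NF_def L_U_left[OF k(3) w(2)] mult.assoc)
  finally have "cg (Poly_Mapping.single 0 (\<epsilon> z) * NF k1 l k2)
      (Poly_Mapping.single 0 (\<epsilon> z) * (Poly_Mapping.single 0 (inverse (\<epsilon> z)) * NF k1' l' k2'))"
    by (rule cg_left) simp
  also have "Poly_Mapping.single 0 (\<epsilon> z) * (Poly_Mapping.single 0 (inverse (\<epsilon> z)) * NF k1' l' k2') = NF k1' l' k2'"
    using eps_nonzero[OF w(1)] by (simp add: mult_single flip: mult.assoc)
  finally show ?thesis using cg_sym by blast
qed

section \<open>Reduction of all words to normal forms\<close>

definition Span :: "(nat word \<Rightarrow>\<^sub>0 complex) set"
  where "Span = {f. \<exists>b\<in>lin_span (NFs UNIV). cg f b}"

lemma Span_cg: "cg f g \<Longrightarrow> g \<in> Span \<Longrightarrow> f \<in> Span"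
  unfolding Span_def using cg_trans by blast

lemma Span_zero: "0 \<in> Span"
  unfolding Span_def using lin_span.zero cg_refl[OF free_algebra_closed(1)] by blast

lemma Span_add:
  assumes "f \<in> Span" "g \<in> Span"
  shows "f + g \<in> Span"
proof -
  obtain b c where "b \<in> lin_span (NFs UNIV)" "cg f b" "c \<in> lin_span (NFs UNIV)" "cg g c"
    using assms unfolding Span_def by blast
  then have "b + c \<in> lin_span (NFs UNIV)" "cg (f + g) (b + c)"
    by (auto intro: lin_span_add cg_add)
  then show ?thesis unfolding Span_def by blast
qed

lemma Span_smult:
  assumes "f \<in> Span"
  shows "Poly_Mapping.single 0 c * f \<in> Span"
proof -
  obtain b where "b \<in> lin_span (NFs UNIV)" "cg f b"
    using assms unfolding Span_def by blast
  then have "Poly_Mapping.single 0 c * b \<in> lin_span (NFs UNIV)"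
      "cg (Poly_Mapping.single 0 c * f) (Poly_Mapping.single 0 c * b)"
    by (auto intro: lin_span_smult cg_left)
  then show ?thesis unfolding Span_def by blast
qed

lemma Span_NF: "k \<in> K \<Longrightarrow> k' \<in> K \<Longrightarrow> NF k l k' \<in> Span"
  unfolding Span_def using lin_span_base[of "NF k l k'" "NFs UNIV"] cg_refl[OF NF_FA]
  unfolding NFs_def by blast

text \<open>Scalars commute with \<open>w\<close>, so by linearity single normal forms
  suffice.\<close>

lemma Span_mult:
  assumes w: "w \<in> FA" and base: "\<And>k l k'. k \<in> K \<Longrightarrow> k' \<in> K \<Longrightarrow> w * NF k l k' \<in> Span"
    and f: "f \<in> Span"
  shows "w * f \<in> Span"
proof -
  obtain b where b: "b \<in> lin_span (NFs UNIV)" "cg f b"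
    using f unfolding Span_def by blast
  have "w * b \<in> Span"
    using b(1)
  proof (induction b rule: lin_span.induct)
    case zero
    show ?case by (simp add: Span_zero)
  next
    case (step x g c)
    obtain k l k' where x: "k \<in> K" "k' \<in> K" "x = NF k l k'"
      using step(1) unfolding NFs_def by blast
    have "w * Poly_Mapping.single 0 c = Poly_Mapping.single 0 c * w"
      by (rule single_zero_commutes)
    then have "w * (Poly_Mapping.single 0 c * x + g) = Poly_Mapping.single 0 c * (w * x) + w * g"
      by (simp add: distrib_left flip: mult.assoc)
    then show ?case
      using Span_add[OF Span_smult[OF base[OF x(1,2)]] step.IH] x(3) by simp
  qed
  then show ?thesis by (rule Span_cg[OF cg_left[OF b(2) w]])
qed

lemma Span_L:
  assumes k: "k \<in> K" and f: "f \<in> Span"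
  shows "L k * f \<in> Span"
proof (rule Span_mult[OF L_FA[OF k] _ f])
  fix k1 l k2 assume k12: "k1 \<in> K" "k2 \<in> K"
  have "L k * NF k1 l k2 = (L k * L k1) * A ^ l * L k2" by (simp add: NF_def mult.assoc)
  also have "cg \<dots> (NF (k \<otimes> k1) l k2)"
    unfolding NF_def by (intro cg_right cg_L_mult A_pow_FA L_FA k k12)
  finally show "L k * NF k1 l k2 \<in> Span"
    by (rule Span_cg) (intro Span_NF K_closed k k12)
qed

text \<open>Here \<open>x\<close> and \<open>h\<close> cross the new \<open>A\<close> to the left
  while \<open>y\<close> crosses the existing power to the right, so the exponent just grows by
  one.\<close>

lemma Span_A_big:
  assumes w: "x \<in> N" "h \<in> T" "y \<in> N'" and k2: "k2 \<in> K"
  shows "A * NF (x \<otimes> h \<otimes> y) l k2 \<in> Span"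
proof -
  obtain x' where x': "x' \<in> N" "a \<otimes> x = x' \<otimes> a" using N_conj[OF w(1)] by blast
  obtain h' where h': "h' \<in> T" "a \<otimes> h = h' \<otimes> a" using T_conj[OF w(2)] by blast
  obtain y' where y': "y' \<in> N'" "cg (L y * A ^ l) (A ^ l * L y')"
    using cg_commute_pow[OF N'_conj subsets(3) w(3)] by blast
  have inK: "x \<in> K" "h \<in> K" "y \<in> K" "x' \<in> K" "h' \<in> K" "y' \<in> K"
    using subsets w x' h' y' by blast+
  have cx: "cg (A * L x) (L x' * A)" by (rule cg_sym[OF cg_commute[OF inK(4,1) x'(2)[symmetric]]])
  have ch: "cg (A * L h) (L h' * A)" by (rule cg_sym[OF cg_commute[OF inK(5,2) h'(2)[symmetric]]])
  have "A * NF (x \<otimes> h \<otimes> y) l k2 = A * L (x \<otimes> h \<otimes> y) * A ^ l * L k2"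
    by (simp add: NF_def mult.assoc)
  also have "cg \<dots> (A * (L x * L h * L y) * A ^ l * L k2)"
    by (intro cg_right cg_left cg_sym[OF cg_L_mult3] A_FA A_pow_FA L_FA inK k2)
  also have "A * (L x * L h * L y) * A ^ l * L k2 = A * L x * L h * (L y * A ^ l) * L k2"
    by (simp add: mult.assoc)
  also have "cg \<dots> (L x' * A * L h * (A ^ l * L y') * L k2)"
    by (intro cg_right cg_mult cx cg_refl y' L_FA inK k2)
  also have "L x' * A * L h * (A ^ l * L y') * L k2 = L x' * (A * L h) * A ^ l * (L y' * L k2)"
    by (simp add: mult.assoc)
  also have "cg \<dots> (L x' * (L h' * A) * A ^ l * L (y' \<otimes> k2))"
    by (intro cg_mult cg_left ch cg_refl cg_L_mult A_pow_FA L_FA inK k2)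
  also have "L x' * (L h' * A) * A ^ l * L (y' \<otimes> k2) = (L x' * L h') * A ^ Suc l * L (y' \<otimes> k2)"
    by (simp add: mult.assoc)
  also have "cg \<dots> (NF (x' \<otimes> h') (Suc l) (y' \<otimes> k2))"
    unfolding NF_def by (intro cg_right cg_L_mult A_pow_FA L_FA K_closed inK k2)
  finally show ?thesis
    by (rule Span_cg) (intro Span_NF K_closed inK k2)
qed

text \<open>Induction on \<open>l\<close> makes the rewriting terminate: replacing
  \<open>A * L k1 * A\<close> by \<open>reduct\<close> leaves terms of exponent at most one in front
  of \<open>A ^ l\<close>. Exponent zero gives a letter times a normal form, and exponent one is an
  instance of the statement for the smaller \<open>l\<close>.\<close>

lemma Span_A_NF:
  assumes "k1 \<in> K" "k2 \<in> K"
  shows "A * NF k1 l k2 \<in> Span"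
  using assms
proof (induction l arbitrary: k1 k2)
  case 0
  have "A * NF k1 0 k2 = A * (L k1 * L k2)" by (simp add: NF_def)
  also have "cg \<dots> (1 * A * L (k1 \<otimes> k2))"
    using cg_left[OF cg_L_mult[OF 0]] by simp
  \<comment> \<open>The unit letter is inserted because a normal form begins with a letter from
    \<open>K\<close>.\<close>
  also have "cg \<dots> (L \<one> * A * L (k1 \<otimes> k2))"
    by (intro cg_right cg_sym[OF cg_L_one] A_FA L_FA K_closed 0)
  also have "L \<one> * A * L (k1 \<otimes> k2) = NF \<one> 1 (k1 \<otimes> k2)" by (simp add: NF_def)
  finally show ?case
    by (rule Span_cg) (intro Span_NF K_closed 0)
next
  case (Suc l)
  consider x h y where "x \<in> N" "h \<in> T" "y \<in> N'" "k1 = x \<otimes> h \<otimes> y" | "small k1"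
    using dichotomy[OF Suc.prems(1)] unfolding small_def by blast
  then show ?case
  proof cases
    case 1
    then show ?thesis using Span_A_big Suc.prems(2) by simp
  next
    case 2
    have tail: "A ^ l * L k2 \<in> FA" using Suc.prems by (intro free_algebra_mult A_pow_FA L_FA)
    have step: "b * (A ^ l * L k2) \<in> Span" if "b \<in> lin_span (NFs {..1::nat})" for b
      using that
    proof (induction b rule: lin_span.induct)
      case zero
      show ?case by (simp add: Span_zero)
    next
      case (step x g c)
      obtain u i w where x: "u \<in> K" "w \<in> K" "i \<le> 1" "x = NF u i w"
        using step(1) unfolding NFs_def by blast
      have "x * (A ^ l * L k2) \<in> Span"
      proof (cases "i = 0")
        case True
        have "x * (A ^ l * L k2) = L u * NF w l k2"
          by (simp add: x(4) True NF_def mult.assoc)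
        then show ?thesis using Span_L[OF x(1) Span_NF[OF x(2) Suc.prems(2)]] by simp
      next
        case False
        then have "i = 1" using x(3) by simp
        then have "x * (A ^ l * L k2) = L u * (A * NF w l k2)"
          by (simp add: x(4) NF_def mult.assoc)
        then show ?thesis using Span_L[OF x(1) Suc.IH[OF x(2) Suc.prems(2)]] by simp
      qed
      then show ?case
        using Span_add[OF Span_smult step.IH] by (simp add: distrib_right mult.assoc)
    qed
    have "A * NF k1 (Suc l) k2 = (A * L k1 * A) * (A ^ l * L k2)"
      by (simp add: NF_def mult.assoc)
    also have "cg \<dots> (reduct (L k1) * (A ^ l * L k2))"
      by (rule cg_right[OF cg_small[OF Suc.prems(1) 2] tail])
    finally show ?thesis
      by (rule Span_cg) (rule step[OF reduct(1)[OF Suc.prems(1) 2]])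
  qed
qed

lemma Span_all: "f \<in> FA \<Longrightarrow> f \<in> Span"
proof (induction f rule: free_algebra_induct)
  case zero
  show ?case by (rule Span_zero)
next
  case one
  have "cg (L \<one> * L \<one>) (1 * 1)" by (rule cg_mult[OF cg_L_one cg_L_one])
  then have "cg (NF \<one> 0 \<one>) 1" by (simp add: NF_def)
  then have "cg 1 (NF \<one> 0 \<one>)" by (rule cg_sym)
  then show ?case by (rule Span_cg) (intro Span_NF K_closed)
next
  case (letter i f)
  show ?case
  proof (cases "i < card KU")
    case True
    then obtain k where "k \<in> K" "idx (k <# U) = i" by (rule idx_obtain)
    then show ?thesis using Span_L[of k f] letter by (simp add: L_def)
  next
    case False
    then have "i = card KU" using letter by simp
    then show ?thesis using Span_mult[OF A_FA Span_A_NF letter(3)] by (simp add: A_def)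
  qed
next
  case (add f g)
  then show ?case by (intro Span_add)
next
  case (smult c f)
  then show ?case by (intro Span_smult)
qed

text \<open>Induction on the number of terms. Fix a term \<open>n\<close> and look at its centre. If
  another term is nonzero there, the two are proportional modulo \<open>J\<close> and can be merged;
  if not, evaluation at the centre shows that the coefficient of \<open>n\<close> is zero. No
  linearly independent subfamily has to be singled out.\<close>

lemma kernel_normal_forms:
  assumes "finite t" "t \<subseteq> NFs UNIV"
    and "ev (\<Sum>x\<in>t. Poly_Mapping.single 0 (c x) * x) = (\<lambda>x. 0)"
  shows "(\<Sum>x\<in>t. Poly_Mapping.single 0 (c x) * x) \<in> J"
  using assms
proof (induction "card t" arbitrary: t c)
  case 0
  then show ?case by (simp add: J_zero)
next
  case (Suc d)
  let ?S = "\<lambda>t c. \<Sum>x\<in>t. Poly_Mapping.single 0 (c x) * x"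
  obtain n where n: "n \<in> t" using Suc.hyps(2) by fastforce
  then obtain k l k' where k: "k \<in> K" "k' \<in> K" "n = NF k l k'"
    using Suc.prems(2) unfolding NFs_def by blast
  let ?g = "k \<otimes> a [^] l \<otimes> k'"
  show ?case
  proof (cases "\<exists>n'\<in>t - {n}. ev n' ?g \<noteq> 0")
    case True
    then obtain n' where n': "n' \<in> t" "n' \<noteq> n" "ev n' ?g \<noteq> 0" by blast
    then obtain k1 l1 k1' where k1: "k1 \<in> K" "k1' \<in> K" "n' = NF k1 l1 k1'"
      using Suc.prems(2) unfolding NFs_def by blast
    obtain s where s: "cg n' (Poly_Mapping.single 0 s * n)"
      using cg_NF_overlap[OF k(1,2) k1(1,2)] n'(3) k(3) k1(3) by blast
    define e where "e = Poly_Mapping.single 0 (c n') * (n' - Poly_Mapping.single 0 s * n)"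
    have e: "e \<in> J" unfolding e_def using s by (intro J_left) (simp_all add: cg_def)
    \<comment> \<open>The coefficient of the discarded \<open>n'\<close> is transferred to
      \<open>n\<close> with the factor \<open>s\<close>; the error \<open>e\<close> lies in the
      ideal.\<close>
    define c' where "c' = c(n := c n + c n' * s)"
    have t: "finite (t - {n'})" "card (t - {n'}) = d" "t - {n'} \<subseteq> NFs UNIV" "n \<in> t - {n'}"
      using Suc.prems Suc.hyps(2) n n' by auto
    have "?S t c = Poly_Mapping.single 0 (c n') * n' + ?S (t - {n'}) c"
      using Suc.prems(1) n'(1) by (rule sum.remove)
    moreover have "?S (t - {n'}) c = Poly_Mapping.single 0 (c n) * n + ?S (t - {n'} - {n}) c"
      using t(1,4) by (rule sum.remove)
    moreover have "?S (t - {n'}) c' = Poly_Mapping.single 0 (c' n) * n + ?S (t - {n'} - {n}) c'"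
      using t(1,4) by (rule sum.remove)
    moreover have "?S (t - {n'} - {n}) c' = ?S (t - {n'} - {n}) c"
      by (rule sum.cong) (auto simp: c'_def)
    moreover have "Poly_Mapping.single 0 (c n' * s) * n =
        Poly_Mapping.single 0 (c n') * (Poly_Mapping.single 0 s * n)"
      by (simp add: mult_single flip: mult.assoc)
    ultimately have split: "?S t c = e + ?S (t - {n'}) c'"
      by (simp add: e_def c'_def single_add distrib_right right_diff_distrib)
    have "ev (?S (t - {n'}) c') = (\<lambda>x. 0)"
      using Suc.prems(3) ev_J[OF e] unfolding split by (simp add: ev_add)
    then have "?S (t - {n'}) c' \<in> J"
      using Suc.hyps(1)[of "t - {n'}" c'] t by simp
    then show ?thesis unfolding split by (rule J_add[OF e])
  next
    case False
    \<comment> \<open>All other terms vanish at the centre of \<open>n\<close>, so evaluation there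
      isolates the coefficient of \<open>n\<close>.\<close>
    have ev_sum: "ev (?S t' c) ?g = (\<Sum>x\<in>t'. c x * ev x ?g)" if "finite t'" for t'
      using that by (induction t' rule: finite_induct) (simp_all add: ev_zero ev_add ev_smult)
    have "0 = (\<Sum>x\<in>t. c x * ev x ?g)"
      using Suc.prems(3) ev_sum[OF Suc.prems(1)] by simp
    also have "\<dots> = c n * ev n ?g + (\<Sum>x\<in>t - {n}. c x * ev x ?g)"
      using Suc.prems(1) n by (rule sum.remove)
    also have "(\<Sum>x\<in>t - {n}. c x * ev x ?g) = 0"
      using False by (intro sum.neutral) simp
    finally have "c n = 0"
      using ev_NF_self[OF k(1,2), of l] k(3) by simp
    then have split: "?S t c = ?S (t - {n}) c"
      using sum.remove[OF Suc.prems(1) n, of "\<lambda>x. Poly_Mapping.single 0 (c x) * x"] by simp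
    have "?S (t - {n}) c \<in> J"
    proof (rule Suc.hyps(1))
      show "d = card (t - {n})" using Suc.hyps(2) n Suc.prems(1) by simp
      show "finite (t - {n})" "t - {n} \<subseteq> NFs UNIV" using Suc.prems by auto
      show "ev (?S (t - {n}) c) = (\<lambda>x. 0)" using Suc.prems(3) unfolding split .
    qed
    then show ?thesis unfolding split .
  qed
qed

theorem finitely_presented_hecke_ring: "finitely_presented_algebra (hecke_ring mu)"
proof (rule finitely_presented_algebraI[OF H.complex_algebra_axioms gen_closed' finite_rels rels_FA])
  show "complex_algebra.free_value (hecke_ring mu) gen r = \<zero>\<^bsub>hecke_ring mu\<^esub>" if "r \<in> rels" for r
    using ev_rels[OF that] by (simp add: ev_def)
  show "carrier (hecke_ring mu) \<subseteq> complex_algebra.free_value (hecke_ring mu) gen ` FA"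
  proof
    fix f assume "f \<in> carrier (hecke_ring mu)"
    then have f: "f \<in> hecke_functions" by simp
    have "\<exists>b\<in>lin_span (NFs UNIV). ev b = f"
    proof (rule hecke_spanned[OF f])
      fix x assume "f x \<noteq> 0"
      then have "x \<in> carrier G" using hecke_outside[OF f] by blast
      then show "\<exists>k\<in>K. \<exists>k'\<in>K. \<exists>l\<in>UNIV. x = k \<otimes> a [^] (l::nat) \<otimes> k'"
        using cartan by blast
    qed
    then show "f \<in> complex_algebra.free_value (hecke_ring mu) gen ` FA"
      using span_FA unfolding ev_def by blast
  qed
  fix f assume f: "f \<in> FA" and "complex_algebra.free_value (hecke_ring mu) gen f = \<zero>\<^bsub>hecke_ring mu\<^esub>"
  then have ev0: "ev f = (\<lambda>x. 0)" by (simp add: ev_def)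
  obtain b where b: "b \<in> lin_span (NFs UNIV)" "cg f b"
    using Span_all[OF f] unfolding Span_def by blast
  have fb: "f - b \<in> J" using b(2) by (simp add: cg_def)
  have "ev f = (\<lambda>x. ev (f - b) x + ev b x)" by (simp flip: ev_add)
  then have "ev b = (\<lambda>x. 0)" using ev0 ev_J[OF fb] by simp
  then have "b \<in> J"
    using lin_span_explicit[OF b(1)] kernel_normal_forms by blast
  then have "(f - b) + b \<in> J" by (rule J_add[OF fb])
  then have "f \<in> J" by simp
  then show "f \<in> Idl\<^bsub>free_algebra gens\<^esub> rels" by (simp add: J_def)
qed

end


section \<open>Local fields and the tame Hilbert symbol\<close>

context nonarch_local_field
begin

abbreviation "PP \<equiv> pideal v"

lemma val_one [simp]: "v 1 = 0"
  using val_mult[of 1 1] by simp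

lemma val_minus_one [simp]: "v (- 1) = 0"
  using val_mult[of "-1" "-1"] by simp

lemma val_uminus [simp]: "v (- x) = v x"
proof (cases "x = 0")
  case False
  then show ?thesis using val_mult[of "-1" x] by simp
qed simp

lemma val_inverse: "x \<noteq> 0 \<Longrightarrow> v (inverse x) = - v x"
  using val_mult[of x "inverse x"] by simp

lemma val_divide: "x \<noteq> 0 \<Longrightarrow> y \<noteq> 0 \<Longrightarrow> v (x / y) = v x - v y"
  using val_mult[of x "inverse y"] val_inverse[of y] by (simp add: divide_inverse)

lemma val_power: "x \<noteq> 0 \<Longrightarrow> v (x ^ k) = int k * v x"
  by (induction k) (simp_all add: val_mult algebra_simps)

lemma val_power_int: "x \<noteq> 0 \<Longrightarrow> v (x powi k) = k * v x"
  by (cases "k \<ge> 0") (simp_all add: power_int_def val_power val_inverse)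

lemma pideal_0 [simp]: "0 \<in> PP k"
  by (simp add: pideal_def)

lemma pideal_iff: "x \<noteq> 0 \<Longrightarrow> x \<in> PP k \<longleftrightarrow> k \<le> v x"
  by (simp add: pideal_def)

lemma pideal_add: "x \<in> PP k \<Longrightarrow> y \<in> PP k \<Longrightarrow> x + y \<in> PP k"
  using val_add[of x y] by (cases "x = 0"; cases "y = 0"; cases "x + y = 0") (auto simp: pideal_def)

lemma pideal_uminus [simp]: "- x \<in> PP k \<longleftrightarrow> x \<in> PP k"
  by (simp add: pideal_def)

lemma pideal_diff: "x \<in> PP k \<Longrightarrow> y \<in> PP k \<Longrightarrow> x - y \<in> PP k"
  using pideal_add[of x k "- y"] by simp

lemma pideal_diff_commute: "x - y \<in> PP k \<longleftrightarrow> y - x \<in> PP k"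
  using pideal_uminus[of "x - y" k] by simp

lemma pideal_mult: "x \<in> PP j \<Longrightarrow> y \<in> PP k \<Longrightarrow> x * y \<in> PP (j + k)"
  using val_mult[of x y] by (cases "x = 0"; cases "y = 0") (auto simp: pideal_def)

lemma pideal_mono: "j \<le> k \<Longrightarrow> x \<in> PP k \<Longrightarrow> x \<in> PP j"
  by (auto simp: pideal_def)

lemma pideal_mult_int: "x \<in> PP 0 \<Longrightarrow> y \<in> PP k \<Longrightarrow> x * y \<in> PP k" "y \<in> PP k \<Longrightarrow> x \<in> PP 0 \<Longrightarrow> y * x \<in> PP k"
  using pideal_mult[of x 0 y k] pideal_mult[of y k x 0] by auto

lemma one_int [simp]: "1 \<in> PP 0" and one_not_max [simp]: "1 \<notin> PP 1"
  by (simp_all add: pideal_def)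

lemma pideal_sum: "(\<And>i. i \<in> I \<Longrightarrow> f i \<in> PP k) \<Longrightarrow> sum f I \<in> PP k"
  by (induction I rule: infinite_finite_induct) (auto intro: pideal_add)

lemma pideal_power: "x \<in> PP 0 \<Longrightarrow> x ^ k \<in> PP 0"
  by (induction k) (auto intro: pideal_mult_int)

lemma of_nat_int: "of_nat k \<in> PP 0"
  by (induction k) (auto intro: pideal_add)

lemma unit_group_iff: "x \<in> unit_group v \<longleftrightarrow> x \<in> PP 0 \<and> x \<notin> PP 1"
  by (auto simp: unit_group_def pideal_def)

lemma unit_nonzero: "x \<in> unit_group v \<Longrightarrow> x \<noteq> 0"
  by (simp add: unit_group_def)

lemma unit_int: "x \<in> unit_group v \<Longrightarrow> x \<in> PP 0"
  by (simp add: unit_group_iff)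

lemma pideal_trans: "x - y \<in> PP k \<Longrightarrow> y - z \<in> PP k \<Longrightarrow> x - z \<in> PP k"
  using pideal_add[of "x - y" k "y - z"] by simp

lemma pideal_cong_mult:
  assumes "x - x' \<in> PP k" "y - y' \<in> PP k" "x \<in> PP 0" "y' \<in> PP 0"
  shows "x * y - x' * y' \<in> PP k"
proof -
  have "x * (y - y') + (x - x') * y' \<in> PP k"
    using assms by (intro pideal_add pideal_mult_int)
  then show ?thesis by (simp add: algebra_simps)
qed

lemma pideal_cong_prod:
  assumes "\<And>i. i \<in> I \<Longrightarrow> f i - g i \<in> PP k" "\<And>i. i \<in> I \<Longrightarrow> f i \<in> PP 0" "\<And>i. i \<in> I \<Longrightarrow> g i \<in> PP 0"
  shows "prod f I - prod g I \<in> PP k"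
proof -
  have "prod f I - prod g I \<in> PP k \<and> prod f I \<in> PP 0 \<and> prod g I \<in> PP 0"
    using assms
    by (induction I rule: infinite_finite_induct) (auto intro!: pideal_cong_mult pideal_mult_int)
  then show ?thesis by blast
qed

lemma pideal_cong_power: "x - y \<in> PP k \<Longrightarrow> x \<in> PP 0 \<Longrightarrow> y \<in> PP 0 \<Longrightarrow> x ^ j - y ^ j \<in> PP k"
  using pideal_cong_prod[of "{..<j}" "\<lambda>_. x" "\<lambda>_. y" k] by simp

lemma val_cong:
  assumes "x \<noteq> 0" "y - x \<in> PP (v x + 1)"
  shows "y \<noteq> 0" "v y = v x"
proof -
  show y: "y \<noteq> 0"
    using assms by (auto simp: pideal_def)
  show "v y = v x"
  proof (cases "y = x")
    case False
    then have d: "v x + 1 \<le> v (y - x)" using assms by (simp add: pideal_def)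
    have "min (v x) (v (y - x)) \<le> v y"
      using val_add[of x "y - x"] assms y False by simp
    moreover have "min (v y) (v (y - x)) \<le> v x"
      using val_add[of y "- (y - x)"] assms y False val_uminus[of "y - x"] by simp
    ultimately show ?thesis using d by linarith
  qed simp
qed

lemma unit_cong:
  assumes "x - y \<in> PP 1" "y \<in> unit_group v"
  shows "x \<in> unit_group v"
  using val_cong[of y x] assms by (simp add: unit_group_def)

lemma pideal_Inter:
  assumes "\<And>k::nat. x \<in> PP (int k)"
  shows "x = 0"
proof (rule ccontr)
  assume "x \<noteq> 0"
  then have "int (nat (v x + 1)) \<le> v x"
    using pideal_iff assms by blast
  then show False by linarith
qed

section \<open>The residue field, Fermat's congruence and Teichmueller representatives\<close>

definition res :: "'a \<Rightarrow> 'a set"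
  where "res x = {y. y - x \<in> PP 1}"

lemma res_eq_iff: "res x = res y \<longleftrightarrow> x - y \<in> PP 1"
proof
  assume "res x = res y"
  moreover have "x \<in> res x" by (simp add: res_def)
  ultimately show "x - y \<in> PP 1" by (simp add: res_def)
next
  assume "x - y \<in> PP 1"
  then have "z - x \<in> PP 1 \<longleftrightarrow> z - y \<in> PP 1" for z
    using pideal_add[of "z - x" 1 "x - y"] pideal_diff[of "z - y" 1 "x - y"] by auto
  then show "res x = res y" by (auto simp: res_def)
qed

definition res_rep :: "'a set \<Rightarrow> 'a"
  where "res_rep C = (SOME x. x \<in> PP 0 \<and> C = res x)"

lemma res_rep:
  assumes "C \<in> residue_classes v"
  shows "res_rep C \<in> PP 0" "res (res_rep C) = C"
proof -
  obtain x where "x \<in> PP 0 \<and> C = res x"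
    using assms by (auto simp: residue_classes_def res_def)
  then have "res_rep C \<in> PP 0 \<and> C = res (res_rep C)"
    unfolding res_rep_def by (rule someI)
  then show "res_rep C \<in> PP 0" "res (res_rep C) = C" by auto
qed

lemma res_in: "x \<in> PP 0 \<Longrightarrow> res x \<in> residue_classes v"
  by (auto simp: residue_classes_def res_def)

lemma res_rep_cong: "x \<in> PP 0 \<Longrightarrow> res_rep (res x) - x \<in> PP 1"
  using res_rep(2)[OF res_in[of x]] by (simp add: res_eq_iff)

abbreviation "q \<equiv> residue_card v"

text \<open>Adding 1 permutes the residue classes; comparing the sums of representatives before and
  after leaves \<open>q\<close> times 1 in the maximal ideal.\<close>

lemma of_nat_q: "of_nat q \<in> PP 1"
proof -
  let ?C = "residue_classes v"
  let ?f = "\<lambda>C. res (res_rep C + 1)"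
  have f: "?f C \<in> ?C" if "C \<in> ?C" for C
    using res_rep(1)[OF that] by (intro res_in pideal_add) auto
  have inj: "inj_on ?f ?C"
  proof (rule inj_onI)
    fix C D assume C: "C \<in> ?C" "D \<in> ?C" "?f C = ?f D"
    then have "res (res_rep C) = res (res_rep D)" by (simp add: res_eq_iff)
    then show "C = D" using res_rep(2) C by simp
  qed
  have "bij_betw ?f ?C ?C"
    unfolding bij_betw_def using inj f endo_inj_surj[OF finite_residue _ inj] by blast
  then have "(\<Sum>C\<in>?C. res_rep (?f C)) = (\<Sum>C\<in>?C. res_rep C)"
    by (rule sum.reindex_bij_betw)
  then have "(\<Sum>C\<in>?C. (res_rep (?f C) - (res_rep C + 1))) = - of_nat q"
    by (simp add: sum_subtractf sum.distrib residue_card_def)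
  moreover have "(\<Sum>C\<in>?C. (res_rep (?f C) - (res_rep C + 1))) \<in> PP 1"
    using res_rep(1) by (intro pideal_sum res_rep_cong pideal_add) auto
  ultimately show ?thesis by simp
qed

lemma res_nonzero_iff: "x \<in> PP 0 \<Longrightarrow> res x \<noteq> res 0 \<longleftrightarrow> x \<in> unit_group v"
  by (simp add: res_eq_iff unit_group_iff)

lemma card_nonzero: "card (residue_classes v - {res 0}) = q - 1"
  using finite_residue res_in[of 0] by (simp add: residue_card_def)

lemma q_pos: "q \<ge> 2"
proof -
  have "res 0 \<noteq> res 1" by (simp add: res_eq_iff)
  moreover have "{res 0, res 1} \<subseteq> residue_classes v" using res_in by auto
  ultimately have "card {res 0, res 1} \<le> q"
    unfolding residue_card_def by (intro card_mono finite_residue)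
  then show ?thesis using \<open>res 0 \<noteq> res 1\<close> by simp
qed

lemma unit_mult: "x \<in> unit_group v \<Longrightarrow> y \<in> unit_group v \<Longrightarrow> x * y \<in> unit_group v"
  by (simp add: unit_group_def val_mult)

lemma unit_one [simp]: "1 \<in> unit_group v"
  by (simp add: unit_group_def)

lemma unit_inverse: "x \<in> unit_group v \<Longrightarrow> inverse x \<in> unit_group v"
  by (simp add: unit_group_def val_inverse)

lemma unit_prod: "(\<And>i. i \<in> I \<Longrightarrow> f i \<in> unit_group v) \<Longrightarrow> prod f I \<in> unit_group v"
  by (induction I rule: infinite_finite_induct) (simp_all add: unit_mult unit_one)

lemma pideal_cancel_unit:
  assumes "y \<in> unit_group v" "x * y \<in> PP k"
  shows "x \<in> PP k"
  using assms by (cases "x = 0") (auto simp: unit_group_def pideal_def val_mult)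

text \<open>Multiplication by \<open>x\<close> permutes the nonzero residue classes; comparing
  products of representatives leaves the factor \<open>x ^ (q - 1)\<close>.\<close>

lemma unit_fermat:
  assumes x: "x \<in> unit_group v"
  shows "x ^ (q - 1) - 1 \<in> PP 1"
proof -
  let ?C = "residue_classes v - {res 0}"
  let ?f = "\<lambda>C. res (x * res_rep C)"
  have u: "res_rep C \<in> unit_group v" if "C \<in> ?C" for C
    using res_rep[of C] that by (auto simp flip: res_nonzero_iff)
  have x0: "x \<in> PP 0" using x by (simp add: unit_group_iff)
  have f: "?f C \<in> ?C" if "C \<in> ?C" for C
    using unit_mult[OF x u[OF that]] res_nonzero_iff[of "x * res_rep C"] res_in[of "x * res_rep C"]
    by (simp add: unit_group_iff)
  have inj: "inj_on ?f ?C"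
  proof (rule inj_onI)
    fix C D assume C: "C \<in> ?C" "D \<in> ?C" "?f C = ?f D"
    then have "(res_rep C - res_rep D) * x \<in> PP 1" by (simp add: res_eq_iff algebra_simps)
    then have "res (res_rep C) = res (res_rep D)"
      unfolding res_eq_iff by (rule pideal_cancel_unit[OF x])
    then show "C = D" using res_rep(2) C by simp
  qed
  have "bij_betw ?f ?C ?C"
    unfolding bij_betw_def using inj f endo_inj_surj[OF _ _ inj] finite_residue by blast
  then have e: "(\<Prod>C\<in>?C. res_rep (?f C)) = (\<Prod>C\<in>?C. res_rep C)"
    by (rule prod.reindex_bij_betw)
  have r: "res_rep C \<in> PP 0" if "C \<in> ?C" for C
    using u[OF that] by (simp add: unit_group_iff)
  have "(\<Prod>C\<in>?C. x * res_rep C) - (\<Prod>C\<in>?C. res_rep (?f C)) \<in> PP 1"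
  proof (rule pideal_cong_prod)
    fix C assume C: "C \<in> ?C"
    show xr: "x * res_rep C \<in> PP 0" by (intro pideal_mult_int x0 r C)
    show "x * res_rep C - res_rep (?f C) \<in> PP 1"
      using res_rep_cong[OF xr] by (subst pideal_diff_commute)
    show "res_rep (?f C) \<in> PP 0" by (intro r f C)
  qed
  then have "(x ^ (q - 1) - 1) * (\<Prod>C\<in>?C. res_rep C) \<in> PP 1"
    unfolding e by (simp add: prod.distrib card_nonzero algebra_simps)
  moreover have "(\<Prod>C\<in>?C. res_rep C) \<in> unit_group v"
    by (rule unit_prod) (rule u)
  ultimately show ?thesis
    using pideal_cancel_unit by blast
qed

lemma geometric_cong:
  assumes "u - 1 \<in> PP 1"
  shows "(\<Sum>i<k. u ^ i) - of_nat k \<in> PP 1"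
proof -
  have "u \<in> PP 0"
    using pideal_add[OF pideal_mono[OF _ assms] one_int] by simp
  then have "(\<Sum>i<k. u ^ i - 1 ^ i) \<in> PP 1"
    using assms by (intro pideal_sum pideal_cong_power) auto
  then show ?thesis by (simp add: sum_subtractf)
qed

text \<open>The geometric sum of the powers of \<open>u\<close> is congruent to \<open>k\<close>,
  hence nonzero, while its product with \<open>u - 1\<close> is zero.\<close>

lemma root_of_unity_one_unit:
  assumes "u - 1 \<in> PP 1" "u ^ k = 1" "of_nat k \<notin> PP 1"
  shows "u = 1"
proof (rule ccontr)
  assume "u \<noteq> 1"
  have "(u - 1) * (\<Sum>i<k. u ^ i) = u ^ k - 1"
    by (simp add: power_diff_1_eq)
  then have "(\<Sum>i<k. u ^ i) = 0" using \<open>u \<noteq> 1\<close> assms(2) by simp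
  then have "of_nat k \<in> PP 1" using geometric_cong[OF assms(1), of k] by simp
  then show False using assms(3) by contradiction
qed

lemma of_nat_q_minus_one: "of_nat (q - 1) \<notin> PP 1"
proof
  assume "of_nat (q - 1) \<in> PP 1"
  then have "of_nat q - of_nat (q - 1) \<in> PP 1" using of_nat_q by (rule pideal_diff[rotated])
  then show False using q_pos by (simp add: of_nat_diff)
qed

text \<open>In the factorization of \<open>y ^ q - z ^ q\<close> by \<open>y - z\<close>, each term
  of the cofactor is congruent to \<open>z ^ (q - 1)\<close>. The cofactor is therefore congruent to
  \<open>q\<close> times this power and lies in the maximal ideal, which gains one order.\<close>

lemma q_power_cong:
  assumes "y - z \<in> PP (int j)" "1 \<le> j" "y \<in> PP 0" "z \<in> PP 0"
  shows "y ^ q - z ^ q \<in> PP (int (Suc j))"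
proof -
  have c: "y - z \<in> PP 1" by (rule pideal_mono[OF _ assms(1)]) (use assms(2) in simp)
  have "(\<Sum>i<q. z ^ (q - Suc i) * y ^ i - z ^ (q - 1)) \<in> PP 1"
  proof (rule pideal_sum)
    fix i assume "i \<in> {..<q}"
    then have "z ^ (q - 1) = z ^ (q - Suc i) * z ^ i"
      by (simp flip: power_add)
    moreover have "z ^ (q - Suc i) * (y ^ i - z ^ i) \<in> PP 1"
      using assms c by (intro pideal_mult_int pideal_power pideal_cong_power)
    ultimately show "z ^ (q - Suc i) * y ^ i - z ^ (q - 1) \<in> PP 1"
      by (simp add: algebra_simps)
  qed
  moreover have "of_nat q * z ^ (q - 1) \<in> PP 1"
    using of_nat_q assms by (intro pideal_mult_int(2) pideal_power)
  ultimately have "(\<Sum>i<q. z ^ (q - Suc i) * y ^ i) \<in> PP 1"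
    using pideal_add by (fastforce simp: sum_subtractf)
  then have "(y - z) * (\<Sum>i<q. z ^ (q - Suc i) * y ^ i) \<in> PP (int j + 1)"
    by (rule pideal_mult[OF assms(1)])
  then show ?thesis by (simp add: power_diff_sumr2 add.commute)
qed

text \<open>The Teichmueller representative is the limit of \<open>x ^ (q ^ k)\<close>: consecutive
  terms agree to increasing order by \<open>q_power_cong\<close>, and the limit satisfies
  \<open>l ^ q = l\<close>.\<close>

lemma teich_exists:
  assumes x: "x \<in> unit_group v"
  shows "\<exists>z. z ^ (q - 1) = 1 \<and> x - z \<in> PP 1"
proof -
  have x0: "x \<in> PP 0" using x by (simp add: unit_group_iff)
  define s where "s k = x ^ (q ^ k)" for k :: nat
  have s0: "s k \<in> PP 0" for k by (simp add: s_def pideal_power x0)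
  have sS: "s (Suc k) = s k ^ q" for k by (simp add: s_def mult.commute flip: power_mult)
  have s_step: "s (Suc k) - s k \<in> PP (int (Suc k))" for k
  proof (induction k)
    case 0
    \<comment> \<open>The induction starts from Fermat's congruence multiplied by
      \<open>x\<close>.\<close>
    have "x * (x ^ (q - 1) - 1) \<in> PP 1" by (intro pideal_mult_int x0 unit_fermat x)
    moreover have "x ^ q = x * x ^ (q - 1)" using q_pos by (simp add: power_eq_if)
    ultimately show ?case by (simp add: s_def algebra_simps)
  next
    case (Suc k)
    show ?case unfolding sS[of "Suc k"] unfolding sS[of k]
      using q_power_cong[OF Suc _ s0 s0] unfolding sS by simp
  qed
  have far: "s (k + d) - s k \<in> PP (int (Suc k))" for k d
  proof (induction d)
    case (Suc d)
    have "s (Suc (k + d)) - s (k + d) \<in> PP (int (Suc k))"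
      by (rule pideal_mono[OF _ s_step]) simp
    then show ?case using pideal_trans Suc by fastforce
  qed simp
  have "\<exists>N::nat. \<forall>i\<ge>N. \<forall>j\<ge>N. s i - s j \<in> PP (int k)" for k :: nat
  proof (intro exI[of _ k] allI impI)
    fix i j assume ij: "k \<le> i" "k \<le> j"
    have "s i - s k \<in> PP (int k)" "s j - s k \<in> PP (int k)"
      using far[of k "i - k"] far[of k "j - k"] ij pideal_mono[of "int k" "int (Suc k)"] by auto
    then show "s i - s j \<in> PP (int k)" using pideal_diff by fastforce
  qed
  then obtain l where l: "\<And>k::nat. \<exists>N::nat. \<forall>i\<ge>N. s i - l \<in> PP (int k)"
    using complete[of s] by blast
  obtain N1 where N1: "\<And>i. i \<ge> N1 \<Longrightarrow> s i - l \<in> PP 1" using l[of 1] by auto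
  have "s N1 - x \<in> PP 1"
    using far[of 0 N1] by (simp add: s_def)
  then have xl: "x - l \<in> PP 1"
    using N1[of N1] pideal_diff[of "s N1 - l" 1 "s N1 - x"] by simp
  then have lx: "l - x \<in> PP 1" by (subst pideal_diff_commute)
  have lu: "l \<in> unit_group v" by (rule unit_cong[OF lx x])
  have l0: "l \<in> PP 0" "l \<noteq> 0"
    using lu[unfolded unit_group_iff] lu[unfolded unit_group_def] by simp_all
  have "l ^ q - l \<in> PP (int k)" for k :: nat
  proof -
    obtain N where N: "\<And>i. i \<ge> N \<Longrightarrow> s i - l \<in> PP (int k)" using l[of k] by auto
    have "s N ^ q - l ^ q \<in> PP (int k)" by (intro pideal_cong_power N s0 l0) simp
    moreover have "s N ^ q - l \<in> PP (int k)" using N[of "Suc N"] by (simp add: sS)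
    ultimately show ?thesis using pideal_diff[of "s N ^ q - l" "int k" "s N ^ q - l ^ q"] by simp
  qed
  then have "l ^ q - l = 0" by (rule pideal_Inter)
  moreover have "l ^ q = l * l ^ (q - 1)" using q_pos by (simp add: power_eq_if)
  ultimately have "l * (l ^ (q - 1) - 1) = 0"
    by (simp add: algebra_simps)
  then have "l ^ (q - 1) = 1" using l0 by simp
  then show ?thesis using xl by blast
qed

text \<open>The quotient of two candidates is a one-unit whose power \<open>q - 1\<close> is one,
  and \<open>q - 1\<close> is a unit.\<close>

lemma teich_unique:
  assumes "z ^ (q - 1) = 1" "z' ^ (q - 1) = 1" "x - z \<in> PP 1" "x - z' \<in> PP 1" "x \<in> unit_group v"
  shows "z = z'"
proof -
  have "z' \<in> unit_group v"
    by (rule unit_cong[OF _ assms(5)]) (use assms(4) in \<open>subst pideal_diff_commute\<close>)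
  then have z': "z' \<noteq> 0" "inverse z' \<in> PP 0"
    by (rule unit_nonzero, intro unit_int unit_inverse)
  have "(z - z') * inverse z' \<in> PP 1"
    using pideal_diff[OF assms(4,3)] z'(2) by (intro pideal_mult_int) simp_all
  then have "z / z' - 1 \<in> PP 1"
    using z'(1) by (simp add: field_simps)
  moreover have "(z / z') ^ (q - 1) = 1" using assms(1,2) by (simp add: power_divide)
  ultimately have "z / z' = 1"
    by (rule root_of_unity_one_unit[OF _ _ of_nat_q_minus_one])
  then show ?thesis using z'(1) by simp
qed

lemma root_of_unity_unit:
  assumes "z ^ k = 1" "k > 0"
  shows "z \<in> unit_group v"
proof -
  have z: "z \<noteq> 0" using assms by (auto simp: power_0_left)
  then have "int k * v z = 0" using val_power[OF z, of k] assms(1) by simp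
  then show ?thesis using z assms(2) by (simp add: unit_group_def)
qed

text \<open>Turns the multiplicative coset in the definition of \<open>teich\<close> into an
  additive congruence, the form in which it is used afterwards.\<close>

lemma one_unit_coset_iff:
  assumes "z \<in> unit_group v"
  shows "x \<in> (\<lambda>y. z * (1 + y)) ` PP 1 \<longleftrightarrow> x - z \<in> PP 1"
proof
  assume "x \<in> (\<lambda>y. z * (1 + y)) ` PP 1"
  then obtain y where "y \<in> PP 1" "x = z * (1 + y)" by blast
  then show "x - z \<in> PP 1"
    using assms pideal_mult_int(1)[of z y 1] by (simp add: algebra_simps unit_group_iff)
next
  assume "x - z \<in> PP 1"
  then have "inverse z * (x - z) \<in> PP 1"
    using unit_inverse[OF assms] by (intro pideal_mult_int) (simp_all add: unit_group_iff)
  moreover have "x = z * (1 + inverse z * (x - z))"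
    using assms by (simp add: unit_group_def field_simps)
  ultimately show "x \<in> (\<lambda>y. z * (1 + y)) ` PP 1" by blast
qed

lemma teich_eqI:
  assumes "z ^ (q - 1) = 1" "x - z \<in> PP 1"
  shows "teich v x = z"
  unfolding teich_def
proof (rule the_equality)
  have q1: "q - 1 > 0" using q_pos by simp
  have zu: "z \<in> unit_group v" by (rule root_of_unity_unit[OF assms(1) q1])
  have xu: "x \<in> unit_group v" by (rule unit_cong[OF assms(2) zu])
  show "z \<in> roots_of_1 (q - 1) \<and> x \<in> (\<lambda>y. z * (1 + y)) ` PP 1"
    using assms one_unit_coset_iff[OF zu] by (simp add: roots_of_1_def)
  fix w assume "w \<in> roots_of_1 (q - 1) \<and> x \<in> (\<lambda>y. w * (1 + y)) ` PP 1"
  then have w: "w ^ (q - 1) = 1" and xw: "x \<in> (\<lambda>y. w * (1 + y)) ` PP 1"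
    by (simp_all add: roots_of_1_def)
  have "x - w \<in> PP 1"
    using one_unit_coset_iff[OF root_of_unity_unit[OF w q1]] xw by blast
  then show "w = z" using teich_unique[OF w assms(1) _ assms(2) xu] by blast
qed

lemma teich:
  assumes "x \<in> unit_group v"
  shows "teich v x ^ (q - 1) = 1" "x - teich v x \<in> PP 1"
  using teich_exists[OF assms] teich_eqI by auto

lemma teich_unit: "x \<in> unit_group v \<Longrightarrow> teich v x \<in> unit_group v"
  using root_of_unity_unit[OF teich(1)] q_pos by auto

lemma teich_mult:
  assumes "x \<in> unit_group v" "y \<in> unit_group v"
  shows "teich v (x * y) = teich v x * teich v y"
  using teich[OF assms(1)] teich[OF assms(2)] assms(1) teich_unit[OF assms(2)]
  by (intro teich_eqI pideal_cong_mult) (simp_all add: power_mult_distrib unit_group_iff)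

lemma teich_one_unit: "x - 1 \<in> PP 1 \<Longrightarrow> teich v x = 1"
  by (rule teich_eqI) simp_all

text \<open>The unit to which \<open>teich\<close> is applied in the Hilbert symbol. Symbol
  identities are first proved for it, because \<open>teich\<close> is multiplicative on units and
  trivial on one-units.\<close>

definition tame_arg :: "'a \<Rightarrow> 'a \<Rightarrow> 'a"
  where "tame_arg a b = (-1) powi (v a * v b) * (b powi v a / a powi v b)"

lemma tame_arg_unit: "a \<noteq> 0 \<Longrightarrow> b \<noteq> 0 \<Longrightarrow> tame_arg a b \<in> unit_group v"
  by (simp add: tame_arg_def unit_group_def val_mult val_divide val_power_int)

lemma tame_arg_mult_left:
  assumes "a \<noteq> 0" "a' \<noteq> 0" "b \<noteq> 0"
  shows "tame_arg (a * a') b = tame_arg a b * tame_arg a' b"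
  using assms
  by (simp add: tame_arg_def val_mult distrib_right power_int_add power_int_mult_distrib)

lemma tame_arg_swap:
  assumes "a \<noteq> 0" "b \<noteq> 0"
  shows "tame_arg a b * tame_arg b a = 1"
proof -
  have "(-1 :: 'a) powi (v a * v b) * (-1) powi (v a * v b) = 1"
    by (simp flip: power_int_mult_distrib)
  then show ?thesis
    using assms by (simp add: tame_arg_def mult.commute field_simps)
qed

lemma one_unit_power_int:
  assumes "x - 1 \<in> PP 1"
  shows "x powi k - 1 \<in> PP 1"
proof -
  have xu: "x \<in> unit_group v" using unit_cong[OF assms] by (simp add: unit_group_def)
  have p: "y ^ j - 1 \<in> PP 1" if "y - 1 \<in> PP 1" "y \<in> PP 0" for y j
    using pideal_cong_power[OF that one_int] by simp
  have "inverse x * (1 - x) \<in> PP 1"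
    using assms unit_inverse[OF xu] pideal_diff_commute
    by (intro pideal_mult_int) (simp_all add: unit_group_iff)
  then have "inverse x - 1 \<in> PP 1"
    using xu by (simp add: unit_group_def right_diff_distrib)
  then show ?thesis
    using p[OF assms] p[of "inverse x"] xu unit_inverse[OF xu]
    by (simp add: power_int_def unit_group_iff)
qed

lemma tame_arg_one_unit:
  assumes "a - 1 \<in> PP 1"
  shows "tame_arg a b - 1 \<in> PP 1"
proof -
  have "v a = 0" using unit_cong[OF assms] by (simp add: unit_group_def)
  then have "tame_arg a b = a powi (- v b)" by (simp add: tame_arg_def power_int_minus_divide)
  then show ?thesis using one_unit_power_int[OF assms] by simp
qed

text \<open>A disjunction, because for positive valuation of \<open>a\<close> it is
  \<open>1 - a\<close> that is a one-unit, and for \<open>a\<close> close to 1 it is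
  \<open>a\<close> itself. Antisymmetry of the symbol later removes the difference.\<close>

lemma tame_arg_steinberg:
  assumes "a \<noteq> 0" "1 - a \<noteq> 0"
  shows "tame_arg a (1 - a) - 1 \<in> PP 1 \<or> tame_arg (1 - a) a - 1 \<in> PP 1"
proof -
  consider "v a > 0" | "v a = 0" | "v a < 0" by linarith
  then show ?thesis
  proof cases
    case 1
    then have "(1 - a) - 1 \<in> PP 1" using assms by (simp add: pideal_def)
    then show ?thesis using tame_arg_one_unit by blast
  next
    case 2
    then have "1 - a \<in> PP 0" using assms by (intro pideal_diff) (simp_all add: pideal_def)
    then have "v (1 - a) = 0 \<or> v (1 - a) \<ge> 1" using assms by (auto simp: pideal_def)
    then show ?thesis
    proof
      assume "v (1 - a) = 0"
      then show ?thesis using 2 by (simp add: tame_arg_def)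
    next
      assume "v (1 - a) \<ge> 1"
      then have "a - 1 \<in> PP 1" using assms pideal_diff_commute[of a 1] by (simp add: pideal_def)
      then show ?thesis using tame_arg_one_unit by blast
    qed
  next
    case 3
    \<comment> \<open>For negative valuation \<open>1 - a\<close> has the valuation of
      \<open>a\<close>, and \<open>(1 - a) / a\<close> is minus a one-unit; its sign cancels against
      the sign in \<open>tame_arg\<close>.\<close>
    have "(1 - a) - (- a) \<in> PP (v (- a) + 1)" using 3 by (simp add: pideal_def)
    then have v1: "v (1 - a) = v a" using val_cong(2)[of "- a" "1 - a"] assms by simp
    have e: "(1 - a) / a = - (1 - inverse a)" using assms by (simp add: field_simps)
    have s: "(-1 :: 'a) powi (v a * v a) * (-1) powi v a = 1"
      by (simp flip: power_int_add add: power_int_minus_left distrib_left)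
    have "tame_arg a (1 - a) = (-1) powi (v a * v a) * ((1 - a) / a) powi v a"
      by (simp add: tame_arg_def v1 power_int_divide_distrib)
    also have "((1 - a) / a) powi v a = (-1) powi v a * (1 - inverse a) powi v a"
      unfolding e by (simp flip: power_int_mult_distrib)
    finally have "tame_arg a (1 - a) = (1 - inverse a) powi v a"
      using s by (simp flip: mult.assoc)
    moreover have "(1 - inverse a) - 1 \<in> PP 1"
      using 3 assms by (simp add: pideal_def val_inverse)
    ultimately show ?thesis using one_unit_power_int by simp
  qed
qed

lemma tame_arg_neg:
  assumes "a \<noteq> 0"
  shows "tame_arg a (- a) = 1"
proof -
  have "(-1 :: 'a) powi (v a * v a) * (-1) powi v a = 1"
    by (simp flip: power_int_add add: power_int_minus_left distrib_left)
  moreover have "(- a) powi v a = (-1) powi v a * a powi v a"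
    by (simp flip: power_int_mult_distrib)
  ultimately show ?thesis using assms by (simp add: tame_arg_def)
qed

abbreviation "mu n \<equiv> roots_of_1 n :: 'a set"

end

locale tame_local_field = nonarch_local_field v for v :: "'a::field \<Rightarrow> int" +
  fixes n :: nat
  assumes n_pos: "1 \<le> n"
    and n_coprime: "coprime n (residue_char v)"
    and n_roots: "card (roots_of_1 n :: 'a set) = n"
begin

text \<open>The residue characteristic is the least positive integer in the maximal ideal, so it
  would divide \<open>n\<close> after division with remainder; coprimality would make it 1, which is
  not in the ideal.\<close>

lemma of_nat_n: "of_nat n \<notin> PP 1"
proof
  assume n: "of_nat n \<in> PP 1"
  let ?p = "residue_char v"
  have "0 < q \<and> of_nat q \<in> PP 1" using q_pos of_nat_q by simp
  then have p: "0 < ?p" "of_nat ?p \<in> PP 1"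
    unfolding residue_char_def by (metis (mono_tags, lifting) LeastI)+
  have least: "?p \<le> k" if "0 < k" "of_nat k \<in> PP 1" for k :: nat
    unfolding residue_char_def by (rule Least_le) (use that in simp)
  have "of_nat n - of_nat (n div ?p) * of_nat ?p \<in> PP 1"
    by (intro pideal_diff n pideal_mult_int of_nat_int p)
  also have "(of_nat n :: 'a) - of_nat (n div ?p) * of_nat ?p = of_nat (n mod ?p)"
    by (metis add_diff_cancel_left' div_mult_mod_eq of_nat_add of_nat_mult)
  finally have "n mod ?p = 0"
    using least[of "n mod ?p"] p(1) by (metis bot_nat_0.not_eq_extremum leD mod_less_divisor)
  then have "?p dvd gcd n ?p" by auto
  then have "?p = 1" using n_coprime by simp
  then show False using p(2) by simp
qed

text \<open>Divided by its Teichmueller representative, \<open>x\<close> becomes a one-unit whose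
  power \<open>n * (q - 1)\<close> is one. Since this exponent is a unit, the quotient is
  one.\<close>

lemma mu_n_subset:
  fixes x :: 'a
  assumes x: "x ^ n = 1"
  shows "x ^ (q - 1) = 1"
proof -
  from x have xu: "x \<in> unit_group v" using root_of_unity_unit n_pos by simp
  let ?z = "teich v x"
  have z: "?z ^ (q - 1) = 1" "?z \<in> unit_group v" by (rule teich[OF xu], rule teich_unit[OF xu])
  have z0: "?z \<noteq> 0" using z(2) by (simp add: unit_group_def)
  have "(x - ?z) * inverse ?z \<in> PP 1"
    using teich(2)[OF xu] unit_inverse[OF z(2)] by (intro pideal_mult_int) (simp_all add: unit_group_iff)
  then have 1: "x / ?z - 1 \<in> PP 1" using z0 by (simp add: field_simps)
  have "(x / ?z) ^ (n * (q - 1)) = (x ^ n) ^ (q - 1) / (?z ^ (q - 1)) ^ n"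
    by (simp add: power_divide flip: power_mult) (simp add: mult.commute)
  then have 2: "(x / ?z) ^ (n * (q - 1)) = 1" using x z by simp
  have "of_nat n \<in> unit_group v" "of_nat (q - 1) \<in> unit_group v"
    unfolding unit_group_iff using of_nat_n of_nat_q_minus_one of_nat_int by blast+
  then have "of_nat n * of_nat (q - 1) \<in> unit_group v" by (rule unit_mult)
  then have 3: "of_nat (n * (q - 1)) \<notin> PP 1" unfolding unit_group_iff of_nat_mult by blast
  have "x / ?z = 1" by (rule root_of_unity_one_unit[OF 1 2 3])
  then show ?thesis using z z0 by simp
qed

text \<open>All \<open>n\<close> roots of unity are also roots of the polynomial with exponent the
  gcd of \<open>n\<close> and \<open>q - 1\<close>, which has at most that many roots; so the gcd is
  \<open>n\<close>. This makes the division in the exponent of the Hilbert symbol exact.\<close>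

lemma n_dvd: "n dvd q - 1"
proof -
  let ?d = "gcd n (q - 1)"
  have d: "?d > 0" using n_pos by simp
  have "roots_of_1 n \<subseteq> {x :: 'a. poly (monom 1 ?d - 1) x = 0}"
  proof
    fix x :: 'a assume "x \<in> roots_of_1 n"
    then have xn: "x ^ n = 1" by (simp add: roots_of_1_def)
    note x = xn mu_n_subset[OF xn]
    obtain i j where "n * i = (q - 1) * j + ?d" using bezout_nat[of n "q - 1"] n_pos by auto
    then have "x ^ (n * i) = x ^ ((q - 1) * j) * x ^ ?d" by (simp add: power_add)
    then have "x ^ ?d = 1" using x by (simp add: power_mult)
    then show "x \<in> {x. poly (monom 1 ?d - 1) x = 0}" by (simp add: poly_monom)
  qed
  moreover have "monom (1 :: 'a) ?d - 1 \<noteq> 0"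
  proof
    assume "monom (1 :: 'a) ?d - 1 = 0"
    then have "coeff (monom (1 :: 'a) ?d - 1) ?d = 0" by simp
    then show False using d by simp
  qed
  ultimately have "n \<le> card {x :: 'a. poly (monom 1 ?d - 1) x = 0}"
    using n_roots card_mono[OF poly_roots_finite] by metis
  also have "\<dots> \<le> degree (monom (1 :: 'a) ?d - 1)"
    by (rule card_poly_roots_bound) fact
  also have "\<dots> \<le> ?d"
    by (rule degree_diff_le) (simp_all add: degree_monom_le)
  finally have "n \<le> ?d" .
  moreover have "?d \<le> n" using n_pos by (intro dvd_imp_le[OF gcd_dvd1]) simp
  ultimately have "?d = n" by simp
  then show ?thesis using gcd_dvd2[of n "q - 1"] by simp
qed

abbreviation hs :: "'a \<Rightarrow> 'a \<Rightarrow> 'a"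
  where "hs \<equiv> hilbert_symbol v n"

lemma hs_def: "hs a b = teich v (tame_arg a b) ^ ((q - 1) div n)"
  by (simp add: hilbert_symbol_def tame_arg_def)

lemma hs_root: "a \<noteq> 0 \<Longrightarrow> b \<noteq> 0 \<Longrightarrow> hs a b \<in> roots_of_1 n"
  using teich(1)[OF tame_arg_unit] n_dvd by (simp add: hs_def roots_of_1_def flip: power_mult)

lemma hs_nonzero: "a \<noteq> 0 \<Longrightarrow> b \<noteq> 0 \<Longrightarrow> hs a b \<noteq> 0"
  using hs_root[of a b] n_pos by (auto simp: roots_of_1_def power_0_left)

lemma hs_mult_left: "a \<noteq> 0 \<Longrightarrow> a' \<noteq> 0 \<Longrightarrow> b \<noteq> 0 \<Longrightarrow> hs (a * a') b = hs a b * hs a' b"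
  by (simp add: hs_def tame_arg_mult_left teich_mult tame_arg_unit power_mult_distrib)

lemma hs_swap_mult: "a \<noteq> 0 \<Longrightarrow> b \<noteq> 0 \<Longrightarrow> hs a b * hs b a = 1"
  by (simp add: hs_def tame_arg_swap tame_arg_unit teich_one_unit flip: power_mult_distrib teich_mult)

lemma hs_swap: "a \<noteq> 0 \<Longrightarrow> b \<noteq> 0 \<Longrightarrow> hs b a = inverse (hs a b)"
  using hs_swap_mult[of a b] by (metis inverse_unique)

lemma hs_mult_right: "a \<noteq> 0 \<Longrightarrow> b \<noteq> 0 \<Longrightarrow> b' \<noteq> 0 \<Longrightarrow> hs a (b * b') = hs a b * hs a b'"
  using hs_mult_left[of b b' a] by (simp add: hs_swap[of _ a])

lemma hs_one_unit:
  assumes "a - 1 \<in> PP 1"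
  shows "hs a b = 1"
  using tame_arg_one_unit[OF assms] by (simp add: hs_def teich_one_unit)

lemma hs_one_unit_right:
  assumes "b - 1 \<in> PP 1" "a \<noteq> 0"
  shows "hs a b = 1"
proof -
  have "b \<noteq> 0" using unit_cong[OF assms(1)] by (simp add: unit_group_def)
  then show ?thesis using hs_swap[of b a] hs_one_unit[OF assms(1)] assms(2) by simp
qed

lemma hs_one [simp]: "hs 1 b = 1"
  by (rule hs_one_unit) simp

lemma hs_one_right [simp]: "a \<noteq> 0 \<Longrightarrow> hs a 1 = 1"
  by (rule hs_one_unit_right) simp_all

lemma hs_inverse_left: "a \<noteq> 0 \<Longrightarrow> b \<noteq> 0 \<Longrightarrow> hs (inverse a) b = inverse (hs a b)"
  using hs_mult_left[of a "inverse a" b] by (metis hs_one inverse_unique inverse_nonzero_iff_nonzero right_inverse)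

lemma hs_inverse_right: "a \<noteq> 0 \<Longrightarrow> b \<noteq> 0 \<Longrightarrow> hs a (inverse b) = inverse (hs a b)"
  using hs_inverse_left[of b a] by (simp add: hs_swap[of _ a])

lemma hs_units: "v a = 0 \<Longrightarrow> v b = 0 \<Longrightarrow> hs a b = 1"
  by (simp add: hs_def tame_arg_def teich_one_unit)

lemma hs_steinberg: "a \<noteq> 0 \<Longrightarrow> 1 - a \<noteq> 0 \<Longrightarrow> hs a (1 - a) = 1"
  using tame_arg_steinberg[of a] hs_swap[of "1 - a" a]
  by (auto simp: hs_def teich_one_unit)

lemma hs_neg: "a \<noteq> 0 \<Longrightarrow> hs a (- a) = 1"
  by (simp add: hs_def tame_arg_neg teich_one_unit)

text \<open>By \<open>hs_neg\<close> and bilinearity \<open>hs a a\<close> is inverse to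
  \<open>hs a (- 1)\<close>, which has square one.\<close>

lemma hs_self:
  assumes "a \<noteq> 0"
  shows "hs a a = hs a (- 1)"
proof -
  have "hs a (- 1) * hs a a = 1"
    using hs_mult_right[of a "-1" a] hs_neg[of a] assms by simp
  also have "1 = hs a (- 1) * hs a (- 1)"
    using hs_mult_right[of a "-1" "-1"] assms by simp
  finally show ?thesis using hs_nonzero[of a "-1"] assms by simp
qed

lemma hs_minus_one_square: "a \<noteq> 0 \<Longrightarrow> hs a (- 1) * hs a (- 1) = 1"
  using hs_mult_right[of a "-1" "-1"] by simp

end


section \<open>The Kubota covering group\<close>

definition mat2 :: "'a \<Rightarrow> 'a \<Rightarrow> 'a \<Rightarrow> 'a \<Rightarrow> 'a ^ 2 ^ 2"
  where "mat2 a b c d = (\<chi> i j. if i = 1 then (if j = 1 then a else b) else (if j = 1 then c else d))"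

lemma two_neq_one: "(2 :: 2) \<noteq> 1"
proof
  assume "(2 :: 2) = 1"
  then have "(UNIV :: 2 set) = {1}" using UNIV_2 by simp
  then have "card (UNIV :: 2 set) = card {1 :: 2}" by (rule arg_cong)
  then show False by simp
qed

lemma mat2_entries [simp]:
  "mat2 a b c d $ 1 $ 1 = a" "mat2 a b c d $ 1 $ 2 = b"
  "mat2 a b c d $ 2 $ 1 = c" "mat2 a b c d $ 2 $ 2 = d"
  using two_neq_one by (simp_all add: mat2_def)

lemma mat2_expand: "g = mat2 (g $ 1 $ 1) (g $ 1 $ 2) (g $ 2 $ 1) (g $ 2 $ 2)"
  by (simp add: vec_eq_iff forall_2)

lemma mat2_eq_iff [simp]: "mat2 a b c d = mat2 a' b' c' d' \<longleftrightarrow> a = a' \<and> b = b' \<and> c = c' \<and> d = d'"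
  by (auto simp: vec_eq_iff forall_2)

lemma mat2_mult [simp]:
  fixes a :: "'a::comm_ring_1"
  shows "mat2 a b c d ** mat2 a' b' c' d' =
    mat2 (a * a' + b * c') (a * b' + b * d') (c * a' + d * c') (c * b' + d * d')"
  by (simp add: vec_eq_iff forall_2 matrix_matrix_mult_def sum_2)

lemma det_mat2 [simp]: "det (mat2 a b c d) = a * d - b * c"
  by (simp add: det_2)

lemma mat_one_mat2: "mat 1 = mat2 1 0 0 1"
  using two_neq_one by (simp add: vec_eq_iff forall_2 mat_def)

lemma kubota_X_mat2 [simp]: "kubota_X (mat2 a b c d) = (if c \<noteq> 0 then c else d)"
  by (simp add: kubota_X_def)

lemma mult_eq_one_D:
  fixes x y :: "'a::field"
  assumes "x * y = 1"
  shows "y \<noteq> 0" "x = 1 / y"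
proof -
  show y: "y \<noteq> 0" using assms by auto
  show "x = 1 / y" using assms y by (simp add: eq_divide_eq)
qed

lemma mat2_cases:
  obtains a b c d where "g = mat2 a b c d"
  using mat2_expand by blast

section \<open>The cocycle identity from bilinearity and the Steinberg relation\<close>

context tame_local_field
begin

lemma hs_div_left: "a \<noteq> 0 \<Longrightarrow> b \<noteq> 0 \<Longrightarrow> c \<noteq> 0 \<Longrightarrow> hs (a / b) c = hs a c / hs b c"
  by (simp add: divide_inverse hs_mult_left hs_inverse_left)

lemma hs_div_right: "a \<noteq> 0 \<Longrightarrow> b \<noteq> 0 \<Longrightarrow> c \<noteq> 0 \<Longrightarrow> hs a (b / c) = hs a b / hs a c"
  by (simp add: divide_inverse hs_mult_right hs_inverse_right)

text \<open>The Kubota cocycle depends on \<open>g\<close>, \<open>h\<close> and their product only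
  through \<open>kubota_X\<close>; in this form the cocycle identity concerns six nonzero
  scalars.\<close>

definition cc :: "'a \<Rightarrow> 'a \<Rightarrow> 'a \<Rightarrow> 'a"
  where "cc x y z = hs (z / x) (z / y)"

lemma cc_expand:
  assumes "x \<noteq> 0" "y \<noteq> 0" "z \<noteq> 0"
  shows "cc x y z = hs z z * hs y z * hs x y / hs x z"
  using assms hs_nonzero
  by (simp add: cc_def hs_div_left hs_div_right hs_swap[of y z] field_simps)

text \<open>In the following case distinction \<open>m\<close> stands for \<open>-1\<close>; keeping it opaque prevents the simplifier
  from normalizing signs inside symbols.\<close>

context
  fixes x1 x2 x3 x12 x23 x123 m :: 'a
  assumes nz: "x1 \<noteq> 0" "x2 \<noteq> 0" "x3 \<noteq> 0" "x12 \<noteq> 0" "x23 \<noteq> 0" "x123 \<noteq> 0" "m \<noteq> 0"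
    and m: "m = - 1"
begin

lemma hs_m: "a \<noteq> 0 \<Longrightarrow> hs m a = hs a m" "hs m m = 1"
proof -
  show "hs m m = 1" by (simp add: m hs_units)
  show "hs m a = hs a m" if "a \<noteq> 0"
    using hs_swap[of a m] inverse_unique[OF hs_minus_one_square[OF that]] that nz(7) by (simp add: m)
qed

lemma hs_m_cancel:
  assumes "a \<noteq> 0"
  shows "hs a m * hs a m = 1" "hs a m * (hs a m * y) = y"
  using hs_minus_one_square[OF assms] by (simp_all add: m flip: mult.assoc)

lemma hs_self_m: "a \<noteq> 0 \<Longrightarrow> hs a a = hs a m"
  unfolding m by (rule hs_self)

abbreviation "assoc_identity \<equiv> cc x1 x2 x12 * cc x12 x3 x123 = cc x1 x23 x123 * cc x2 x3 x23"

text \<open>Bilinear expansion, one fixed order of the variables inside each symbol, and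
  \<open>hs a a\<close> replaced by a symbol with \<open>m\<close>: products of symbols then have a
  normal form.\<close>

lemmas expand = cc_expand hs_div_left hs_div_right hs_mult_left hs_mult_right hs_m
  hs_self_m[OF nz(1)] hs_self_m[OF nz(2)]
  hs_self_m[OF nz(3)] hs_self_m[OF nz(4)] hs_self_m[OF nz(5)] hs_self_m[OF nz(6)]
  hs_swap[OF nz(1) nz(2)] hs_swap[OF nz(1) nz(3)] hs_swap[OF nz(1) nz(4)] hs_swap[OF nz(1) nz(5)]
  hs_swap[OF nz(1) nz(6)] hs_swap[OF nz(2) nz(3)] hs_swap[OF nz(2) nz(4)] hs_swap[OF nz(2) nz(5)]
  hs_swap[OF nz(2) nz(6)] hs_swap[OF nz(3) nz(4)] hs_swap[OF nz(3) nz(5)] hs_swap[OF nz(3) nz(6)]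
  hs_swap[OF nz(4) nz(5)] hs_swap[OF nz(4) nz(6)] hs_swap[OF nz(5) nz(6)]

text \<open>This lemma and the following ones up to \<open>assoc_9\<close> treat the configurations
  in which some lower-left entry vanishes. The scalars are then related by monomial equations, so
  bilinearity, antisymmetry and \<open>hs_self_m\<close> decide the identity.\<close>

lemma assoc_1:
  assumes e: "x12 = x1 * x2" "x123 = x1 * x23"
  shows assoc_identity
  unfolding e using nz
  by (simp add: expand hs_nonzero) (simp add: hs_nonzero hs_m_cancel field_simps)?

lemma assoc_2:
  assumes e: "x12 = x1 / x2" "x23 = x2 * x3" "x123 = x1 / (x2 * x3)"
  shows assoc_identity
  unfolding e using nz
  by (simp add: expand hs_nonzero) (simp add: hs_nonzero hs_m_cancel field_simps)?

lemma assoc_3: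
  assumes e: "x23 = x2 / x3" "x123 = x12 / x3"
  shows assoc_identity
  unfolding e using nz
  by (simp add: expand hs_nonzero) (simp add: hs_nonzero hs_m_cancel field_simps)?

lemma assoc_4:
  assumes e: "x1 = m * x12 * x2" "x23 = x2 / x3" "x123 = x12 * x3"
  shows assoc_identity
  unfolding e using nz
  by (simp add: expand hs_nonzero) (simp add: hs_nonzero hs_m_cancel field_simps)?

lemma assoc_5:
  assumes e: "x12 = x1 / x2" "x23 = x2 * x3"
  shows assoc_identity
  unfolding e using nz
  by (simp add: expand hs_nonzero) (simp add: hs_nonzero hs_m_cancel field_simps)?

lemma assoc_7:
  assumes e: "x12 = m * x123 * x3" "x23 = m * x1 / x123"
  shows assoc_identity
  unfolding e using nz
  by (simp add: expand hs_nonzero) (simp add: hs_nonzero hs_m_cancel field_simps)?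

lemma assoc_8:
  assumes e: "x1 = m * x12 * x2" "x123 = x12 * x3"
  shows assoc_identity
  unfolding e using nz
  by (simp add: expand hs_nonzero) (simp add: hs_nonzero hs_m_cancel field_simps)?

lemma assoc_9:
  assumes e: "x3 = m * x2 / x23" "x123 = x1 / x23"
  shows assoc_identity
  unfolding e using nz
  by (simp add: expand hs_nonzero) (simp add: hs_nonzero hs_m_cancel field_simps)?

text \<open>Dividing the additive hypothesis by \<open>x12 * x23\<close> presents 1 as a sum of two
  ratios, and the Steinberg relation for these two ratios, expanded bilinearly, is the cocycle
  identity.\<close>

lemma assoc_generic:
  assumes "x12 * x23 = x2 * x123 + x1 * x3"
  shows assoc_identity
proof -
  let ?p = "(x2 * x123) / (x12 * x23)"
  have "x1 * x3 = x12 * x23 - x2 * x123" using assms by simp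
  then have q: "1 - ?p = (x1 * x3) / (x12 * x23)"
    using nz by (simp add: diff_divide_distrib)
  have st: "hs ?p ((x1 * x3) / (x12 * x23)) = 1"
    using hs_steinberg[of ?p] nz unfolding q by simp
  \<comment> \<open>The expanded Steinberg symbol contains both \<open>hs x12 m\<close> and
    \<open>hs x23 m\<close>. Multiplication by \<open>hs x12 m\<close>, whose square is one, moves
    the former to the other side, as the goal requires.\<close>
  then have "hs x12 m * hs ?p ((x1 * x3) / (x12 * x23)) = hs x12 m" by simp
  then show ?thesis
    using nz by (simp add: expand hs_nonzero) (simp add: hs_nonzero hs_m_cancel field_simps)
qed

end

abbreviation "kd \<equiv> kubota_cocycle v n"

lemma kd_cc: "kd g h = cc (kubota_X g) (kubota_X h) (kubota_X (g ** h))"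
  by (simp add: kubota_cocycle_def cc_def)

lemma kubota_X_nonzero: "det g = 1 \<Longrightarrow> kubota_X g \<noteq> 0"
  by (rule mat2_cases[of g]) auto

lemma kd_root: "det g = 1 \<Longrightarrow> det h = 1 \<Longrightarrow> kd g h \<in> roots_of_1 n"
  unfolding kubota_cocycle_def
  by (intro hs_root) (simp_all add: kubota_X_nonzero det_mul)

text \<open>The lower-left entries satisfy the Pluecker relation
  \<open>c12 * c23 = c2 * c123 + c1 * c3\<close>, a consequence of \<open>det h = 1\<close>. If all
  six are nonzero this is the hypothesis of \<open>assoc_generic\<close>; otherwise the case
  distinction on vanishing entries yields monomial relations.\<close>

lemma kd_cocycle:
  assumes "det g = 1" "det h = 1" "det k = 1"
  shows "kd g h * kd (g ** h) k = kd g (h ** k) * kd h k"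
proof -
  obtain a1 b1 c1 d1 where g: "g = mat2 a1 b1 c1 d1" by (rule mat2_cases)
  obtain a2 b2 c2 d2 where h: "h = mat2 a2 b2 c2 d2" by (rule mat2_cases)
  obtain a3 b3 c3 d3 where k: "k = mat2 a3 b3 c3 d3" by (rule mat2_cases)
  have det: "a1 * d1 - b1 * c1 = 1" "a2 * d2 - b2 * c2 = 1" "a3 * d3 - b3 * c3 = 1"
    using assms by (simp_all add: g h k)
  define x1 x2 x3 x12 x23 x123 where X: "x1 = kubota_X g" "x2 = kubota_X h" "x3 = kubota_X k"
    "x12 = kubota_X (g ** h)" "x23 = kubota_X (h ** k)" "x123 = kubota_X (g ** h ** k)"
  have nz: "x1 \<noteq> 0" "x2 \<noteq> 0" "x3 \<noteq> 0" "x12 \<noteq> 0" "x23 \<noteq> 0" "x123 \<noteq> 0"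
    unfolding X using assms by (simp_all add: kubota_X_nonzero det_mul)
  have m: "(- 1 :: 'a) \<noteq> 0" by simp
  obtain c12 d12 c23 d23 c123 d123 A B where
    r: "c12 = c1 * a2 + d1 * c2" "d12 = c1 * b2 + d1 * d2"
       "c23 = c2 * a3 + d2 * c3" "d23 = c2 * b3 + d2 * d3"
       "A = a2 * a3 + b2 * c3" "B = a2 * b3 + b2 * d3"
    and r123: "c123 = c12 * a3 + d12 * c3" "d123 = c12 * b3 + d12 * d3" by blast
  have X': "x1 = (if c1 \<noteq> 0 then c1 else d1)" "x2 = (if c2 \<noteq> 0 then c2 else d2)"
    "x3 = (if c3 \<noteq> 0 then c3 else d3)" "x12 = (if c12 \<noteq> 0 then c12 else d12)"
    "x23 = (if c23 \<noteq> 0 then c23 else d23)" "x123 = (if c123 \<noteq> 0 then c123 else d123)"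
    unfolding X g h k r123 r by simp_all
  have r123': "c123 = c1 * A + d1 * c23" "d123 = c1 * B + d1 * d23"
    unfolding r123 r by (simp_all add: algebra_simps)
  have "c12 * c23 - c2 * c123 = c1 * c3 * (a2 * d2 - b2 * c2)"
    unfolding r123 r by (simp add: algebra_simps)
  then have pluecker: "c12 * c23 = c2 * c123 + c1 * c3"
    using det(2) by (simp add: algebra_simps)
  have "c12 * d2 - d12 * c2 = c1 * (a2 * d2 - b2 * c2)"
    unfolding r by (simp add: algebra_simps)
  then have c1_eq: "c1 = c12 * d2 - d12 * c2" using det(2) by simp
  have "a2 * c23 - c2 * A = c3 * (a2 * d2 - b2 * c2)"
    unfolding r by (simp add: algebra_simps)
  then have c3_eq: "c3 = a2 * c23 - c2 * A" using det(2) by simp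
  have "c123 * d3 - d123 * c3 = c12 * (a3 * d3 - b3 * c3)"
    unfolding r123 by (simp add: algebra_simps)
  then have c12_eq: "c12 = c123 * d3 - d123 * c3" using det(3) by simp
  have "A * d23 - B * c23 = (a2 * d2 - b2 * c2) * (a3 * d3 - b3 * c3)"
    unfolding r by (simp add: algebra_simps)
  then have det23: "A * d23 - B * c23 = 1" using det by simp
  \<comment> \<open>Here the opaque \<open>m\<close> of the preceding lemmas is instantiated with
    \<open>- 1\<close>.\<close>
  note assoc = nz m refl
  have "cc x1 x2 x12 * cc x12 x3 x123 = cc x1 x23 x123 * cc x2 x3 x23"
  proof (cases "c1 = 0")
    case c1: True
    then have "d1 \<noteq> 0" using det(1) by auto
    then have "x12 = x1 * x2" "x123 = x1 * x23"
      unfolding X' r123' r(1,2) using c1 by auto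
    then show ?thesis by (rule assoc_1[OF assoc])
  next
    case c1: False
    then have x1: "x1 = c1" by (simp add: X')
    show ?thesis
    proof (cases "c3 = 0")
      case c3: True
      then have "a3 * d3 = 1" using det by simp
      note d3 = mult_eq_one_D[OF this]
      have x3: "x3 = d3" using c3 by (simp add: X')
      show ?thesis
      proof (cases "c2 = 0")
        case c2: True
        then have "a2 * d2 = 1" using det by simp
        note d2 = mult_eq_one_D[OF this]
        have e: "c12 = c1 / d2" "c23 = 0" "d23 = d2 * d3" using c2 c3 d2 by (simp_all add: r)
        have "x12 = x1 / x2" "x23 = x2 * x3" "x123 = x1 / (x2 * x3)"
          using c1 c2 d2 d3 e c3 by (simp_all add: X' r123)
        then show ?thesis by (rule assoc_2[OF assoc])
      next
        case c2: False
        have e: "c23 = c2 / d3" using c3 d3 by (simp add: r)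
        have x23: "x23 = x2 / x3" using e c2 d3 c3 by (simp add: X')
        show ?thesis
        proof (cases "c12 = 0")
          case c12: True
          then have "x1 = - 1 * x12 * x2" using c1_eq c2 x1 by (simp add: X')
          moreover have "x123 = x12 * x3" using c12 c3 by (simp add: X' r123)
          ultimately show ?thesis using x23 by (intro assoc_4[OF assoc])
        next
          case c12: False
          then have "x123 = x12 / x3" using c3 d3 by (simp add: X' r123)
          then show ?thesis by (rule assoc_3[OF assoc x23])
        qed
      qed
    next
      case c3: False
      then have x3: "x3 = c3" by (simp add: X')
      show ?thesis
      proof (cases "c2 = 0")
        case c2: True
        then have "a2 * d2 = 1" using det by simp
        note d2 = mult_eq_one_D[OF this]
        have "c12 = c1 / d2" "c23 = d2 * c3" using c2 d2 by (simp_all add: r)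
        then have "x12 = x1 / x2" "x23 = x2 * x3"
          using c1 c2 c3 d2 by (simp_all add: X')
        then show ?thesis by (rule assoc_5[OF assoc])
      next
        case c2: False
        then have x2: "x2 = c2" by (simp add: X')
        show ?thesis
        proof (cases "c12 = 0")
          case c12: True
          then have e: "c1 = - (d12 * c2)" using c1_eq by simp
          then have d12: "d12 \<noteq> 0" using c1 by auto
          have x12: "x12 = d12" using c12 by (simp add: X')
          have "x1 = - 1 * x12 * x2" using e by (simp add: x1 x12 x2)
          moreover have "x123 = x12 * x3" using c12 c3 d12 by (simp add: X' r123)
          ultimately show ?thesis by (rule assoc_8[OF assoc])
        next
          case c12: False
          then have x12: "x12 = c12" by (simp add: X')
          show ?thesis
          proof (cases "c23 = 0")
            case c23: True
            then have x23: "x23 = d23" by (simp add: X')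
            have "A * d23 = 1" using det23 c23 by simp
            note d23 = mult_eq_one_D[OF this]
            have "c3 = - (c2 * A)" using c3_eq c23 by simp
            then have "x3 = - 1 * x2 / x23" using d23 by (simp add: x3 x2 x23)
            moreover have e123: "c123 = c1 / d23" using r123'(1) c23 d23 by simp
            have "x123 = x1 / x23" using c1 d23(1) by (simp add: X'(6) e123 x1 x23)
            ultimately show ?thesis by (intro assoc_9[OF assoc])
          next
            case c23: False
            then have x23: "x23 = c23" by (simp add: X')
            show ?thesis
            proof (cases "c123 = 0")
              case c0: True
              then have x123: "x123 = d123" by (simp add: X')
              have e12: "c12 = - (d123 * c3)" using c12_eq c0 by simp
              then have d0: "d123 \<noteq> 0" using c12 by auto
              have "c12 * c23 = c1 * c3" using pluecker c0 by simp
              then have "(- (d123 * c23)) * c3 = c1 * c3" unfolding e12 by (simp add: algebra_simps)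
              then have "- (d123 * c23) = c1" using c3 mult_right_cancel by blast
              then have "c1 = - (d123 * c23)" by simp
              then have "x23 = - 1 * x1 / x123" using d0 by (simp add: x23 x1 x123)
              moreover have "x12 = - 1 * x123 * x3" using e12 by (simp add: x12 x123 x3)
              ultimately show ?thesis by (intro assoc_7[OF assoc])
            next
              case c0: False
              then have "x123 = c123" by (simp add: X')
              then have "x12 * x23 = x2 * x123 + x1 * x3"
                using pluecker by (simp add: x12 x23 x2 x1 x3)
              then show ?thesis by (rule assoc_generic[OF assoc])
            qed
          qed
        qed
      qed
    qed
  qed
  then show ?thesis by (simp add: kd_cc X matrix_mul_assoc)
qed

lemma roots_mult: "x \<in> roots_of_1 n \<Longrightarrow> y \<in> roots_of_1 n \<Longrightarrow> x * y \<in> roots_of_1 n" for x y :: 'a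
  by (simp add: roots_of_1_def power_mult_distrib)

lemma roots_inverse: "x \<in> roots_of_1 n \<Longrightarrow> inverse x \<in> roots_of_1 n" for x :: 'a
  by (simp add: roots_of_1_def power_inverse)

lemma roots_one [simp]: "(1 :: 'a) \<in> roots_of_1 n"
  by (simp add: roots_of_1_def)

lemma roots_nonzero: "x \<in> roots_of_1 n \<Longrightarrow> x \<noteq> 0" for x :: 'a
  using n_pos by (auto simp: roots_of_1_def power_0_left)

section \<open>The covering group and its projection to matrices\<close>

abbreviation "C \<equiv> cover v n"

lemma cover_simps [simp]:
  "carrier C = {g. det g = 1} \<times> roots_of_1 n"
  "(g, a) \<otimes>\<^bsub>C\<^esub> (h, b) = (g ** h, kd g h * a * b)" "one C = (mat 1, 1)"
  by (simp_all add: cover_def)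

lemma kd_one [simp]: "det g = 1 \<Longrightarrow> kd (mat 1) g = 1" "det g = 1 \<Longrightarrow> kd g (mat 1) = 1"
  using kubota_X_nonzero[of g] by (simp_all add: kubota_cocycle_def mat_one_mat2)
    (simp_all flip: mat_one_mat2)

lemma adj_mult:
  fixes a :: "'b::comm_ring_1"
  assumes "a * d - b * c = 1"
  shows "mat2 d (- b) (- c) a ** mat2 a b c d = mat 1" "mat2 a b c d ** mat2 d (- b) (- c) a = mat 1"
  using assms by (simp_all add: mat_one_mat2 algebra_simps)

lemma group_cover: "group C"
proof (rule groupI)
  fix x y assume "x \<in> carrier C" "y \<in> carrier C"
  then show "x \<otimes>\<^bsub>C\<^esub> y \<in> carrier C"
    by (auto simp: det_mul intro!: roots_mult kd_root)
next
  fix x y z assume xyz: "x \<in> carrier C" "y \<in> carrier C" "z \<in> carrier C"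
  obtain g1 a1 g2 a2 g3 a3 where e: "x = (g1, a1)" "y = (g2, a2)" "z = (g3, a3)"
    by (metis surj_pair)
  have "kd g1 g2 * kd (g1 ** g2) g3 = kd g1 (g2 ** g3) * kd g2 g3"
    using xyz by (intro kd_cocycle) (simp_all add: e)
  then show "x \<otimes>\<^bsub>C\<^esub> y \<otimes>\<^bsub>C\<^esub> z = x \<otimes>\<^bsub>C\<^esub> (y \<otimes>\<^bsub>C\<^esub> z)"
    by (simp add: e matrix_mul_assoc) (metis mult.assoc mult.commute)
next
  fix x assume x: "x \<in> carrier C"
  obtain g a where e: "x = (g, a)" by (metis surj_pair)
  then show "\<one>\<^bsub>C\<^esub> \<otimes>\<^bsub>C\<^esub> x = x" using x by simp
  obtain p q' r s where g: "g = mat2 p q' r s" by (rule mat2_cases)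
  have d: "p * s - q' * r = 1" using x by (simp add: e g)
  let ?h = "mat2 s (- q') (- r) p"
  have dh: "det ?h = 1" "det g = 1" using d by (simp_all add: g mult.commute)
  have k: "kd ?h g \<in> roots_of_1 n" by (rule kd_root[OF dh])
  have ar: "a \<in> roots_of_1 n" using x by (simp add: e)
  let ?y = "(?h, inverse (kd ?h g * a))"
  have "?y \<in> carrier C"
    using dh roots_inverse[OF roots_mult[OF k ar]] by simp
  moreover have hg: "?h ** g = mat 1" unfolding g by (rule adj_mult(1)[OF d])
  have "kd ?h g * inverse (kd ?h g * a) * a = 1"
    using roots_nonzero[OF k] roots_nonzero[OF ar] by (simp add: field_simps)
  then have "?y \<otimes>\<^bsub>C\<^esub> x = \<one>\<^bsub>C\<^esub>"
    by (simp only: e cover_simps hg)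
  ultimately show "\<exists>y\<in>carrier C. y \<otimes>\<^bsub>C\<^esub> x = \<one>\<^bsub>C\<^esub>" by blast
qed simp

sublocale C: group C
  by (rule group_cover)

lemma fst_mult [simp]: "fst (x \<otimes>\<^bsub>C\<^esub> y) = fst x ** fst y"
  by (cases x; cases y) simp

lemma det_fst: "x \<in> carrier C \<Longrightarrow> det (fst x) = 1"
  by auto

text \<open>The matrix part of an inverse is the adjugate; the root of unity, which involves a
  cocycle value, is left implicit.\<close>

lemma fst_inv:
  assumes x: "x \<in> carrier C" and e: "fst x = mat2 p q' r s"
  shows "fst (inv\<^bsub>C\<^esub> x) = mat2 s (- q') (- r) p"
proof -
  have d: "p * s - q' * r = 1" using det_fst[OF x] e by simp
  have "fst (inv\<^bsub>C\<^esub> x \<otimes>\<^bsub>C\<^esub> x) = mat 1" by (simp only: C.l_inv[OF x]) simp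
  then have "fst (inv\<^bsub>C\<^esub> x) ** mat2 p q' r s = mat 1" by (simp add: e)
  then have "fst (inv\<^bsub>C\<^esub> x) ** (mat2 p q' r s ** mat2 s (- q') (- r) p) = mat2 s (- q') (- r) p"
    by (simp add: matrix_mul_assoc del: mat2_mult)
  then show ?thesis unfolding adj_mult(2)[OF d] by simp
qed

text \<open>The projection to matrices has the central roots of unity as its kernel; a matrix
  identity thus lifts up to such a factor.\<close>

lemma fst_eqE:
  assumes "x \<in> carrier C" "y \<in> carrier C" "fst x = fst y"
  obtains \<zeta> where "\<zeta> \<in> roots_of_1 n" "y = x \<otimes>\<^bsub>C\<^esub> (mat 1, \<zeta>)"
proof (rule that)
  let ?\<zeta> = "inverse (snd x) * snd y"
  have s: "snd x \<in> roots_of_1 n" "snd y \<in> roots_of_1 n" using assms by auto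
  show "?\<zeta> \<in> roots_of_1 n" by (intro roots_mult roots_inverse s)
  show "y = x \<otimes>\<^bsub>C\<^esub> (mat 1, ?\<zeta>)"
    using assms roots_nonzero[OF s(1)] by (cases x; cases y) (simp add: field_simps)
qed

abbreviation nu :: "'a \<Rightarrow> 'a ^ 2 ^ 2" where "nu x \<equiv> mat2 1 x 0 1"
abbreviation nl :: "'a \<Rightarrow> 'a ^ 2 ^ 2" where "nl y \<equiv> mat2 1 0 y 1"
abbreviation dg :: "'a \<Rightarrow> 'a ^ 2 ^ 2" where "dg s \<equiv> mat2 s 0 0 (inverse s)"

text \<open>Multiplication by an upper unipotent on either side does not change
  \<open>kubota_X\<close>, so one argument of the symbol is 1.\<close>

lemma kd_nu: "det g = 1 \<Longrightarrow> kd (nu x) g = 1" "det g = 1 \<Longrightarrow> kd g (nu x) = 1"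
proof -
  assume g: "det g = 1"
  obtain p q' r s where e: "g = mat2 p q' r s" by (rule mat2_cases)
  have "kubota_X (nu x ** g) = kubota_X g" by (simp add: e)
  then show "kd (nu x) g = 1" using kubota_X_nonzero[OF g] by (simp add: kubota_cocycle_def)
  have "kubota_X (g ** nu x) = kubota_X g" using g by (simp add: e)
  then show "kd g (nu x) = 1" using kubota_X_nonzero[OF g] by (simp add: kubota_cocycle_def)
qed

definition SLO :: "('a ^ 2 ^ 2) set"
  where "SLO = {g. det g = 1 \<and> (\<forall>i j. g $ i $ j \<in> PP 0)}"

lemma SLO_mat2: "mat2 p q' r s \<in> SLO \<longleftrightarrow>
    p * s - q' * r = 1 \<and> p \<in> PP 0 \<and> q' \<in> PP 0 \<and> r \<in> PP 0 \<and> s \<in> PP 0"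
  by (auto simp: SLO_def forall_2)

lemma SLO_mult: "g \<in> SLO \<Longrightarrow> h \<in> SLO \<Longrightarrow> g ** h \<in> SLO"
proof -
  assume gh: "g \<in> SLO" "h \<in> SLO"
  then have "(g ** h) $ i $ j \<in> PP 0" for i j
    by (auto simp: SLO_def matrix_matrix_mult_def intro!: pideal_sum pideal_mult_int)
  then show ?thesis using gh by (simp add: SLO_def det_mul)
qed

abbreviation "KK m \<equiv> congruence_subgroup v m"

lemma KK_mat2: "mat2 p q' r s \<in> KK m \<longleftrightarrow>
    p * s - q' * r = 1 \<and> p - 1 \<in> PP (int m) \<and> q' \<in> PP (int m) \<and> r \<in> PP (int m) \<and> s - 1 \<in> PP (int m)"
proof -
  have "x \<in> PP 0" if "x - 1 \<in> PP (int m)" for x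
    using pideal_add[OF pideal_mono[OF _ that] one_int] by simp
  moreover have "x \<in> PP 0" if "x \<in> PP (int m)" for x
    using pideal_mono[OF _ that] by simp
  ultimately show ?thesis
    unfolding congruence_subgroup_def by (auto simp: forall_2 mat_one_mat2)
qed

lemma KK_SLO: "g \<in> KK m \<Longrightarrow> g \<in> SLO"
  by (simp add: congruence_subgroup_def SLO_def)

lemma KK_mono: "i \<le> j \<Longrightarrow> g \<in> KK j \<Longrightarrow> g \<in> KK i"
  using pideal_mono[of "int i" "int j"] by (simp add: congruence_subgroup_def)

lemma KK_det: "g \<in> KK m \<Longrightarrow> det g = 1"
  by (simp add: congruence_subgroup_def)

text \<open>The adjugate is the inverse of \<open>g\<close>, and its product with \<open>h\<close>
  minus the identity is its product with \<open>h - g\<close>, whose entries lie in the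
  ideal.\<close>

lemma SLO_cong:
  assumes "g \<in> SLO" "h \<in> SLO" "\<And>i j. g $ i $ j - h $ i $ j \<in> PP (int m)"
    and "g = mat2 p q' r s"
  shows "mat2 s (- q') (- r) p ** h \<in> KK m"
proof -
  obtain p' q2 r' s' where h: "h = mat2 p' q2 r' s'" by (rule mat2_cases)
  have O: "p \<in> PP 0" "q' \<in> PP 0" "r \<in> PP 0" "s \<in> PP 0" and d: "p * s - q' * r = 1" "p' * s' - q2 * r' = 1"
    using assms(1,2) by (simp_all add: SLO_mat2 assms(4) h)
  have c: "p' - p \<in> PP (int m)" "q2 - q' \<in> PP (int m)" "r' - r \<in> PP (int m)" "s' - s \<in> PP (int m)"
    using assms(3)[of 1 1] assms(3)[of 1 2] assms(3)[of 2 1] assms(3)[of 2 2]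
    by (simp_all add: assms(4) h pideal_diff_commute[of p] pideal_diff_commute[of q']
      pideal_diff_commute[of r] pideal_diff_commute[of s])
  have "s * (p' - p) - q' * (r' - r) \<in> PP (int m)" "s * (q2 - q') - q' * (s' - s) \<in> PP (int m)"
    "p * (r' - r) - r * (p' - p) \<in> PP (int m)" "p * (s' - s) - r * (q2 - q') \<in> PP (int m)"
    by (intro pideal_diff pideal_mult_int(1) O c)+
  moreover have "s * (p' - p) - q' * (r' - r) = s * p' + - q' * r' - 1"
    "p * (s' - s) - r * (q2 - q') = - r * q2 + p * s' - 1"
    "s * (q2 - q') - q' * (s' - s) = s * q2 + - q' * s'" "p * (r' - r) - r * (p' - p) = - r * p' + p * r'"
    using d by (simp_all add: algebra_simps)
  moreover have "det (mat2 s (- q') (- r) p ** h) = 1"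
    using d assms by (simp add: det_mul h mult.commute del: mat2_mult)
  ultimately show ?thesis by (simp add: h KK_mat2)
qed

text \<open>Conjugating \<open>x\<close> minus the identity instead of \<open>x\<close> keeps every
  entry in the ideal.\<close>

lemma KK_conj:
  assumes "g = mat2 p q' r s" "g \<in> SLO" "x \<in> KK m"
  shows "g ** x ** mat2 s (- q') (- r) p \<in> KK m"
proof -
  obtain a b c d where x: "x = mat2 a b c d" by (rule mat2_cases)
  have O: "p \<in> PP 0" "q' \<in> PP 0" "r \<in> PP 0" "s \<in> PP 0" and dt: "p * s - q' * r = 1" "a * d - b * c = 1"
    using assms by (simp_all add: SLO_mat2 KK_mat2 x)
  have c: "a - 1 \<in> PP (int m)" "b \<in> PP (int m)" "c \<in> PP (int m)" "d - 1 \<in> PP (int m)"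
    using assms by (simp_all add: KK_mat2 x)
  have M: "p * (a - 1) + q' * c \<in> PP (int m)" "p * b + q' * (d - 1) \<in> PP (int m)"
    "r * (a - 1) + s * c \<in> PP (int m)" "r * b + s * (d - 1) \<in> PP (int m)"
    by (intro pideal_add pideal_mult_int(1) O c)+
  have "(p * (a - 1) + q' * c) * s - (p * b + q' * (d - 1)) * r \<in> PP (int m)"
    "(p * b + q' * (d - 1)) * p - (p * (a - 1) + q' * c) * q' \<in> PP (int m)"
    "(r * (a - 1) + s * c) * s - (r * b + s * (d - 1)) * r \<in> PP (int m)"
    "(r * b + s * (d - 1)) * p - (r * (a - 1) + s * c) * q' \<in> PP (int m)"
    by (intro pideal_diff pideal_mult_int(2) O M)+
  moreover have "(p * (a - 1) + q' * c) * s - (p * b + q' * (d - 1)) * r =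
      (p * a + q' * c) * s + (p * b + q' * d) * - r - (p * s - q' * r)"
    "(r * b + s * (d - 1)) * p - (r * (a - 1) + s * c) * q' =
      (r * a + s * c) * - q' + (r * b + s * d) * p - (p * s - q' * r)"
    "(p * b + q' * (d - 1)) * p - (p * (a - 1) + q' * c) * q' = (p * a + q' * c) * - q' + (p * b + q' * d) * p"
    "(r * (a - 1) + s * c) * s - (r * b + s * (d - 1)) * r = (r * a + s * c) * s + (r * b + s * d) * - r"
    by (simp_all add: algebra_simps)
  moreover have "det (g ** x ** mat2 s (- q') (- r) p) = 1"
    using dt by (simp add: det_mul x assms(1) mult.commute del: mat2_mult)
  ultimately show ?thesis
    using dt(1) by (simp add: x assms(1) KK_mat2)
qed

text \<open>Apply \<open>SLO_cong\<close> to the inverse of \<open>g\<close> and to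
  \<open>h\<close>, both of which are congruent to the identity.\<close>

lemma KK_mult:
  assumes "g \<in> KK m" "h \<in> KK m"
  shows "g ** h \<in> KK m"
proof -
  obtain p q' r s where g: "g = mat2 p q' r s" by (rule mat2_cases)
  obtain a b c d where h: "h = mat2 a b c d" by (rule mat2_cases)
  have dg: "p * s - q' * r = 1" using assms(1) by (simp add: g KK_mat2)
  let ?k = "mat2 s (- q') (- r) p"
  have k: "?k \<in> SLO" using KK_SLO[OF assms(1)] dg by (simp add: g SLO_mat2 mult.commute)
  have "mat2 p (- (- q')) (- (- r)) s ** h \<in> KK m"
  proof (rule SLO_cong[OF k KK_SLO[OF assms(2)] _ refl])
    have "s - a \<in> PP (int m)" "- q' - b \<in> PP (int m)" "- r - c \<in> PP (int m)" "p - d \<in> PP (int m)"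
      using assms pideal_diff[of "s - 1" "int m" "a - 1"] pideal_diff[of "p - 1" "int m" "d - 1"]
        pideal_add[of q' "int m" b] pideal_add[of r "int m" c] pideal_uminus[of "q' + b" "int m"]
        pideal_uminus[of "r + c" "int m"]
      by (simp_all add: g h KK_mat2)
    then have "\<forall>i j. ?k $ i $ j - h $ i $ j \<in> PP (int m)" by (simp add: h forall_2)
    then show "?k $ i $ j - h $ i $ j \<in> PP (int m)" for i j by blast
  qed
  then show ?thesis by (simp add: g)
qed

text \<open>Multiplying by \<open>x\<close> changes the unit lower-left entry \<open>r\<close> only
  modulo the maximal ideal. One argument of the symbol is therefore a one-unit.\<close>

lemma kd_unit_entry:
  assumes g: "g = mat2 p q' r s" "g \<in> SLO" "r \<in> unit_group v" and x: "x \<in> KK 1"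
  shows "kd g x = 1" "kd x g = 1"
proof -
  obtain a b c d where e: "x = mat2 a b c d" by (rule mat2_cases)
  have O: "p \<in> PP 0" "q' \<in> PP 0" "r \<in> PP 0" "s \<in> PP 0" using g by (simp_all add: SLO_mat2)
  have xs: "a - 1 \<in> PP 1" "b \<in> PP 1" "c \<in> PP 1" "d - 1 \<in> PP 1" "det x = 1"
    using x by (simp_all add: KK_mat2 e)
  have r0: "r \<noteq> 0" using g(3) by (rule unit_nonzero)
  have Xx: "kubota_X x \<noteq> 0" "kubota_X g = r"
    using kubota_X_nonzero[OF xs(5)] r0 by (simp_all add: g)
  have ratio: "y \<noteq> 0 \<and> y / r - 1 \<in> PP 1" if "y - r \<in> PP 1" for y
  proof
    show "y \<noteq> 0" using unit_nonzero unit_cong[OF that g(3)] by blast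
    have "(y - r) * inverse r \<in> PP 1"
      by (intro pideal_mult_int(2) that unit_int unit_inverse g(3))
    then show "y / r - 1 \<in> PP 1" using r0 by (simp add: field_simps)
  qed
  have "r * (a - 1) + s * c \<in> PP 1" by (intro pideal_add pideal_mult_int(1) O xs)
  then have "(r * a + s * c) - r \<in> PP 1" by (simp add: algebra_simps)
  from ratio[OF this] show "kd g x = 1"
    using hs_one_unit by (simp add: kubota_cocycle_def g e r0)
  have "c * p + (d - 1) * r \<in> PP 1" by (intro pideal_add pideal_mult_int(2) O xs)
  then have "(c * p + d * r) - r \<in> PP 1" by (simp add: algebra_simps)
  from ratio[OF this] have 2: "kubota_X (x ** g) \<noteq> 0" "kubota_X (x ** g) / r - 1 \<in> PP 1"
    by (simp_all add: g e)
  then show "kd x g = 1"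
    unfolding kubota_cocycle_def using Xx by (intro hs_one_unit_right) simp_all
qed

lemma SLO_w: "mat2 0 1 (- 1) 0 \<in> SLO" "mat2 0 (- 1) 1 0 \<in> SLO"
  by (simp_all add: SLO_mat2)

lemma minus_one_unit: "- 1 \<in> unit_group v"
  by (simp add: unit_group_def)

text \<open>Near the identity the lower-left entry is small and \<open>kd_unit_entry\<close> does
  not apply directly. After left multiplication by a Weyl element it becomes a unit, and the cocycle
  identity transports the triviality back.\<close>

lemma kd_KK:
  assumes "x \<in> KK 1" "y \<in> KK 1"
  shows "kd x y = 1"
proof -
  let ?w = "mat2 0 1 (- 1) 0 :: 'a ^ 2 ^ 2"
  obtain a b c d where e: "x = mat2 a b c d" by (rule mat2_cases)
  have xs: "a - 1 \<in> PP 1" "det x = 1" "det y = 1"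
    using assms(1)[unfolded e KK_mat2] KK_det[OF assms(1)] KK_det[OF assms(2)] by simp_all
  have au: "- a \<in> unit_group v"
    using unit_cong[OF xs(1) unit_one] by (simp add: unit_group_def)
  have wx: "?w ** x \<in> SLO" by (rule SLO_mult[OF SLO_w(1) KK_SLO[OF assms(1)]])
  have "kd ?w x = 1" "kd ?w (x ** y) = 1"
    using assms by (intro kd_unit_entry(1)[OF refl SLO_w(1) minus_one_unit] KK_mult; simp)+
  moreover have "kd (?w ** x) y = 1"
    using kd_unit_entry(1)[of "?w ** x" "c" d "- a" "- b" y] wx au assms by (simp add: e)
  moreover have "kd ?w x * kd (?w ** x) y = kd ?w (x ** y) * kd x y"
    by (rule kd_cocycle) (simp_all add: xs)
  ultimately show ?thesis by simp
qed

text \<open>The lower-right entry is a one-unit, so its symbol with \<open>c\<close> is trivial.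
  Consequently the lifted congruence subgroups are products with the trivial group, as
  \<open>lifted_eq\<close> records.\<close>

lemma theta_one:
  assumes "g \<in> KK m" "1 \<le> m"
  shows "kubota_theta v n g = 1"
proof -
  obtain a b c d where e: "g = mat2 a b c d" by (rule mat2_cases)
  have "g \<in> KK 1" using KK_mono[OF assms(2,1)] .
  then have c: "c \<in> PP 1" "d - 1 \<in> PP 1" by (simp_all add: KK_mat2 e)
  then show ?thesis
    using hs_one_unit_right[OF c(2), of c] by (simp add: kubota_theta_def e)
qed

lemma lifted_eq: "1 \<le> m \<Longrightarrow> lifted_subgroup v n m = KK m \<times> {1}"
  using theta_one by (force simp: lifted_subgroup_def)

section \<open>Cartan decomposition and finiteness for integral matrices\<close>

lemma nu_dg_nl: "d \<noteq> 0 \<Longrightarrow> a * d - b * c = 1 \<Longrightarrow> mat2 a b c d = nu (b / d) ** dg (inverse d) ** nl (c / d)"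
  by (simp add: field_simps)

text \<open>The determinant lies in the square of the ideal generated by the minimal entry
  \<open>d\<close>, so \<open>v d\<close> is not positive and supplies the exponent
  \<open>- v d\<close>. The quotients by \<open>d\<close> are integral, which makes the unipotent
  factors integral.\<close>

lemma cartan_lower_right:
  assumes t: "t \<noteq> 0" "v t = 1" and det: "a * d - b * c = 1" and d: "d \<noteq> 0"
    and min: "a \<in> PP (v d)" "b \<in> PP (v d)" "c \<in> PP (v d)"
  shows "\<exists>k1\<in>SLO. \<exists>k2\<in>SLO. \<exists>l::nat. mat2 a b c d = k1 ** dg (t ^ l) ** k2"
proof -
  have "a * d - b * c \<in> PP (v d + v d)"
    by (intro pideal_diff pideal_mult min) (simp add: pideal_def)
  then have vd: "v d \<le> 0" using det by (simp add: pideal_def)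
  define l where "l = nat (- v d)"
  define s where "s = inverse d * inverse (t ^ l)"
  have s: "s \<noteq> 0" "v s = 0"
    using d t vd by (simp_all add: s_def l_def val_mult val_inverse val_power)
  then have su: "s \<in> unit_group v" by (simp add: unit_group_def)
  have q: "x / d \<in> PP 0" if "x \<in> PP (v d)" for x
    using that d by (cases "x = 0") (simp_all add: pideal_def val_divide)
  have e: "inverse d = t ^ l * s" using t by (simp add: s_def)
  have "dg (inverse d) = dg (t ^ l) ** dg s"
    using d t s by (simp add: e)
  then have "mat2 a b c d = nu (b / d) ** dg (t ^ l) ** (dg s ** nl (c / d))"
    using nu_dg_nl[OF d det] by (simp only: matrix_mul_assoc)
  moreover have "nu (b / d) \<in> SLO" "dg s ** nl (c / d) \<in> SLO"
    using q min s unit_int[OF su] unit_int[OF unit_inverse[OF su]]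
    by (simp_all add: SLO_mat2 SLO_mult)  (simp add: SLO_mat2 SLO_mult pideal_mult_int)
  ultimately show ?thesis by blast
qed

lemma min_entry:
  assumes "finite S" "x \<in> S" "x \<noteq> (0::'a)"
  shows "\<exists>e\<in>S. e \<noteq> 0 \<and> (\<forall>y\<in>S. y \<in> PP (v e))"
proof -
  let ?S = "S - {0}"
  have f: "finite (v ` ?S)" "v ` ?S \<noteq> {}" using assms by auto
  obtain e where e: "e \<in> ?S" "Min (v ` ?S) = v e" using Min_in[OF f] by (rule imageE)
  have "y \<in> PP (v e)" if "y \<in> S" for y
    using Min_le[OF f(1), of "v y"] that e(2) by (auto simp: pideal_def)
  then show ?thesis using e(1) by blast
qed

text \<open>Weyl elements on either side move an entry of least valuation to the lower right
  corner.\<close>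

lemma cartan_matrix:
  assumes t: "t \<noteq> 0" "v t = 1" and g: "det g = 1"
  shows "\<exists>k1\<in>SLO. \<exists>k2\<in>SLO. \<exists>l::nat. g = k1 ** dg (t ^ l) ** k2"
proof -
  obtain a b c d where e: "g = mat2 a b c d" by (rule mat2_cases)
  have det: "a * d - b * c = 1" using g by (simp add: e)
  let ?w = "mat2 0 1 (- 1) 0 :: 'a ^ 2 ^ 2"
  let ?w' = "mat2 0 (- 1) 1 0 :: 'a ^ 2 ^ 2"
  have "\<exists>x\<in>{a, b, c, d}. x \<noteq> 0"
    using det by (metis diff_self insertCI mult_zero_left zero_neq_one)
  then obtain x where x: "x \<in> {a, b, c, d}" "x \<noteq> 0" "\<forall>y\<in>{a, b, c, d}. y \<in> PP (v x)"
    using min_entry[of "{a, b, c, d}"] by blast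
  then consider "x = d" | "x = b" | "x = c" | "x = a" by blast
  then show ?thesis
  proof cases
    case 1
    then show ?thesis unfolding e using x by (intro cartan_lower_right[OF t det]) auto
  next
    case 2
    have "\<exists>k1\<in>SLO. \<exists>k2\<in>SLO. \<exists>l::nat. mat2 (- c) (- d) a b = k1 ** dg (t ^ l) ** k2"
      using x 2 det by (intro cartan_lower_right[OF t]) (auto simp: algebra_simps)
    then obtain k1 k2 l where k: "k1 \<in> SLO" "k2 \<in> SLO" "mat2 (- c) (- d) a b = k1 ** dg (t ^ l) ** k2"
      by blast
    have "g = ?w ** (k1 ** dg (t ^ l) ** k2)" unfolding k(3)[symmetric] e by simp
    then have "g = (?w ** k1) ** dg (t ^ l) ** k2" by (simp only: matrix_mul_assoc)
    then show ?thesis using SLO_mult[OF SLO_w(1) k(1)] k(2) by blast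
  next
    case 3
    have "\<exists>k1\<in>SLO. \<exists>k2\<in>SLO. \<exists>l::nat. mat2 b (- a) d (- c) = k1 ** dg (t ^ l) ** k2"
      using x 3 det by (intro cartan_lower_right[OF t]) (auto simp: algebra_simps)
    then obtain k1 k2 l where k: "k1 \<in> SLO" "k2 \<in> SLO" "mat2 b (- a) d (- c) = k1 ** dg (t ^ l) ** k2"
      by blast
    have "g = (k1 ** dg (t ^ l) ** k2) ** ?w" unfolding k(3)[symmetric] e by simp
    then have "g = k1 ** dg (t ^ l) ** (k2 ** ?w)" by (simp only: matrix_mul_assoc)
    then show ?thesis using SLO_mult[OF k(2) SLO_w(1)] k(1) by blast
  next
    case 4
    have "\<exists>k1\<in>SLO. \<exists>k2\<in>SLO. \<exists>l::nat. mat2 d (- c) (- b) a = k1 ** dg (t ^ l) ** k2"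
      using x 4 det by (intro cartan_lower_right[OF t]) (auto simp: algebra_simps)
    then obtain k1 k2 l where k: "k1 \<in> SLO" "k2 \<in> SLO" "mat2 d (- c) (- b) a = k1 ** dg (t ^ l) ** k2"
      by blast
    have "g = ?w' ** (k1 ** dg (t ^ l) ** k2) ** ?w" unfolding k(3)[symmetric] e by simp
    then have "g = (?w' ** k1) ** dg (t ^ l) ** (k2 ** ?w)" by (simp only: matrix_mul_assoc)
    then show ?thesis using SLO_mult[OF k(2) SLO_w(1)] SLO_mult[OF SLO_w(2) k(1)] by blast
  qed
qed

lemma SLO_entries_left:
  "k \<in> SLO \<Longrightarrow> (\<And>i j. g $ i $ j \<in> PP l) \<Longrightarrow> (k ** g) $ i $ j \<in> PP l"
  unfolding matrix_matrix_mult_def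
  by (auto intro!: pideal_sum pideal_mult_int(1) simp: SLO_def)

lemma SLO_entries_right:
  "k \<in> SLO \<Longrightarrow> (\<And>i j. g $ i $ j \<in> PP l) \<Longrightarrow> (g ** k) $ i $ j \<in> PP l"
  unfolding matrix_matrix_mult_def
  by (auto intro!: pideal_sum pideal_mult_int(2) simp: SLO_def)

lemma SLO_entries:
  assumes "k1 \<in> SLO" "k2 \<in> SLO" "\<And>i j. g $ i $ j \<in> PP l"
  shows "(k1 ** g ** k2) $ i $ j \<in> PP l"
  by (rule SLO_entries_right[OF assms(2) SLO_entries_left[OF assms(1,3)]])

text \<open>Digit expansion: a representative modulo one power is refined by adding a representative
  of a residue class times \<open>t ^ j\<close>.\<close>

lemma finite_quotient: "\<exists>F. finite F \<and> (\<forall>x\<in>PP 0. \<exists>f\<in>F. x - f \<in> PP (int j))"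
proof (induction j)
  case 0
  show ?case by (intro exI[of _ "{0}"]) simp
next
  case (Suc j)
  then obtain F where F: "finite F" "\<And>x. x \<in> PP 0 \<Longrightarrow> \<exists>f\<in>F. x - f \<in> PP (int j)" by blast
  obtain t where t: "t \<noteq> 0" "v t = 1" using uniformizer by blast
  let ?F = "(\<lambda>(f, C). f + res_rep C * t ^ j) ` (F \<times> residue_classes v)"
  have cover: "\<exists>f\<in>?F. x - f \<in> PP (int (Suc j))" if x: "x \<in> PP 0" for x
  proof -
    obtain f where f: "f \<in> F" "x - f \<in> PP (int j)" using F(2)[OF x] by blast
    define y where "y = (x - f) / t ^ j"
    have xf: "x - f = y * t ^ j" using t by (simp add: y_def)
    have y: "y \<in> PP 0"
      using f(2) t unfolding y_def
      by (cases "x - f = 0") (simp_all add: pideal_def val_divide val_power)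
    have "y - res_rep (res y) \<in> PP 1"
      using res_rep_cong[OF y] by (subst pideal_diff_commute)
    moreover have "t ^ j \<in> PP (int j)" using t by (simp add: pideal_def val_power)
    ultimately have "(y - res_rep (res y)) * t ^ j \<in> PP (1 + int j)"
      by (rule pideal_mult)
    also have "(y - res_rep (res y)) * t ^ j = x - (f + res_rep (res y) * t ^ j)"
      using xf by (simp add: left_diff_distrib algebra_simps)
    finally have "x - (f + res_rep (res y) * t ^ j) \<in> PP (int (Suc j))" by simp
    moreover have "f + res_rep (res y) * t ^ j \<in> ?F"
      using f(1) res_in[OF y] by (intro image_eqI[of _ _ "(f, res y)"]) simp_all
    ultimately show ?thesis by (rule bexI)
  qed
  show ?case
  proof (intro exI conjI ballI)
    show "finite ?F" using F(1) finite_residue by simp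
    show "\<exists>f\<in>?F. x - f \<in> PP (int (Suc j))" if "x \<in> PP 0" for x
      using that by (rule cover)
  qed
qed

text \<open>Rounding all four entries modulo a power of the ideal has finite image. Representatives
  are taken from \<open>S\<close> itself as preimages, because the rounded matrices need not lie in
  \<open>S\<close>.\<close>

lemma finite_representatives:
  assumes S: "S \<subseteq> SLO"
  shows "\<exists>E. finite E \<and> E \<subseteq> S \<and> (\<forall>g\<in>S. \<exists>e\<in>E. \<forall>i k. e $ i $ k - g $ i $ k \<in> PP (int j))"
proof -
  obtain F where F: "finite F" "\<forall>x\<in>PP 0. \<exists>f\<in>F. x - f \<in> PP (int j)"
    using finite_quotient[of j] by (elim exE conjE) (rule that)
  obtain r where r: "\<forall>x\<in>PP 0. r x \<in> F \<and> x - r x \<in> PP (int j)"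
    using bchoice[OF F(2)[unfolded Bex_def]] by (elim exE) (rule that)
  define \<phi> where "\<phi> g = (r (g $ 1 $ 1), r (g $ 1 $ 2), r (g $ 2 $ 1), r (g $ 2 $ 2))" for g :: "'a ^ 2 ^ 2"
  have ent: "g $ i $ k \<in> PP 0" if "g \<in> S" for g i k
    using subsetD[OF S that] by (simp add: SLO_def)
  have rF: "r (g $ i $ k) \<in> F" if "g \<in> S" for g i k
    using r ent[OF that] by simp
  have "\<phi> ` S \<subseteq> F \<times> F \<times> F \<times> F"
  proof (rule image_subsetI)
    show "\<phi> g \<in> F \<times> F \<times> F \<times> F" if "g \<in> S" for g
      unfolding \<phi>_def by (intro SigmaI rF that)
  qed
  then have fin: "finite (\<phi> ` S)" by (rule finite_subset) (intro finite_SigmaI F(1))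
  let ?E = "inv_into S \<phi> ` \<phi> ` S"
  have c: "e $ i $ k - g $ i $ k \<in> PP (int j)"
    if "e \<in> S" "g \<in> S" "r (e $ i $ k) = r (g $ i $ k)" for e g :: "'a ^ 2 ^ 2" and i k
  proof -
    have "(e $ i $ k - r (e $ i $ k)) - (g $ i $ k - r (g $ i $ k)) \<in> PP (int j)"
      by (rule pideal_diff) (simp_all add: r ent that(1,2))
    then show ?thesis using that(3) by simp
  qed
  have ex: "\<exists>e\<in>?E. \<forall>i k. e $ i $ k - g $ i $ k \<in> PP (int j)" if g: "g \<in> S" for g
  proof -
    obtain e where e: "e \<in> ?E" "e \<in> S" "\<phi> e = \<phi> g"
    proof (rule that)
      show "inv_into S \<phi> (\<phi> g) \<in> ?E" "inv_into S \<phi> (\<phi> g) \<in> S"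
        "\<phi> (inv_into S \<phi> (\<phi> g)) = \<phi> g"
        by (intro inv_into_into f_inv_into_f imageI g)+
    qed
    have "\<forall>i k. r (e $ i $ k) = r (g $ i $ k)"
      using e(3) unfolding \<phi>_def prod.inject forall_2 by (elim conjE) (intro conjI)
    then have "\<forall>i k. e $ i $ k - g $ i $ k \<in> PP (int j)"
      using c[OF e(2) g] by simp
    then show ?thesis using e(1) by (rule bexI)
  qed
  moreover have "?E \<subseteq> S"
    by (intro image_subsetI) (rule inv_into_into)
  ultimately show ?thesis using finite_imageI[OF fin] ex by (intro exI conjI ballI)
qed

text \<open>For general units the symbol with \<open>t\<close> may be nontrivial; the diagonal
  factors of \<open>Us_decomp\<close> are one-units, so they fall under this case.\<close>

lemma kd_diag_one_unit:
  assumes "s - 1 \<in> PP 1" "t \<noteq> 0"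
  shows "kd (dg s) (dg t) = 1" "kd (dg t) (dg s) = 1"
proof -
  have s: "s \<in> unit_group v" by (rule unit_cong[OF assms(1) unit_one])
  have s0: "s \<noteq> 0" by (rule unit_nonzero[OF s])
  have i: "inverse s - 1 \<in> PP 1"
    using one_unit_power_int[OF assms(1), of "-1"] by (simp add: power_int_minus)
  show "kd (dg s) (dg t) = 1"
    using s0 assms(2) hs_one_unit_right[OF i, of "inverse t"] by (simp add: kubota_cocycle_def)
  show "kd (dg t) (dg s) = 1"
    using s0 assms(2) hs_one_unit[OF i] by (simp add: kubota_cocycle_def)
qed

text \<open>Both cocycle values equal \<open>hs t y\<close>, since the square of
  \<open>hs t t\<close> is one. This is what makes lower unipotents cross the lifted diagonal
  element without a root of unity.\<close>

lemma kd_nl_diag: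
  assumes "t \<noteq> 0"
  shows "kd (nl y) (dg t) = kd (dg t) (nl (t * t * y))"
proof (cases "y = 0")
  case True
  then show ?thesis using kd_one[of "dg t"] assms by (simp flip: mat_one_mat2)
next
  case False
  have "kd (nl y) (dg t) = hs t (y * t * t)"
    using assms False by (simp add: kubota_cocycle_def) (simp add: divide_inverse)
  also have "\<dots> = hs t y"
    using assms False hs_minus_one_square[OF assms]
    by (simp add: hs_mult_right hs_self[OF assms] mult.assoc)
  also have "\<dots> = hs (t * t * y) (inverse t)"
    using assms False hs_minus_one_square[OF assms]
    by (simp add: hs_mult_left hs_inverse_right hs_self[OF assms] hs_swap[of t y])
  also have "\<dots> = kd (dg t) (nl (t * t * y))"
    using assms False by (simp add: kubota_cocycle_def field_simps)
  finally show ?thesis .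
qed

end


section \<open>The subgroups of the cover that form the Cartan pair\<close>

locale kubota_pair = tame_local_field v n for v :: "'a::field \<Rightarrow> int" and n :: nat +
  fixes m :: nat and t :: 'a
  assumes m_pos: "1 \<le> m" and t: "t \<noteq> 0" "v t = 1"
begin

definition Zs :: "(('a ^ 2 ^ 2) \<times> 'a) set" where "Zs = {mat 1} \<times> roots_of_1 n"
definition Us :: "(('a ^ 2 ^ 2) \<times> 'a) set" where "Us = KK m \<times> {1}"
definition Ks :: "(('a ^ 2 ^ 2) \<times> 'a) set" where "Ks = {x \<in> carrier C. fst x \<in> SLO}"
definition Ns :: "(('a ^ 2 ^ 2) \<times> 'a) set" where "Ns = {(nu x, 1) | x. x \<in> PP 0}"
text \<open>All lifts are included, since conjugation by \<open>aa\<close> may change the root of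
  unity above a diagonal unit.\<close>

definition Ts :: "(('a ^ 2 ^ 2) \<times> 'a) set"
  where "Ts = {x \<in> carrier C. \<exists>s\<in>unit_group v. fst x = dg s}"
definition N's :: "(('a ^ 2 ^ 2) \<times> 'a) set" where "N's = {(nl y, 1) | y. y \<in> PP 0}"
definition aa :: "('a ^ 2 ^ 2) \<times> 'a" where "aa = (dg t, 1)"

abbreviation cmult (infixl \<open>\<odot>\<close> 70) where "x \<odot> y \<equiv> x \<otimes>\<^bsub>C\<^esub> y"

lemma Us_carrier: "x \<in> Us \<Longrightarrow> x \<in> carrier C"
  by (auto simp: Us_def KK_det)

lemma KK_one: "g \<in> KK m \<Longrightarrow> g \<in> KK 1"
  by (rule KK_mono[OF m_pos])

lemma Us_mult: "x \<in> Us \<Longrightarrow> y \<in> Us \<Longrightarrow> x \<odot> y \<in> Us"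
  using kd_KK KK_one by (auto simp: Us_def KK_mult simp del: cover_simps(1))

lemma Us_eqI: "x \<in> Us \<Longrightarrow> y \<in> Us \<Longrightarrow> fst x = fst y \<Longrightarrow> x = y"
  by (auto simp: Us_def)

lemma Us_inv:
  assumes "x \<in> Us"
  shows "inv\<^bsub>C\<^esub> x \<in> Us"
proof -
  obtain g where x: "x = (g, 1)" "g \<in> KK m" using assms by (auto simp: Us_def)
  obtain p q' r s where g: "g = mat2 p q' r s" by (rule mat2_cases)
  let ?h = "mat2 s (- q') (- r) p"
  have d: "p * s - q' * r = 1" using x by (simp add: g KK_mat2)
  have h: "?h \<in> KK m" using x(2) d by (simp add: g KK_mat2 mult.commute)
  have "kd ?h g = 1" by (rule kd_KK[OF KK_one[OF h] KK_one[OF x(2)]])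
  then have "(?h, 1) \<odot> x = \<one>\<^bsub>C\<^esub>"
    using adj_mult(1)[OF d] by (simp only: x g cover_simps mult_1)
  then have "inv\<^bsub>C\<^esub> x = (?h, 1)"
    using Us_carrier[OF assms] h by (intro C.inv_equality) (simp_all add: KK_det del: det_mat2)
  then show ?thesis using h by (simp add: Us_def)
qed

lemma Us_subgroup: "subgroup Us C"
proof (rule C.subgroupI)
  show "Us \<subseteq> carrier C" using Us_carrier by blast
  have "(mat 1, 1) \<in> Us" by (simp add: Us_def mat_one_mat2 KK_mat2)
  then show "Us \<noteq> {}" by blast
qed (use Us_inv Us_mult in blast)+

lemma Zs_subgroup: "subgroup Zs C"
proof (rule C.subgroupI)
  show "Zs \<subseteq> carrier C" by (auto simp: Zs_def)
  have "(mat 1, 1) \<in> Zs" by (simp add: Zs_def)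
  then show "Zs \<noteq> {}" by blast
  fix x assume x: "x \<in> Zs"
  then obtain \<zeta> where z: "x = (mat 1, \<zeta>)" "\<zeta> \<in> roots_of_1 n" by (auto simp: Zs_def)
  have "inv\<^bsub>C\<^esub> x = (mat 1, inverse \<zeta>)"
    using z roots_nonzero[OF z(2)] roots_inverse[OF z(2)] by (intro C.inv_equality) simp_all
  then show "inv\<^bsub>C\<^esub> x \<in> Zs" using roots_inverse[OF z(2)] by (simp add: Zs_def)
  fix y assume "y \<in> Zs"
  then show "x \<odot> y \<in> Zs" using x by (auto simp: Zs_def roots_mult)
qed

lemma Zs_central: "z \<in> Zs \<Longrightarrow> x \<in> carrier C \<Longrightarrow> x \<odot> z = z \<odot> x"
  by (auto simp: Zs_def)

lemma Ks_subgroup: "subgroup Ks C"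
proof (rule C.subgroupI)
  show "Ks \<subseteq> carrier C" by (auto simp: Ks_def)
  have "(mat 1, 1) \<in> Ks" by (simp add: Ks_def mat_one_mat2 SLO_mat2)
  then show "Ks \<noteq> {}" by blast
  fix x assume x: "x \<in> Ks"
  obtain p q' r s where g: "fst x = mat2 p q' r s" by (rule mat2_cases)
  have "fst (inv\<^bsub>C\<^esub> x) = mat2 s (- q') (- r) p"
    using x by (intro fst_inv[OF _ g]) (simp add: Ks_def)
  moreover have "mat2 s (- q') (- r) p \<in> SLO" using x g by (simp add: Ks_def SLO_mat2 mult.commute)
  moreover have "inv\<^bsub>C\<^esub> x \<in> carrier C" using x by (intro C.inv_closed) (simp add: Ks_def)
  ultimately show "inv\<^bsub>C\<^esub> x \<in> Ks" unfolding Ks_def by simp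
  fix y assume y: "y \<in> Ks"
  have "x \<odot> y \<in> carrier C" using x y by (intro C.m_closed) (simp_all add: Ks_def)
  then show "x \<odot> y \<in> Ks" using x y SLO_mult unfolding Ks_def by simp
qed

text \<open>For a unit lower-left entry the cocycle is trivial against congruence elements on both
  sides, so conjugation in the cover is matrix conjugation with second component 1.\<close>

lemma conj_unit_entry:
  assumes k: "k \<in> Ks" "fst k = mat2 p q' r s" "r \<in> unit_group v" and u: "u \<in> Us"
  shows "k \<odot> u \<odot> inv\<^bsub>C\<^esub> k \<in> Us"
proof -
  obtain g \<alpha> where e: "k = (g, \<alpha>)" by (metis surj_pair)
  obtain x where x: "u = (x, 1)" "x \<in> KK m" using u by (auto simp: Us_def)
  have g: "g = mat2 p q' r s" "g \<in> SLO" using k by (simp_all add: e Ks_def)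
  have d: "p * s - q' * r = 1" using g by (simp add: SLO_mat2)
  let ?y = "g ** x ** mat2 s (- q') (- r) p"
  have y: "?y \<in> KK m" by (rule KK_conj[OF g x(2)])
  have "?y ** g = g ** x ** (mat2 s (- q') (- r) p ** g)"
    by (simp only: matrix_mul_assoc)
  also have "\<dots> = g ** x" unfolding g(1) adj_mult(1)[OF d] by simp
  finally have yg: "?y ** g = g ** x" .
  have "k \<odot> u = (?y, 1) \<odot> k"
    using kd_unit_entry[OF g k(3) KK_one[OF x(2)]] kd_unit_entry(2)[OF g k(3) KK_one[OF y]] yg
    by (simp only: e x cover_simps mult_1 mult_1_right)
  moreover have Y: "(?y, 1) \<in> Us" using y by (simp add: Us_def)
  moreover have kc: "k \<in> carrier C" using k by (simp add: Ks_def)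
  moreover have "(?y, 1) \<odot> k \<odot> inv\<^bsub>C\<^esub> k = (?y, 1)"
    unfolding C.m_assoc[OF Us_carrier[OF Y] kc C.inv_closed[OF kc]] C.r_inv[OF kc]
    by (rule C.r_one[OF Us_carrier[OF Y]])
  ultimately show ?thesis by (simp only:)
qed

text \<open>If the lower-left entry of \<open>k\<close> is not a unit, the upper-left one is. Left
  multiplication by a Weyl element then reaches \<open>conj_unit_entry\<close>, and its inverse,
  again with unit lower-left entry, undoes the step.\<close>

lemma Us_normal:
  assumes k: "k \<in> Ks" and u: "u \<in> Us"
  shows "k \<odot> u \<odot> inv\<^bsub>C\<^esub> k \<in> Us"
proof -
  obtain p q' r s where g: "fst k = mat2 p q' r s" by (rule mat2_cases)
  have O: "p \<in> PP 0" "q' \<in> PP 0" "r \<in> PP 0" "s \<in> PP 0" and d: "p * s - q' * r = 1"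
    using k by (simp_all add: Ks_def g SLO_mat2)
  show ?thesis
  proof (cases "r \<in> unit_group v")
    case True
    then show ?thesis by (rule conj_unit_entry[OF k g _ u])
  next
    case False
    then have r: "r \<in> PP 1" using O by (simp add: unit_group_iff)
    have "p \<notin> PP 1"
    proof
      assume "p \<in> PP 1"
      then have "p * s - q' * r \<in> PP 1" by (intro pideal_diff pideal_mult_int O r)
      then show False using d by simp
    qed
    then have pu: "- p \<in> unit_group v" using O by (simp add: unit_group_iff)
    let ?w = "(mat2 0 1 (- 1) 0, 1) :: ('a ^ 2 ^ 2) \<times> 'a"
    have w: "?w \<in> Ks" using SLO_w by (simp add: Ks_def)
    have wi: "inv\<^bsub>C\<^esub> ?w \<in> Ks" by (rule subgroup.m_inv_closed[OF Ks_subgroup w])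
    have fwi: "fst (inv\<^bsub>C\<^esub> ?w) = mat2 0 (- 1) 1 0"
      using fst_inv[of ?w 0 1 "-1" 0] by simp
    have wk: "?w \<odot> k \<in> Ks" by (rule subgroup.m_closed[OF Ks_subgroup w k])
    have fwk: "fst (?w \<odot> k) = mat2 r s (- p) (- q')" by (simp add: g)
    have c: "?w \<in> carrier C" "k \<in> carrier C" "u \<in> carrier C"
      using w k u Us_carrier by (simp_all add: Ks_def)
    have "(?w \<odot> k) \<odot> u \<odot> inv\<^bsub>C\<^esub> (?w \<odot> k) \<in> Us"
      by (rule conj_unit_entry[OF wk fwk pu u])
    then have "inv\<^bsub>C\<^esub> ?w \<odot> ((?w \<odot> k) \<odot> u \<odot> inv\<^bsub>C\<^esub> (?w \<odot> k)) \<odot> inv\<^bsub>C\<^esub> (inv\<^bsub>C\<^esub> ?w) \<in> Us"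
      by (rule conj_unit_entry[OF wi fwi unit_one])
    also have "inv\<^bsub>C\<^esub> ?w \<odot> ((?w \<odot> k) \<odot> u \<odot> inv\<^bsub>C\<^esub> (?w \<odot> k)) \<odot> inv\<^bsub>C\<^esub> (inv\<^bsub>C\<^esub> ?w) = k \<odot> u \<odot> inv\<^bsub>C\<^esub> k"
      using c by (simp add: C.m_assoc C.inv_mult_group C.inv_mult_cancel del: cover_simps)
    finally show ?thesis .
  qed
qed

lemma aa_carrier: "aa \<in> carrier C"
  using t by (simp add: aa_def)

lemma aa_nu: "aa \<odot> (nu x, 1) = (nu (t * t * x), 1) \<odot> aa"
  using t kd_nu[of "dg t"] by (simp add: aa_def)

lemma nl_aa: "(nl y, 1) \<odot> aa = aa \<odot> (nl (t * t * y), 1)"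
  using t kd_nl_diag[OF t(1), of y] by (simp add: aa_def)

lemma dg_aa:
  assumes "s - 1 \<in> PP 1"
  shows "(dg s, 1) \<odot> aa = aa \<odot> (dg s, 1)"
  using kd_diag_one_unit[OF assms t(1)] by (simp add: aa_def mult.commute)

lemma fst_aa_pow: "fst (aa [^]\<^bsub>C\<^esub> (l::nat)) = dg (t ^ l)"
proof (induction l)
  case 0
  show ?case by (simp add: mat_one_mat2)
next
  case (Suc l)
  then show ?case by (simp add: aa_def mult.commute del: cover_simps(2))
qed

text \<open>Lifts with trivial root of unity. For them the crossing rules with \<open>aa\<close>
  hold exactly, \<open>HH\<close> being restricted to one-units there.\<close>

definition NN :: "'a \<Rightarrow> ('a ^ 2 ^ 2) \<times> 'a" where "NN x = (nu x, 1)"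
definition HH :: "'a \<Rightarrow> ('a ^ 2 ^ 2) \<times> 'a" where "HH s = (dg s, 1)"
definition LL :: "'a \<Rightarrow> ('a ^ 2 ^ 2) \<times> 'a" where "LL y = (nl y, 1)"

lemma fst_factors [simp]: "fst (NN x) = nu x" "fst (HH s) = dg s" "fst (LL y) = nl y" "fst aa = dg t"
  by (simp_all add: NN_def HH_def LL_def aa_def)

lemma NN_carrier: "NN x \<in> carrier C" and LL_carrier: "LL y \<in> carrier C"
  and HH_carrier: "s \<noteq> 0 \<Longrightarrow> HH s \<in> carrier C"
  by (simp_all add: NN_def LL_def HH_def)

lemma N_sets: "Ns = NN ` PP 0" "N's = LL ` PP 0"
  by (auto simp: Ns_def N's_def NN_def LL_def)

lemma m_int: "1 \<le> int m" "0 \<le> int m"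
  using m_pos by simp_all

lemma one_unit_m: "s - 1 \<in> PP (int m) \<Longrightarrow> s - 1 \<in> PP 1"
  by (rule pideal_mono[OF m_int(1)])

lemma one_unit_inverse:
  assumes "s - 1 \<in> PP (int m)"
  shows "inverse s - 1 \<in> PP (int m)" "s \<in> unit_group v"
proof -
  show u: "s \<in> unit_group v" by (rule unit_cong[OF one_unit_m[OF assms] unit_one])
  have "(s - 1) * - inverse s \<in> PP (int m)"
    using unit_int[OF unit_inverse[OF u]] by (intro pideal_mult_int(2) assms) simp
  then show "inverse s - 1 \<in> PP (int m)" using unit_nonzero[OF u] by (simp add: algebra_simps)
qed

lemma Us_factors: "NN x \<in> Us \<longleftrightarrow> x \<in> PP (int m)" "LL y \<in> Us \<longleftrightarrow> y \<in> PP (int m)"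
  "s - 1 \<in> PP (int m) \<Longrightarrow> HH s \<in> Us"
  using one_unit_inverse unit_nonzero by (auto simp: NN_def LL_def HH_def Us_def KK_mat2)

lemma aa_NN: "aa \<odot> NN x = NN (t * t * x) \<odot> aa" and LL_aa: "LL y \<odot> aa = aa \<odot> LL (t * t * y)"
  and HH_aa: "s - 1 \<in> PP 1 \<Longrightarrow> HH s \<odot> aa = aa \<odot> HH s"
  unfolding NN_def LL_def HH_def by (rule aa_nu nl_aa dg_aa)+

declare cover_simps [simp del]

abbreviation cpow (infixr \<open>\<up>\<close> 75) where "x \<up> (l::nat) \<equiv> x [^]\<^bsub>C\<^esub> l"

lemma pow_carrier: "aa \<up> l \<in> carrier C"
  by (rule C.nat_pow_closed[OF aa_carrier])

lemma pow_NN: "aa \<up> l \<odot> NN x = NN ((t * t) ^ l * x) \<odot> aa \<up> l"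
proof (induction l arbitrary: x)
  case (Suc l)
  have "aa \<up> Suc l \<odot> NN x = (aa \<up> l \<odot> NN (t * t * x)) \<odot> aa"
    using NN_carrier aa_carrier pow_carrier by (simp add: C.m_assoc aa_NN)
  also have "\<dots> = NN ((t * t) ^ Suc l * x) \<odot> aa \<up> Suc l"
    using NN_carrier aa_carrier pow_carrier unfolding Suc by (simp add: C.m_assoc mult_ac)
  finally show ?case .
qed (use NN_carrier in simp)

lemma pow_LL: "LL y \<odot> aa \<up> l = aa \<up> l \<odot> LL ((t * t) ^ l * y)"
proof (induction l)
  case (Suc l)
  have "LL y \<odot> aa \<up> Suc l = (LL y \<odot> aa \<up> l) \<odot> aa"
    using LL_carrier aa_carrier pow_carrier by (simp add: C.m_assoc)
  also have "\<dots> = aa \<up> l \<odot> (LL ((t * t) ^ l * y) \<odot> aa)"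
    using LL_carrier aa_carrier pow_carrier unfolding Suc by (simp add: C.m_assoc)
  also have "\<dots> = aa \<up> Suc l \<odot> LL ((t * t) ^ Suc l * y)"
    using LL_carrier aa_carrier pow_carrier unfolding LL_aa by (simp add: C.m_assoc mult_ac)
  finally show ?case .
qed (use LL_carrier in simp)

lemma pow_HH:
  assumes "s - 1 \<in> PP 1" "s \<noteq> 0"
  shows "HH s \<odot> aa \<up> l = aa \<up> l \<odot> HH s"
proof (induction l)
  case (Suc l)
  have "HH s \<odot> aa \<up> Suc l = (HH s \<odot> aa \<up> l) \<odot> aa"
    using HH_carrier[OF assms(2)] aa_carrier pow_carrier by (simp add: C.m_assoc)
  also have "\<dots> = aa \<up> l \<odot> (HH s \<odot> aa)"
    using HH_carrier[OF assms(2)] aa_carrier pow_carrier unfolding Suc by (simp add: C.m_assoc)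
  also have "\<dots> = aa \<up> Suc l \<odot> HH s"
    using HH_carrier[OF assms(2)] aa_carrier pow_carrier unfolding HH_aa[OF assms(1)]
    by (simp add: C.m_assoc)
  finally show ?case .
qed (use HH_carrier[OF assms(2)] in simp)

text \<open>When a factored element passes the power of \<open>aa\<close>, the upper unipotent
  parameter is divided by \<open>(t * t) ^ l\<close>, the lower one is multiplied by it, and the
  diagonal factor is unchanged.\<close>

lemma shift:
  assumes s: "s - 1 \<in> PP 1" "s \<noteq> 0"
  shows "NN ((t * t) ^ l * x) \<odot> HH s \<odot> LL y \<odot> aa \<up> l = aa \<up> l \<odot> (NN x \<odot> HH s \<odot> LL ((t * t) ^ l * y))"
proof -
  note c = NN_carrier LL_carrier HH_carrier[OF s(2)] pow_carrier
  have "NN ((t * t) ^ l * x) \<odot> HH s \<odot> LL y \<odot> aa \<up> l = NN ((t * t) ^ l * x) \<odot> (HH s \<odot> (LL y \<odot> aa \<up> l))"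
    using c by (simp add: C.m_assoc)
  also have "\<dots> = NN ((t * t) ^ l * x) \<odot> ((HH s \<odot> aa \<up> l) \<odot> LL ((t * t) ^ l * y))"
    using c unfolding pow_LL by (simp add: C.m_assoc)
  also have "\<dots> = (NN ((t * t) ^ l * x) \<odot> aa \<up> l) \<odot> HH s \<odot> LL ((t * t) ^ l * y)"
    using c unfolding pow_HH[OF s] by (simp add: C.m_assoc)
  also have "\<dots> = aa \<up> l \<odot> (NN x \<odot> HH s \<odot> LL ((t * t) ^ l * y))"
    using c unfolding pow_NN[symmetric] by (simp add: C.m_assoc)
  finally show ?thesis .
qed

text \<open>The Iwahori factorization. The depth \<open>j\<close> of the unipotent parameters may
  exceed \<open>m\<close>, which leaves room for the factor \<open>t * t\<close> lost when crossing
  \<open>aa\<close>. Equality in the cover follows from equality of matrices because both sides lie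
  in \<open>Us\<close>.\<close>

lemma Us_decomp:
  assumes u: "u \<in> Us" "fst u \<in> KK j" and j: "m \<le> j"
  obtains x s y where "x \<in> PP (int j)" "s - 1 \<in> PP (int m)" "y \<in> PP (int j)" "u = NN x \<odot> HH s \<odot> LL y"
proof -
  obtain a b c d where g: "fst u = mat2 a b c d" by (rule mat2_cases)
  have k: "a * d - b * c = 1" "b \<in> PP (int j)" "c \<in> PP (int j)" "d - 1 \<in> PP (int j)"
    using u(2) by (simp_all add: g KK_mat2)
  have d: "d - 1 \<in> PP (int m)" by (rule pideal_mono[OF _ k(4)]) (use j in simp)
  have du: "d \<in> unit_group v" "inverse d \<in> PP 0"
    using one_unit_inverse[OF d] unit_int[OF unit_inverse] by blast+
  have xy: "b / d \<in> PP (int j)" "c / d \<in> PP (int j)"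
    unfolding divide_inverse by (intro pideal_mult_int(2) k du)+
  have xym: "b / d \<in> PP (int m)" "c / d \<in> PP (int m)"
    by (rule pideal_mono[OF _ xy(1)] pideal_mono[OF _ xy(2)], use j in simp)+
  show ?thesis
  proof (rule that[OF xy(1) one_unit_inverse(1)[OF d] xy(2)], rule Us_eqI)
    show "NN (b / d) \<odot> HH (inverse d) \<odot> LL (c / d) \<in> Us"
      by (intro Us_mult Us_factors(3) one_unit_inverse d) (simp_all add: Us_factors xym)
    show "fst u = fst (NN (b / d) \<odot> HH (inverse d) \<odot> LL (c / d))"
      unfolding g fst_mult fst_factors by (rule nu_dg_nl[OF unit_nonzero[OF du(1)] k(1)])
  qed (rule u)
qed

lemma Us_fst: "u \<in> Us \<Longrightarrow> fst u \<in> KK m"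
  by (auto simp: Us_def)

lemma Us_iwahori:
  assumes u: "u \<in> Us"
  shows "\<exists>u1\<in>Us. \<exists>u2\<in>Us. \<exists>y\<in>N's \<inter> Us. u = u1 \<odot> y \<and> aa \<odot> u1 = u2 \<odot> aa"
proof -
  obtain x s y where d: "x \<in> PP (int m)" "s - 1 \<in> PP (int m)" "y \<in> PP (int m)" "u = NN x \<odot> HH s \<odot> LL y"
    by (rule Us_decomp[OF u Us_fst[OF u] order_refl])
  have s: "s \<noteq> 0" "s - 1 \<in> PP 1"
    using unit_nonzero[OF one_unit_inverse(2)[OF d(2)]] one_unit_m[OF d(2)] by simp_all
  have tx: "t * t * x \<in> PP (int m)"
    by (rule pideal_mult_int(1)[OF _ d(1)]) (use t in \<open>simp add: pideal_def val_mult\<close>)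
  have "aa \<odot> (NN x \<odot> HH s) = (aa \<odot> NN x) \<odot> HH s"
    using NN_carrier HH_carrier[OF s(1)] aa_carrier by (simp add: C.m_assoc)
  also have "\<dots> = NN (t * t * x) \<odot> (HH s \<odot> aa)"
    unfolding aa_NN HH_aa[OF s(2)] using NN_carrier HH_carrier[OF s(1)] aa_carrier by (simp add: C.m_assoc)
  also have "\<dots> = (NN (t * t * x) \<odot> HH s) \<odot> aa"
    using NN_carrier HH_carrier[OF s(1)] aa_carrier by (simp add: C.m_assoc)
  finally have "aa \<odot> (NN x \<odot> HH s) = (NN (t * t * x) \<odot> HH s) \<odot> aa" .
  moreover have "NN x \<odot> HH s \<in> Us" "NN (t * t * x) \<odot> HH s \<in> Us"
    by (intro Us_mult Us_factors(3) d(2); simp add: Us_factors d(1) tx)+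
  moreover have "LL y \<in> N's \<inter> Us"
    using d(3) pideal_mono[OF m_int(2) d(3)] by (simp add: Us_factors N_sets)
  ultimately show ?thesis using d(4) by (intro bexI conjI)
qed

text \<open>Any \<open>u\<close> differs from a representative by an element so deep that, after its
  Iwahori factors have crossed \<open>aa\<close>, it still lies in \<open>Us\<close>.\<close>

lemma Us_aa_finite: "\<exists>E. finite E \<and> E \<subseteq> Us \<and> (\<forall>u\<in>Us. \<exists>e\<in>E. \<exists>u'\<in>Us. u \<odot> aa = e \<odot> aa \<odot> u')"
proof -
  have sub: "KK m \<subseteq> SLO" by (rule subsetI) (rule KK_SLO)
  \<comment> \<open>The two extra orders pay for dividing the upper unipotent parameter by
    \<open>t * t\<close>.\<close>
  obtain E where E: "finite E" "E \<subseteq> KK m"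
    "\<forall>g\<in>KK m. \<exists>e\<in>E. \<forall>i k. e $ i $ k - g $ i $ k \<in> PP (int (m + 2))"
    using finite_representatives[OF sub, of "m + 2"] by (elim exE conjE) (rule that)
  show ?thesis
  proof (intro exI[of _ "E \<times> {1}"] conjI ballI)
    show "finite (E \<times> {1})" "E \<times> {1} \<subseteq> Us" using E by (auto simp: Us_def)
    fix u assume u: "u \<in> Us"
    then obtain e0 where e0: "e0 \<in> E" "\<And>i k. e0 $ i $ k - fst u $ i $ k \<in> PP (int (m + 2))"
      using bspec[OF E(3) Us_fst[OF u]] by (elim bexE) blast
    let ?e = "(e0, 1) :: ('a ^ 2 ^ 2) \<times> 'a"
    have e: "?e \<in> Us" using e0(1) E(2) by (auto simp: Us_def)
    obtain p q' r s where g: "e0 = mat2 p q' r s" by (rule mat2_cases)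
    let ?w = "inv\<^bsub>C\<^esub> ?e \<odot> u"
    have w: "?w \<in> Us" by (intro Us_mult Us_inv e u)
    have "fst (inv\<^bsub>C\<^esub> ?e) = mat2 s (- q') (- r) p"
      by (rule fst_inv[OF Us_carrier[OF e]]) (simp add: g)
    moreover have "e0 \<in> SLO" using KK_SLO[OF Us_fst[OF e]] by simp
    ultimately have "fst ?w \<in> KK (m + 2)"
      unfolding fst_mult using SLO_cong[OF _ KK_SLO[OF Us_fst[OF u]] e0(2) g] by simp
    then obtain x \<sigma> y where d: "x \<in> PP (int (m + 2))" "\<sigma> - 1 \<in> PP (int m)"
      "y \<in> PP (int (m + 2))" "?w = NN x \<odot> HH \<sigma> \<odot> LL y" by (rule Us_decomp[OF w _ le_add1])
    have s: "\<sigma> - 1 \<in> PP 1" "\<sigma> \<noteq> 0"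
      using unit_nonzero[OF one_unit_inverse(2)[OF d(2)]] one_unit_m[OF d(2)] by simp_all
    define x' where "x' = x / (t * t)"
    have x: "x = (t * t) ^ 1 * x'" using t by (simp add: x'_def)
    have x': "x' \<in> PP (int m)"
      using d(1) t by (cases "x = 0") (simp_all add: x'_def pideal_def val_divide val_mult)
    have y': "(t * t) ^ 1 * y \<in> PP (int m)"
      using d(3) t by (cases "y = 0") (simp_all add: pideal_def val_mult)
    let ?u' = "NN x' \<odot> HH \<sigma> \<odot> LL ((t * t) ^ 1 * y)"
    have u': "?u' \<in> Us"
      using Us_factors(1)[of x'] Us_factors(2)[of "(t * t) ^ 1 * y"] x' y'
      by (intro Us_mult Us_factors(3) d(2)) simp_all
    have "?w \<odot> aa \<up> 1 = aa \<up> 1 \<odot> ?u'"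
      unfolding d(4) x by (rule shift[OF s])
    then have wa: "?w \<odot> aa = aa \<odot> ?u'" using aa_carrier by simp
    have "u \<odot> aa = ?e \<odot> (?w \<odot> aa)"
      using Us_carrier[OF u] Us_carrier[OF e] aa_carrier by (simp add: C.m_assoc C.inv_mult_cancel)
    also have "\<dots> = ?e \<odot> aa \<odot> ?u'"
      unfolding wa using Us_carrier[OF u'] Us_carrier[OF e] aa_carrier by (simp add: C.m_assoc)
    finally have "u \<odot> aa = ?e \<odot> aa \<odot> ?u'" .
    moreover have "?e \<in> E \<times> {1}" using e0(1) by simp
    ultimately show "\<exists>e\<in>E \<times> {1}. \<exists>u'\<in>Us. u \<odot> aa = e \<odot> aa \<odot> u'"
      using u' by (intro bexI)
  qed
qed

lemma Ks_iff: "x \<in> Ks \<longleftrightarrow> x \<in> carrier C \<and> fst x \<in> SLO"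
  by (simp add: Ks_def)

lemmas Ks_mult = subgroup.m_closed[OF Ks_subgroup] and Ks_inv = subgroup.m_inv_closed[OF Ks_subgroup]

lemma Zs_Ks: "z \<in> Zs \<Longrightarrow> z \<in> Ks"
  by (auto simp: Zs_def Ks_iff cover_simps mat_one_mat2 SLO_mat2)

lemma Us_Ks: "u \<in> Us \<Longrightarrow> u \<in> Ks"
  by (simp add: Ks_iff Us_carrier KK_SLO[OF Us_fst])

lemma finite_roots: "finite (roots_of_1 n :: 'a set)"
  using n_roots n_pos by (intro card_ge_0_finite) simp

text \<open>Finitely many matrices represent the integral group modulo the congruence subgroup, and
  each is combined with every root of unity, since a lift is known only up to its central
  factor.\<close>

lemma Ks_finite_index: "\<exists>E. finite E \<and> E \<subseteq> Ks \<and> (\<forall>k\<in>Ks. \<exists>e\<in>E. \<exists>u\<in>Us. k = e \<odot> u)"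
proof -
  obtain E where E: "finite E" "E \<subseteq> SLO"
    "\<forall>g\<in>SLO. \<exists>e\<in>E. \<forall>i k. e $ i $ k - g $ i $ k \<in> PP (int m)"
    using finite_representatives[OF order_refl, of m] by (elim exE conjE) (rule that)
  let ?R = "roots_of_1 n :: 'a set"
  have sub: "E \<times> ?R \<subseteq> Ks"
    using E(2) by (auto simp: Ks_iff cover_simps SLO_def)
  have "\<exists>e\<in>E \<times> ?R. \<exists>u\<in>Us. k = e \<odot> u" if k: "k \<in> Ks" for k
  proof -
    have kc: "k \<in> carrier C" and ks: "fst k \<in> SLO" using k by (simp_all add: Ks_iff)
    obtain e0 where e0: "e0 \<in> E" "\<And>i j. e0 $ i $ j - fst k $ i $ j \<in> PP (int m)"
      using bspec[OF E(3) ks] by (elim bexE) blast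
    obtain p q' r s where g: "e0 = mat2 p q' r s" by (rule mat2_cases)
    have es: "e0 \<in> SLO" using e0(1) E(2) by blast
    let ?h = "mat2 s (- q') (- r) p ** fst k"
    have h: "?h \<in> KK m" by (rule SLO_cong[OF es ks e0(2) g])
    let ?u = "(?h, 1) :: ('a ^ 2 ^ 2) \<times> 'a" and ?e = "(e0, 1) :: ('a ^ 2 ^ 2) \<times> 'a"
    have u: "?u \<in> Us" using h by (simp add: Us_def)
    have ec: "?e \<in> carrier C" using es by (simp add: cover_simps SLO_def)
    have det: "p * s - q' * r = 1" using es by (simp add: g SLO_mat2)
    have "fst (?e \<odot> ?u) = (e0 ** mat2 s (- q') (- r) p) ** fst k"
      by (simp add: matrix_mul_assoc)
    also have "\<dots> = fst k" unfolding g adj_mult(2)[OF det] by simp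
    finally obtain \<zeta> where z: "\<zeta> \<in> ?R" "k = ?e \<odot> ?u \<odot> (mat 1, \<zeta>)"
      by (rule fst_eqE[OF C.m_closed[OF ec Us_carrier[OF u]] kc])
    have zz: "(mat 1, \<zeta>) \<in> Zs" using z(1) by (simp add: Zs_def)
    then have zc: "(mat 1, \<zeta>) \<in> carrier C" by (rule subgroup.mem_carrier[OF Zs_subgroup])
    have "k = ?e \<odot> (?u \<odot> (mat 1, \<zeta>))"
      by (rule trans[OF z(2) C.m_assoc[OF ec Us_carrier[OF u] zc]])
    also have "\<dots> = (?e \<odot> (mat 1, \<zeta>)) \<odot> ?u"
      unfolding Zs_central[OF zz Us_carrier[OF u]] by (rule C.m_assoc[OF ec zc Us_carrier[OF u], symmetric])
    also have "?e \<odot> (mat 1, \<zeta>) = (e0, \<zeta>)"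
      using es by (simp add: cover_simps SLO_def)
    finally have "k = (e0, \<zeta>) \<odot> ?u" .
    moreover have "(e0, \<zeta>) \<in> E \<times> ?R" using e0(1) z(1) by simp
    ultimately show ?thesis using u by (intro bexI)
  qed
  then show ?thesis
    by (intro exI[of _ "E \<times> ?R"] conjI ballI finite_cartesian_product E(1) finite_roots sub)
qed

lemma fst_aa_inv: "fst (inv\<^bsub>C\<^esub> (aa \<up> l)) = mat2 (inverse (t ^ l)) 0 0 (t ^ l)"
  using fst_inv[OF pow_carrier[of l] fst_aa_pow] by simp

lemma fst_inv_factors: "fst (inv\<^bsub>C\<^esub> (NN x)) = nu (- x)" "fst (inv\<^bsub>C\<^esub> (LL y)) = nl (- y)"
  using fst_inv[OF NN_carrier fst_factors(1)] fst_inv[OF LL_carrier fst_factors(3)] by simp_all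

lemma Ts_iff: "h \<in> Ts \<longleftrightarrow> h \<in> carrier C \<and> (\<exists>s\<in>unit_group v. fst h = dg s)"
  by (simp add: Ts_def)

lemma subsets_Ks: "Ns \<subseteq> Ks" "Ts \<subseteq> Ks" "N's \<subseteq> Ks"
proof -
  show "Ns \<subseteq> Ks" "N's \<subseteq> Ks"
    unfolding N_sets by (auto simp: Ks_iff NN_carrier LL_carrier SLO_mat2)
  show "Ts \<subseteq> Ks"
  proof
    fix h assume "h \<in> Ts"
    then obtain s where s: "s \<in> unit_group v" "fst h = dg s" and h: "h \<in> carrier C"
      unfolding Ts_iff by (elim conjE bexE)
    show "h \<in> Ks"
      using h unit_int[OF s(1)] unit_int[OF unit_inverse[OF s(1)]] unit_nonzero[OF s(1)]
      by (simp add: Ks_iff s(2) SLO_mat2)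
  qed
qed

lemma Ts_conj:
  assumes "h \<in> Ts"
  shows "\<exists>h'\<in>Ts. aa \<odot> h = h' \<odot> aa"
proof -
  obtain s where s: "s \<in> unit_group v" "fst h = dg s" and h: "h \<in> carrier C"
    using assms unfolding Ts_iff by (elim conjE bexE)
  have fi: "fst (inv\<^bsub>C\<^esub> aa) = mat2 (inverse t) 0 0 t"
    using fst_inv[OF aa_carrier fst_factors(4)] by simp
  let ?h = "aa \<odot> h \<odot> inv\<^bsub>C\<^esub> aa"
  have "fst ?h = dg s" using t(1) by (simp add: s(2) fi)
  then have "?h \<in> Ts"
    using s(1) h aa_carrier by (auto simp: Ts_iff)
  moreover have "aa \<odot> h = ?h \<odot> aa"
    using h aa_carrier by (simp add: C.m_assoc)
  ultimately show ?thesis by (rule bexI[rotated])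
qed

lemma SLO_lift: "g \<in> SLO \<Longrightarrow> (g, 1) \<in> Ks"
  by (simp add: Ks_iff cover_simps SLO_def)

lemma Ks_carrier: "k \<in> Ks \<Longrightarrow> k \<in> carrier C"
  by (simp add: Ks_iff)

text \<open>The matrix decomposition lifts up to a root of unity, which is absorbed into the right
  factor.\<close>

lemma Ks_cartan:
  assumes g: "g \<in> carrier C"
  shows "\<exists>k1\<in>Ks. \<exists>k2\<in>Ks. \<exists>l::nat. g = k1 \<odot> aa \<up> l \<odot> k2"
proof -
  obtain k1 k2 and l :: nat where k: "k1 \<in> SLO" "k2 \<in> SLO" "fst g = k1 ** dg (t ^ l) ** k2"
    using cartan_matrix[OF t det_fst[OF g]] by (elim bexE exE) (rule that)
  define K1 K2 :: "('a ^ 2 ^ 2) \<times> 'a" where "K1 = (k1, 1)" and "K2 = (k2, 1)"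
  have K: "K1 \<in> Ks" "K2 \<in> Ks" "fst K1 = k1" "fst K2 = k2"
    using k by (simp_all add: K1_def K2_def SLO_lift)
  have c: "K1 \<odot> aa \<up> l \<in> carrier C" "K2 \<in> carrier C"
    by (intro C.m_closed Ks_carrier K pow_carrier)+
  have "fst (K1 \<odot> aa \<up> l \<odot> K2) = fst g"
    unfolding fst_mult fst_aa_pow K k(3) ..
  then obtain \<zeta> where z: "\<zeta> \<in> roots_of_1 n" "g = K1 \<odot> aa \<up> l \<odot> K2 \<odot> (mat 1, \<zeta>)"
    by (rule fst_eqE[OF C.m_closed[OF c] g])
  have "(mat 1, \<zeta>) \<in> Ks" using z(1) by (intro Zs_Ks) (simp add: Zs_def)
  moreover from this have "g = K1 \<odot> aa \<up> l \<odot> (K2 \<odot> (mat 1, \<zeta>))"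
    using z(2) C.m_assoc[OF c Ks_carrier] by simp
  ultimately show ?thesis using K(1) Ks_mult[OF K(2)] by (intro bexI exI)
qed

lemma dg_pow_entries: "dg (t ^ l) $ i $ j \<in> PP (- int l)"
proof -
  have "\<forall>i j. dg (t ^ l) $ i $ j \<in> PP (- int l)"
    using t by (simp add: forall_2 pideal_def val_power val_inverse)
  then show ?thesis by simp
qed

text \<open>Multiplication by integral matrices preserves the fractional ideal containing all
  entries, and the power \<open>l\<close> of \<open>aa\<close> has the entry of valuation
  \<open>- l\<close>.\<close>

lemma cartan_exponent_le:
  assumes k: "k1 \<in> Ks" "k2 \<in> Ks" and e: "g = k1 \<odot> aa \<up> l \<odot> k2"
    and g: "\<And>i j. fst g $ i $ j \<in> PP (- int l')"
  shows "l \<le> l'"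
proof -
  note c = Ks_carrier[OF k(1)] Ks_carrier[OF k(2)] pow_carrier[of l]
  have "inv\<^bsub>C\<^esub> k1 \<odot> g \<odot> inv\<^bsub>C\<^esub> k2 = aa \<up> l"
    unfolding e using c by (simp add: C.m_assoc C.inv_mult_cancel)
  then have "dg (t ^ l) = fst (inv\<^bsub>C\<^esub> k1) ** fst g ** fst (inv\<^bsub>C\<^esub> k2)"
    by (metis fst_aa_pow fst_mult)
  moreover have "(fst (inv\<^bsub>C\<^esub> k1) ** fst g ** fst (inv\<^bsub>C\<^esub> k2)) $ 2 $ 2 \<in> PP (- int l')"
    using Ks_inv[OF k(1)] Ks_inv[OF k(2)] by (intro SLO_entries g) (simp_all add: Ks_iff)
  ultimately have "dg (t ^ l) $ 2 $ 2 \<in> PP (- int l')" by simp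
  then show ?thesis using t by (simp add: pideal_def val_power val_inverse)
qed

lemma Ks_cartan_unique:
  assumes k: "k1 \<in> Ks" "k2 \<in> Ks" and e: "k1 \<odot> aa \<up> l \<odot> k2 = aa \<up> l'"
  shows "l = l'"
proof (rule antisym)
  show "l \<le> l'"
    using dg_pow_entries by (intro cartan_exponent_le[OF k e[symmetric]]) (simp add: fst_aa_pow)
  note c = Ks_carrier[OF k(1)] Ks_carrier[OF k(2)] pow_carrier[of l]
  have "aa \<up> l = inv\<^bsub>C\<^esub> k1 \<odot> aa \<up> l' \<odot> inv\<^bsub>C\<^esub> k2"
    unfolding e[symmetric] using c by (simp add: C.m_assoc C.inv_mult_cancel)
  from cartan_exponent_le[OF Ks_inv[OF k(1)] Ks_inv[OF k(2)] this] show "l' \<le> l"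
    using dg_pow_entries by (simp add: fst_aa_pow)
qed

lemma lower_right_unit:
  assumes "mat2 p q' r s \<in> SLO" "q' \<in> PP 1"
  shows "s \<in> unit_group v"
proof -
  have O: "p * s - q' * r = 1" "p \<in> PP 0" "r \<in> PP 0" "s \<in> PP 0" using assms(1) by (simp_all add: SLO_mat2)
  have "s \<notin> PP 1"
  proof
    assume "s \<in> PP 1"
    then have "p * s - q' * r \<in> PP 1"
      by (intro pideal_diff pideal_mult_int(1)[OF O(2)] pideal_mult_int(2)[OF assms(2) O(3)])
    then show False using O(1) by simp
  qed
  then show ?thesis using O(4) by (simp add: unit_group_iff)
qed

text \<open>The equation makes the upper-right entry of \<open>k\<close> divisible by
  \<open>t ^ (2 * l)\<close>. For positive \<open>l\<close> the lower-right entry \<open>s\<close>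
  is thus a unit, and \<open>k\<close> factors as upper unipotent, diagonal, lower unipotent with
  upper parameter still integral after division by \<open>t ^ (2 * l)\<close>.\<close>

lemma Ks_stabilizer:
  assumes k: "k \<in> Ks" "k' \<in> Ks" and l: "0 < l" and e: "k \<odot> aa \<up> l = aa \<up> l \<odot> k'"
  shows "\<exists>x\<in>Ns. \<exists>h\<in>Ts. \<exists>y\<in>N's. k \<odot> aa \<up> l = aa \<up> l \<odot> x \<odot> h \<odot> inv\<^bsub>C\<^esub> (aa \<up> l) \<odot> y \<odot> aa \<up> l"
proof -
  obtain p q' r s where g: "fst k = mat2 p q' r s" by (rule mat2_cases)
  obtain p2 q2 r2 s2 where g2: "fst k' = mat2 p2 q2 r2 s2" by (rule mat2_cases)
  have ks: "mat2 p q' r s \<in> SLO" "mat2 p2 q2 r2 s2 \<in> SLO"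
    using k by (simp_all add: Ks_iff g g2)
  have O: "p * s - q' * r = 1" "r \<in> PP 0" "q2 \<in> PP 0" using ks by (simp_all add: SLO_mat2)
  have "fst k ** fst (aa \<up> l) = fst (aa \<up> l) ** fst k'"
    using arg_cong[OF e, of fst] by simp
  then have "q' * inverse (t ^ l) = t ^ l * q2" by (simp add: g g2 fst_aa_pow)
  then have q: "q' = t ^ l * t ^ l * q2" using t(1) by (simp add: field_simps)
  have "t ^ l \<in> PP 1" "t ^ l \<in> PP 0" using t l by (simp_all add: pideal_def val_power)
  then have "q' \<in> PP 1" unfolding q by (intro pideal_mult_int(2) O)
  then have s: "s \<in> unit_group v" by (rule lower_right_unit[OF ks(1)])
  have s0: "s \<noteq> 0" and si: "inverse s \<in> PP 0"
    using unit_nonzero[OF s] unit_int[OF unit_inverse[OF s]] by simp_all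
  define X Y where "X = NN (q2 / s)" and "Y = LL (r / s)"
  have X: "X \<in> Ns" "X \<in> carrier C" "Y \<in> N's" "Y \<in> carrier C"
    using pideal_mult_int(1)[OF O(2) si] pideal_mult_int(1)[OF O(3) si]
    by (simp_all add: X_def Y_def N_sets NN_carrier LL_carrier divide_inverse)
  let ?A = "aa \<up> l"
  \<comment> \<open>The diagonal factor is defined by solving the equation in the group, so its root
    of unity need not be computed; only its matrix is checked.\<close>
  let ?h = "inv\<^bsub>C\<^esub> X \<odot> inv\<^bsub>C\<^esub> ?A \<odot> k \<odot> inv\<^bsub>C\<^esub> Y \<odot> ?A"
  note c = Ks_carrier[OF k(1)] pow_carrier[of l] X(2,4)
  have "fst ?h = dg (inverse s)"
    using s0 t(1) O(1) by (simp add: g q X_def Y_def fst_inv_factors fst_aa_pow fst_aa_inv field_simps)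
  moreover have "?h \<in> carrier C" by (intro C.m_closed C.inv_closed c)
  ultimately have "?h \<in> Ts" unfolding Ts_iff using unit_inverse[OF s] by blast
  moreover have "k \<odot> ?A = ?A \<odot> X \<odot> ?h \<odot> inv\<^bsub>C\<^esub> ?A \<odot> Y \<odot> ?A"
    using c by (simp add: C.m_assoc C.inv_mult_cancel)
  ultimately show ?thesis using X(1,3) by (intro bexI)
qed

text \<open>The split is whether the lower-right entry \<open>s\<close> is a unit. If so, division
  by \<open>s\<close> gives the integral factorization. If not, all entries of the product with two
  copies of \<open>aa\<close> have valuation at least \<open>- 1\<close>, and
  \<open>cartan_exponent_le\<close> bounds the exponent by 1.\<close>

lemma Ks_dichotomy:
  assumes k: "k \<in> Ks"
  shows "(\<exists>x\<in>Ns. \<exists>h\<in>Ts. \<exists>y\<in>N's. k = x \<odot> h \<odot> y) \<or>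
    (\<forall>u\<in>Us. \<exists>k1\<in>Ks. \<exists>k2\<in>Ks. \<exists>i\<le>1::nat. aa \<odot> u \<odot> k \<odot> aa = k1 \<odot> aa \<up> i \<odot> k2)"
proof -
  obtain p q' r s where g: "fst k = mat2 p q' r s" by (rule mat2_cases)
  have ks: "mat2 p q' r s \<in> SLO" using k by (simp add: Ks_iff g)
  have O: "p * s - q' * r = 1" "r \<in> PP 0" "q' \<in> PP 0" "s \<in> PP 0" using ks by (simp_all add: SLO_mat2)
  note kc = Ks_carrier[OF k]
  show ?thesis
  proof (cases "s \<in> unit_group v")
    case s: True
    have s0: "s \<noteq> 0" and si: "inverse s \<in> PP 0"
      using unit_nonzero[OF s] unit_int[OF unit_inverse[OF s]] by simp_all
    define X Y where "X = NN (q' / s)" and "Y = LL (r / s)"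
    have X: "X \<in> Ns" "X \<in> carrier C" "Y \<in> N's" "Y \<in> carrier C"
      using pideal_mult_int(1)[OF O(2) si] pideal_mult_int(1)[OF O(3) si]
      by (simp_all add: X_def Y_def N_sets NN_carrier LL_carrier divide_inverse)
    let ?h = "inv\<^bsub>C\<^esub> X \<odot> k \<odot> inv\<^bsub>C\<^esub> Y"
    have "fst ?h = dg (inverse s)"
      using s0 O(1) by (simp add: g X_def Y_def fst_inv_factors field_simps)
    moreover have "?h \<in> carrier C" by (intro C.m_closed C.inv_closed X kc)
    ultimately have "?h \<in> Ts" unfolding Ts_iff using unit_inverse[OF s] by blast
    moreover have "k = X \<odot> ?h \<odot> Y"
      using kc X by (simp add: C.m_assoc C.inv_mult_cancel)
    ultimately show ?thesis using X(1,3) by (intro disjI1 bexI)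
  next
    case False
    then have s: "s \<in> PP 1" using O(4) by (simp add: unit_group_iff)
    have "\<exists>k1\<in>Ks. \<exists>k2\<in>Ks. \<exists>i\<le>1::nat. aa \<odot> u \<odot> k \<odot> aa = k1 \<odot> aa \<up> i \<odot> k2" if u: "u \<in> Us" for u
    proof -
      note uc = Us_carrier[OF u]
      obtain a b c d where fu: "fst u = mat2 a b c d" by (rule mat2_cases)
      have "c \<in> PP (int m)" using Us_fst[OF u] by (simp add: fu KK_mat2)
      then have c: "c \<in> PP 1" by (rule pideal_mono[OF m_int(1)])
      have us: "mat2 a b c d \<in> SLO" using KK_SLO[OF Us_fst[OF u]] by (simp add: fu)
      then have U: "a \<in> PP 0" "b \<in> PP 0" "d \<in> PP 0" by (simp_all add: SLO_mat2)
      have "mat2 a b c d ** mat2 p q' r s \<in> SLO" by (rule SLO_mult[OF us ks])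
      then have E: "a * p + b * r \<in> PP 0" "a * q' + b * s \<in> PP 0" "c * p + d * r \<in> PP 0"
        by (simp_all add: SLO_mat2)
      \<comment> \<open>Both summands contain a factor in the maximal ideal; dividing this entry by
        the square of \<open>t\<close> therefore costs only one negative order.\<close>
      have E2: "c * q' + d * s \<in> PP 1" by (intro pideal_add pideal_mult_int(1)[OF U(3) s] pideal_mult_int(2)[OF c O(3)])
      let ?g = "aa \<odot> u \<odot> k \<odot> aa"
      have fg: "fst ?g = mat2 (t * (a * p + b * r) * t) (a * q' + b * s) (c * p + d * r)
          (inverse t * (c * q' + d * s) * inverse t)"
        using t(1) by (simp add: fu g algebra_simps)
      have tt: "t \<in> PP 1" "inverse t \<in> PP (- 1)" using t by (simp_all add: pideal_def val_inverse)
      have "t * (a * p + b * r) * t \<in> PP (1 + 0 + 1)" "inverse t * (c * q' + d * s) * inverse t \<in> PP (- 1 + 1 + - 1)"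
        by (intro pideal_mult tt E E2)+
      then have "\<forall>i j. fst ?g $ i $ j \<in> PP (- 1)"
        unfolding fg using E by (simp add: forall_2 pideal_mono[of "- 1" 2] pideal_mono[of "- 1" 0])
      then have ge: "fst ?g $ i $ j \<in> PP (- int 1)" for i j by simp
      have gc: "?g \<in> carrier C" by (intro C.m_closed aa_carrier uc kc)
      obtain k1 k2 and l :: nat where kk: "k1 \<in> Ks" "k2 \<in> Ks" "?g = k1 \<odot> aa \<up> l \<odot> k2"
        using Ks_cartan[OF gc] by (elim bexE exE) (rule that)
      moreover have "l \<le> 1" by (rule cartan_exponent_le[OF kk ge])
      ultimately show ?thesis by (intro bexI exI conjI)
    qed
    then show ?thesis by (intro disjI2 ballI)
  qed
qed

text \<open>Moving \<open>u\<close> across the power of \<open>aa\<close> turns the equation into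
  \<open>z \<odot> W \<odot> u' = 1\<close>, so the matrix of \<open>W\<close> is in the congruence
  subgroup. This forces its unipotent parameters into the ideal, hence \<open>W\<close> is in
  \<open>Us\<close>, and \<open>z\<close> lies in the trivial intersection of \<open>Zs\<close> and
  \<open>Us\<close>.\<close>

lemma aa_admissible:
  assumes z: "z \<in> Zs" and u: "u \<in> Us" and u': "u' \<in> Us" and e: "z \<odot> u \<odot> aa \<up> l \<odot> u' = aa \<up> l"
  shows "z = \<one>\<^bsub>C\<^esub>"
proof -
  obtain x s y where d: "x \<in> PP (int m)" "s - 1 \<in> PP (int m)" "y \<in> PP (int m)" "u = NN x \<odot> HH s \<odot> LL y"
    by (rule Us_decomp[OF u Us_fst[OF u] order_refl])
  have s: "s - 1 \<in> PP 1" "s \<noteq> 0"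
    using unit_nonzero[OF one_unit_inverse(2)[OF d(2)]] one_unit_m[OF d(2)] by simp_all
  define x' y' where "x' = x / (t * t) ^ l" and "y' = (t * t) ^ l * y"
  define W where "W = NN x' \<odot> HH s \<odot> LL y'"
  have Wc: "W \<in> carrier C" unfolding W_def by (intro C.m_closed NN_carrier HH_carrier s LL_carrier)
  have x: "x = (t * t) ^ l * x'" using t(1) by (simp add: x'_def)
  have sh: "u \<odot> aa \<up> l = aa \<up> l \<odot> W"
    unfolding d(4) W_def y'_def x by (rule shift[OF s])
  have zc: "z \<in> carrier C" by (rule Ks_carrier[OF Zs_Ks[OF z]])
  note c = zc Us_carrier[OF u] Us_carrier[OF u'] Wc pow_carrier[of l]
  have "aa \<up> l = z \<odot> (u \<odot> aa \<up> l) \<odot> u'"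
    using e c by (simp add: C.m_assoc)
  also have "\<dots> = (z \<odot> aa \<up> l) \<odot> (W \<odot> u')"
    unfolding sh using c by (simp add: C.m_assoc)
  also have "\<dots> = aa \<up> l \<odot> (z \<odot> (W \<odot> u'))"
    unfolding Zs_central[OF z c(5), symmetric] using c by (simp add: C.m_assoc)
  finally have one: "z \<odot> (W \<odot> u') = \<one>\<^bsub>C\<^esub>"
    using c C.l_cancel_one'[of "aa \<up> l" "z \<odot> (W \<odot> u')"] by simp
  have zWu: "z \<odot> W = inv\<^bsub>C\<^esub> u'"
    using c one by (intro C.inv_equality[symmetric]) (simp_all add: C.m_assoc)
  then have "fst (z \<odot> W) \<in> KK m" using Us_fst[OF Us_inv[OF u']] by simp
  moreover have "fst z = mat 1" using z by (auto simp: Zs_def)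
  ultimately have "fst W \<in> KK m" by simp
  then have W: "s + x' * (inverse s * y') - 1 \<in> PP (int m)" "x' * inverse s \<in> PP (int m)" "inverse s * y' \<in> PP (int m)"
    by (simp_all add: W_def KK_mat2 mult.assoc)
  have so: "s \<in> PP 0" using unit_int one_unit_inverse(2)[OF d(2)] by blast
  have "x' * inverse s * s \<in> PP (int m)" "s * (inverse s * y') \<in> PP (int m)"
    by (intro pideal_mult_int W so)+
  moreover have "x' * inverse s * s = x'" "s * (inverse s * y') = y'" using s(2) by simp_all
  ultimately have xy: "x' \<in> PP (int m)" "y' \<in> PP (int m)" by simp_all
  \<comment> \<open>Each factor of \<open>W\<close> is now a canonical lift inside
    \<open>Us\<close>, so \<open>W\<close> carries no root of unity; knowing its matrix alone would
    not exclude one.\<close>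
  have WU: "W \<in> Us" unfolding W_def by (intro Us_mult Us_factors(3) d(2)) (simp_all add: Us_factors xy)
  have "z = inv\<^bsub>C\<^esub> u' \<odot> inv\<^bsub>C\<^esub> W"
    by (rule iffD2[OF C.inv_solve_right[OF zc C.inv_closed[OF c(3)] Wc] zWu[symmetric]])
  then have "z \<in> Us" using Us_mult[OF Us_inv[OF u'] Us_inv[OF WU]] by simp
  then show ?thesis using z by (auto simp: Us_def Zs_def cover_simps)
qed

sublocale P: cartan_pair C Zs Us Ks Ns Ts N's aa
proof (intro cartan_pair.intro cartan_pair_axioms.intro central_pair.intro central_pair_axioms.intro)
  show "group C" by (rule group_cover)
  show "finite Zs" using finite_roots by (simp add: Zs_def)
  show "subgroup Zs C" "subgroup Us C" "subgroup Ks C"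
    by (rule Zs_subgroup Us_subgroup Ks_subgroup)+
  show "Us \<subseteq> Ks" "Zs \<subseteq> Ks" using Us_Ks Zs_Ks by blast+
  show "aa \<in> carrier C" by (rule aa_carrier)
  show "\<exists>E. finite E \<and> E \<subseteq> Ks \<and> (\<forall>k\<in>Ks. \<exists>e\<in>E. \<exists>u\<in>Us. k = e \<odot> u)" by (rule Ks_finite_index)
  show "\<exists>E. finite E \<and> E \<subseteq> Us \<and> (\<forall>u\<in>Us. \<exists>e\<in>E. \<exists>u'\<in>Us. u \<odot> aa = e \<odot> aa \<odot> u')"
    by (rule Us_aa_finite)
  show "Ns \<subseteq> Ks" "Ts \<subseteq> Ks" "N's \<subseteq> Ks" by (rule subsets_Ks)+
next
  fix x z assume "z \<in> Zs" "x \<in> carrier C"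
  then show "x \<odot> z = z \<odot> x" by (rule Zs_central)
next
  fix k u assume "k \<in> Ks" "u \<in> Us"
  then show "k \<odot> u \<odot> inv\<^bsub>C\<^esub> k \<in> Us" by (rule Us_normal)
next
  have tt: "t * t * x \<in> PP j" if "x \<in> PP j" for x j
    by (rule pideal_mult_int(1)[OF _ that]) (use t in \<open>simp add: pideal_def val_mult\<close>)
  have Nb: "\<exists>b\<in>PP 0. x = NN b" if "x \<in> Ns" for x using that unfolding N_sets by blast
  have Lb: "\<exists>b\<in>PP 0. y = LL b" if "y \<in> N's" for y using that unfolding N_sets by blast
  show "\<exists>x'\<in>Ns. aa \<odot> x = x' \<odot> aa" if x: "x \<in> Ns" for x
  proof -
    obtain b where b: "b \<in> PP 0" "x = NN b" using Nb[OF x] by (rule bexE)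
    have "NN (t * t * b) \<in> Ns" unfolding N_sets by (intro imageI tt b(1))
    then show ?thesis unfolding b(2) aa_NN by (intro bexI[of _ "NN (t * t * b)"] refl)
  qed
  show ex: "\<exists>y'\<in>N's. y \<odot> aa = aa \<odot> y'" if y: "y \<in> N's" for y
  proof -
    obtain b where b: "b \<in> PP 0" "y = LL b" using Lb[OF y] by (rule bexE)
    have "LL (t * t * b) \<in> N's" unfolding N_sets by (intro imageI tt b(1))
    then show ?thesis unfolding b(2) LL_aa by (intro bexI[of _ "LL (t * t * b)"] refl)
  qed
  show "\<exists>y'\<in>N's \<inter> Us. y \<odot> aa = aa \<odot> y'" if y: "y \<in> N's" "y \<in> Us" for y
  proof -
    obtain b where b: "b \<in> PP 0" "y = LL b" using Lb[OF y(1)] by (rule bexE)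
    have "LL (t * t * b) \<in> Us"
      using tt[of b "int m"] y(2) by (simp add: b Us_factors)
    then have "LL (t * t * b) \<in> N's \<inter> Us"
      unfolding N_sets by (intro IntI imageI tt b(1))
    then show ?thesis unfolding b(2) LL_aa by (intro bexI[of _ "LL (t * t * b)"] refl)
  qed
qed (fact Ts_conj Us_iwahori Ks_cartan Ks_cartan_unique Ks_stabilizer Ks_dichotomy aa_admissible)+

end


section \<open>The topology of the covering group\<close>

context nonarch_local_field
begin

text \<open>By the ultrametric inequality a step bound holds for all later terms too, and it
  persists in the limit; completeness is thus obtained with an explicit rate.\<close>

lemma limit_of_refinements:
  assumes "\<And>i. s (Suc i) - s i \<in> PP (int (k + i))"
  shows "\<exists>l. \<forall>i. s i - l \<in> PP (int (k + i))"
proof -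
  have step: "s (i + d) - s i \<in> PP (int (k + i))" for i d
  proof (induction d)
    case (Suc d)
    have "s (Suc (i + d)) - s (i + d) \<in> PP (int (k + i))"
      by (rule pideal_mono[OF _ assms]) simp
    from pideal_trans[OF this Suc] show ?case by simp
  qed simp
  have cauchy: "s j - s i \<in> PP (int (k + i))" if "i \<le> j" for i j
    using step[of i "j - i"] that by simp
  have "\<exists>l. \<forall>k::nat. \<exists>N::nat. \<forall>i\<ge>N. s i - l \<in> PP (int k)"
  proof (rule complete)
    fix K :: nat
    have "s i - s j \<in> PP (int K)" if ij: "K \<le> i" "K \<le> j" for i j
    proof -
      have "s i - s K \<in> PP (int (k + K))" "s j - s K \<in> PP (int (k + K))"
        by (rule cauchy[OF ij(1)], rule cauchy[OF ij(2)])
      from pideal_diff[OF this] have "s i - s j \<in> PP (int (k + K))" by simp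
      then show ?thesis by (rule pideal_mono[rotated]) simp
    qed
    then show "\<exists>N. \<forall>i\<ge>N. \<forall>j\<ge>N. s i - s j \<in> PP (int K)" by blast
  qed
  then obtain l where l: "\<And>k::nat. \<exists>N::nat. \<forall>i\<ge>N. s i - l \<in> PP (int k)" by blast
  have "s i - l \<in> PP (int (k + i))" for i
  proof -
    obtain N where N: "\<And>j. N \<le> j \<Longrightarrow> s j - l \<in> PP (int (k + i))" using l[of "k + i"] by blast
    have "s i - s (max N i) \<in> PP (int (k + i))"
      using cauchy[of i "max N i"] by (subst pideal_diff_commute) simp
    from pideal_trans[OF this N] show ?thesis by simp
  qed
  then show ?thesis by blast
qed

end

section \<open>Basic neighbourhoods and compactness in the cover\<close>

context kubota_pair
begin

abbreviation "TT \<equiv> cover_topology v n"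

definition UU :: "nat \<Rightarrow> (('a ^ 2 ^ 2) \<times> 'a) set" where "UU j = KK j \<times> {1}"
definition nb :: "('a ^ 2 ^ 2) \<times> 'a \<Rightarrow> nat \<Rightarrow> (('a ^ 2 ^ 2) \<times> 'a) set"
  where "nb x j = x <#\<^bsub>C\<^esub> UU j"

lemma UU_m: "UU m = Us"
  by (simp add: UU_def Us_def)

lemma UU_subgroup:
  assumes "1 \<le> j"
  shows "subgroup (UU j) C"
proof -
  interpret J: kubota_pair v n j t
    using assms t by unfold_locales
  show ?thesis using J.Us_subgroup by (simp only: J.Us_def UU_def)
qed

lemma UU_carrier: "1 \<le> j \<Longrightarrow> UU j \<subseteq> carrier C"
  by (rule subgroup.subset[OF UU_subgroup])

lemma nb_carrier: "x \<in> carrier C \<Longrightarrow> 1 \<le> j \<Longrightarrow> nb x j \<subseteq> carrier C"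
  unfolding nb_def by (rule C.l_coset_subset_G[OF UU_carrier])

lemma nb_mono: "i \<le> j \<Longrightarrow> nb x j \<subseteq> nb x i"
  unfolding nb_def C.l_coset_image UU_def using KK_mono by blast

lemma nb_self: "x \<in> carrier C \<Longrightarrow> 1 \<le> j \<Longrightarrow> x \<in> nb x j"
  unfolding nb_def using C.l_coset_memI[OF subgroup.one_closed[OF UU_subgroup], of j x] by simp

lemma nb_memE:
  assumes "y \<in> nb x j"
  obtains u where "u \<in> UU j" "y = x \<odot> u"
  using assms unfolding nb_def by (rule C.l_coset_memE)

lemma nb_eq:
  assumes "x \<in> carrier C" "1 \<le> j" "y \<in> nb x j"
  shows "nb y j = nb x j"
  using assms(3) C.l_coset_absorb[OF UU_subgroup[OF assms(2)] assms(1)] unfolding nb_def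
  by (elim C.l_coset_memE) simp

lemma nb_translate:
  assumes "x \<in> carrier C" "y \<in> carrier C" "1 \<le> j" "z \<in> nb y j"
  shows "x \<odot> z \<in> nb (x \<odot> y) j"
proof -
  obtain u where u: "u \<in> UU j" "z = y \<odot> u" using assms(4) by (rule nb_memE)
  have "x \<odot> z = x \<odot> y \<odot> u"
    using C.m_assoc[OF assms(1,2) subsetD[OF UU_carrier[OF assms(3)] u(1)]] by (simp add: u(2))
  then show ?thesis unfolding nb_def by (simp add: C.l_coset_memI[OF u(1)])
qed

lemma openin_nb:
  assumes "x \<in> carrier C" "1 \<le> j"
  shows "openin TT (nb x j)"
  unfolding cover_topology_def nb_def UU_def lifted_eq[OF assms(2), symmetric]
  by (rule topology_generated_by_Basis) (use assms in blast)

lemma topspace_TT: "topspace TT = carrier C"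
proof
  have "x <#\<^bsub>C\<^esub> lifted_subgroup v n j \<subseteq> carrier C" if "x \<in> carrier C" "1 \<le> j" for x j
    using nb_carrier[OF that] lifted_eq[OF that(2)] by (simp add: nb_def UU_def)
  then show "topspace TT \<subseteq> carrier C"
    unfolding cover_topology_def topology_generated_by_topspace by blast
  show "carrier C \<subseteq> topspace TT"
  proof
    fix x assume x: "x \<in> carrier C"
    show "x \<in> topspace TT"
      by (rule subsetD[OF openin_subset[OF openin_nb[OF x le_refl]] nb_self[OF x le_refl]])
  qed
qed

text \<open>The generating cosets are indeed a base: neighbourhoods of one point are nested, which
  handles intersections, and a coset is the neighbourhood of each of its points.\<close>

lemma openin_TT:
  assumes "openin TT S" "x \<in> S"
  shows "\<exists>j\<ge>1. nb x j \<subseteq> S"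
proof -
  have "generate_topology_on {x <#\<^bsub>C\<^esub> lifted_subgroup v n j | x j. x \<in> carrier C \<and> 1 \<le> j} S"
    using assms(1) unfolding cover_topology_def openin_topology_generated_by_iff .
  then show ?thesis using assms(2)
  proof induction
    case (Int A B)
    obtain i j where ij: "1 \<le> i" "nb x i \<subseteq> A" "1 \<le> j" "nb x j \<subseteq> B" using Int by auto
    have "nb x (max i j) \<subseteq> A \<inter> B"
      using ij nb_mono[of i "max i j" x] nb_mono[of j "max i j" x] by auto
    then show ?case using ij(1) by (intro exI[of _ "max i j"]) simp
  next
    case (UN K)
    then obtain k where k: "k \<in> K" "x \<in> k" by blast
    then obtain j where "1 \<le> j" "nb x j \<subseteq> k" using UN.IH by blast
    then show ?case using k(1) by blast
  next
    case (Basis S)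
    then obtain y j where S: "S = y <#\<^bsub>C\<^esub> lifted_subgroup v n j" "y \<in> carrier C" "1 \<le> j" by blast
    then have "S = nb y j" by (simp add: nb_def UU_def lifted_eq)
    then have "nb x j = S" using nb_eq[OF S(2,3), of x] Basis(2) by simp
    then show ?case using S(3) by blast
  qed simp
qed

lemma openin_TT_I:
  assumes S: "S \<subseteq> carrier C" "\<And>x. x \<in> S \<Longrightarrow> nb x m \<subseteq> S"
  shows "openin TT S"
proof -
  have "\<exists>T. openin TT T \<and> x \<in> T \<and> T \<subseteq> S" if x: "x \<in> S" for x
    using openin_nb[OF subsetD[OF S(1) x] m_pos] nb_self[OF subsetD[OF S(1) x] m_pos] S(2)[OF x]
    by (intro exI conjI)
  then show ?thesis by (subst openin_subopen) simp
qed

text \<open>The cosets \<open>nb x m\<close> partition the group, so with \<open>S\<close> its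
  complement is also a union of such cosets.\<close>

lemma closedin_TT_I:
  assumes S: "S \<subseteq> carrier C" "\<And>x. x \<in> S \<Longrightarrow> nb x m \<subseteq> S"
  shows "closedin TT S"
proof -
  have "nb x m \<subseteq> carrier C - S" if x: "x \<in> carrier C - S" for x
  proof
    fix y assume y: "y \<in> nb x m"
    have xc: "x \<in> carrier C" using x by simp
    have "y \<notin> S"
    proof
      assume ys: "y \<in> S"
      have "nb x m \<subseteq> S" using S(2)[OF ys] nb_eq[OF xc m_pos y] by simp
      then show False using subsetD[OF _ nb_self[OF xc m_pos]] x by simp
    qed
    then show "y \<in> carrier C - S" using subsetD[OF nb_carrier[OF xc m_pos] y] by simp
  qed
  then have "openin TT (carrier C - S)" by (intro openin_TT_I) simp_all
  then show ?thesis using S(1) by (simp add: closedin_def topspace_TT)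
qed

text \<open>Inside \<open>Us\<close> all roots of unity are trivial, so being close in the group
  topology is the same as being close entry by entry; \<open>nb_close\<close> is the converse
  direction.\<close>

lemma Us_close:
  assumes e: "e \<in> Us" and u: "u \<in> Us" and c: "\<And>i k. fst e $ i $ k - fst u $ i $ k \<in> PP (int j)"
  shows "u \<in> nb e j"
proof -
  obtain p q' r s where g: "fst e = mat2 p q' r s" by (rule mat2_cases)
  let ?w = "inv\<^bsub>C\<^esub> e \<odot> u"
  have w: "?w \<in> Us" by (intro Us_mult Us_inv e u)
  have "fst ?w \<in> KK j"
    unfolding fst_mult fst_inv[OF Us_carrier[OF e] g]
    by (rule SLO_cong[OF KK_SLO[OF Us_fst[OF e]] KK_SLO[OF Us_fst[OF u]] c g])
  then have "?w \<in> UU j" using w by (simp add: UU_def Us_def mem_Times_iff)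
  moreover have "u = e \<odot> ?w"
    using Us_carrier[OF e] Us_carrier[OF u] by simp
  ultimately show ?thesis unfolding nb_def by (metis C.l_coset_memI)
qed

lemma nb_close:
  assumes e: "fst e \<in> SLO" and u: "u \<in> nb e j"
  shows "fst u $ i $ k - fst e $ i $ k \<in> PP (int j)"
proof -
  obtain p q' r s where g: "fst e = mat2 p q' r s" by (rule mat2_cases)
  obtain w where w: "w \<in> UU j" "u = e \<odot> w" using u by (rule nb_memE)
  obtain a b c d where h: "fst w = mat2 a b c d" by (rule mat2_cases)
  have O: "p \<in> PP 0" "q' \<in> PP 0" "r \<in> PP 0" "s \<in> PP 0" using e by (simp_all add: g SLO_mat2)
  have "fst w \<in> KK j" using w(1) by (auto simp: UU_def)
  then have K: "a - 1 \<in> PP (int j)" "b \<in> PP (int j)" "c \<in> PP (int j)" "d - 1 \<in> PP (int j)"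
    by (simp_all add: h KK_mat2)
  have "p * (a - 1) + q' * c \<in> PP (int j)" "p * b + q' * (d - 1) \<in> PP (int j)"
    "r * (a - 1) + s * c \<in> PP (int j)" "r * b + s * (d - 1) \<in> PP (int j)"
    by (intro pideal_add pideal_mult_int(1) O K)+
  then have "\<forall>i k. fst u $ i $ k - fst e $ i $ k \<in> PP (int j)"
    by (simp add: forall_2 w(2) g h algebra_simps)
  then show ?thesis by simp
qed

lemma Us_finite_cover:
  assumes i: "m \<le> i"
  shows "\<exists>E. finite E \<and> E \<subseteq> UU i \<and> UU i \<subseteq> (\<Union>e\<in>E. nb e (Suc i))"
proof -
  have sub: "KK i \<subseteq> SLO" by (rule subsetI) (rule KK_SLO)
  obtain E where E: "finite E" "E \<subseteq> KK i"
    "\<forall>g\<in>KK i. \<exists>e\<in>E. \<forall>a b. e $ a $ b - g $ a $ b \<in> PP (int (Suc i))"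
    using finite_representatives[OF sub, of "Suc i"] by (elim exE conjE) (rule that)
  have UUs: "UU i \<subseteq> Us" using KK_mono[OF i] unfolding UU_def Us_def by blast
  have EU: "E \<times> {1} \<subseteq> UU i" using E(2) by (auto simp: UU_def)
  have "\<exists>e\<in>E \<times> {1}. u \<in> nb e (Suc i)" if u: "u \<in> UU i" for u
  proof -
    have "fst u \<in> KK i" using u by (auto simp: UU_def)
    then obtain e where e: "e \<in> E" "\<forall>a b. e $ a $ b - fst u $ a $ b \<in> PP (int (Suc i))"
      using E(3) by (elim ballE bexE) blast+
    have "u \<in> nb (e, 1) (Suc i)"
    proof (rule Us_close)
      show "(e, 1) \<in> Us" "u \<in> Us" using e(1) EU UUs u by auto
    qed (use e(2) in simp)
    then show ?thesis using e(1) by (intro bexI[of _ "(e, 1)"]) simp_all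
  qed
  then show ?thesis using E(1) EU by (intro exI[of _ "E \<times> {1}"]) blast
qed

text \<open>The entries converge by completeness with the stated rate. The limit matrix stays in the
  congruence subgroup because all conditions are congruences modulo powers of the ideal.\<close>

lemma Us_limit:
  assumes w: "\<And>i. w i \<in> Us" "\<And>i. w (Suc i) \<in> nb (w i) (m + i)"
  shows "\<exists>g\<in>Us. \<forall>i. g \<in> nb (w i) (m + i)"
proof -
  have S: "fst (w i) \<in> SLO" for i by (rule KK_SLO[OF Us_fst[OF w(1)]])
  have "\<exists>l. \<forall>i. fst (w i) $ a $ b - l \<in> PP (int (m + i))" for a b
    by (rule limit_of_refinements) (rule nb_close[OF S w(2)])
  then obtain L where L: "\<And>a b i. fst (w i) $ a $ b - L a b \<in> PP (int (m + i))" by metis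
  define g where "g = mat2 (L 1 1) (L 1 2) (L 2 1) (L 2 2)"
  have gL: "g $ a $ b = L a b" for a b
  proof -
    have "\<forall>a b. g $ a $ b = L a b" by (simp add: forall_2 g_def)
    then show ?thesis by simp
  qed
  have LO: "L a b \<in> PP 0" for a b
  proof -
    have "fst (w 0) $ a $ b \<in> PP 0" using S[of 0] by (simp add: SLO_def)
    moreover have "fst (w 0) $ a $ b - L a b \<in> PP 0" by (rule pideal_mono[OF _ L]) simp
    ultimately have "fst (w 0) $ a $ b - (fst (w 0) $ a $ b - L a b) \<in> PP 0" by (rule pideal_diff)
    then show ?thesis by simp
  qed
  \<comment> \<open>The determinant of the limit differs from 1 by an element of every power of the
    ideal, hence not at all.\<close>
  have "L 1 1 * L 2 2 - L 1 2 * L 2 1 - 1 \<in> PP (int i)" for i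
  proof -
    have d: "fst (w i) $ 1 $ 1 * fst (w i) $ 2 $ 2 - fst (w i) $ 1 $ 2 * fst (w i) $ 2 $ 1 = 1"
      using S[of i] unfolding SLO_def by (simp add: det_2)
    have li: "L a b - fst (w i) $ a $ b \<in> PP (int i)" for a b
      using pideal_mono[OF _ L[of i a b], of "int i"] by (subst pideal_diff_commute) simp
    have so: "fst (w i) $ a $ b \<in> PP 0" for a b using S[of i] by (simp add: SLO_def)
    have eq: "(A - p) - (B - q') = A - B - (p - q')" for A B p q' :: 'a by simp
    have "(L 1 1 * L 2 2 - fst (w i) $ 1 $ 1 * fst (w i) $ 2 $ 2) -
        (L 1 2 * L 2 1 - fst (w i) $ 1 $ 2 * fst (w i) $ 2 $ 1) \<in> PP (int i)"
      by (intro pideal_diff pideal_cong_mult li LO so)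
    then show ?thesis unfolding eq d .
  qed
  then have "L 1 1 * L 2 2 - L 1 2 * L 2 1 - 1 = 0" by (rule pideal_Inter)
  moreover have "L a b - mat 1 $ a $ b \<in> PP (int m)" for a b
  proof -
    have "fst (w 0) $ a $ b - mat 1 $ a $ b \<in> PP (int m)"
      using Us_fst[OF w(1)[of 0]] by (simp add: congruence_subgroup_def)
    from pideal_diff[OF this, of "fst (w 0) $ a $ b - L a b"] L[of 0 a b] show ?thesis by simp
  qed
  ultimately have "g \<in> KK m"
    unfolding congruence_subgroup_def using LO by (simp add: det_2 gL)
  then have gU: "(g, 1) \<in> Us" by (simp add: Us_def)
  have "(g, 1) \<in> nb (w i) (m + i)" for i
    by (rule Us_close[OF w(1) gU]) (use L in \<open>simp add: gL\<close>)
  then show ?thesis using gU by blast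
qed

text \<open>A nested-neighbourhood argument. Each neighbourhood is a finite union of neighbourhoods
  of the next depth, so failure of a finite subcover passes to arbitrarily small ones. Their centres
  converge, and an open set of the cover around the limit contains one of them.\<close>

lemma compactin_nb:
  assumes x: "x \<in> carrier C"
  shows "compactin TT (nb x m)"
  unfolding compactin_def topspace_TT
proof (intro conjI allI impI)
  show "nb x m \<subseteq> carrier C" by (rule nb_carrier[OF x m_pos])
  fix \<U> assume U: "(\<forall>U\<in>\<U>. openin TT U) \<and> nb x m \<subseteq> \<Union>\<U>"
  define fin where "fin B \<longleftrightarrow> (\<exists>\<F>. finite \<F> \<and> \<F> \<subseteq> \<U> \<and> B \<subseteq> \<Union>\<F>)" for B
  have fin_UN: "fin (\<Union>e\<in>E. B e)" if "finite E" "\<And>e. e \<in> E \<Longrightarrow> fin (B e)" for E :: "(('a ^ 2 ^ 2) \<times> 'a) set" and B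
    using that
  proof (induction E)
    case empty
    show ?case unfolding fin_def by (intro exI[of _ "{}"]) simp
  next
    case (insert e E)
    obtain F1 F2 where "finite F1" "F1 \<subseteq> \<U>" "B e \<subseteq> \<Union>F1" "finite F2" "F2 \<subseteq> \<U>" "(\<Union>e\<in>E. B e) \<subseteq> \<Union>F2"
      using insert unfolding fin_def by (metis insertCI)
    then show ?case unfolding fin_def by (intro exI[of _ "F1 \<union> F2"]) auto
  qed
  have step: "\<exists>y'. y' \<in> nb y i \<and> \<not> fin (nb y' (Suc i))"
    if y: "y \<in> carrier C" "\<not> fin (nb y i)" and i: "m \<le> i" for y i
  proof (rule ccontr)
    assume "\<not> ?thesis"
    then have a: "fin (nb y' (Suc i))" if "y' \<in> nb y i" for y' using that by blast
    obtain E where E: "finite E" "E \<subseteq> UU i" "UU i \<subseteq> (\<Union>e\<in>E. nb e (Suc i))"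
      using Us_finite_cover[OF i] by (elim exE conjE)
    have i1: "1 \<le> i" "1 \<le> Suc i" using m_pos i by simp_all
    have "fin (\<Union>e\<in>E. nb (y \<odot> e) (Suc i))"
    proof (rule fin_UN[OF E(1)])
      fix e assume "e \<in> E"
      then have "y \<odot> e \<in> nb y i" unfolding nb_def using E(2) by (intro C.l_coset_memI) blast
      then show "fin (nb (y \<odot> e) (Suc i))" by (rule a)
    qed
    moreover have "nb y i \<subseteq> (\<Union>e\<in>E. nb (y \<odot> e) (Suc i))"
    proof
      fix z assume "z \<in> nb y i"
      then obtain u where u: "u \<in> UU i" "z = y \<odot> u" by (rule nb_memE)
      obtain e where e: "e \<in> E" "u \<in> nb e (Suc i)" using E(3) u(1) by blast
      have "e \<in> carrier C" using e(1) E(2) UU_carrier[OF i1(1)] by blast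
      from nb_translate[OF y(1) this i1(2) e(2)] show "z \<in> (\<Union>e\<in>E. nb (y \<odot> e) (Suc i))"
        using e(1) unfolding u(2) by blast
    qed
    ultimately have "fin (nb y i)" unfolding fin_def by (meson subset_trans)
    then show False using y(2) by simp
  qed
  show "\<exists>\<F>. finite \<F> \<and> \<F> \<subseteq> \<U> \<and> nb x m \<subseteq> \<Union>\<F>"
  proof (rule ccontr)
    assume "\<not> ?thesis"
    then have nf: "\<not> fin (nb x m)" unfolding fin_def .
    \<comment> \<open>Dependent choice selects a chain of ever smaller neighbourhoods, none with a
      finite subcover.\<close>
    have "\<exists>Y. \<forall>i. (Y i \<in> nb x m \<and> \<not> fin (nb (Y i) (m + i))) \<and> Y (Suc i) \<in> nb (Y i) (m + i)"
    proof (rule dependent_nat_choice)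
      show "\<exists>y. y \<in> nb x m \<and> \<not> fin (nb y (m + 0))"
        using nf nb_self[OF x m_pos] by (intro exI[of _ x]) simp
      fix y i assume y: "y \<in> nb x m \<and> \<not> fin (nb y (m + i))"
      have yc: "y \<in> carrier C" by (rule subsetD[OF nb_carrier[OF x m_pos] conjunct1[OF y]])
      obtain y' where y': "y' \<in> nb y (m + i)" "\<not> fin (nb y' (Suc (m + i)))"
        using step[OF yc conjunct2[OF y] le_add1] by (elim exE conjE)
      have "y' \<in> nb x m"
        using subsetD[OF nb_mono[OF le_add1] y'(1)] nb_eq[OF x m_pos conjunct1[OF y]] by simp
      then show "\<exists>z. (z \<in> nb x m \<and> \<not> fin (nb z (m + Suc i))) \<and> z \<in> nb y (m + i)"
        using y' by (intro exI[of _ y']) simp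
    qed
    then obtain Y where Y: "\<And>i. Y i \<in> nb x m" "\<And>i. \<not> fin (nb (Y i) (m + i))"
      "\<And>i. Y (Suc i) \<in> nb (Y i) (m + i)" by blast
    have Yc: "Y i \<in> carrier C" for i by (rule subsetD[OF nb_carrier[OF x m_pos] Y(1)])
    define w where "w i = inv\<^bsub>C\<^esub> x \<odot> Y i" for i
    have m1: "1 \<le> m + i" for i using m_pos by simp
    have Yw: "Y i = x \<odot> w i" for i using x Yc by (simp add: w_def)
    have wU: "w i \<in> Us" for i
    proof -
      obtain u where u: "u \<in> UU m" "Y i = x \<odot> u" using Y(1) by (rule nb_memE)
      then have "w i = u" unfolding w_def using x Us_carrier[of u] by (simp add: UU_m)
      then show ?thesis using u(1) by (simp add: UU_m)
    qed
    have "w (Suc i) \<in> nb (w i) (m + i)" for i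
      unfolding w_def by (rule nb_translate[OF C.inv_closed[OF x] Yc m1 Y(3)])
    from Us_limit[OF wU this] obtain g where g: "g \<in> Us" "\<And>i. g \<in> nb (w i) (m + i)" by blast
    have gY: "x \<odot> g \<in> nb (Y i) (m + i)" for i
      unfolding Yw by (rule nb_translate[OF x Us_carrier[OF wU] m1 g(2)])
    have "x \<odot> g \<in> nb x m" unfolding nb_def UU_m by (rule C.l_coset_memI[OF g(1)])
    then obtain V where V: "V \<in> \<U>" "x \<odot> g \<in> V" using U by blast
    obtain j where j: "1 \<le> j" "nb (x \<odot> g) j \<subseteq> V" using openin_TT[OF _ V(2)] U V(1) by blast
    \<comment> \<open>The limit lies in this neighbourhood, which is therefore also the
      neighbourhood of the limit of the same depth.\<close>
    have "nb (Y j) (m + j) \<subseteq> V"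
      unfolding nb_eq[OF Yc m1 gY, symmetric] by (rule subset_trans[OF nb_mono[OF le_add2] j(2)])
    then have "fin (nb (Y j) (m + j))"
      unfolding fin_def using V(1) by (intro exI[of _ "{V}"]) simp
    then show False using Y(2) by simp
  qed
qed

end

section \<open>The genuine Hecke algebra of the covering group\<close>

locale kubota_hecke = kubota_pair v n m t for v :: "'a::field \<Rightarrow> int" and n m :: nat and t :: 'a +
  fixes \<epsilon> :: "'a \<Rightarrow> complex" and M :: "(('a ^ 2 ^ 2) \<times> 'a) measure"
  assumes faithful: "faithful_character n \<epsilon>"
    and haar: "haar_measure (cover v n) (cover_topology v n) M"
    and normalized: "emeasure M (central_roots n <#>\<^bsub>cover v n\<^esub> lifted_subgroup v n m) = 1"
begin

abbreviation "Vs \<equiv> Zs <#>\<^bsub>C\<^esub> Us"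

sublocale H: hecke_cartan C Zs Us Ks Ns Ts N's aa "\<lambda>z. \<epsilon> (snd z)" "convolution C M"
proof
  fix z z' assume "z \<in> Zs" "z' \<in> Zs"
  then show "\<epsilon> (snd (z \<odot> z')) = \<epsilon> (snd z) * \<epsilon> (snd z')"
    using faithful by (auto simp: Zs_def cover_simps faithful_character_def)
next
  fix z assume "z \<in> Zs"
  then show "\<epsilon> (snd z) \<noteq> 0"
    using faithful by (auto simp: Zs_def faithful_character_def)
qed

lemma Vs_lifted: "central_roots n <#>\<^bsub>C\<^esub> lifted_subgroup v n m = Vs"
  by (simp add: central_roots_def Zs_def Us_def lifted_eq[OF m_pos])

lemma Us_Vs: "u \<in> Us \<Longrightarrow> u \<in> Vs"
  using P.ZU_I[OF P.one_Z, of u] Us_carrier[of u] by simp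

lemma coset_carrier: "x \<in> carrier C \<Longrightarrow> x <#\<^bsub>C\<^esub> Vs \<subseteq> carrier C"
  by (rule C.l_coset_subset_G[OF P.V_carrier])

lemma coset_eq:
  assumes x: "x \<in> carrier C" and y: "y \<in> x <#\<^bsub>C\<^esub> Vs"
  shows "y <#\<^bsub>C\<^esub> Vs = x <#\<^bsub>C\<^esub> Vs"
proof -
  obtain w where w: "w \<in> Vs" "y = x \<odot> w" using y by (rule C.l_coset_memE)
  show ?thesis unfolding w(2) by (rule C.l_coset_absorb[OF P.ZU_subgroup x w(1)])
qed

lemma nb_coset: "nb x m \<subseteq> x <#\<^bsub>C\<^esub> Vs"
  unfolding nb_def UU_m C.l_coset_image using Us_Vs by (intro image_mono subsetI)

lemma openin_coset:
  assumes x: "x \<in> carrier C"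
  shows "openin TT (x <#\<^bsub>C\<^esub> Vs)"
proof (rule openin_TT_I[OF coset_carrier[OF x]])
  fix y assume "y \<in> x <#\<^bsub>C\<^esub> Vs"
  then show "nb y m \<subseteq> x <#\<^bsub>C\<^esub> Vs" using nb_coset[of y] coset_eq[OF x] by simp
qed

lemma coset_Union:
  assumes x: "x \<in> carrier C"
  shows "x <#\<^bsub>C\<^esub> Vs = (\<Union>z\<in>Zs. nb (x \<odot> z) m)"
proof (intro subset_antisym subsetI)
  fix y assume "y \<in> x <#\<^bsub>C\<^esub> Vs"
  then obtain w where w: "w \<in> Vs" "y = x \<odot> w" by (rule C.l_coset_memE)
  then obtain z u where zu: "z \<in> Zs" "u \<in> Us" "w = z \<odot> u" unfolding P.ZU_iff by (elim bexE)
  have "y = x \<odot> z \<odot> u"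
    unfolding w(2) zu(3) using x P.Z_carrier[OF zu(1)] Us_carrier[OF zu(2)] by (simp add: C.m_assoc)
  then have "y \<in> nb (x \<odot> z) m"
    unfolding nb_def UU_m using C.l_coset_memI[OF zu(2)] by simp
  then show "y \<in> (\<Union>z\<in>Zs. nb (x \<odot> z) m)" by (rule UN_I[OF zu(1)])
next
  fix y assume "y \<in> (\<Union>z\<in>Zs. nb (x \<odot> z) m)"
  then obtain z where z: "z \<in> Zs" "y \<in> nb (x \<odot> z) m" by (rule UN_E)
  obtain u where u: "u \<in> Us" "y = x \<odot> z \<odot> u"
    by (rule nb_memE[OF z(2), unfolded UU_m])
  have "y = x \<odot> (z \<odot> u)"
    unfolding u(2) using x P.Z_carrier[OF z(1)] Us_carrier[OF u(1)] by (simp add: C.m_assoc)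
  then show "y \<in> x <#\<^bsub>C\<^esub> Vs"
    using C.l_coset_memI[OF P.ZU_I[OF z(1) u(1)]] by simp
qed

lemma compactin_coset:
  assumes x: "x \<in> carrier C"
  shows "compactin TT (x <#\<^bsub>C\<^esub> Vs)"
  unfolding coset_Union[OF x]
proof (rule compactin_Union)
  show "finite ((\<lambda>z. nb (x \<odot> z) m) ` Zs)" by (rule finite_imageI[OF P.finite_Z])
  fix B assume "B \<in> (\<lambda>z. nb (x \<odot> z) m) ` Zs"
  then obtain z where z: "B = nb (x \<odot> z) m" "z \<in> Zs" by (rule imageE)
  show "compactin TT B" unfolding z(1) by (rule compactin_nb[OF C.m_closed[OF x P.Z_carrier[OF z(2)]]])
qed

text \<open>By \<open>r\<close> the nonvanishing set is a union of cosets of \<open>Vs\<close> and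
  is closed, so taking the closure changes nothing. These cosets are compact, open and disjoint,
  hence their union is compact exactly when there are finitely many.\<close>

lemma compact_support_iff:
  assumes r: "\<And>x w. x \<in> carrier C \<Longrightarrow> w \<in> Vs \<Longrightarrow> f (x \<odot> w) = 0 \<longleftrightarrow> f x = 0"
  shows "compactly_supported TT f \<longleftrightarrow> finite (P.cosets_of {x \<in> carrier C. f x \<noteq> 0})"
proof -
  let ?S = "{x \<in> carrier C. f x \<noteq> 0}"
  have cos: "x <#\<^bsub>C\<^esub> Vs \<subseteq> ?S" if "x \<in> ?S" for x
  proof
    fix y assume y: "y \<in> x <#\<^bsub>C\<^esub> Vs"
    then obtain w where w: "w \<in> Vs" "y = x \<odot> w" by (rule C.l_coset_memE)
    show "y \<in> ?S" using that r[of x w] w C.m_closed[OF _ subsetD[OF P.V_carrier w(1)]] by simp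
  qed
  have "closedin TT ?S"
    by (rule closedin_TT_I) (use subset_trans[OF nb_coset cos] in simp_all)
  then have cl: "TT closure_of {x \<in> topspace TT. f x \<noteq> 0} = ?S"
    by (simp add: topspace_TT closure_of_eq)
  have U: "?S = \<Union>(P.cosets_of ?S)"
  proof (intro subset_antisym subsetI)
    show "x \<in> \<Union>(P.cosets_of ?S)" if "x \<in> ?S" for x
      unfolding P.cosets_of_def using that by (intro UN_I[of x] P.coset_self) simp_all
    show "x \<in> ?S" if "x \<in> \<Union>(P.cosets_of ?S)" for x
      using that subsetD[OF cos] unfolding P.cosets_of_def by (elim UN_E)
  qed
  show ?thesis unfolding compactly_supported_def cl
  proof
    assume "compactin TT ?S"
    moreover have "\<forall>B\<in>P.cosets_of ?S. openin TT B"
      unfolding P.cosets_of_def using openin_coset by simp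
    ultimately obtain F where F: "finite F" "F \<subseteq> P.cosets_of ?S" "?S \<subseteq> \<Union>F"
      using U by (auto simp: compactin_def)
    have "B \<in> F" if B: "B \<in> P.cosets_of ?S" for B
    proof -
      obtain y where y: "B = y <#\<^bsub>C\<^esub> Vs" "y \<in> ?S" using B unfolding P.cosets_of_def by (rule imageE)
      obtain D where D: "D \<in> F" "y \<in> D" using F(3) y(2) by blast
      obtain x where x: "D = x <#\<^bsub>C\<^esub> Vs" "x \<in> ?S"
        using subsetD[OF F(2) D(1)] unfolding P.cosets_of_def by (rule imageE)
      have "B = D" unfolding y(1) x(1) by (rule coset_eq) (use x D in simp_all)
      then show ?thesis using D(1) by simp
    qed
    then show "finite (P.cosets_of ?S)" by (intro finite_subset[OF subsetI F(1)])
  next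
    assume f: "finite (P.cosets_of ?S)"
    have "compactin TT (\<Union>(P.cosets_of ?S))"
      by (rule compactin_Union[OF f]) (auto simp: P.cosets_of_def intro!: compactin_coset)
    then show "compactin TT ?S" by (simp only: U[symmetric])
  qed
qed

text \<open>Local constancy follows from right invariance under the open subgroup \<open>Us\<close>,
  and compact support becomes finiteness modulo \<open>Vs\<close>.\<close>

lemma hecke_space_eq: "hecke_space v n m \<epsilon> = H.hecke_functions"
proof -
  have iff: "f \<in> hecke_space v n m \<epsilon> \<longleftrightarrow> f \<in> H.hecke_functions" for f
  proof -
    define A where "A \<longleftrightarrow> (\<forall>x. x \<notin> carrier C \<longrightarrow> f x = 0) \<and>
      (\<forall>z\<in>Zs. \<forall>x\<in>carrier C. f (z \<odot> x) = \<epsilon> (snd z) * f x) \<and>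
      (\<forall>u\<in>Us. \<forall>u'\<in>Us. \<forall>x\<in>carrier C. f (u \<odot> x \<odot> u') = f x)"
    have "f \<in> hecke_space v n m \<epsilon> \<longleftrightarrow> A \<and> locally_constant_on TT f \<and> compactly_supported TT f"
      unfolding hecke_space_def A_def lifted_eq[OF m_pos] Us_def[symmetric] by (auto simp: Zs_def)
    moreover have "f \<in> H.hecke_functions \<longleftrightarrow> A \<and> finite (P.cosets_of {x \<in> carrier C. f x \<noteq> 0})"
      unfolding H.hecke_functions_def A_def by auto
    moreover have "locally_constant_on TT f \<and>
        (compactly_supported TT f \<longleftrightarrow> finite (P.cosets_of {x \<in> carrier C. f x \<noteq> 0}))" if A: A
    proof
      have g: "f (z \<odot> x) = \<epsilon> (snd z) * f x" if "z \<in> Zs" "x \<in> carrier C" for z x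
        using A that unfolding A_def by blast
      have r: "f (x \<odot> u) = f x" if "u \<in> Us" "x \<in> carrier C" for x u
      proof -
        have "f (\<one>\<^bsub>C\<^esub> \<odot> x \<odot> u) = f x" using A that P.one_U unfolding A_def by blast
        then show ?thesis using that(2) by simp
      qed
      show "locally_constant_on TT f"
        unfolding locally_constant_on_def topspace_TT
      proof (intro ballI exI conjI)
        fix x assume x: "x \<in> carrier C"
        show "openin TT (nb x m)" "x \<in> nb x m" by (rule openin_nb[OF x m_pos] nb_self[OF x m_pos])+
        fix y assume "y \<in> nb x m"
        then show "f y = f x" using r[OF _ x] unfolding UU_m[symmetric] by (elim nb_memE) simp
      qed
      show "compactly_supported TT f \<longleftrightarrow> finite (P.cosets_of {x \<in> carrier C. f x \<noteq> 0})"
      proof (rule compact_support_iff)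
        fix x w assume x: "x \<in> carrier C" and "w \<in> Vs"
        then obtain z u where zu: "z \<in> Zs" "u \<in> Us" "w = z \<odot> u" unfolding P.ZU_iff by (elim bexE)
        have "f (x \<odot> w) = \<epsilon> (snd z) * f x"
          unfolding zu(3) P.Z_left_comm[OF zu(1) x Us_carrier[OF zu(2)]]
          using g[OF zu(1) C.m_closed[OF x Us_carrier[OF zu(2)]]] r[OF zu(2) x] by simp
        then show "f (x \<odot> w) = 0 \<longleftrightarrow> f x = 0" using H.eps_nonzero[OF zu(1)] by simp
      qed
    qed
    ultimately show ?thesis by blast
  qed
  show ?thesis by (rule Set.set_eqI) (rule iff)
qed

text \<open>Since \<open>kubota_theta\<close> is one on the congruence subgroup, both functions are
  genuine extensions of the constant 1 on \<open>Us\<close> to the product of the centre with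
  \<open>Us\<close>.\<close>

lemma hecke_one_eq: "hecke_one v n m \<epsilon> = H.chi \<one>\<^bsub>C\<^esub>"
proof
  fix x :: "('a ^ 2 ^ 2) \<times> 'a"
  obtain g b where x: "x = (g, b)" by (metis surj_pair)
  have e: "z \<odot> u \<odot> \<one>\<^bsub>C\<^esub> \<odot> u' = z \<odot> (u \<odot> u')" if "z \<in> Zs" "u \<in> Us" "u' \<in> Us" for z u u'
    using that P.Z_carrier[of z] Us_carrier[of u] Us_carrier[of u'] by (simp add: C.m_assoc)
  show "hecke_one v n m \<epsilon> x = H.chi \<one>\<^bsub>C\<^esub> x"
  proof (cases "g \<in> KK m \<and> b \<in> roots_of_1 n")
    case True
    have zu: "(mat 1, b) \<in> Zs" "(g, 1) \<in> Us" using True by (simp_all add: Zs_def Us_def)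
    have "(mat 1, b) \<odot> (g, 1) \<odot> \<one>\<^bsub>C\<^esub> \<odot> \<one>\<^bsub>C\<^esub> = (mat 1, b) \<odot> (g, 1)"
      using P.Z_carrier[OF zu(1)] Us_carrier[OF zu(2)] by simp
    also have "\<dots> = x" using True KK_det[of g m] by (simp add: cover_simps x)
    finally have "H.chi \<one>\<^bsub>C\<^esub> x = \<epsilon> b"
      using H.chi_eq[OF C.one_closed zu P.one_U] by simp
    then show ?thesis using True by (simp add: hecke_one_def x theta_one[OF _ m_pos])
  next
    case False
    have "H.chi \<one>\<^bsub>C\<^esub> x = 0"
    proof (rule ccontr)
      assume "H.chi \<one>\<^bsub>C\<^esub> x \<noteq> 0"
      then obtain z u u' where zu: "z \<in> Zs" "u \<in> Us" "u' \<in> Us" "x = z \<odot> u \<odot> \<one>\<^bsub>C\<^esub> \<odot> u'"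
        by (rule H.chi_nonzeroE)
      have w: "u \<odot> u' \<in> Us" by (rule Us_mult[OF zu(2,3)])
      have xe: "x = z \<odot> (u \<odot> u')" using zu(4) e[OF zu(1-3)] by simp
      have "x \<in> carrier C" unfolding xe by (rule C.m_closed[OF P.Z_carrier[OF zu(1)] Us_carrier[OF w]])
      moreover have "fst z = mat 1" using zu(1) by (auto simp: Zs_def)
      then have "fst x \<in> KK m" using Us_fst[OF w] unfolding xe by simp
      ultimately show False using False by (simp add: x cover_simps)
    qed
    then show ?thesis using False by (auto simp: hecke_one_def x)
  qed
qed

lemma M_props: "space M = carrier C" "sets M = sigma_sets (carrier C) {U. openin TT U}"
  "x \<in> carrier C \<Longrightarrow> A \<in> sets M \<Longrightarrow> emeasure M (x <#\<^bsub>C\<^esub> A) = emeasure M A"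
  using haar unfolding haar_measure_def by blast+

lemma coset_sets: "x \<in> carrier C \<Longrightarrow> x <#\<^bsub>C\<^esub> Vs \<in> sets M"
  unfolding M_props(2) using openin_coset by (intro sigma_sets.Basic) simp

lemma coset_measure:
  assumes x: "x \<in> carrier C"
  shows "emeasure M (x <#\<^bsub>C\<^esub> Vs) = 1"
proof -
  have "\<one>\<^bsub>C\<^esub> <#\<^bsub>C\<^esub> Vs = Vs" by (rule C.lcos_mult_one[OF P.V_carrier])
  then have "Vs \<in> sets M" using coset_sets[OF C.one_closed] by simp
  from M_props(3)[OF x this] show ?thesis using normalized by (simp add: Vs_lifted)
qed

text \<open>On the space of \<open>M\<close> the function is a finite combination of indicators of
  cosets, each of measure one by invariance and normalization. This connects the analytic
  convolution with the algebraic one.\<close>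

lemma integral_sum_cosets:
  assumes \<phi>: "\<phi> \<in> P.coset_functions"
  shows "(LINT y|M. \<phi> y) = P.sum_cosets \<phi>"
proof -
  define D where "D = P.cosets_of {x \<in> carrier C. \<phi> x \<noteq> 0}"
  have D: "finite D" using \<phi> by (simp add: D_def P.coset_functions_def)
  have DE: "\<exists>x\<in>carrier C. B = x <#\<^bsub>C\<^esub> Vs" if "B \<in> D" for B
    using that unfolding D_def P.cosets_of_def by blast
  have "has_bochner_integral M (\<lambda>y. \<Sum>B\<in>D. indicator B y *\<^sub>R \<phi> (P.coset_rep B))
      (\<Sum>B\<in>D. measure M B *\<^sub>R \<phi> (P.coset_rep B))"
  proof (rule has_bochner_integral_sum)
    fix B assume "B \<in> D"
    then obtain x where "x \<in> carrier C" "B = x <#\<^bsub>C\<^esub> Vs" using DE[OF \<open>B \<in> D\<close>] by blast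
    then have "B \<in> sets M" "emeasure M B < \<infinity>" using coset_sets coset_measure by simp_all
    then show "has_bochner_integral M (\<lambda>y. indicator B y *\<^sub>R \<phi> (P.coset_rep B)) (measure M B *\<^sub>R \<phi> (P.coset_rep B))"
      by (rule has_bochner_integral_indicator)
  qed
  moreover have "(\<Sum>B\<in>D. indicator B y *\<^sub>R \<phi> (P.coset_rep B)) = \<phi> y" if "y \<in> space M" for y
  proof -
    have y: "y \<in> carrier C" using that by (simp add: M_props)
    have "indicator B y *\<^sub>R \<phi> (P.coset_rep B) = (if y <#\<^bsub>C\<^esub> Vs = B then \<phi> y else 0)" if B: "B \<in> D" for B
    proof -
      obtain x where x: "x \<in> carrier C" "B = x <#\<^bsub>C\<^esub> Vs" using DE[OF B] by (rule bexE)
      have "y \<in> B \<longleftrightarrow> y <#\<^bsub>C\<^esub> Vs = B"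
        using coset_eq[OF x(1), of y] P.coset_self[OF y] unfolding x(2) by (intro iffI) simp_all
      then show ?thesis
        using P.coset_functions_rep[OF \<phi> y] by (cases "y <#\<^bsub>C\<^esub> Vs = B") simp_all
    qed
    then have "(\<Sum>B\<in>D. indicator B y *\<^sub>R \<phi> (P.coset_rep B)) = (\<Sum>B\<in>D. if y <#\<^bsub>C\<^esub> Vs = B then \<phi> y else 0)"
      by (rule sum.cong[OF refl])
    also have "\<dots> = (if y <#\<^bsub>C\<^esub> Vs \<in> D then \<phi> y else 0)" by (rule sum.delta'[OF D])
    also have "\<dots> = \<phi> y" using y by (auto simp: D_def P.cosets_of_def)
    finally show ?thesis .
  qed
  ultimately have "has_bochner_integral M \<phi> (\<Sum>B\<in>D. measure M B *\<^sub>R \<phi> (P.coset_rep B))"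
    by (simp cong: has_bochner_integral_cong)
  then have "(LINT y|M. \<phi> y) = (\<Sum>B\<in>D. measure M B *\<^sub>R \<phi> (P.coset_rep B))"
    by (rule has_bochner_integral_integral_eq)
  also have "\<dots> = (\<Sum>B\<in>D. \<phi> (P.coset_rep B))"
  proof (rule sum.cong[OF refl])
    fix B assume "B \<in> D"
    then obtain x where "x \<in> carrier C" "B = x <#\<^bsub>C\<^esub> Vs" using DE[OF \<open>B \<in> D\<close>] by blast
    then show "measure M B *\<^sub>R \<phi> (P.coset_rep B) = \<phi> (P.coset_rep B)"
      using coset_measure by (simp add: measure_def)
  qed
  finally show ?thesis by (simp add: P.sum_cosets_def D_def)
qed

sublocale H: hecke_presentation C Zs Us Ks Ns Ts N's aa "\<lambda>z. \<epsilon> (snd z)" "convolution C M"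
proof
  fix f h assume f: "f \<in> H.hecke_functions" and h: "h \<in> H.hecke_functions"
  show "convolution C M f h = H.convol f h"
  proof
    fix x
    show "convolution C M f h x = H.convol f h x"
    proof (cases "x \<in> carrier C")
      case True
      then show ?thesis
        unfolding convolution_def H.convol_def
        using integral_sum_cosets[OF H.convol_coset_function[OF f h True]] by simp
    qed (simp add: convolution_def H.convol_def)
  qed
qed

lemma hecke_algebra_eq: "hecke_algebra v n m \<epsilon> M = H.hecke_ring (convolution C M)"
  by (simp add: hecke_algebra_def H.hecke_ring_def hecke_space_eq hecke_one_eq)

end

theorem theorem4p2:
  fixes v :: "'a::field \<Rightarrow> int"
    and n m :: nat
    and \<epsilon> :: "'a \<Rightarrow> complex"
    and M :: "(('a ^ 2 ^ 2) \<times> 'a) measure"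
  assumes "nonarch_local_field v"
    and "1 \<le> n"
    and "coprime n (residue_char v)"
    and "card (roots_of_1 n :: 'a set) = n"
    and "faithful_character n \<epsilon>"
    and "1 \<le> m"
    and "haar_measure (cover v n) (cover_topology v n) M"
    and "emeasure M (central_roots n <#>\<^bsub>cover v n\<^esub> lifted_subgroup v n m) = 1"
  shows "finitely_presented_algebra (hecke_algebra v n m \<epsilon> M)"
proof -
  \<comment> \<open>The uniformizer is a choice inside the proof: it fixes \<open>aa\<close>, while
    the Hecke algebra is independent of it.\<close>
  obtain t where t: "t \<noteq> 0" "v t = 1"
    using nonarch_local_field.uniformizer[OF assms(1)] by (elim exE conjE)
  interpret kubota_hecke v n m t \<epsilon> M
    by (intro kubota_hecke.intro kubota_hecke_axioms.intro kubota_pair.intro kubota_pair_axioms.intro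
      tame_local_field.intro tame_local_field_axioms.intro assms t)
  show ?thesis unfolding hecke_algebra_eq by (rule H.finitely_presented_hecke_ring)
qed

end
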